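(* Let $\mathcal{M}$ be an $\mathrm{L}_\mathcal{M}$-structure, $\mathfrak{N}=\{\mathcal{N}_a\}_{a\in\mathcal{M}}$ a class of $\mathrm{L}_\mathfrak{N}$-structures, and consider the lexicographic sum $\mathcal{S}:=\mathcal{M}[\mathfrak{N}]$ of $\mathfrak{N}$ with respect to $\mathcal{M}$ in the language $\mathrm{L}_{\mathcal{M}[\mathfrak{N}]}=(S,\mathrm{L}_{\bullet,\mathfrak{N}})\cup(\mathcal{M},\mathrm{L}_\mathcal{M})\cup\{v:S\to\mathcal{M}\}$. Assume that for all sentences $\phi\in\mathrm{L}_\mathfrak{N}$, the set $\{a\in\mathcal{M}\mid\mathcal{N}_a\models\phi\}$ is $\emptyset$-definable in $\mathcal{M}$. Assume also that $\mathfrak{N}$ interprets uniformly a structure $\mathcal{K}$ (in a language $\mathrm{L}_K$, with base set $K$) with a non-empty set of surjective maps $\{\lambda_i:\mathcal{N}_a^{k_i}\to K\}_{a\in\mathcal{M},i\in I}$. Enrich $\mathcal{S}$ with a sort for $\mathcal{K}$ and with the maps $\lambda_{\bullet,i}:S^{k_i}\to K$ defined, for $(a_1,b_1),\dots,(a_{k_i},b_{k_i})\in S$, by $$\lambda_{\bullet,i}((a_1,b_1),\dots,(a_{k_i},b_{k_i})):=\begin{cases}\lambda_i^{\mathcal{N}_a}(b_1,\dots,b_{k_i})&\text{if }a_1=\cdots=a_{k_i}=a,\\0&\text{otherwise,}\end{cases}$$ where $0$ is a constant in $K$. Finally, assume: $(RQE)_\mathfrak{N}$: for all $\rho\in S_1^{\mathrm{Th}(\mathcal{M})}$,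 $\mathcal{N}_\rho$ admits quantifier elimination relative to $K$ in $\mathrm{L}_\mathfrak{N}\cup\mathrm{L}_K\cup\{\lambda_i\}_{i\in I}$. Then $(\mathcal{M}[\mathfrak{N}],\mathcal{K},\{\lambda_{\bullet,i}\}_{i\in I})$ eliminates quantifiers relative to $\mathcal{M}$ and $K$ in $\mathrm{L}_{\mathcal{M}[\mathfrak{N}]}\cup\mathrm{L}_K\cup\{\lambda_{\bullet,i}\}_{i\in I}$.
   Context: $\mathrm{L}_\mathcal{M},\mathrm{L}_\mathfrak{N},\mathrm{L}_K$ are disjoint languages, not necessarily relational. Lexicographic sum: $\mathcal{M}[\mathfrak{N}]$ is the multisorted structure with a main sort $S:=\bigcup_{a\in\mathcal{M}}\{a\}\times\mathcal{N}_a$, a sort for the structure $\mathcal{M}$ (in $\mathrm{L}_\mathcal{M}$), and the projection $v:S\to\mathcal{M}$, $(a,b)\mapsto a$. The sort $S$ carries a structure in a copy $\mathrm{L}_{\bullet,\mathfrak{N}}=\{P_\bullet\}_{P\in\mathrm{L}_\mathfrak{N}}$ of $\mathrm{L}_\mathfrak{N}$. For an $n$-ary predicate $P$, $P_\bullet:=\{((a,b_1),\dots,(a,b_n))\mid a\in\mathcal{M},\ \mathcal{N}_a\models P(b_1,\dots,b_n)\}$. For an $n$-ary function symbol $f$, $f_\bullet((a_1,b_1),\dots,(a_n,b_n)):=(a,f^{\mathcal{N}_a}(b_1,\dots,b_n))$ if $a_1=\dots=a_n=a$, and $:=u$ otherwise, where $u$ is a constant standing for "undetermined" (one can also pick an existing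 constant of the language). Uniform interpretation: $\mathfrak{N}$ interprets $\mathcal{K}$ uniformly with maps $\{\lambda_i\}$ if there are $\mathrm{L}_\mathfrak{N}$-formulas $D$, $E$ such that for all $\mathcal{N}\in\mathfrak{N}$, $E$ defines an equivalence relation on $D(\mathcal{N})$ and $D(\mathcal{N})/E(\mathcal{N})\simeq K$; and for every function symbol (resp. relation symbol) of $\mathrm{L}_K$ and every $i\in I$ there is one $\mathrm{L}_\mathfrak{N}$-formula which in every $\mathcal{N}\in\mathfrak{N}$ interprets the graph of this function (resp. this relation), respectively the graph of $\lambda_i:\mathcal{N}^{k_i}\to K$. If $\mathrm{L}_K$ has no constant, one formally adds a point named $0$ to $K$. $\mathcal{N}_\rho$: $S_1^{\mathrm{Th}(\mathcal{M})}$ is the set of complete $1$-types over $\emptyset$ of $\mathrm{Th}(\mathcal{M})$. For $\rho$ in it, $\mathcal{N}_\rho$ denotes the ultraproduct $\prod_\mathcal{U}\mathcal{N}_a$ for any ultrafilter $\mathcal{U}$ on $\mathcal{M}$ containing $\{\phi(\mathcal{M})\mid\phi\in\rho\}$; by the definability assumption its theory does not depend on $\mathcal{U}$. It carries the correspondingly interpreted $\mathrm{L}_K$-structure and maps $\lambda_i$ given by the uniform interpretation. Relative quantifier elimination: a theory (or structure) eliminates quantifiers relative to a set of sorts $\Sigma$ if it admits quantifier elimination in the language enriched with predicates for all definable sets in $\Sigma$ (a predicate for every formula of the language restricted to $\Sigma$).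
   Formalization: The language of the fibres is assumed to have no constant symbols (function symbols of arity at least 1): the definition of f_• fixes no fibre for n = 0, and the claim fails for the natural readings of c_•. Also k_i ≥ 1 is assumed. *)

theory Defs
  imports Complex_Main "HOL-Library.FuncSet"
begin

section \<open>Many-sorted first-order logic\<close>

text \<open>The symbols of a language are the members of \<open>funs\<close> and \<open>rels\<close>, so that a language may
  lack function symbols or relation symbols altogether. Constants are function symbols with
  \<open>fdom = []\<close>. One-sorted languages are those with sort type \<open>unit\<close>.\<close>

record ('s, 'f, 'r) lang =
  lsorts :: "'s set"
  funs :: "'f set"
  fdom :: "'f \<Rightarrow> 's list"
  fcod :: "'f \<Rightarrow> 's"
  rels :: "'r set"
  rdom :: "'r \<Rightarrow> 's list"

definition wf_lang :: "('s, 'f, 'r) lang \<Rightarrow> bool" where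
  "wf_lang L \<longleftrightarrow> lsorts L \<noteq> {}
     \<and> (\<forall>f\<in>funs L. set (fdom L f) \<subseteq> lsorts L \<and> fcod L f \<in> lsorts L)
     \<and> (\<forall>r\<in>rels L. set (rdom L r) \<subseteq> lsorts L)"

type_synonym 's var = "'s \<times> nat"

datatype ('s, 'f) tm = Var "'s var" | Fn 'f "('s, 'f) tm list"

datatype ('s, 'f, 'r) fm =
    Fls
  | Eq "('s, 'f) tm" "('s, 'f) tm"
  | Rel 'r "('s, 'f) tm list"
  | Neg "('s, 'f, 'r) fm"
  | Conj "('s, 'f, 'r) fm" "('s, 'f, 'r) fm"
  | Ex "'s var" "('s, 'f, 'r) fm"

fun tm_sort :: "('s, 'f, 'r) lang \<Rightarrow> ('s, 'f) tm \<Rightarrow> 's" where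
  "tm_sort L (Var v) = fst v"
| "tm_sort L (Fn f ts) = fcod L f"

fun wf_tm :: "('s, 'f, 'r) lang \<Rightarrow> ('s, 'f) tm \<Rightarrow> bool" where
  "wf_tm L (Var v) \<longleftrightarrow> fst v \<in> lsorts L"
| "wf_tm L (Fn f ts) \<longleftrightarrow>
     f \<in> funs L \<and> map (tm_sort L) ts = fdom L f \<and> (\<forall>t\<in>set ts. wf_tm L t)"

fun wf_fm :: "('s, 'f, 'r) lang \<Rightarrow> ('s, 'f, 'r) fm \<Rightarrow> bool" where
  "wf_fm L Fls \<longleftrightarrow> True"
| "wf_fm L (Eq t u) \<longleftrightarrow> wf_tm L t \<and> wf_tm L u \<and> tm_sort L t = tm_sort L u"
| "wf_fm L (Rel r ts) \<longleftrightarrow>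
     r \<in> rels L \<and> map (tm_sort L) ts = rdom L r \<and> (\<forall>t\<in>set ts. wf_tm L t)"
| "wf_fm L (Neg \<phi>) \<longleftrightarrow> wf_fm L \<phi>"
| "wf_fm L (Conj \<phi> \<psi>) \<longleftrightarrow> wf_fm L \<phi> \<and> wf_fm L \<psi>"
| "wf_fm L (Ex v \<phi>) \<longleftrightarrow> fst v \<in> lsorts L \<and> wf_fm L \<phi>"

fun fv_tm :: "('s, 'f) tm \<Rightarrow> 's var set" where
  "fv_tm (Var v) = {v}"
| "fv_tm (Fn f ts) = (\<Union>t\<in>set ts. fv_tm t)"

fun fv :: "('s, 'f, 'r) fm \<Rightarrow> 's var set" where
  "fv Fls = {}"
| "fv (Eq t u) = fv_tm t \<union> fv_tm u"
| "fv (Rel r ts) = (\<Union>t\<in>set ts. fv_tm t)"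
| "fv (Neg \<phi>) = fv \<phi>"
| "fv (Conj \<phi> \<psi>) = fv \<phi> \<union> fv \<psi>"
| "fv (Ex v \<phi>) = fv \<phi> - {v}"

fun qf :: "('s, 'f, 'r) fm \<Rightarrow> bool" where
  "qf (Neg \<phi>) \<longleftrightarrow> qf \<phi>"
| "qf (Conj \<phi> \<psi>) \<longleftrightarrow> qf \<phi> \<and> qf \<psi>"
| "qf (Ex v \<phi>) \<longleftrightarrow> False"
| "qf _ \<longleftrightarrow> True"

text \<open>\<open>fint\<close> and \<open>rint\<close> are only relevant on symbols of the language and on tuples from the
  carriers.\<close>

record ('s, 'f, 'r, 'u) struct =
  carr :: "'s \<Rightarrow> 'u set"
  fint :: "'f \<Rightarrow> 'u list \<Rightarrow> 'u"
  rint :: "'r \<Rightarrow> 'u list \<Rightarrow> bool"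

definition is_struct :: "('s, 'f, 'r) lang \<Rightarrow> ('s, 'f, 'r, 'u) struct \<Rightarrow> bool" where
  "is_struct L A \<longleftrightarrow> (\<forall>s\<in>lsorts L. carr A s \<noteq> {})
     \<and> (\<forall>f\<in>funs L. \<forall>us. list_all2 (\<lambda>u s. u \<in> carr A s) us (fdom L f)
            \<longrightarrow> fint A f us \<in> carr A (fcod L f))"

fun tm_val :: "('s, 'f, 'r, 'u) struct \<Rightarrow> ('s var \<Rightarrow> 'u) \<Rightarrow> ('s, 'f) tm \<Rightarrow> 'u" where
  "tm_val A e (Var v) = e v"
| "tm_val A e (Fn f ts) = fint A f (map (tm_val A e) ts)"

fun sat :: "('s, 'f, 'r, 'u) struct \<Rightarrow> ('s var \<Rightarrow> 'u) \<Rightarrow> ('s, 'f, 'r) fm \<Rightarrow> bool" where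
  "sat A e Fls \<longleftrightarrow> False"
| "sat A e (Eq t u) \<longleftrightarrow> tm_val A e t = tm_val A e u"
| "sat A e (Rel r ts) \<longleftrightarrow> rint A r (map (tm_val A e) ts)"
| "sat A e (Neg \<phi>) \<longleftrightarrow> \<not> sat A e \<phi>"
| "sat A e (Conj \<phi> \<psi>) \<longleftrightarrow> sat A e \<phi> \<and> sat A e \<psi>"
| "sat A e (Ex v \<phi>) \<longleftrightarrow> (\<exists>u\<in>carr A (fst v). sat A (e(v := u)) \<phi>)"


section \<open>Relative quantifier elimination\<close>

text \<open>Quantifier elimination of the complete theory of \<open>A\<close>.\<close>

definition elim_quantifiers :: "('s, 'f, 'r) lang \<Rightarrow> ('s, 'f, 'r, 'u) struct \<Rightarrow> bool" where
  "elim_quantifiers L A \<longleftrightarrow>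
     (\<forall>\<phi>. wf_fm L \<phi> \<longrightarrow>
        (\<exists>\<psi>. wf_fm L \<psi> \<and> qf \<psi> \<and> fv \<psi> \<subseteq> fv \<phi> \<and>
           (\<forall>e. (\<forall>v. fst v \<in> lsorts L \<longrightarrow> e v \<in> carr A (fst v)) \<longrightarrow>
                sat A e \<phi> = sat A e \<psi>)))"

definition restrict_lang :: "('s, 'f, 'r) lang \<Rightarrow> 's set \<Rightarrow> ('s, 'f, 'r) lang" where
  "restrict_lang L \<Sigma> = L\<lparr>
     lsorts := lsorts L \<inter> \<Sigma>,
     funs := {f \<in> funs L. set (fdom L f) \<subseteq> \<Sigma> \<and> fcod L f \<in> \<Sigma>},
     rels := {r \<in> rels L. set (rdom L r) \<subseteq> \<Sigma>}\<rparr>"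

text \<open>The enrichment by a predicate for every formula of the language restricted to the sorts
  \<open>\<Sigma>\<close>. The predicate symbol \<open>Inr (xs, \<phi>)\<close> stands for \<open>\<phi>\<close> regarded as a formula in the tuple
  of distinct variables \<open>xs\<close>, which includes the free variables of \<open>\<phi>\<close>.\<close>

type_synonym ('s, 'f, 'r) morley_rel = "'r + 's var list \<times> ('s, 'f, 'r) fm"

definition morley_lang ::
  "('s, 'f, 'r) lang \<Rightarrow> 's set \<Rightarrow> ('s, 'f, ('s, 'f, 'r) morley_rel) lang" where
  "morley_lang L \<Sigma> = \<lparr>
     lsorts = lsorts L, funs = funs L, fdom = fdom L, fcod = fcod L,
     rels = Inl ` rels L \<union>
       Inr ` {(xs, \<phi>). distinct xs \<and> fst ` set xs \<subseteq> lsorts L \<inter> \<Sigma> \<and>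
                       wf_fm (restrict_lang L \<Sigma>) \<phi> \<and> fv \<phi> \<subseteq> set xs},
     rdom = case_sum (rdom L) (\<lambda>(xs, \<phi>). map fst xs)\<rparr>"

definition morley_struct ::
  "('s, 'f, 'r, 'u) struct \<Rightarrow> ('s, 'f, ('s, 'f, 'r) morley_rel, 'u) struct" where
  "morley_struct A = \<lparr>
     carr = carr A, fint = fint A,
     rint = case_sum (rint A) (\<lambda>(xs, \<phi>) us. sat A (\<lambda>v. the (map_of (zip xs us) v)) \<phi>)\<rparr>"

definition elim_quantifiers_rel ::
  "('s, 'f, 'r) lang \<Rightarrow> 's set \<Rightarrow> ('s, 'f, 'r, 'u) struct \<Rightarrow> bool" where
  "elim_quantifiers_rel L \<Sigma> A \<longleftrightarrow> elim_quantifiers (morley_lang L \<Sigma>) (morley_struct A)"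


section \<open>Adjoining a further structure together with maps into it\<close>

text \<open>The disjoint union of two (many-sorted) languages, with a new function symbol for every
  \<open>i \<in> I\<close> from the sorts \<open>ar i\<close> of the first language to the sort \<open>t\<close> of the second.\<close>

type_synonym ('f, 'g, 'i) adj_fun = "('f + 'g) + 'i"

definition adjoin_lang ::
  "('s, 'f, 'r) lang \<Rightarrow> ('t, 'g, 'q) lang \<Rightarrow> 'i set \<Rightarrow> ('i \<Rightarrow> 's list) \<Rightarrow> 't
     \<Rightarrow> ('s + 't, ('f, 'g, 'i) adj_fun, 'r + 'q) lang" where
  "adjoin_lang L L' I ar t = \<lparr>
     lsorts = Inl ` lsorts L \<union> Inr ` lsorts L',
     funs = Inl ` (Inl ` funs L \<union> Inr ` funs L') \<union> Inr ` I,
     fdom = case_sum (case_sum (map Inl \<circ> fdom L) (map Inr \<circ> fdom L')) (map Inl \<circ> ar),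
     fcod = case_sum (case_sum (Inl \<circ> fcod L) (Inr \<circ> fcod L')) (\<lambda>_. Inr t),
     rels = Inl ` rels L \<union> Inr ` rels L',
     rdom = case_sum (map Inl \<circ> rdom L) (map Inr \<circ> rdom L')\<rparr>"

definition adjoin_struct ::
  "('s, 'f, 'r, 'u) struct \<Rightarrow> ('t, 'g, 'q, 'w) struct \<Rightarrow> ('i \<Rightarrow> 'u list \<Rightarrow> 'w)
     \<Rightarrow> ('s + 't, ('f, 'g, 'i) adj_fun, 'r + 'q, 'u + 'w) struct" where
  "adjoin_struct A B lam = \<lparr>
     carr = case_sum (\<lambda>s. Inl ` carr A s) (\<lambda>t. Inr ` carr B t),
     fint = case_sum
              (case_sum (\<lambda>f us. Inl (fint A f (map projl us)))
                        (\<lambda>g us. Inr (fint B g (map projr us))))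
              (\<lambda>i us. Inr (lam i (map projl us))),
     rint = case_sum (\<lambda>r us. rint A r (map projl us)) (\<lambda>q us. rint B q (map projr us))\<rparr>"


section \<open>One-sorted structures: definable sets, types, ultraproducts\<close>

text \<open>Truth of a formula in the variables \<open>x\<^sub>0, \<dots>, x\<^sub>n\<^sub>-\<^sub>1\<close> at an \<open>n\<close>-tuple.\<close>

definition vars_below :: "nat \<Rightarrow> unit var set" where
  "vars_below n = {((), j) | j. j < n}"

definition is_fm :: "(unit, 'f, 'r) lang \<Rightarrow> nat \<Rightarrow> (unit, 'f, 'r) fm \<Rightarrow> bool" where
  "is_fm L n \<phi> \<longleftrightarrow> wf_fm L \<phi> \<and> fv \<phi> \<subseteq> vars_below n"

definition holds :: "(unit, 'f, 'r, 'u) struct \<Rightarrow> (unit, 'f, 'r) fm \<Rightarrow> 'u list \<Rightarrow> bool" where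
  "holds A \<phi> us \<longleftrightarrow> sat A (\<lambda>v. us ! snd v) \<phi>"

abbreviation univ :: "(unit, 'f, 'r, 'u) struct \<Rightarrow> 'u set" where
  "univ A \<equiv> carr A ()"

definition tuples :: "(unit, 'f, 'r, 'u) struct \<Rightarrow> nat \<Rightarrow> 'u list set" where
  "tuples A n = {us. length us = n \<and> set us \<subseteq> univ A}"

definition definable :: "(unit, 'f, 'r) lang \<Rightarrow> (unit, 'f, 'r, 'u) struct \<Rightarrow> 'u set \<Rightarrow> bool" where
  "definable L A X \<longleftrightarrow> (\<exists>\<delta>. is_fm L 1 \<delta> \<and> X = {a \<in> univ A. holds A \<delta> [a]})"

text \<open>Complete 1-types over the empty set of the complete theory of \<open>A\<close>; as that theory is
  complete, consistency with it is finite satisfiability in \<open>A\<close>.\<close>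

definition complete_1type ::
  "(unit, 'f, 'r) lang \<Rightarrow> (unit, 'f, 'r, 'u) struct \<Rightarrow> (unit, 'f, 'r) fm set \<Rightarrow> bool" where
  "complete_1type L A \<rho> \<longleftrightarrow>
     (\<forall>\<phi>\<in>\<rho>. is_fm L 1 \<phi>)
     \<and> (\<forall>\<Delta>. finite \<Delta> \<and> \<Delta> \<subseteq> \<rho> \<longrightarrow> (\<exists>a\<in>univ A. \<forall>\<phi>\<in>\<Delta>. holds A \<phi> [a]))
     \<and> (\<forall>\<phi>. is_fm L 1 \<phi> \<longrightarrow> \<phi> \<in> \<rho> \<or> Neg \<phi> \<in> \<rho>)"

definition ultrafilter_on :: "'a set \<Rightarrow> 'a filter \<Rightarrow> bool" where
  "ultrafilter_on X U \<longleftrightarrow> U \<noteq> bot \<and> eventually (\<lambda>a. a \<in> X) U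
     \<and> (\<forall>P. eventually P U \<or> eventually (\<lambda>a. \<not> P a) U)"

definition ultra_rel ::
  "'m set \<Rightarrow> 'm filter \<Rightarrow> ('m \<Rightarrow> (unit, 'f, 'r, 'u) struct) \<Rightarrow> (('m \<Rightarrow> 'u) \<times> ('m \<Rightarrow> 'u)) set" where
  "ultra_rel X U N = {(x, y). x \<in> (\<Pi>\<^sub>E a\<in>X. univ (N a)) \<and> y \<in> (\<Pi>\<^sub>E a\<in>X. univ (N a))
                              \<and> eventually (\<lambda>a. x a = y a) U}"

definition ultraproduct ::
  "'m set \<Rightarrow> 'm filter \<Rightarrow> ('m \<Rightarrow> (unit, 'f, 'r, 'u) struct)
     \<Rightarrow> (unit, 'f, 'r, ('m \<Rightarrow> 'u) set) struct" where
  "ultraproduct X U N = \<lparr>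
     carr = (\<lambda>_. (\<Pi>\<^sub>E a\<in>X. univ (N a)) // ultra_rel X U N),
     fint = (\<lambda>f Ys. ultra_rel X U N ``
               {\<lambda>a\<in>X. fint (N a) f (map (\<lambda>Y. (SOME y. y \<in> Y) a) Ys)}),
     rint = (\<lambda>r Ys. eventually (\<lambda>a. rint (N a) r (map (\<lambda>Y. (SOME y. y \<in> Y) a) Ys)) U)\<rparr>"


section \<open>Uniform interpretations\<close>

text \<open>The data of an interpretation of a structure \<open>K\<close> with maps \<open>\<lambda>\<^sub>i\<close> into \<open>K\<close> on
  \<open>d\<close>-tuples, \<open>d = idim\<close>. A formula about \<open>n\<close> elements of \<open>K\<close> is a formula in \<open>n * d\<close>
  variables, consecutive blocks of length \<open>d\<close> representing the elements. For a graph, the block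
  of the value comes last; the formula for \<open>\<lambda>\<^sub>i\<close> starts with \<open>k\<^sub>i\<close> variables for the argument.\<close>

record ('f, 'r, 'g, 'q, 'i) interp =
  idim :: nat
  idom :: "(unit, 'f, 'r) fm"
  ieq :: "(unit, 'f, 'r) fm"
  ifun :: "'g \<Rightarrow> (unit, 'f, 'r) fm"
  irel :: "'q \<Rightarrow> (unit, 'f, 'r) fm"
  imap :: "'i \<Rightarrow> (unit, 'f, 'r) fm"

definition interp_dom ::
  "('f, 'r, 'g, 'q, 'i) interp \<Rightarrow> (unit, 'f, 'r, 'u) struct \<Rightarrow> 'u list set" where
  "interp_dom J A = {us \<in> tuples A (idim J). holds A (idom J) us}"

definition interp_eq ::
  "('f, 'r, 'g, 'q, 'i) interp \<Rightarrow> (unit, 'f, 'r, 'u) struct \<Rightarrow> ('u list \<times> 'u list) set" where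
  "interp_eq J A = {(us, vs). us \<in> interp_dom J A \<and> vs \<in> interp_dom J A \<and>
                              holds A (ieq J) (us @ vs)}"

text \<open>The structure and the maps interpreted by \<open>J\<close> in \<open>A\<close>, on the quotient of the domain.\<close>

definition interp_struct ::
  "('f, 'r, 'g, 'q, 'i) interp \<Rightarrow> (unit, 'f, 'r, 'u) struct
     \<Rightarrow> (unit, 'g, 'q, 'u list set) struct" where
  "interp_struct J A = \<lparr>
     carr = (\<lambda>_. interp_dom J A // interp_eq J A),
     fint = (\<lambda>g Xs. THE Y. Y \<in> interp_dom J A // interp_eq J A \<and>
               (\<exists>xss y. list_all2 (\<in>) xss Xs \<and> y \<in> Y \<and> holds A (ifun J g) (concat xss @ y))),
     rint = (\<lambda>q Xs. \<exists>xss. list_all2 (\<in>) xss Xs \<and> holds A (irel J q) (concat xss))\<rparr>"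

definition interp_map ::
  "('f, 'r, 'g, 'q, 'i) interp \<Rightarrow> (unit, 'f, 'r, 'u) struct \<Rightarrow> 'i \<Rightarrow> 'u list \<Rightarrow> 'u list set" where
  "interp_map J A i ws = (THE Y. Y \<in> interp_dom J A // interp_eq J A \<and>
                                 (\<exists>y\<in>Y. holds A (imap J i) (ws @ y)))"

text \<open>\<open>J\<close> interprets \<open>K\<close> with the maps \<open>\<lambda>\<^sub>i\<close>, \<open>i \<in> I\<close>, uniformly in the structures \<open>N a\<close>,
  \<open>a \<in> X\<close>; \<open>h\<close> is the identification of the quotient with \<open>K\<close>.\<close>

definition interprets_uniformly ::
  "(unit, 'f, 'r) lang \<Rightarrow> 'm set \<Rightarrow> ('m \<Rightarrow> (unit, 'f, 'r, 'u) struct)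
     \<Rightarrow> (unit, 'g, 'q) lang \<Rightarrow> (unit, 'g, 'q, 'w) struct
     \<Rightarrow> 'i set \<Rightarrow> ('i \<Rightarrow> nat) \<Rightarrow> ('i \<Rightarrow> 'm \<Rightarrow> 'u list \<Rightarrow> 'w)
     \<Rightarrow> ('f, 'r, 'g, 'q, 'i) interp \<Rightarrow> bool" where
  "interprets_uniformly L X N LK K I k lam J \<longleftrightarrow>
     is_fm L (idim J) (idom J) \<and> is_fm L (2 * idim J) (ieq J)
     \<and> (\<forall>g\<in>funs LK. is_fm L ((length (fdom LK g) + 1) * idim J) (ifun J g))
     \<and> (\<forall>q\<in>rels LK. is_fm L (length (rdom LK q) * idim J) (irel J q))
     \<and> (\<forall>i\<in>I. is_fm L (k i + idim J) (imap J i))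
     \<and> (\<forall>a\<in>X. let A = N a; D = interp_dom J A; E = interp_eq J A in
          equiv D E \<and>
          (\<exists>h. bij_betw h (D // E) (univ K)
             \<and> (\<forall>g\<in>funs LK. \<forall>xss y. length xss = length (fdom LK g) \<and> set xss \<subseteq> D \<and> y \<in> D \<longrightarrow>
                  (holds A (ifun J g) (concat xss @ y) \<longleftrightarrow>
                     fint K g (map (\<lambda>x. h (E `` {x})) xss) = h (E `` {y})))
             \<and> (\<forall>q\<in>rels LK. \<forall>xss. length xss = length (rdom LK q) \<and> set xss \<subseteq> D \<longrightarrow>
                  (holds A (irel J q) (concat xss) \<longleftrightarrow>
                     rint K q (map (\<lambda>x. h (E `` {x})) xss)))
             \<and> (\<forall>i\<in>I. \<forall>ws\<in>tuples A (k i). \<forall>y\<in>D.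
                  (holds A (imap J i) (ws @ y) \<longleftrightarrow> lam i a ws = h (E `` {y})))))"

text \<open>A structure \<open>A\<close> together with the structure and the maps that \<open>J\<close> interprets in it, in the
  language of \<open>A\<close>, that of \<open>K\<close> and the maps \<open>\<lambda>\<^sub>i\<close>. The sort of \<open>K\<close> is \<open>Inr ()\<close>.\<close>

definition interp_expansion_lang ::
  "(unit, 'f, 'r) lang \<Rightarrow> (unit, 'g, 'q) lang \<Rightarrow> 'i set \<Rightarrow> ('i \<Rightarrow> nat)
     \<Rightarrow> (unit + unit, ('f, 'g, 'i) adj_fun, 'r + 'q) lang" where
  "interp_expansion_lang L LK I k = adjoin_lang L LK I (\<lambda>i. replicate (k i) ()) ()"

definition interp_expansion ::
  "('f, 'r, 'g, 'q, 'i) interp \<Rightarrow> (unit, 'f, 'r, 'u) struct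
     \<Rightarrow> (unit + unit, ('f, 'g, 'i) adj_fun, 'r + 'q, 'u + 'u list set) struct" where
  "interp_expansion J A = adjoin_struct A (interp_struct J A) (interp_map J A)"


section \<open>The constant 0 of \<open>K\<close>\<close>

text \<open>\<open>Some c\<close> chooses the constant \<open>c\<close> of the language of \<open>K\<close> as 0. If there is no constant
  in that language, \<open>None\<close> stands for a new constant: a point \<open>None\<close> named 0 is added to \<open>K\<close>,
  where relations do not hold at tuples involving the new point and functions map
  such tuples to the new point. For \<open>Some c\<close>, the structure below is just a copy of \<open>K\<close>.\<close>

definition zero_choice :: "(unit, 'g, 'q) lang \<Rightarrow> 'g option \<Rightarrow> bool" where
  "zero_choice LK z \<longleftrightarrow>
     (case z of Some c \<Rightarrow> c \<in> funs LK \<and> fdom LK c = [] | None \<Rightarrow> \<forall>g\<in>funs LK. fdom LK g \<noteq> [])"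

definition pointed_lang :: "(unit, 'g, 'q) lang \<Rightarrow> 'g option \<Rightarrow> (unit, 'g option, 'q) lang" where
  "pointed_lang LK z = \<lparr>
     lsorts = lsorts LK,
     funs = Some ` funs LK \<union> (if z = None then {None} else {}),
     fdom = case_option [] (fdom LK),
     fcod = (\<lambda>_. ()),
     rels = rels LK,
     rdom = rdom LK\<rparr>"

definition pointed_struct ::
  "(unit, 'g, 'q, 'w) struct \<Rightarrow> 'g option \<Rightarrow> (unit, 'g option, 'q, 'w option) struct" where
  "pointed_struct K z = \<lparr>
     carr = (\<lambda>_. Some ` univ K \<union> (if z = None then {None} else {})),
     fint = case_option (\<lambda>_. None)
              (\<lambda>g us. if None \<in> set us then None else Some (fint K g (map the us))),
     rint = (\<lambda>q us. None \<notin> set us \<and> rint K q (map the us))\<rparr>"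

definition zero_elt :: "(unit, 'g, 'q, 'w) struct \<Rightarrow> 'g option \<Rightarrow> 'w option" where
  "zero_elt K z = map_option (\<lambda>c. fint K c []) z"


section \<open>Lexicographic sums\<close>

datatype lex_sort = MainS | BaseS

datatype ('f, 'g) lex_fun = BaseFn 'f | MainFn 'g | Undet | Proj

datatype ('m, 'n) lex_elt = BaseElt (base_of: 'm) | MainElt (fibre: 'm) (coord: 'n)

text \<open>The constant \<open>Undet\<close> belongs to the language precisely if it is needed, that is if there is
  a function symbol of arity at least two on the fibres. The definitions are meant for fibres whose
  language has no constants: for arity 0, the arguments would not determine a fibre.\<close>

definition lex_lang ::
  "(unit, 'f, 'r) lang \<Rightarrow> (unit, 'g, 'q) lang \<Rightarrow> (lex_sort, ('f, 'g) lex_fun, 'r + 'q) lang" where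
  "lex_lang LM LN = \<lparr>
     lsorts = {MainS, BaseS},
     funs = BaseFn ` funs LM \<union> MainFn ` funs LN \<union> {Proj} \<union>
            (if \<exists>g\<in>funs LN. length (fdom LN g) \<ge> 2 then {Undet} else {}),
     fdom = case_lex_fun (\<lambda>f. map (\<lambda>_. BaseS) (fdom LM f)) (\<lambda>g. map (\<lambda>_. MainS) (fdom LN g))
              [] [MainS],
     fcod = case_lex_fun (\<lambda>_. BaseS) (\<lambda>_. MainS) MainS BaseS,
     rels = Inl ` rels LM \<union> Inr ` rels LN,
     rdom = case_sum (\<lambda>r. map (\<lambda>_. BaseS) (rdom LM r)) (\<lambda>q. map (\<lambda>_. MainS) (rdom LN q))\<rparr>"

text \<open>\<open>fibrewise t d us\<close> is \<open>t a bs\<close> if all members of the nonempty tuple \<open>us\<close> lie in the same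
  fibre \<open>a\<close>, with coordinates \<open>bs\<close>, and \<open>d\<close> otherwise.\<close>

definition fibrewise :: "('m \<Rightarrow> 'n list \<Rightarrow> 'c) \<Rightarrow> 'c \<Rightarrow> ('m, 'n) lex_elt list \<Rightarrow> 'c" where
  "fibrewise t d us =
     (if \<exists>a. \<forall>w\<in>set us. fibre w = a then t (fibre (hd us)) (map coord us) else d)"

text \<open>\<open>u\<close> is the element of the main sort that interprets the constant for "undetermined".\<close>

definition lex_struct ::
  "(unit, 'f, 'r, 'm) struct \<Rightarrow> ('m \<Rightarrow> (unit, 'g, 'q, 'n) struct) \<Rightarrow> ('m, 'n) lex_elt
     \<Rightarrow> (lex_sort, ('f, 'g) lex_fun, 'r + 'q, ('m, 'n) lex_elt) struct" where
  "lex_struct M N u = \<lparr>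
     carr = case_lex_sort {MainElt a b | a b. a \<in> univ M \<and> b \<in> univ (N a)} (BaseElt ` univ M),
     fint = case_lex_fun
              (\<lambda>f us. BaseElt (fint M f (map base_of us)))
              (\<lambda>g us. fibrewise (\<lambda>a bs. MainElt a (fint (N a) g bs)) u us)
              (\<lambda>_. u)
              (\<lambda>us. BaseElt (fibre (hd us))),
     rint = case_sum
              (\<lambda>r us. rint M r (map base_of us))
              (\<lambda>q us. \<exists>a\<in>univ M. \<exists>bs. us = map (MainElt a) bs \<and> rint (N a) q bs)\<rparr>"

text \<open>The lexicographic sum with the additional sort for \<open>K\<close> and the maps from powers of the main
  sort to \<open>K\<close> induced by the \<open>\<lambda>\<^sub>i\<close>. The sorts are \<open>Inl MainS\<close>, \<open>Inl BaseS\<close> and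
  \<open>Inr ()\<close>.\<close>

definition lex_expansion_lang ::
  "(unit, 'f, 'r) lang \<Rightarrow> (unit, 'g, 'q) lang \<Rightarrow> (unit, 'fk, 'rk) lang \<Rightarrow> 'fk option
     \<Rightarrow> 'i set \<Rightarrow> ('i \<Rightarrow> nat)
     \<Rightarrow> (lex_sort + unit, (('f, 'g) lex_fun, 'fk option, 'i) adj_fun, ('r + 'q) + 'rk) lang" where
  "lex_expansion_lang LM LN LK z I k =
     adjoin_lang (lex_lang LM LN) (pointed_lang LK z) I (\<lambda>i. replicate (k i) MainS) ()"

definition lex_expansion ::
  "(unit, 'f, 'r, 'm) struct \<Rightarrow> ('m \<Rightarrow> (unit, 'g, 'q, 'n) struct) \<Rightarrow> ('m, 'n) lex_elt
     \<Rightarrow> (unit, 'fk, 'rk, 'w) struct \<Rightarrow> 'fk option \<Rightarrow> ('i \<Rightarrow> 'm \<Rightarrow> 'n list \<Rightarrow> 'w)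
     \<Rightarrow> (lex_sort + unit, (('f, 'g) lex_fun, 'fk option, 'i) adj_fun, ('r + 'q) + 'rk,
         ('m, 'n) lex_elt + 'w option) struct" where
  "lex_expansion M N u K z lam =
     adjoin_struct (lex_struct M N u) (pointed_struct K z)
       (\<lambda>i. fibrewise (\<lambda>a bs. Some (lam i a bs)) (zero_elt K z))"

end

theory Submission
  imports Defs
begin

text \<open>The ultraproducts of the fibres are the only place where elimination of quantifiers is known.
  Since the interpretation is uniform, a \<open>\<lambda>\<close>-formula of a fibre is equivalent to a formula of
  the pure language of the fibres, so that Los' theorem applies, and compactness yields for every
  formula finitely many quantifier-free candidates such that in each fibre one of them is equivalent
  to it; by definability, \<open>\<M>\<close> knows which one.

  In the sum, all quantifiers over \<open>\<M>\<close> and \<open>K\<close> are harmless, since a quantifier-free formula splits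
  into atoms of the main sort and a formula over \<open>\<M>\<close> and \<open>K\<close> in the values of finitely many interface
  terms. To eliminate a quantifier over the main sort, quantify first over the fibre \<open>m\<close> of the new
  element and then inside that fibre. Once it is known which of the variables lie in the fibre \<open>m\<close>,
  a term either takes its value in this fibre and is a term of the fibre, or it does not depend on the
  new element. So the inner quantifier is one over a formula of the fibre, where the
  finitely many candidates are available.\<close>

section \<open>Terms, formulas and substitution\<close>

text \<open>The obstacle in the last step is that the new element \<open>y\<close> enters the
  formula over M and K through its interface terms, and that formula is arbitrary, so
  \<open>y\<close> cannot be isolated in it. The remedy is to name the values of the interface
  terms: \<open>\<exists>y. A y \<and> B (t y)\<close> is equivalent to
  \<open>\<exists>w. B w \<and> (\<exists>y. A y \<and> w = t y)\<close>. The outer quantifier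
  ranges over M or K and is harmless, while the inner one sees only atoms and equations, each of
  which can be localized in one fibre. Two elements fit badly into the fibres and shape the case
  distinctions. The element \<open>u\<close> lies in a single fibre, so it is treated like one more
  variable, with index 0. An added point 0 of K is invisible in every fibre; the patterns therefore
  record which variables take this value, and quantifiers over K that come from a fibre are
  relativized to the other points. The pure language of the fibres matters twice: both Los' theorem
  and the definability assumption speak of its sentences only, so the statement that two formulas
  are equivalent in the expanded fibre has to become one such sentence.\<close>

declare split_paired_All [simp del] split_paired_Ex [simp del]

lemma tm_val_cong: "(\<And>v. v \<in> fv_tm t \<Longrightarrow> e v = e' v) \<Longrightarrow> tm_val A e t = tm_val A e' t"
proof (induction t)
  case (Fn f ts)
  have "tm_val A e t = tm_val A e' t" if "t \<in> set ts" for t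
    using Fn.IH[OF that] Fn.prems that by auto
  then show ?case by (simp cong: map_cong)
qed simp

lemma map_tm_val_cong:
  "(\<And>v. v \<in> (\<Union>t\<in>set ts. fv_tm t) \<Longrightarrow> e v = e' v) \<Longrightarrow> map (tm_val A e) ts = map (tm_val A e') ts"
  by (auto intro!: tm_val_cong)

lemma sat_cong: "(\<And>v. v \<in> fv \<phi> \<Longrightarrow> e v = e' v) \<Longrightarrow> sat A e \<phi> = sat A e' \<phi>"
proof (induction \<phi> arbitrary: e e')
  case (Eq t u)
  have "tm_val A e t = tm_val A e' t" "tm_val A e u = tm_val A e' u"
    using Eq by (auto intro!: tm_val_cong)
  then show ?case by simp
next
  case (Rel r ts)
  have "map (tm_val A e) ts = map (tm_val A e') ts" using Rel by (intro map_tm_val_cong) auto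
  then show ?case by (simp only: sat.simps)
next
  case (Neg \<phi>)
  have "sat A e \<phi> = sat A e' \<phi>" by (rule Neg.IH) (use Neg.prems in auto)
  then show ?case by simp
next
  case (Conj \<phi> \<psi>)
  have "sat A e \<phi> = sat A e' \<phi>" "sat A e \<psi> = sat A e' \<psi>"
    using Conj.prems by (auto intro!: Conj.IH)
  then show ?case by simp
next
  case (Ex v \<phi>)
  have "sat A (e(v := u)) \<phi> = sat A (e'(v := u)) \<phi>" for u
    using Ex.prems by (intro Ex.IH) auto
  then show ?case by simp
qed simp

lemma finite_fv_tm: "finite (fv_tm t)"
  by (induction t) auto

lemma finite_fv: "finite (fv \<phi>)"
  by (induction \<phi>) (auto simp: finite_fv_tm)

lemma tm_val_carr:
  assumes "is_struct L A" "wf_tm L t" "\<And>v. v \<in> fv_tm t \<Longrightarrow> e v \<in> carr A (fst v)"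
  shows "tm_val A e t \<in> carr A (tm_sort L t)"
  using assms(2,3)
proof (induction t)
  case (Fn f ts)
  have "list_all2 (\<lambda>u s. u \<in> carr A s) (map (tm_val A e) ts) (map (tm_sort L) ts)"
    unfolding list_all2_map1 list_all2_map2 by (rule list_all2_same[THEN iffD2]) (use Fn in auto)
  then show ?case using assms(1) Fn.prems by (simp add: is_struct_def)
qed simp

section \<open>Derived connectives and blocks of quantifiers\<close>

definition Disj :: "('s, 'f, 'r) fm \<Rightarrow> ('s, 'f, 'r) fm \<Rightarrow> ('s, 'f, 'r) fm" where
  "Disj \<phi> \<psi> = Neg (Conj (Neg \<phi>) (Neg \<psi>))"

definition Iff :: "('s, 'f, 'r) fm \<Rightarrow> ('s, 'f, 'r) fm \<Rightarrow> ('s, 'f, 'r) fm" where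
  "Iff \<phi> \<psi> = Disj (Conj \<phi> \<psi>) (Conj (Neg \<phi>) (Neg \<psi>))"

definition conjs :: "('s, 'f, 'r) fm list \<Rightarrow> ('s, 'f, 'r) fm" where
  "conjs \<phi>s = foldr Conj \<phi>s (Neg Fls)"

definition Exs :: "'s var list \<Rightarrow> ('s, 'f, 'r) fm \<Rightarrow> ('s, 'f, 'r) fm" where
  "Exs vs \<phi> = foldr Ex vs \<phi>"

lemma Disj_simps [simp]:
  "sat A e (Disj \<phi> \<psi>) \<longleftrightarrow> sat A e \<phi> \<or> sat A e \<psi>"
  "wf_fm L (Disj \<phi> \<psi>) \<longleftrightarrow> wf_fm L \<phi> \<and> wf_fm L \<psi>"
  "qf (Disj \<phi> \<psi>) \<longleftrightarrow> qf \<phi> \<and> qf \<psi>"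
  "fv (Disj \<phi> \<psi>) = fv \<phi> \<union> fv \<psi>"
  by (auto simp: Disj_def)

lemma Iff_simps [simp]:
  "sat A e (Iff \<phi> \<psi>) \<longleftrightarrow> (sat A e \<phi> \<longleftrightarrow> sat A e \<psi>)"
  "wf_fm L (Iff \<phi> \<psi>) \<longleftrightarrow> wf_fm L \<phi> \<and> wf_fm L \<psi>"
  "fv (Iff \<phi> \<psi>) = fv \<phi> \<union> fv \<psi>"
  by (auto simp: Iff_def)

lemma conjs_simps [simp]:
  "sat A e (conjs \<phi>s) \<longleftrightarrow> (\<forall>\<phi>\<in>set \<phi>s. sat A e \<phi>)"
  "wf_fm L (conjs \<phi>s) \<longleftrightarrow> (\<forall>\<phi>\<in>set \<phi>s. wf_fm L \<phi>)"
  "qf (conjs \<phi>s) \<longleftrightarrow> (\<forall>\<phi>\<in>set \<phi>s. qf \<phi>)"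
  "fv (conjs \<phi>s) = (\<Union>\<phi>\<in>set \<phi>s. fv \<phi>)"
  by (induction \<phi>s) (auto simp: conjs_def)

lemma Exs_syntax [simp]:
  "wf_fm L (Exs vs \<phi>) \<longleftrightarrow> fst ` set vs \<subseteq> lsorts L \<and> wf_fm L \<phi>"
  "fv (Exs vs \<phi>) = fv \<phi> - set vs"
  by (induction vs) (auto simp: Exs_def)

text \<open>A block of quantifiers amounts to one change of the assignment on the set of the listed
  variables, so their order and repetitions do not matter. Later arguments about blocks use this
  form instead of unfolding the quantifiers one at a time.\<close>

lemma sat_Exs:
  "sat A e (Exs vs \<phi>) \<longleftrightarrow>
     (\<exists>e'. (\<forall>v\<in>set vs. e' v \<in> carr A (fst v)) \<and> (\<forall>v. v \<notin> set vs \<longrightarrow> e' v = e v) \<and> sat A e' \<phi>)"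
proof (induction vs arbitrary: e)
  case Nil
  have "(\<forall>v. e' v = e v) \<longleftrightarrow> e' = e" for e' by auto
  then show ?case by (simp add: Exs_def)
next
  case (Cons w vs)
  have "sat A e (Exs (w # vs) \<phi>) \<longleftrightarrow> (\<exists>u\<in>carr A (fst w). sat A (e(w := u)) (Exs vs \<phi>))"
    by (simp add: Exs_def)
  also have "\<dots> \<longleftrightarrow> (\<exists>u\<in>carr A (fst w). \<exists>e'. (\<forall>v\<in>set vs. e' v \<in> carr A (fst v)) \<and>
      (\<forall>v. v \<notin> set vs \<longrightarrow> e' v = (e(w := u)) v) \<and> sat A e' \<phi>)" by (simp only: Cons.IH)
  also have "\<dots> \<longleftrightarrow> (\<exists>e'. (\<forall>v\<in>set (w # vs). e' v \<in> carr A (fst v)) \<and>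
      (\<forall>v. v \<notin> set (w # vs) \<longrightarrow> e' v = e v) \<and> sat A e' \<phi>)" (is "?l \<longleftrightarrow> ?r")
  proof
    assume ?l
    then obtain u e' where "u \<in> carr A (fst w)" "\<forall>v\<in>set vs. e' v \<in> carr A (fst v)"
      "\<forall>v. v \<notin> set vs \<longrightarrow> e' v = (e(w := u)) v" "sat A e' \<phi>" by blast
    then show ?r by (intro exI[of _ e']) (metis fun_upd_apply list.set_intros set_ConsD)
  next
    assume ?r
    then obtain e' where *: "\<forall>v\<in>set (w # vs). e' v \<in> carr A (fst v)"
      "\<forall>v. v \<notin> set (w # vs) \<longrightarrow> e' v = e v" "sat A e' \<phi>" by blast
    then show ?l by (intro bexI[of _ "e' w"] exI[of _ e']) auto
  qed
  finally show ?case .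
qed

section \<open>Renaming of variables and substitution without capture\<close>

fun shift_var :: "nat \<Rightarrow> 's var \<Rightarrow> 's var" where
  "shift_var B (s, n) = (s, n + B)"

fun shift_tm :: "nat \<Rightarrow> ('s, 'f) tm \<Rightarrow> ('s, 'f) tm" where
  "shift_tm B (Var v) = Var (shift_var B v)"
| "shift_tm B (Fn f ts) = Fn f (map (shift_tm B) ts)"

fun shift :: "nat \<Rightarrow> ('s, 'f, 'r) fm \<Rightarrow> ('s, 'f, 'r) fm" where
  "shift B Fls = Fls"
| "shift B (Eq t u) = Eq (shift_tm B t) (shift_tm B u)"
| "shift B (Rel r ts) = Rel r (map (shift_tm B) ts)"
| "shift B (Neg \<phi>) = Neg (shift B \<phi>)"
| "shift B (Conj \<phi> \<psi>) = Conj (shift B \<phi>) (shift B \<psi>)"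
| "shift B (Ex v \<phi>) = Ex (shift_var B v) (shift B \<phi>)"

lemma fst_shift_var [simp]: "fst (shift_var B v) = fst v"
  by (cases v) (simp add: shift_var.simps)

declare shift_var.simps [simp del]

lemma inj_shift_var: "inj (shift_var B)"
proof (rule injI)
  fix v w :: "'a var" show "shift_var B v = shift_var B w \<Longrightarrow> v = w" by (cases v; cases w) (simp add: shift_var.simps)
qed

lemma shift_var_eq_iff [simp]: "shift_var B v = shift_var B w \<longleftrightarrow> v = w"
  using inj_shift_var by (auto dest: injD)

lemma tm_val_shift: "tm_val A e (shift_tm B t) = tm_val A (\<lambda>v. e (shift_var B v)) t"
  by (induction t) (simp_all cong: map_cong)

lemma sat_shift: "sat A e (shift B \<phi>) = sat A (\<lambda>v. e (shift_var B v)) \<phi>"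
proof (induction \<phi> arbitrary: e)
  case (Ex v \<phi>)
  have "(\<lambda>w. (e(shift_var B v := u)) (shift_var B w)) = (\<lambda>w. e (shift_var B w))(v := u)" for u
    by auto
  then show ?case using Ex by simp
qed (simp_all add: tm_val_shift comp_def)

lemma tm_sort_shift [simp]: "tm_sort L (shift_tm B t) = tm_sort L t"
  by (cases t) simp_all

lemma wf_tm_shift [simp]: "wf_tm L (shift_tm B t) = wf_tm L t"
  by (induction t) (auto simp: comp_def)

lemma wf_shift [simp]: "wf_fm L (shift B \<phi>) = wf_fm L \<phi>"
  by (induction \<phi>) (auto simp: comp_def)

lemma fv_tm_shift: "fv_tm (shift_tm B t) = shift_var B ` fv_tm t"
  by (induction t) auto

lemma fv_shift: "fv (shift B \<phi>) = shift_var B ` fv \<phi>"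
  by (induction \<phi>) (auto simp: fv_tm_shift)

text \<open>Substitution in the form \<open>\<exists>xs. xs = ts \<and> \<phi>\<close>, with all variables of \<open>\<phi>\<close> shifted beyond those of \<open>ts\<close>, so
  that bound variables need no renaming.\<close>

definition inst :: "'s var list \<Rightarrow> ('s, 'f) tm list \<Rightarrow> ('s, 'f, 'r) fm \<Rightarrow> ('s, 'f, 'r) fm" where
  "inst xs ts \<phi> =
     (let B = Suc (Max (insert 0 (snd ` (\<Union>t\<in>set ts. fv_tm t)))) in
      Exs (map (shift_var B) xs)
        (Conj (conjs (map (\<lambda>(x, t). Eq (Var (shift_var B x)) t) (zip xs ts))) (shift B \<phi>)))"

lemma snd_shift_var: "snd (shift_var B v) = snd v + B"
  by (cases v) (simp add: shift_var.simps)

lemma the_map_of_zip: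
  assumes "distinct xs" "length us = length xs" "i < length xs"
  shows "the (map_of (zip xs us) (xs ! i)) = us ! i"
  using assms by (simp add: map_of_zip_nth)

text \<open>The equations force the shifted variables to take the values of \<open>ts\<close>, and
  these values are those of the old assignment because all shifted variables lie beyond the
  variables of \<open>ts\<close>. The carrier condition is needed since the values are reached by
  quantifiers, which range over the carriers.\<close>

lemma sat_inst:
  assumes xs: "distinct xs" and len: "length ts = length xs" and fv: "fv \<phi> \<subseteq> set xs"
    and carr: "\<And>i. i < length xs \<Longrightarrow> tm_val A e (ts ! i) \<in> carr A (fst (xs ! i))"
  shows "sat A e (inst xs ts \<phi>) = sat A (\<lambda>v. the (map_of (zip xs (map (tm_val A e) ts)) v)) \<phi>"
    (is "_ = sat A ?g \<phi>")
proof -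
  let ?S = "snd ` (\<Union>t\<in>set ts. fv_tm t)"
  define B where "B = Suc (Max (insert 0 ?S))"
  have fin: "finite (insert 0 ?S)" by (auto simp: finite_fv_tm)
  have fresh: "v \<notin> shift_var B ` set xs" if "t \<in> set ts" "v \<in> fv_tm t" for t v
  proof
    assume "v \<in> shift_var B ` set xs"
    then have "snd v \<ge> B" by (auto simp: snd_shift_var)
    moreover have "snd v \<le> Max (insert 0 ?S)"
      using that by (intro Max_ge[OF fin]) auto
    ultimately show False by (simp add: B_def)
  qed
  have val: "tm_val A e' t = tm_val A e t"
    if "t \<in> set ts" "\<forall>v. v \<notin> shift_var B ` set xs \<longrightarrow> e' v = e v" for t e'
    using fresh[OF that(1)] that(2) by (intro tm_val_cong) auto
  have g: "?g (xs ! i) = tm_val A e (ts ! i)" if "i < length xs" for i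
    using that by (simp add: the_map_of_zip xs len)
  have eqs: "(\<forall>p\<in>set (zip xs ts). sat A e' (case p of (x, t) \<Rightarrow> Eq (Var (shift_var B x)) t)) \<longleftrightarrow>
      (\<forall>i<length xs. e' (shift_var B (xs ! i)) = tm_val A e' (ts ! i))" for e'
    by (fastforce simp: set_zip len)
  have "sat A e (inst xs ts \<phi>) \<longleftrightarrow> (\<exists>e'. (\<forall>v\<in>set xs. e' (shift_var B v) \<in> carr A (fst v)) \<and>
      (\<forall>v. v \<notin> shift_var B ` set xs \<longrightarrow> e' v = e v) \<and>
      (\<forall>i<length xs. e' (shift_var B (xs ! i)) = tm_val A e' (ts ! i)) \<and>
      sat A (\<lambda>v. e' (shift_var B v)) \<phi>)"
    unfolding inst_def B_def[symmetric] Let_def sat_Exs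
    by (simp add: sat_shift eqs del: set_zip)
  also have "\<dots> \<longleftrightarrow> sat A ?g \<phi>"
  proof
    assume "\<exists>e'. (\<forall>v\<in>set xs. e' (shift_var B v) \<in> carr A (fst v)) \<and>
      (\<forall>v. v \<notin> shift_var B ` set xs \<longrightarrow> e' v = e v) \<and>
      (\<forall>i<length xs. e' (shift_var B (xs ! i)) = tm_val A e' (ts ! i)) \<and>
      sat A (\<lambda>v. e' (shift_var B v)) \<phi>"
    then obtain e' where e': "\<forall>v. v \<notin> shift_var B ` set xs \<longrightarrow> e' v = e v"
      "\<forall>i<length xs. e' (shift_var B (xs ! i)) = tm_val A e' (ts ! i)"
      "sat A (\<lambda>v. e' (shift_var B v)) \<phi>" by blast
    have "e' (shift_var B v) = ?g v" if "v \<in> fv \<phi>" for v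
    proof -
      have "v \<in> set xs" using that fv by auto
      then obtain i where i: "i < length xs" "v = xs ! i" by (auto simp: in_set_conv_nth)
      have "e' (shift_var B v) = tm_val A e' (ts ! i)" using e'(2) i by simp
      also have "\<dots> = tm_val A e (ts ! i)" by (rule val) (use i len e'(1) in auto)
      finally show ?thesis using g i by simp
    qed
    then have "sat A (\<lambda>v. e' (shift_var B v)) \<phi> = sat A ?g \<phi>" by (rule sat_cong)
    then show "sat A ?g \<phi>" using e'(3) by simp
  next
    assume R: "sat A ?g \<phi>"
    \<comment> \<open>The only candidate for a witness: the shifted variables receive the values of
      the terms, everything else keeps its value.\<close>
    define e' where "e' v = (if v \<in> shift_var B ` set xs then ?g (the_inv (shift_var B) v) else e v)" for v
    have *: "e' (shift_var B v) = ?g v" if "v \<in> set xs" for v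
      using that by (simp add: e'_def the_inv_f_f inj_shift_var)
    have out: "\<forall>v. v \<notin> shift_var B ` set xs \<longrightarrow> e' v = e v" by (simp add: e'_def)
    have "sat A (\<lambda>v. e' (shift_var B v)) \<phi>"
      using R * fv sat_cong[of \<phi> "\<lambda>v. e' (shift_var B v)" ?g A] by auto
    moreover have "\<forall>i<length xs. e' (shift_var B (xs ! i)) = tm_val A e' (ts ! i)"
      using * g val[OF _ out] len by simp
    moreover have "\<forall>v\<in>set xs. e' (shift_var B v) \<in> carr A (fst v)"
      using * g carr by (metis in_set_conv_nth)
    ultimately show "\<exists>e'. (\<forall>v\<in>set xs. e' (shift_var B v) \<in> carr A (fst v)) \<and>
      (\<forall>v. v \<notin> shift_var B ` set xs \<longrightarrow> e' v = e v) \<and>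
      (\<forall>i<length xs. e' (shift_var B (xs ! i)) = tm_val A e' (ts ! i)) \<and>
      sat A (\<lambda>v. e' (shift_var B v)) \<phi>" using out by blast
  qed
  finally show ?thesis .
qed

lemma wf_inst:
  assumes "fst ` set xs \<subseteq> lsorts L" "wf_fm L \<phi>" "map (tm_sort L) ts = map fst xs"
    "\<And>t. t \<in> set ts \<Longrightarrow> wf_tm L t"
  shows "wf_fm L (inst xs ts \<phi>)"
proof -
  have len: "length ts = length xs" using assms(3) map_eq_imp_length_eq by blast
  have "tm_sort L (ts ! i) = fst (xs ! i)" if "i < length xs" for i
    using assms(3) that len by (metis nth_map)
  then show ?thesis using assms len
    by (fastforce simp: inst_def Let_def set_zip image_subset_iff)
qed

lemma fv_inst:
  assumes "fv \<phi> \<subseteq> set xs" "length ts = length xs"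
  shows "fv (inst xs ts \<phi>) \<subseteq> (\<Union>t\<in>set ts. fv_tm t)"
  using assms by (fastforce simp: inst_def Let_def fv_shift set_zip)

section \<open>Translating the interpreted structure away\<close>

definition first_vars :: "nat \<Rightarrow> unit var list" where
  "first_vars n = map (Pair ()) [0..<n]"

lemma first_vars_simps [simp]:
  "length (first_vars n) = n" "distinct (first_vars n)" "set (first_vars n) = vars_below n"
  by (auto simp: first_vars_def vars_below_def distinct_map inj_on_def)

definition plug :: "nat \<Rightarrow> (unit, 'f, 'r) fm \<Rightarrow> (unit, 'f) tm list \<Rightarrow> (unit, 'f, 'r) fm" where
  "plug n \<phi> ts = inst (first_vars n) ts \<phi>"

lemma sat_plug:
  assumes len: "length ts = n" and fv: "fv \<phi> \<subseteq> vars_below n"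
    and carr: "\<And>t. t \<in> set ts \<Longrightarrow> tm_val A e t \<in> univ A"
  shows "sat A e (plug n \<phi> ts) = holds A \<phi> (map (tm_val A e) ts)"
proof -
  have "sat A e (plug n \<phi> ts) =
      sat A (\<lambda>v. the (map_of (zip (first_vars n) (map (tm_val A e) ts)) v)) \<phi>"
    unfolding plug_def by (rule sat_inst) (use assms in auto)
  also have "\<dots> = holds A \<phi> (map (tm_val A e) ts)"
    unfolding holds_def
  proof (rule sat_cong)
    fix v assume "v \<in> fv \<phi>"
    then have v: "v = ((), snd v)" "snd v < n" using fv by (auto simp: vars_below_def)
    then have "v = first_vars n ! snd v" by (simp add: first_vars_def)
    then show "the (map_of (zip (first_vars n) (map (tm_val A e) ts)) v) = map (tm_val A e) ts ! snd v"
      using v(2) len the_map_of_zip[of "first_vars n" "map (tm_val A e) ts" "snd v"] by simp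
  qed
  finally show ?thesis .
qed

lemma wf_plug:
  assumes "wf_lang L" "wf_fm L \<phi>" "length ts = n" "\<And>t. t \<in> set ts \<Longrightarrow> wf_tm L t"
  shows "wf_fm L (plug n \<phi> ts)"
  unfolding plug_def
proof (rule wf_inst)
  have "() \<in> lsorts L" using assms(1) by (auto simp: wf_lang_def)
  then show "fst ` set (first_vars n) \<subseteq> lsorts L" by auto
  show "map (tm_sort L) ts = map fst (first_vars n)"
    by (rule nth_equalityI) (use assms(3) in auto)
qed (use assms in auto)

lemma fv_plug: "fv \<phi> \<subseteq> vars_below n \<Longrightarrow> length ts = n \<Longrightarrow> fv (plug n \<phi> ts) \<subseteq> (\<Union>t\<in>set ts. fv_tm t)"
  unfolding plug_def by (rule fv_inst) auto

text \<open>The variables come in groups of length \<open>1 + d\<close>. The first one of group \<open>n\<close> is the slot for the \<open>n\<close>-th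
  variable of the main sort; the other ones form the block for the \<open>n\<close>-th variable of the sort of \<open>K\<close>.\<close>

definition slot :: "nat \<Rightarrow> nat \<Rightarrow> unit var" where
  "slot d n = ((), n * Suc d)"

definition blk :: "nat \<Rightarrow> nat \<Rightarrow> unit var list" where
  "blk d n = map (\<lambda>j. ((), n * Suc d + Suc j)) [0..<d]"

definition cenv :: "nat \<Rightarrow> (nat \<Rightarrow> 'u) \<Rightarrow> (nat \<Rightarrow> 'u list) \<Rightarrow> unit var \<Rightarrow> 'u" where
  "cenv d f F v = (let n = snd v div Suc d; r = snd v mod Suc d in if r = 0 then f n else F n ! (r - 1))"

lemma length_blk [simp]: "length (blk d n) = d"
  by (simp add: blk_def)

lemma cenv_slot [simp]: "cenv d f F (slot d n) = f n"
  by (simp add: cenv_def slot_def del: mult_Suc_right)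

lemma cenv_blk_nth [simp]: "j < d \<Longrightarrow> cenv d f F (blk d n ! j) = F n ! j"
proof -
  assume j: "j < d"
  have "(n * Suc d + Suc j) div Suc d = n" "(n * Suc d + Suc j) mod Suc d = Suc j"
    using j by (metis div_mult_self3 div_less add.right_neutral add.commute Suc_less_eq nat.simps(3),
      metis mod_mult_self3 mod_less Suc_less_eq)
  then show ?thesis using j by (simp add: cenv_def blk_def del: mult_Suc_right)
qed

lemma map_cenv_blk [simp]: "length (F n) = d \<Longrightarrow> map (cenv d f F) (blk d n) = F n"
  by (rule nth_equalityI) auto

lemma var_cases: obtains n where "v = slot d n" | n j where "j < d" "v = blk d n ! j"
proof (cases "snd v mod Suc d")
  case 0
  then have "v = slot d (snd v div Suc d)"
    by (cases v) (simp add: slot_def del: mult_Suc_right, metis mod_0_imp_dvd dvd_div_mult_self)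
  then show thesis using that by blast
next
  case (Suc j)
  have "j < d" using Suc by (metis Suc_less_eq mod_less_divisor zero_less_Suc)
  moreover have "snd v = snd v div Suc d * Suc d + Suc j" using Suc by (metis div_mult_mod_eq)
  ultimately have "v = blk d (snd v div Suc d) ! j"
    by (cases v) (simp add: blk_def del: mult_Suc_right)
  then show thesis using \<open>j < d\<close> that by blast
qed

lemma slot_inj [simp]: "slot d n = slot d m \<longleftrightarrow> n = m"
  by (metis cenv_slot[of d "\<lambda>n. n"])

text \<open>Variables are told apart by evaluating them in suitable assignments: contents
  \<open>replicate d n\<close> reveal the number of the block, contents \<open>[0..<d]\<close> the
  position inside it.\<close>

lemma blk_inj:
  assumes "i < d" "j < d"
  shows "blk d n ! i = blk d m ! j \<longleftrightarrow> n = m \<and> i = j"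
proof
  assume eq: "blk d n ! i = blk d m ! j"
  have "F n ! i = F m ! j" for F :: "nat \<Rightarrow> nat list"
    using arg_cong[OF eq, of "cenv d (\<lambda>_. 0) F"] assms by (simp only: cenv_blk_nth)
  from this[of "\<lambda>n. replicate d n"] this[of "\<lambda>_. [0..<d]"] show "n = m \<and> i = j"
    using assms by simp
qed auto

lemma slot_neq_blk: "j < d \<Longrightarrow> slot d n \<noteq> blk d m ! j"
proof
  assume j: "j < d" and eq: "slot d n = blk d m ! j"
  have "0 = (replicate d 1 ! j :: nat)"
    using arg_cong[OF eq, of "cenv d (\<lambda>_. 0) (\<lambda>_. replicate d 1)"] j by (simp only: cenv_blk_nth cenv_slot)
  then show False using j by simp
qed

lemmas blk_neq_slot = slot_neq_blk[symmetric]

lemma cenv_upd_slot: "(cenv d f F)(slot d n := x) = cenv d (f(n := x)) F"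
proof
  fix v show "((cenv d f F)(slot d n := x)) v = cenv d (f(n := x)) F v"
    by (rule var_cases[of v d]) (auto simp: slot_neq_blk blk_neq_slot)
qed

text \<open>Reassigning the variables of one block leads to an assignment of the same shape. Thus
  \<open>d\<close> quantifiers over elements act as one quantifier over tuples.\<close>

lemma cenv_upd_blk:
  assumes "\<And>v. v \<notin> set (blk d n) \<Longrightarrow> e v = cenv d f F v"
  shows "e = cenv d f (F(n := map e (blk d n)))"
proof
  fix v show "e v = cenv d f (F(n := map e (blk d n))) v"
  proof (rule var_cases[of v d])
    fix m assume "v = slot d m"
    moreover from this have "v \<notin> set (blk d n)" by (auto simp: in_set_conv_nth blk_neq_slot)
    ultimately show ?thesis using assms by simp
  next
    fix m j assume j: "j < d" "v = blk d m ! j"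
    show ?thesis
    proof (cases "m = n")
      case False
      then have "v \<notin> set (blk d n)" using j by (auto simp: in_set_conv_nth blk_inj)
      then show ?thesis using assms j False by simp
    qed (use j in simp)
  qed
qed

section \<open>The translation into the language of the fibres\<close>

lemma adj_fun_cases:
  obtains f where "h = Inl (Inl f)" | g where "h = Inl (Inr g)" | i where "h = Inr i"
  by (metis old.sum.exhaust)

text \<open>Only the syntactic half of a uniform interpretation is fixed here. The semantic half is
  the predicate \<open>coded\<close>, a condition on one structure at a time. In this way one and
  the same translation serves all fibres and also the ultraproduct, whose interpreted structure need
  not be \<open>K\<close>.\<close>

locale interp_data =
  fixes LN :: "(unit, 'fn, 'rn) lang" and LK :: "(unit, 'fk, 'rk) lang"
    and I :: "'i set" and k :: "'i \<Rightarrow> nat" and J :: "('fn, 'rn, 'fk, 'rk, 'i) interp"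
  assumes LN: "wf_lang LN" and LK: "wf_lang LK"
    and idom: "is_fm LN (idim J) (idom J)" and ieq: "is_fm LN (2 * idim J) (ieq J)"
    and ifun: "\<And>g. g \<in> funs LK \<Longrightarrow> is_fm LN ((length (fdom LK g) + 1) * idim J) (ifun J g)"
    and irel: "\<And>q. q \<in> rels LK \<Longrightarrow> is_fm LN (length (rdom LK q) * idim J) (irel J q)"
    and imap: "\<And>i. i \<in> I \<Longrightarrow> is_fm LN (k i + idim J) (imap J i)"
begin

abbreviation "d \<equiv> idim J"
abbreviation "L' \<equiv> interp_expansion_lang LN LK I k"

lemma L'_simps [simp]:
  "lsorts L' = UNIV"
  "Inl (Inl f) \<in> funs L' \<longleftrightarrow> f \<in> funs LN"
  "Inl (Inr g) \<in> funs L' \<longleftrightarrow> g \<in> funs LK"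
  "Inr i \<in> funs L' \<longleftrightarrow> i \<in> I"
  "fdom L' (Inl (Inl f)) = map Inl (fdom LN f)"
  "fdom L' (Inl (Inr g)) = map Inr (fdom LK g)"
  "fdom L' (Inr i) = replicate (k i) (Inl ())"
  "fcod L' (Inl (Inl f)) = Inl ()"
  "fcod L' (Inl (Inr g)) = Inr ()"
  "fcod L' (Inr i) = Inr ()"
  "Inl r \<in> rels L' \<longleftrightarrow> r \<in> rels LN"
  "Inr q \<in> rels L' \<longleftrightarrow> q \<in> rels LK"
  "rdom L' (Inl r) = map Inl (rdom LN r)"
  "rdom L' (Inr q) = map Inr (rdom LK q)"
proof -
  have "lsorts LN = {()}" "lsorts LK = {()}" using LN LK by (auto simp: wf_lang_def)
  then show "lsorts L' = UNIV"
    by (auto simp: interp_expansion_lang_def adjoin_lang_def) (metis old.sum.exhaust old.unit.exhaust UNIV_I)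
qed (auto simp: interp_expansion_lang_def adjoin_lang_def)

lemma unit_map [simp]: "map Inl (xs :: unit list) = map Inl ys \<longleftrightarrow> length xs = length ys"
  "map Inr (xs :: unit list) = map Inr ys \<longleftrightarrow> length xs = length ys"
  by (auto intro!: nth_equalityI dest: map_eq_imp_length_eq)

lemma sorts_main: "map (tm_sort L') ts = map Inl us \<longleftrightarrow>
    length ts = length us \<and> (\<forall>t\<in>set ts. tm_sort L' t = Inl ())"
  unfolding list_eq_iff_nth_eq by (auto simp: all_set_conv_all_nth)

lemma sorts_K: "map (tm_sort L') ts = map Inr us \<longleftrightarrow>
    length ts = length us \<and> (\<forall>t\<in>set ts. tm_sort L' t = Inr ())"
  unfolding list_eq_iff_nth_eq by (auto simp: all_set_conv_all_nth)

lemma sorts_rep: "map (tm_sort L') ts = replicate n (Inl ()) \<longleftrightarrow>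
    length ts = n \<and> (\<forall>t\<in>set ts. tm_sort L' t = Inl ())"
  unfolding list_eq_iff_nth_eq by (auto simp: all_set_conv_all_nth)

lemma lsorts_LN [simp]: "lsorts LN = UNIV"
  using LN by (auto simp: wf_lang_def)

text \<open>Meant for terms of the main sort, in which all function symbols come from the language
  of the fibres; on other symbols \<open>projl (projl f)\<close> is arbitrary.\<close>

fun main_tm :: "(unit + unit, ('fn, 'fk, 'i) adj_fun) tm \<Rightarrow> (unit, 'fn) tm" where
  "main_tm (Var v) = Var (slot d (snd v))"
| "main_tm (Fn f ts) = Fn (projl (projl f)) (map main_tm ts)"

fun code :: "(unit + unit) var \<Rightarrow> unit var set" where
  "code (Inl s, n) = {slot d n}"
| "code (Inr s, n) = set (blk d n)"

lemma wf_main_tm: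
  "wf_tm L' t \<Longrightarrow> tm_sort L' t = Inl () \<Longrightarrow> wf_tm LN (main_tm t) \<and> fv_tm (main_tm t) \<subseteq> (\<Union>v\<in>fv_tm t. code v)"
proof (induction t)
  case (Var v)
  then show ?case by (cases v) auto
next
  case (Fn f ts)
  obtain g where f: "f = Inl (Inl g)" using Fn.prems
    by (cases f rule: adj_fun_cases) auto
  have ts: "\<forall>t\<in>set ts. wf_tm L' t \<and> tm_sort L' t = Inl ()" "length ts = length (fdom LN g)"
    using Fn.prems by (auto simp: f sorts_main)
  have "map (tm_sort LN \<circ> main_tm) ts = fdom LN g" using ts by (auto intro!: nth_equalityI)
  then show ?case using Fn.prems Fn.IH ts by (fastforce simp: f)
qed

definition dm :: "nat \<Rightarrow> (unit, 'fn, 'rn) fm" where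
  "dm p = plug d (idom J) (map Var (blk d p))"

text \<open>A quantifier over K becomes a quantifier over representing tuples, relativized to the
  domain of the interpretation.\<close>

definition exb :: "nat list \<Rightarrow> (unit, 'fn, 'rn) fm \<Rightarrow> (unit, 'fn, 'rn) fm" where
  "exb ps \<phi> = foldr (\<lambda>p \<phi>. Exs (blk d p) (Conj (dm p) \<phi>)) ps \<phi>"

lemma interp_dom_iff: "us \<in> interp_dom J A \<longleftrightarrow> length us = d \<and> set us \<subseteq> univ A \<and> holds A (idom J) us"
  by (auto simp: interp_dom_def tuples_def)

lemma interp_domD: "us \<in> interp_dom J A \<Longrightarrow> length us = d" "us \<in> interp_dom J A \<Longrightarrow> set us \<subseteq> univ A"
  by (auto simp: interp_dom_iff)

lemma sat_exb1:
  "sat A (cenv d f F) (Exs (blk d p) (Conj (dm p) \<phi>)) \<longleftrightarrow>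
     (\<exists>us\<in>interp_dom J A. sat A (cenv d f (F(p := us))) \<phi>)"
proof -
  have dm: "sat A e (dm p) \<longleftrightarrow> holds A (idom J) (map e (blk d p))"
    if "\<forall>v\<in>set (blk d p). e v \<in> univ A" for e
    unfolding dm_def by (subst sat_plug) (use that idom in \<open>auto simp: is_fm_def comp_def\<close>)
  show ?thesis
  proof
    assume "sat A (cenv d f F) (Exs (blk d p) (Conj (dm p) \<phi>))"
    then obtain e where e: "\<forall>v\<in>set (blk d p). e v \<in> univ A"
      "\<forall>v. v \<notin> set (blk d p) \<longrightarrow> e v = cenv d f F v" "sat A e (dm p)" "sat A e \<phi>"
      by (auto simp: sat_Exs)
    have "e = cenv d f (F(p := map e (blk d p)))" using e by (intro cenv_upd_blk) auto
    moreover have "map e (blk d p) \<in> interp_dom J A"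
      using e dm[of e] by (auto simp: interp_dom_iff)
    ultimately show "\<exists>us\<in>interp_dom J A. sat A (cenv d f (F(p := us))) \<phi>" using e(4) by metis
  next
    assume "\<exists>us\<in>interp_dom J A. sat A (cenv d f (F(p := us))) \<phi>"
    then obtain us where us: "us \<in> interp_dom J A" "sat A (cenv d f (F(p := us))) \<phi>" by blast
    define e where "e = cenv d f (F(p := us))"
    have m: "map e (blk d p) = us" using interp_domD[OF us(1)] by (simp add: e_def)
    have 1: "\<forall>v\<in>set (blk d p). e v \<in> univ A" using interp_domD(2)[OF us(1)] m by (metis image_subset_iff list.set_map)
    moreover have "e v = cenv d f F v" if "v \<notin> set (blk d p)" for v
      by (rule var_cases[of v d]) (use that in \<open>auto simp: e_def\<close>)
    moreover have "sat A e (dm p)" using dm[OF 1] m us(1) by (simp add: interp_dom_iff)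
    ultimately show "sat A (cenv d f F) (Exs (blk d p) (Conj (dm p) \<phi>))"
      using us(2) unfolding e_def[symmetric] by (auto simp: sat_Exs intro!: exI[of _ e])
  qed
qed

lemma sat_exb:
  assumes "\<And>n. F n \<in> interp_dom J A"
  shows "sat A (cenv d f F) (exb ps \<phi>) \<longleftrightarrow>
    (\<exists>F'. (\<forall>n. F' n \<in> interp_dom J A) \<and> (\<forall>n. n \<notin> set ps \<longrightarrow> F' n = F n) \<and> sat A (cenv d f F') \<phi>)"
  using assms
proof (induction ps arbitrary: F)
  case Nil
  have "(\<forall>n. F' n = F n) \<longleftrightarrow> F' = F" for F' by auto
  then show ?case using Nil by (auto simp: exb_def)
next
  case (Cons p ps)
  have "sat A (cenv d f F) (exb (p # ps) \<phi>) \<longleftrightarrow>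
      (\<exists>us\<in>interp_dom J A. sat A (cenv d f (F(p := us))) (exb ps \<phi>))"
    by (simp add: exb_def sat_exb1)
  also have "\<dots> \<longleftrightarrow> (\<exists>us\<in>interp_dom J A. \<exists>F'. (\<forall>n. F' n \<in> interp_dom J A) \<and>
      (\<forall>n. n \<notin> set ps \<longrightarrow> F' n = (F(p := us)) n) \<and> sat A (cenv d f F') \<phi>)"
    by (rule bex_cong[OF refl], rule Cons.IH) (use Cons.prems in auto)
  also have "\<dots> \<longleftrightarrow> (\<exists>F'. (\<forall>n. F' n \<in> interp_dom J A) \<and>
      (\<forall>n. n \<notin> set (p # ps) \<longrightarrow> F' n = F n) \<and> sat A (cenv d f F') \<phi>)" (is "?l \<longleftrightarrow> ?r")
  proof
    assume ?l
    then obtain us F' where "us \<in> interp_dom J A" "\<forall>n. F' n \<in> interp_dom J A"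
      "\<forall>n. n \<notin> set ps \<longrightarrow> F' n = (F(p := us)) n" "sat A (cenv d f F') \<phi>" by blast
    then show ?r by (intro exI[of _ F']) auto
  next
    assume ?r
    then obtain F' where "\<forall>n. F' n \<in> interp_dom J A"
      "\<forall>n. n \<notin> set (p # ps) \<longrightarrow> F' n = F n" "sat A (cenv d f F') \<phi>" by blast
    then show ?l by (intro bexI[of _ "F' p"] exI[of _ F']) auto
  qed
  finally show ?case .
qed

lemma fv_dm: "fv (dm p) \<subseteq> set (blk d p)"
  unfolding dm_def using idom by (auto simp: is_fm_def dest!: fv_plug[of _ _ "map Var (blk d p)", THEN subsetD, rotated 2])

lemma fv_exb: "fv (exb ps \<phi>) \<subseteq> fv \<phi> - (\<Union>p\<in>set ps. set (blk d p))"
  using fv_dm by (induction ps) (fastforce simp: exb_def)+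

lemma wf_exb: "wf_fm LN \<phi> \<Longrightarrow> wf_fm LN (exb ps \<phi>)"
  using idom by (induction ps) (auto simp: exb_def dm_def is_fm_def intro!: wf_plug LN)

text \<open>Serves function and relation symbols of K alike. The blocks from \<open>p\<close> on
  represent the arguments, each described by a formula of \<open>\<phi>s\<close>; the blocks
  \<open>rs\<close> that follow them in \<open>\<chi>\<close> consist of the block of the value for
  a graph and are absent for a relation.\<close>

definition args :: "nat \<Rightarrow> (unit, 'fn, 'rn) fm list \<Rightarrow> nat list \<Rightarrow> (unit, 'fn, 'rn) fm \<Rightarrow> (unit, 'fn, 'rn) fm"
  where "args p \<phi>s rs \<chi> = exb [p..<p + length \<phi>s] (Conj (conjs \<phi>s)
    (plug ((length \<phi>s + length rs) * d) \<chi>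
       (map Var (concat (map (blk d) ([p..<p + length \<phi>s] @ rs))))))"

lemma length_concat_blk: "length (concat (map (blk d) ps)) = length ps * d"
  by (induction ps) auto

lemma map_concat_blk:
  "(\<And>n. length (F n) = d) \<Longrightarrow> map (cenv d f F) (concat (map (blk d) ps)) = concat (map F ps)"
  by (induction ps) auto

text \<open>The formulas \<open>\<phi>s\<close> are evaluated after the new blocks have been filled,
  so the hypothesis on them is about all \<open>F'\<close> that agree with \<open>F\<close> below
  \<open>p\<close>. The values \<open>w i\<close> must not depend on this filling, whereas the
  tuples \<open>xss\<close> may be any representatives of them.\<close>

lemma sat_args:
  assumes F: "\<And>n. F n \<in> interp_dom J A" and rs: "\<And>r. r \<in> set rs \<Longrightarrow> r < p"
    and \<chi>: "fv \<chi> \<subseteq> vars_below ((length \<phi>s + length rs) * d)"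
    and \<phi>s: "\<And>i F'. i < length \<phi>s \<Longrightarrow> (\<And>n. F' n \<in> interp_dom J A) \<Longrightarrow> (\<And>n. n < p \<Longrightarrow> F' n = F n) \<Longrightarrow>
        sat A (cenv d f F') (\<phi>s ! i) \<longleftrightarrow> w i = H (F' (p + i))"
  shows "sat A (cenv d f F) (args p \<phi>s rs \<chi>) \<longleftrightarrow>
    (\<exists>xss. length xss = length \<phi>s \<and> set xss \<subseteq> interp_dom J A \<and>
       (\<forall>i<length \<phi>s. H (xss ! i) = w i) \<and> holds A \<chi> (concat (xss @ map F rs)))"
proof -
  let ?ps = "[p..<p + length \<phi>s]"
  have plug: "sat A (cenv d f F') (plug ((length \<phi>s + length rs) * d) \<chi>
       (map Var (concat (map (blk d) (?ps @ rs))))) \<longleftrightarrow> holds A \<chi> (concat (map F' ?ps @ map F' rs))"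
    if F': "\<And>n. F' n \<in> interp_dom J A" for F'
  proof -
    have len: "length (F' n) = d" for n using interp_domD[OF F'] by auto
    have m: "map (cenv d f F') (concat (map (blk d) (?ps @ rs))) = concat (map F' (?ps @ rs))"
      by (rule map_concat_blk[OF len])
    have "sat A (cenv d f F') (plug ((length \<phi>s + length rs) * d) \<chi>
       (map Var (concat (map (blk d) (?ps @ rs))))) \<longleftrightarrow>
       holds A \<chi> (map (tm_val A (cenv d f F')) (map Var (concat (map (blk d) (?ps @ rs)))))"
    proof (rule sat_plug)
      show "length (map Var (concat (map (blk d) (?ps @ rs)))) = (length \<phi>s + length rs) * d"
        by (simp only: length_map length_concat_blk length_append) simp
      fix t :: "(unit, 'fn) tm" assume "t \<in> set (map Var (concat (map (blk d) (?ps @ rs))))"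
      then have "tm_val A (cenv d f F') t \<in> set (map (cenv d f F') (concat (map (blk d) (?ps @ rs))))"
        by fastforce
      then have "tm_val A (cenv d f F') t \<in> set (concat (map F' (?ps @ rs)))" by (simp only: m)
      then show "tm_val A (cenv d f F') t \<in> univ A" using interp_domD(2)[OF F'] by fastforce
    qed (rule \<chi>)
    also have "map (tm_val A (cenv d f F')) (map Var (concat (map (blk d) (?ps @ rs)))) =
        map (cenv d f F') (concat (map (blk d) (?ps @ rs)))" by simp
    finally show ?thesis unfolding m by (simp only: map_append)
  qed
  have \<phi>s': "(\<forall>\<phi>\<in>set \<phi>s. sat A (cenv d f F') \<phi>) \<longleftrightarrow> (\<forall>i<length \<phi>s. w i = H (F' (p + i)))"
    if "\<And>n. F' n \<in> interp_dom J A" "\<And>n. n \<notin> set ?ps \<Longrightarrow> F' n = F n" for F'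
    unfolding all_set_conv_all_nth using \<phi>s[of _ F'] that by simp
  have rs': "map F' rs = map F rs" if "\<And>n. n \<notin> set ?ps \<Longrightarrow> F' n = F n" for F'
    using that rs by fastforce
  show ?thesis
  proof
    assume "sat A (cenv d f F) (args p \<phi>s rs \<chi>)"
    then obtain F' where F0: "\<forall>n. F' n \<in> interp_dom J A" "\<forall>n. n \<notin> set ?ps \<longrightarrow> F' n = F n"
      "sat A (cenv d f F') (Conj (conjs \<phi>s) (plug ((length \<phi>s + length rs) * d) \<chi>
       (map Var (concat (map (blk d) (?ps @ rs))))))"
      unfolding args_def sat_exb[OF F] by blast
    have F': "\<And>n. F' n \<in> interp_dom J A" "\<And>n. n \<notin> set ?ps \<Longrightarrow> F' n = F n"
      "\<forall>\<phi>\<in>set \<phi>s. sat A (cenv d f F') \<phi>" "holds A \<chi> (concat (map F' ?ps @ map F' rs))"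
      using F0 plug[of F'] by (simp_all del: map_append concat_append)
    show "\<exists>xss. length xss = length \<phi>s \<and> set xss \<subseteq> interp_dom J A \<and>
       (\<forall>i<length \<phi>s. H (xss ! i) = w i) \<and> holds A \<chi> (concat (xss @ map F rs))"
    proof (rule exI[of _ "map F' ?ps"])
      have "map F' rs = map F rs" by (rule rs') (rule F'(2))
      then have "holds A \<chi> (concat (map F' ?ps @ map F rs))" using F'(4) by metis
      then show "length (map F' ?ps) = length \<phi>s \<and> set (map F' ?ps) \<subseteq> interp_dom J A \<and>
        (\<forall>i<length \<phi>s. H (map F' ?ps ! i) = w i) \<and> holds A \<chi> (concat (map F' ?ps @ map F rs))"
        using F'(1-3) \<phi>s'[OF F'(1,2)] by auto
    qed
  next
    assume "\<exists>xss. length xss = length \<phi>s \<and> set xss \<subseteq> interp_dom J A \<and>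
       (\<forall>i<length \<phi>s. H (xss ! i) = w i) \<and> holds A \<chi> (concat (xss @ map F rs))"
    then obtain xss where xss: "length xss = length \<phi>s" "set xss \<subseteq> interp_dom J A"
       "\<forall>i<length \<phi>s. H (xss ! i) = w i" "holds A \<chi> (concat (xss @ map F rs))" by blast
    \<comment> \<open>Block \<open>p + i\<close> stores the representative of argument
      \<open>i\<close>.\<close>
    define F' where "F' n = (if n \<in> set ?ps then xss ! (n - p) else F n)" for n
    have F': "\<And>n. F' n \<in> interp_dom J A" "\<And>n. n \<notin> set ?ps \<Longrightarrow> F' n = F n"
      using xss F by (auto simp: F'_def subset_iff)
    have ps: "map F' ?ps = xss" by (rule nth_equalityI) (use xss in \<open>auto simp: F'_def\<close>)
    have "\<forall>i<length \<phi>s. w i = H (F' (p + i))" using xss(3) by (auto simp: F'_def)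
    then have 1: "sat A (cenv d f F') (conjs \<phi>s)" using \<phi>s'[OF F'] by simp
    have rsE: "map F' rs = map F rs" by (rule rs') (rule F'(2))
    have "holds A \<chi> (concat (map F' ?ps @ map F' rs))" using xss(4) by (simp only: ps rsE)
    then have 2: "sat A (cenv d f F') (plug ((length \<phi>s + length rs) * d) \<chi>
       (map Var (concat (map (blk d) (?ps @ rs)))))" using plug[of F'] F'(1) by blast
    show "sat A (cenv d f F) (args p \<phi>s rs \<chi>)"
      unfolding args_def sat_exb[OF F] using F' 1 2 by (intro exI[of _ F']) simp
  qed
qed

lemma fv_args:
  assumes "fv \<chi> \<subseteq> vars_below ((length \<phi>s + length rs) * d)"
    "\<And>i. i < length \<phi>s \<Longrightarrow> fv (\<phi>s ! i) \<subseteq> V \<union> set (blk d (p + i))"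
  shows "fv (args p \<phi>s rs \<chi>) \<subseteq> V \<union> (\<Union>r\<in>set rs. set (blk d r))"
proof -
  let ?ps = "[p..<p + length \<phi>s]"
  have 1: "fv (plug ((length \<phi>s + length rs) * d) \<chi> (map Var (concat (map (blk d) (?ps @ rs))))) \<subseteq>
      (\<Union>r\<in>set (?ps @ rs). set (blk d r))"
    using fv_plug[OF assms(1), of "map Var (concat (map (blk d) (?ps @ rs)))"]
    by (simp add: length_concat comp_def sum_list_triv distrib_right)
  have 2: "fv (conjs \<phi>s) \<subseteq> V \<union> (\<Union>r\<in>set ?ps. set (blk d r))"
    using assms(2) by (fastforce simp: in_set_conv_nth)
  show ?thesis unfolding args_def using fv_exb 1 2 by fastforce
qed

lemma wf_args:
  assumes "wf_fm LN \<chi>" "\<And>\<phi>. \<phi> \<in> set \<phi>s \<Longrightarrow> wf_fm LN \<phi>"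
  shows "wf_fm LN (args p \<phi>s rs \<chi>)"
proof -
  have "length (map Var (concat (map (blk d) ([p..<p + length \<phi>s] @ rs)))) = (length \<phi>s + length rs) * d"
    by (simp only: length_map length_concat_blk length_append) simp
  then show ?thesis unfolding args_def using assms by (auto intro!: wf_exb wf_plug LN)
qed

text \<open>Block \<open>p\<close> represents the value of the term.\<close>

function graph :: "(unit + unit, ('fn, 'fk, 'i) adj_fun) tm \<Rightarrow> nat \<Rightarrow> (unit, 'fn, 'rn) fm" where
  "graph (Var v) p = plug (2 * d) (ieq J) (map Var (blk d (snd v) @ blk d p))"
| "graph (Fn f ts) p = (case f of
     Inr i \<Rightarrow> plug (k i + d) (imap J i) (map main_tm ts @ map Var (blk d p))
   | Inl (Inr g) \<Rightarrow>
       args (Suc p) (map (\<lambda>i. graph (ts ! i) (Suc p + i)) [0..<length ts]) [p] (ifun J g)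
   | Inl (Inl f) \<Rightarrow> Fls)"
  by pat_completeness auto
termination
  by (relation "measure (\<lambda>(t, p). size t)")
    (auto simp: less_Suc_eq_le intro!: size_list_estimation'[OF nth_mem])

definition fresh :: "(unit + unit, ('fn, 'fk, 'i) adj_fun) tm list \<Rightarrow> nat" where
  "fresh ts = Suc (Max (insert 0 (snd ` (\<Union>t\<in>set ts. fv_tm t))))"

text \<open>Variables keep their numbers: slot \<open>n\<close> or block \<open>n\<close>, according
  to the sort. Two terms over K cannot be compared directly, so their equality is rendered by a
  common representative of both values.\<close>

fun tr :: "(unit + unit, ('fn, 'fk, 'i) adj_fun, 'rn + 'rk) fm \<Rightarrow> (unit, 'fn, 'rn) fm" where
  "tr Fls = Fls"
| "tr (Eq t s) = (case tm_sort L' t of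
     Inl _ \<Rightarrow> Eq (main_tm t) (main_tm s)
   | Inr _ \<Rightarrow> (let p = fresh [t, s] in exb [p] (Conj (graph t p) (graph s p))))"
| "tr (Rel r ts) = (case r of
     Inl r \<Rightarrow> Rel r (map main_tm ts)
   | Inr q \<Rightarrow> (let p = fresh ts in
       args p (map (\<lambda>i. graph (ts ! i) (p + i)) [0..<length ts]) [] (irel J q)))"
| "tr (Neg \<phi>) = Neg (tr \<phi>)"
| "tr (Conj \<phi> \<psi>) = Conj (tr \<phi>) (tr \<psi>)"
| "tr (Ex v \<phi>) = (case fst v of
     Inl _ \<Rightarrow> Ex (slot d (snd v)) (tr \<phi>)
   | Inr _ \<Rightarrow> exb [snd v] (tr \<phi>))"

text \<open>\<open>H\<close> sends a representing tuple to the element of \<open>K\<close> it represents.\<close>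

definition coded :: "(unit, 'fn, 'rn, 'u) struct \<Rightarrow> (unit, 'fk, 'rk, 'w) struct
    \<Rightarrow> ('i \<Rightarrow> 'u list \<Rightarrow> 'w) \<Rightarrow> ('u list \<Rightarrow> 'w) \<Rightarrow> bool" where
  "coded A K lam H \<longleftrightarrow> is_struct LN A \<and> is_struct LK K
     \<and> (\<forall>i\<in>I. \<forall>ws\<in>tuples A (k i). lam i ws \<in> univ K)
     \<and> H ` interp_dom J A = univ K
     \<and> (\<forall>x\<in>interp_dom J A. \<forall>y\<in>interp_dom J A. holds A (ieq J) (x @ y) \<longleftrightarrow> H x = H y)
     \<and> (\<forall>g\<in>funs LK. \<forall>xss y. length xss = length (fdom LK g) \<and> set xss \<subseteq> interp_dom J A \<and> y \<in> interp_dom J A \<longrightarrow>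
          (holds A (ifun J g) (concat xss @ y) \<longleftrightarrow> fint K g (map H xss) = H y))
     \<and> (\<forall>q\<in>rels LK. \<forall>xss. length xss = length (rdom LK q) \<and> set xss \<subseteq> interp_dom J A \<longrightarrow>
          (holds A (irel J q) (concat xss) \<longleftrightarrow> rint K q (map H xss)))
     \<and> (\<forall>i\<in>I. \<forall>ws\<in>tuples A (k i). \<forall>y\<in>interp_dom J A.
          (holds A (imap J i) (ws @ y) \<longleftrightarrow> lam i ws = H y))"

fun benv :: "('u list \<Rightarrow> 'w) \<Rightarrow> (nat \<Rightarrow> 'u) \<Rightarrow> (nat \<Rightarrow> 'u list) \<Rightarrow> (unit + unit) var \<Rightarrow> 'u + 'w" where
  "benv H f F (Inl s, n) = Inl (f n)"
| "benv H f F (Inr s, n) = Inr (H (F n))"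

lemma adjoin_struct_simps [simp]:
  "carr (adjoin_struct A K lam) (Inl s) = Inl ` carr A s"
  "carr (adjoin_struct A K lam) (Inr t) = Inr ` carr K t"
  "fint (adjoin_struct A K lam) (Inl (Inl f)) us = Inl (fint A f (map projl us))"
  "fint (adjoin_struct A K lam) (Inl (Inr g)) us = Inr (fint K g (map projr us))"
  "fint (adjoin_struct A K lam) (Inr i) us = Inr (lam i (map projl us))"
  "rint (adjoin_struct A K lam) (Inl r) us = rint A r (map projl us)"
  "rint (adjoin_struct A K lam) (Inr q) us = rint K q (map projr us)"
  by (simp_all add: adjoin_struct_def)

lemma tm_val_main_tm:
  "wf_tm L' t \<Longrightarrow> tm_sort L' t = Inl () \<Longrightarrow>
    tm_val (adjoin_struct A K lam) (benv H f F) t = Inl (tm_val A (cenv d f F) (main_tm t))"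
proof (induction t)
  case (Var v)
  then show ?case by (cases v) auto
next
  case (Fn h ts)
  obtain g where h: "h = Inl (Inl g)" using Fn.prems by (cases h rule: adj_fun_cases) auto
  have "map (tm_val (adjoin_struct A K lam) (benv H f F)) ts = map (Inl \<circ> tm_val A (cenv d f F) \<circ> main_tm) ts"
    using Fn by (auto simp: h sorts_main)
  then have "map (projl \<circ> tm_val (adjoin_struct A K lam) (benv H f F)) ts = map (tm_val A (cenv d f F) \<circ> main_tm) ts"
    by simp
  then show ?case by (simp add: h del: map_eq_conv)
qed

lemma is_struct_adjoin:
  assumes "is_struct LN A" "is_struct LK K" "\<forall>i\<in>I. \<forall>ws\<in>tuples A (k i). lam i ws \<in> univ K"
  shows "is_struct L' (adjoin_struct A K lam)"
  unfolding is_struct_def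
proof (intro conjI ballI allI impI)
  fix s show "carr (adjoin_struct A K lam) s \<noteq> {}"
    using assms LN LK by (cases s) (auto simp: is_struct_def wf_lang_def)
next
  fix h us assume h: "h \<in> funs L'" and us: "list_all2 (\<lambda>u s. u \<in> carr (adjoin_struct A K lam) s) us (fdom L' h)"
  have l: "map projl us \<in> tuples A (length xs)"
    if "list_all2 (\<lambda>u s. u \<in> carr (adjoin_struct A K lam) s) us (map Inl xs)" for xs
    using that by (fastforce simp: tuples_def list_all2_conv_all_nth in_set_conv_nth)
  have r: "map projr us \<in> tuples K (length xs)"
    if "list_all2 (\<lambda>u s. u \<in> carr (adjoin_struct A K lam) s) us (map Inr xs)" for xs
    using that by (fastforce simp: tuples_def list_all2_conv_all_nth in_set_conv_nth)
  have tup: "list_all2 (\<lambda>u s. u \<in> carr A' s) vs xs" if "vs \<in> tuples A' (length xs)" for vs xs and A' :: "(unit, 'x, 'y, 'z) struct"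
    using that by (auto simp: tuples_def list_all2_conv_all_nth subset_iff)
  show "fint (adjoin_struct A K lam) h us \<in> carr (adjoin_struct A K lam) (fcod L' h)"
  proof (cases h rule: adj_fun_cases)
    case (1 f)
    then show ?thesis using h us assms(1) tup[OF l[of "fdom LN f"]] by (auto simp: is_struct_def)
  next
    case (2 g)
    then show ?thesis using h us assms(2) tup[OF r[of "fdom LK g"]] by (auto simp: is_struct_def)
  next
    case (3 i)
    then show ?thesis using h us assms(3) l[of "replicate (k i) ()"] by auto
  qed
qed

lemma fresh: "t \<in> set ts \<Longrightarrow> v \<in> fv_tm t \<Longrightarrow> snd v < fresh ts"
proof -
  assume "t \<in> set ts" "v \<in> fv_tm t"
  then have "snd v \<le> Max (insert 0 (snd ` (\<Union>t\<in>set ts. fv_tm t)))"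
    by (intro Max_ge) (auto simp: finite_fv_tm)
  then show ?thesis by (simp add: fresh_def)
qed

section \<open>Translated formulas are well-formed\<close>

lemma graph_syntax:
  assumes "wf_tm L' t" "tm_sort L' t = Inr ()"
  shows "wf_fm LN (graph t p) \<and> fv (graph t p) \<subseteq> (\<Union>v\<in>fv_tm t. code v) \<union> set (blk d p)"
  using assms
proof (induction t arbitrary: p)
  case (Var v)
  have "fv (plug (2 * d) (ieq J) (map Var (blk d (snd v) @ blk d p))) \<subseteq> set (blk d (snd v) @ blk d p)"
    using fv_plug[of "ieq J" "2 * d" "map Var (blk d (snd v) @ blk d p)"] ieq by (simp add: is_fm_def)
  then show ?case using Var ieq by (cases v) (auto simp: is_fm_def intro!: wf_plug LN)
next
  case (Fn h ts)
  show ?case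
  proof (cases h rule: adj_fun_cases)
    case (1 f)
    then show ?thesis using Fn.prems by simp
  next
    case (2 g)
    have ts: "length ts = length (fdom LK g)" "\<And>t. t \<in> set ts \<Longrightarrow> wf_tm L' t \<and> tm_sort L' t = Inr ()"
      and g: "is_fm LN ((length ts + 1) * d) (ifun J g)"
      using Fn.prems ifun[of g] by (auto simp: 2 sorts_K)
    have IH: "wf_fm LN (graph (ts ! i) p')"
      "fv (graph (ts ! i) p') \<subseteq> (\<Union>v\<in>fv_tm (Fn h ts). code v) \<union> set (blk d p')" if "i < length ts" for i p'
      using Fn.IH[of "ts ! i" p'] ts(2)[of "ts ! i"] that by fastforce+
    have "fv (graph (Fn h ts) p) \<subseteq> (\<Union>v\<in>fv_tm (Fn h ts). code v) \<union> (\<Union>r\<in>set [p]. set (blk d r))"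
      unfolding graph.simps 2 sum.case
      by (rule fv_args) (use g IH in \<open>auto simp: is_fm_def 2\<close>)
    moreover have "wf_fm LN (graph (Fn h ts) p)"
      unfolding graph.simps 2 sum.case by (rule wf_args) (use g IH in \<open>auto simp: is_fm_def\<close>)
    ultimately show ?thesis by simp
  next
    case (3 i)
    have ts: "length ts = k i" "\<And>t. t \<in> set ts \<Longrightarrow> wf_tm L' t \<and> tm_sort L' t = Inl ()" and i: "i \<in> I"
      using Fn.prems by (auto simp: 3 sorts_rep)
    have m: "wf_tm LN (main_tm t)" "fv_tm (main_tm t) \<subseteq> (\<Union>v\<in>fv_tm t. code v)" if "t \<in> set ts" for t
      using wf_main_tm[of t] ts(2)[OF that] by auto
    have "fv (plug (k i + d) (imap J i) (map main_tm ts @ map Var (blk d p))) \<subseteq>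
        (\<Union>t\<in>set (map main_tm ts @ map Var (blk d p)). fv_tm t)"
      by (rule fv_plug) (use imap[OF i] ts in \<open>auto simp: is_fm_def\<close>)
    then show ?thesis using m ts imap[OF i] by (fastforce simp: 3 is_fm_def intro!: wf_plug LN)
  qed
qed

lemma tr_syntax:
  assumes "wf_fm L' \<phi>"
  shows "wf_fm LN (tr \<phi>) \<and> fv (tr \<phi>) \<subseteq> (\<Union>v\<in>fv \<phi>. code v)"
  using assms
proof (induction \<phi>)
  case (Eq t s)
  show ?case
  proof (cases "tm_sort L' t")
    case (Inl a)
    then have "tm_sort L' t = Inl ()" "tm_sort L' s = Inl ()" using Eq by auto
    then show ?thesis using Eq wf_main_tm[of t] wf_main_tm[of s] by auto
  next
    case (Inr a)
    define p where "p = fresh [t, s]"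
    have "fv (exb [p] (Conj (graph t p) (graph s p))) \<subseteq> (\<Union>v\<in>fv (Eq t s). code v)"
      using fv_exb[of "[p]" "Conj (graph t p) (graph s p)"] graph_syntax[of t p] graph_syntax[of s p] Eq Inr by auto
    moreover have "wf_fm LN (exb [p] (Conj (graph t p) (graph s p)))"
      by (rule wf_exb) (use graph_syntax[of t p] graph_syntax[of s p] Eq Inr in auto)
    ultimately show ?thesis by (simp add: Inr p_def[symmetric])
  qed
next
  case (Rel r ts)
  show ?case
  proof (cases r)
    case (Inl q)
    have "\<forall>t\<in>set ts. wf_tm LN (main_tm t) \<and> fv_tm (main_tm t) \<subseteq> (\<Union>v\<in>fv_tm t. code v)" "length ts = length (rdom LN q)"
      using Rel wf_main_tm by (auto simp: Inl sorts_main)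
    moreover from this have "map (tm_sort LN \<circ> main_tm) ts = rdom LN q" by (auto intro!: nth_equalityI)
    ultimately show ?thesis using Rel by (fastforce simp: Inl)
  next
    case (Inr q)
    define p where "p = fresh ts"
    have ts: "length ts = length (rdom LK q)" "\<And>t. t \<in> set ts \<Longrightarrow> wf_tm L' t \<and> tm_sort L' t = Inr ()"
      and q: "is_fm LN (length ts * d) (irel J q)"
      using Rel irel[of q] by (auto simp: Inr sorts_K)
    have gr: "wf_fm LN (graph (ts ! i) p')"
      "fv (graph (ts ! i) p') \<subseteq> (\<Union>v\<in>fv (Rel r ts). code v) \<union> set (blk d p')" if "i < length ts" for i p'
      using graph_syntax[of "ts ! i" p'] ts(2)[of "ts ! i"] that by fastforce+
    have "fv (tr (Rel r ts)) \<subseteq> (\<Union>v\<in>fv (Rel r ts). code v) \<union> (\<Union>r\<in>set []. set (blk d r))"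
      unfolding tr.simps Inr sum.case p_def[symmetric] Let_def
      by (rule fv_args) (use q gr in \<open>auto simp: is_fm_def Inr\<close>)
    moreover have "wf_fm LN (tr (Rel r ts))"
      unfolding tr.simps Inr sum.case p_def[symmetric] Let_def
      by (rule wf_args) (use q gr in \<open>auto simp: is_fm_def\<close>)
    ultimately show ?thesis by simp
  qed
next
  case (Ex v \<phi>)
  obtain s n where v: "v = (s, n)" by (cases v)
  show ?case
  proof (cases s)
    case (Inl a)
    have "wf_fm LN (tr \<phi>)" "fv (tr \<phi>) \<subseteq> (\<Union>v\<in>fv \<phi>. code v)" using Ex by auto
    then show ?thesis using v Inl by fastforce
  next
    case (Inr a)
    have "fv (exb [n] (tr \<phi>)) \<subseteq> fv (tr \<phi>) - set (blk d n)" using fv_exb[of "[n]" "tr \<phi>"] by simp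
    moreover have "wf_fm LN (tr \<phi>)" "fv (tr \<phi>) \<subseteq> (\<Union>v\<in>fv \<phi>. code v)" using Ex by auto
    moreover from this have "wf_fm LN (exb [n] (tr \<phi>))" by (intro wf_exb)
    ultimately show ?thesis using v Inr by fastforce
  qed
qed auto

section \<open>Truth of translated formulas\<close>

lemma benv_carr:
  assumes "H ` interp_dom J A = univ K" "\<And>n. f n \<in> univ A" "\<And>n. F n \<in> interp_dom J A"
  shows "benv H f F v \<in> carr (adjoin_struct A K lam) (fst v)"
  using assms by (cases "(H, f, F, v)" rule: benv.cases) auto

text \<open>\<open>H\<close> maps the domain onto \<open>K\<close>, so every value in the sort of K
  has a representing tuple. These tuples fill the blocks over which the translation
  quantifies.\<close>

lemma tm_val_K:
  assumes c: "coded A K lam H" and "wf_tm L' t" "tm_sort L' t = Inr ()"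
    and F: "\<And>n. f n \<in> univ A" "\<And>n. F n \<in> interp_dom J A"
  shows "\<exists>y\<in>interp_dom J A. tm_val (adjoin_struct A K lam) (benv H f F) t = Inr (H y)"
proof -
  have "tm_val (adjoin_struct A K lam) (benv H f F) t \<in> carr (adjoin_struct A K lam) (Inr ())"
    using tm_val_carr[OF is_struct_adjoin assms(2), of A K lam "benv H f F"] benv_carr[of H A K f F] assms
    by (auto simp: coded_def)
  moreover have "univ K = H ` interp_dom J A" using c by (simp add: coded_def)
  ultimately show ?thesis by auto
qed

lemma benv_cong:
  assumes "\<And>n. n < p \<Longrightarrow> F' n = F n" "\<And>v. v \<in> fv_tm t \<Longrightarrow> snd v < p"
  shows "tm_val B (benv H f F') t = tm_val B (benv H f F) t"
proof (rule tm_val_cong)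
  fix v assume "v \<in> fv_tm t"
  then show "benv H f F' v = benv H f F v"
    using assms by (cases "(H, f, F, v)" rule: benv.cases) auto
qed

text \<open>The variables of \<open>t\<close> are numbered below \<open>p\<close>, and besides their
  codes only block \<open>p\<close> is free in \<open>graph t p\<close>. Therefore the blocks bound
  inside the formula for one argument may coincide with those reserved for later arguments: the
  shadowing is harmless.\<close>

lemma sat_graph:
  assumes c: "coded A K lam H" and f: "\<And>n. f n \<in> univ A"
  shows "wf_tm L' t \<Longrightarrow> tm_sort L' t = Inr () \<Longrightarrow> (\<And>v. v \<in> fv_tm t \<Longrightarrow> snd v < p) \<Longrightarrow>
    (\<And>n. F n \<in> interp_dom J A) \<Longrightarrow>
    sat A (cenv d f F) (graph t p) \<longleftrightarrow> tm_val (adjoin_struct A K lam) (benv H f F) t = Inr (H (F p))"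
proof (induction t arbitrary: p F)
  case (Var v)
  have len: "length (F n) = d" for n using interp_domD(1)[OF Var.prems(4)] .
  obtain n where v: "v = (Inr (), n)" using Var by (cases v) auto
  have "sat A (cenv d f F) (plug (2 * d) (ieq J) (map Var (blk d n @ blk d p))) \<longleftrightarrow>
      holds A (ieq J) (map (tm_val A (cenv d f F)) (map Var (blk d n @ blk d p)))"
  proof (rule sat_plug)
    fix t :: "(unit, 'fn) tm" assume "t \<in> set (map Var (blk d n @ blk d p))"
    then have "tm_val A (cenv d f F) t \<in> set (map (cenv d f F) (blk d n)) \<union> set (map (cenv d f F) (blk d p))"
      by auto
    then show "tm_val A (cenv d f F) t \<in> univ A"
      unfolding map_cenv_blk[OF len] using interp_domD(2)[OF Var.prems(4)] by auto
  qed (use ieq in \<open>auto simp: is_fm_def\<close>)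
  also have "\<dots> \<longleftrightarrow> holds A (ieq J) (F n @ F p)" using len by (simp add: comp_def)
  also have "\<dots> \<longleftrightarrow> H (F n) = H (F p)" using c Var.prems(4) by (simp add: coded_def)
  finally show ?case by (simp add: v)
next
  case (Fn h ts)
  let ?B = "adjoin_struct A K lam"
  show ?case
  proof (cases h rule: adj_fun_cases)
    case (1 f)
    then show ?thesis using Fn.prems by simp
  next
    case (2 g)
    have ts: "length ts = length (fdom LK g)" "\<And>t. t \<in> set ts \<Longrightarrow> wf_tm L' t \<and> tm_sort L' t = Inr ()"
      and g: "is_fm LN ((length ts + 1) * d) (ifun J g)" "g \<in> funs LK"
      using Fn.prems ifun[of g] by (auto simp: 2 sorts_K)
    define w where "w i = projr (tm_val ?B (benv H f F) (ts ! i))" for i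
    have w: "tm_val ?B (benv H f F) (ts ! i) = Inr (w i)" if "i < length ts" for i
      using tm_val_K[OF c, of "ts ! i" f F] that ts(2) f Fn.prems(4) by (auto simp: w_def)
    have "sat A (cenv d f F) (graph (Fn h ts) p) \<longleftrightarrow>
      (\<exists>xss. length xss = length ts \<and> set xss \<subseteq> interp_dom J A \<and>
       (\<forall>i<length ts. H (xss ! i) = w i) \<and> holds A (ifun J g) (concat (xss @ map F [p])))"
      unfolding graph.simps 2 sum.case
    proof (subst sat_args[where w = w and H = H])
      fix i F' assume i: "i < length (map (\<lambda>i. graph (ts ! i) (Suc p + i)) [0..<length ts])"
        and F': "\<And>n. F' n \<in> interp_dom J A" "\<And>n. n < Suc p \<Longrightarrow> F' n = F n"
      have vp: "snd v < p" if "v \<in> fv_tm (ts ! i)" for v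
        using i that by (intro Fn.prems(3)) auto
      have "sat A (cenv d f F') (graph (ts ! i) (Suc p + i)) \<longleftrightarrow>
          tm_val ?B (benv H f F') (ts ! i) = Inr (H (F' (Suc p + i)))"
      proof (rule Fn.IH)
        fix v assume "v \<in> fv_tm (ts ! i)"
        then show "snd v < Suc p + i" using vp by fastforce
      qed (use i ts F' in auto)
      moreover have "tm_val ?B (benv H f F') (ts ! i) = tm_val ?B (benv H f F) (ts ! i)"
        by (rule benv_cong[of p]) (use F' vp in auto)
      ultimately show "sat A (cenv d f F') (map (\<lambda>i. graph (ts ! i) (Suc p + i)) [0..<length ts] ! i) =
          (w i = H (F' (Suc p + i)))"
        using i w[of i] by simp
    qed (use Fn.prems g in \<open>auto simp: is_fm_def\<close>)
    also have "\<dots> \<longleftrightarrow> (\<exists>xss. length xss = length ts \<and> set xss \<subseteq> interp_dom J A \<and>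
       (\<forall>i<length ts. H (xss ! i) = w i) \<and> fint K g (map H xss) = H (F p))"
      using c g(2) ts(1) Fn.prems(4) by (intro ex_cong1) (auto simp: coded_def)
    also have "\<dots> \<longleftrightarrow> fint K g (map w [0..<length ts]) = H (F p)"
    proof -
      have "\<exists>y\<in>interp_dom J A. H y = w i" if "i < length ts" for i
        using tm_val_K[OF c, of "ts ! i" f F] that ts(2) f Fn.prems(4) w[OF that] by auto
      then obtain y where y: "\<And>i. i < length ts \<Longrightarrow> y i \<in> interp_dom J A \<and> H (y i) = w i" by metis
      have *: "map H xss = map w [0..<length ts]" if "length xss = length ts" "\<forall>i<length ts. H (xss ! i) = w i" for xss
        by (rule nth_equalityI) (use that in auto)
      \<comment> \<open>Representatives of all argument values exist, and any two choices have the
        same image under \<open>H\<close>; hence the quantifier over \<open>xss\<close>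
        disappears.\<close>
      have "\<exists>xss. length xss = length ts \<and> set xss \<subseteq> interp_dom J A \<and> (\<forall>i<length ts. H (xss ! i) = w i)"
        by (rule exI[of _ "map y [0..<length ts]"]) (use y in auto)
      then show ?thesis using * by metis
    qed
    also have "map w [0..<length ts] = map projr (map (tm_val ?B (benv H f F)) ts)"
      by (rule nth_equalityI) (auto simp: w_def)
    finally show ?thesis by (simp add: 2)
  next
    case (3 i)
    have ts: "length ts = k i" "\<And>t. t \<in> set ts \<Longrightarrow> wf_tm L' t \<and> tm_sort L' t = Inl ()" and i: "i \<in> I"
      using Fn.prems by (auto simp: 3 sorts_rep)
    have len: "length (F n) = d" for n using interp_domD(1)[OF Fn.prems(4)] .
    let ?ws = "map (tm_val A (cenv d f F) \<circ> main_tm) ts"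
    have tv: "tm_val ?B (benv H f F) t = Inl (tm_val A (cenv d f F) (main_tm t))" if "t \<in> set ts" for t
      using tm_val_main_tm[of t] ts(2)[OF that] by blast
    have ws: "tm_val A (cenv d f F) (main_tm t) \<in> univ A" if "t \<in> set ts" for t
    proof -
      have "tm_val ?B (benv H f F) t \<in> carr ?B (Inl ())"
        using tm_val_carr[OF is_struct_adjoin, of A K lam t "benv H f F"] ts(2)[OF that]
          benv_carr[of H A K f F] c f Fn.prems(4) by (auto simp: coded_def)
      then show ?thesis using tv[OF that] by auto
    qed
    have "sat A (cenv d f F) (graph (Fn h ts) p) \<longleftrightarrow>
        holds A (imap J i) (map (tm_val A (cenv d f F)) (map main_tm ts @ map Var (blk d p)))"
      unfolding graph.simps 3 sum.case
    proof (rule sat_plug)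
      fix t assume "t \<in> set (map main_tm ts @ map Var (blk d p))"
      then have "t \<in> main_tm ` set ts \<or> tm_val A (cenv d f F) t \<in> set (map (cenv d f F) (blk d p))" by auto
      then show "tm_val A (cenv d f F) t \<in> univ A"
        unfolding map_cenv_blk[OF len] using interp_domD(2)[OF Fn.prems(4)] ws by auto
    qed (use imap[OF i] ts in \<open>auto simp: is_fm_def\<close>)
    also have "\<dots> \<longleftrightarrow> holds A (imap J i) (?ws @ F p)" using len by (simp add: comp_def)
    also have "\<dots> \<longleftrightarrow> lam i ?ws = H (F p)"
    proof -
      have "?ws \<in> tuples A (k i)" using ws ts by (auto simp: tuples_def)
      then show ?thesis using c i Fn.prems(4) unfolding coded_def by blast
    qed
    also have "?ws = map projl (map (tm_val ?B (benv H f F)) ts)" using tv by simp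
    finally show ?thesis by (simp add: 3)
  qed
qed

lemma benv_upd:
  "(benv H f F)((Inl s, n) := Inl x) = benv H (f(n := x)) F"
  "(benv H f F)((Inr t, n) := Inr (H y)) = benv H f (F(n := y))"
proof -
  show "(benv H f F)((Inl s, n) := Inl x) = benv H (f(n := x)) F"
  proof
    fix v show "((benv H f F)((Inl s, n) := Inl x)) v = benv H (f(n := x)) F v"
      by (cases "(H, f, F, v)" rule: benv.cases) auto
  qed
  show "(benv H f F)((Inr t, n) := Inr (H y)) = benv H f (F(n := y))"
  proof
    fix v show "((benv H f F)((Inr t, n) := Inr (H y))) v = benv H f (F(n := y)) v"
      by (cases "(H, f, F, v)" rule: benv.cases) auto
  qed
qed

text \<open>Both sides read the same data \<open>f\<close> and \<open>F\<close>. The left side sees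
  a block only through \<open>H\<close>, the right side sees the tuple itself, and the conditions in
  \<open>coded\<close> say that the formulas of the interpretation do not notice the
  difference.\<close>

theorem sat_tr:
  assumes c: "coded A K lam H"
  shows "wf_fm L' \<phi> \<Longrightarrow> (\<And>n. f n \<in> univ A) \<Longrightarrow> (\<And>n. F n \<in> interp_dom J A) \<Longrightarrow>
    sat (adjoin_struct A K lam) (benv H f F) \<phi> \<longleftrightarrow> sat A (cenv d f F) (tr \<phi>)"
proof (induction \<phi> arbitrary: f F)
  case (Eq t s)
  let ?B = "adjoin_struct A K lam"
  show ?case
  proof (cases "tm_sort L' t")
    case (Inl a)
    then have "tm_sort L' t = Inl ()" "tm_sort L' s = Inl ()" using Eq by auto
    then show ?thesis using Eq tm_val_main_tm[of t A K lam H f F] tm_val_main_tm[of s A K lam H f F] by simp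
  next
    case (Inr a)
    then have srt: "tm_sort L' t = Inr ()" "tm_sort L' s = Inr ()" using Eq by auto
    \<comment> \<open>Block \<open>p\<close> lies beyond all variables of both terms, so filling it
      leaves their values unchanged.\<close>
    define p where "p = fresh [t, s]"
    have p: "snd v < p" if "v \<in> fv_tm t \<union> fv_tm s" for v using that fresh[of _ "[t, s]" v] by (auto simp: p_def)
    have "sat A (cenv d f F) (exb [p] (Conj (graph t p) (graph s p))) \<longleftrightarrow>
      (\<exists>F'. (\<forall>n. F' n \<in> interp_dom J A) \<and> (\<forall>n. n \<notin> {p} \<longrightarrow> F' n = F n) \<and>
        tm_val ?B (benv H f F') t = Inr (H (F' p)) \<and> tm_val ?B (benv H f F') s = Inr (H (F' p)))"
      unfolding sat_exb[OF Eq.prems(3)]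
    proof (intro ex_cong1)
      fix F'
      have "sat A (cenv d f F') (graph x p) \<longleftrightarrow> tm_val ?B (benv H f F') x = Inr (H (F' p))"
        if "\<forall>n. F' n \<in> interp_dom J A" "x \<in> {t, s}" for x
        by (rule sat_graph[OF c Eq.prems(2)]) (use Eq.prems srt p that in auto)
      then show "(\<forall>n. F' n \<in> interp_dom J A) \<and> (\<forall>n. n \<notin> set [p] \<longrightarrow> F' n = F n) \<and>
          sat A (cenv d f F') (Conj (graph t p) (graph s p)) \<longleftrightarrow>
          (\<forall>n. F' n \<in> interp_dom J A) \<and> (\<forall>n. n \<notin> {p} \<longrightarrow> F' n = F n) \<and>
          tm_val ?B (benv H f F') t = Inr (H (F' p)) \<and> tm_val ?B (benv H f F') s = Inr (H (F' p))"
        by auto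
    qed
    also have "\<dots> \<longleftrightarrow> (\<exists>F'. (\<forall>n. F' n \<in> interp_dom J A) \<and> (\<forall>n. n \<notin> {p} \<longrightarrow> F' n = F n) \<and>
        tm_val ?B (benv H f F) t = Inr (H (F' p)) \<and> tm_val ?B (benv H f F) s = Inr (H (F' p)))"
    proof (intro ex_cong1 conj_cong refl)
      fix F' assume "\<forall>n. n \<notin> {p} \<longrightarrow> F' n = F n"
      then have "tm_val ?B (benv H f F') t = tm_val ?B (benv H f F) t"
        "tm_val ?B (benv H f F') s = tm_val ?B (benv H f F) s"
        using p by (auto intro!: benv_cong[of p])
      then show "(tm_val ?B (benv H f F') t = Inr (H (F' p))) = (tm_val ?B (benv H f F) t = Inr (H (F' p)))"
        "(tm_val ?B (benv H f F') s = Inr (H (F' p))) = (tm_val ?B (benv H f F) s = Inr (H (F' p)))" by auto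
    qed
    also have "\<dots> \<longleftrightarrow> tm_val ?B (benv H f F) t = tm_val ?B (benv H f F) s"
    proof
      assume eq: "tm_val ?B (benv H f F) t = tm_val ?B (benv H f F) s"
      obtain y where "y \<in> interp_dom J A" "tm_val ?B (benv H f F) t = Inr (H y)"
        using tm_val_K[OF c, of t f F] Eq.prems srt by auto
      then show "\<exists>F'. (\<forall>n. F' n \<in> interp_dom J A) \<and> (\<forall>n. n \<notin> {p} \<longrightarrow> F' n = F n) \<and>
        tm_val ?B (benv H f F) t = Inr (H (F' p)) \<and> tm_val ?B (benv H f F) s = Inr (H (F' p))"
        using eq Eq.prems by (intro exI[of _ "F(p := y)"]) auto
    qed auto
    finally show ?thesis by (simp add: Inr p_def[symmetric])
  qed
next
  case (Rel r ts)
  let ?B = "adjoin_struct A K lam"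
  show ?case
  proof (cases r)
    case (Inl q)
    have ts: "\<And>t. t \<in> set ts \<Longrightarrow> wf_tm L' t \<and> tm_sort L' t = Inl ()"
      using Rel by (auto simp: Inl sorts_main)
    have "map (projl \<circ> tm_val ?B (benv H f F)) ts = map (tm_val A (cenv d f F) \<circ> main_tm) ts"
      using ts tm_val_main_tm[of _ A K lam H f F] by simp
    then show ?thesis by (simp add: Inl del: map_eq_conv)
  next
    case (Inr q)
    define p where "p = fresh ts"
    have ts: "length ts = length (rdom LK q)" "\<And>t. t \<in> set ts \<Longrightarrow> wf_tm L' t \<and> tm_sort L' t = Inr ()"
      and q: "is_fm LN (length ts * d) (irel J q)" "q \<in> rels LK"
      using Rel irel[of q] by (auto simp: Inr sorts_K)
    have p: "snd v < p" if "v \<in> fv_tm t" "t \<in> set ts" for v t using that fresh by (auto simp: p_def)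
    define w where "w i = projr (tm_val ?B (benv H f F) (ts ! i))" for i
    have w: "tm_val ?B (benv H f F) (ts ! i) = Inr (w i)" if "i < length ts" for i
      using tm_val_K[OF c, of "ts ! i" f F] that ts(2) Rel.prems by (auto simp: w_def)
    have "sat A (cenv d f F) (tr (Rel r ts)) \<longleftrightarrow>
      (\<exists>xss. length xss = length ts \<and> set xss \<subseteq> interp_dom J A \<and>
       (\<forall>i<length ts. H (xss ! i) = w i) \<and> holds A (irel J q) (concat (xss @ map F [])))"
      unfolding tr.simps Inr sum.case p_def[symmetric] Let_def
    proof (subst sat_args[where w = w and H = H])
      fix i F' assume i: "i < length (map (\<lambda>i. graph (ts ! i) (p + i)) [0..<length ts])"
        and F': "\<And>n. F' n \<in> interp_dom J A" "\<And>n. n < p \<Longrightarrow> F' n = F n"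
      have "sat A (cenv d f F') (graph (ts ! i) (p + i)) \<longleftrightarrow>
          tm_val ?B (benv H f F') (ts ! i) = Inr (H (F' (p + i)))"
        by (rule sat_graph[OF c]) (use i ts Rel.prems F' p in \<open>auto simp: trans_less_add1\<close>)
      moreover have "tm_val ?B (benv H f F') (ts ! i) = tm_val ?B (benv H f F) (ts ! i)"
        by (rule benv_cong[of p]) (use F' i p in auto)
      ultimately show "sat A (cenv d f F') (map (\<lambda>i. graph (ts ! i) (p + i)) [0..<length ts] ! i) =
          (w i = H (F' (p + i)))"
        using i w[of i] by simp
    qed (use Rel.prems q in \<open>auto simp: is_fm_def\<close>)
    also have "\<dots> \<longleftrightarrow> (\<exists>xss. length xss = length ts \<and> set xss \<subseteq> interp_dom J A \<and>
       (\<forall>i<length ts. H (xss ! i) = w i) \<and> rint K q (map H xss))"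
      using c q(2) ts(1) by (intro ex_cong1) (auto simp: coded_def)
    also have "\<dots> \<longleftrightarrow> rint K q (map w [0..<length ts])"
    proof -
      have "\<exists>y\<in>interp_dom J A. H y = w i" if "i < length ts" for i
        using tm_val_K[OF c, of "ts ! i" f F] that ts(2) Rel.prems w[OF that] by auto
      then obtain y where y: "\<And>i. i < length ts \<Longrightarrow> y i \<in> interp_dom J A \<and> H (y i) = w i" by metis
      have *: "map H xss = map w [0..<length ts]" if "length xss = length ts" "\<forall>i<length ts. H (xss ! i) = w i" for xss
        by (rule nth_equalityI) (use that in auto)
      have "\<exists>xss. length xss = length ts \<and> set xss \<subseteq> interp_dom J A \<and> (\<forall>i<length ts. H (xss ! i) = w i)"
        by (rule exI[of _ "map y [0..<length ts]"]) (use y in auto)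
      then show ?thesis using * by metis
    qed
    also have "map w [0..<length ts] = map projr (map (tm_val ?B (benv H f F)) ts)"
      by (rule nth_equalityI) (auto simp: w_def)
    finally show ?thesis by (simp add: Inr)
  qed
next
  case (Ex v \<phi>)
  let ?B = "adjoin_struct A K lam"
  obtain s n where v: "v = (s, n)" by (cases v)
  show ?case
  proof (cases s)
    case (Inl a)
    have "sat ?B (benv H f F) (Ex v \<phi>) \<longleftrightarrow> (\<exists>x\<in>univ A. sat ?B (benv H (f(n := x)) F) \<phi>)"
      by (simp add: v Inl benv_upd)
    also have "\<dots> \<longleftrightarrow> (\<exists>x\<in>univ A. sat A (cenv d (f(n := x)) F) (tr \<phi>))"
      by (rule bex_cong[OF refl], rule Ex.IH) (use Ex.prems in auto)
    finally show ?thesis by (simp add: v Inl cenv_upd_slot)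
  next
    case (Inr a)
    have K: "univ K = H ` interp_dom J A" using c by (simp add: coded_def)
    have "sat ?B (benv H f F) (Ex v \<phi>) \<longleftrightarrow> (\<exists>y\<in>interp_dom J A. sat ?B (benv H f (F(n := y))) \<phi>)"
      by (simp add: v Inr benv_upd K)
    also have "\<dots> \<longleftrightarrow> (\<exists>y\<in>interp_dom J A. sat A (cenv d f (F(n := y))) (tr \<phi>))"
      by (rule bex_cong[OF refl], rule Ex.IH) (use Ex.prems in auto)
    finally show ?thesis by (simp add: v Inr exb_def sat_exb1)
  qed
next
  case (Neg \<phi>)
  have "sat (adjoin_struct A K lam) (benv H f F) \<phi> \<longleftrightarrow> sat A (cenv d f F) (tr \<phi>)"
    by (rule Neg.IH) (use Neg.prems in auto)
  then show ?case by simp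
next
  case (Conj \<phi> \<psi>)
  have "sat (adjoin_struct A K lam) (benv H f F) \<phi> \<longleftrightarrow> sat A (cenv d f F) (tr \<phi>)"
    by (rule Conj.IH) (use Conj.prems in auto)
  moreover have "sat (adjoin_struct A K lam) (benv H f F) \<psi> \<longleftrightarrow> sat A (cenv d f F) (tr \<psi>)"
    by (rule Conj.IH) (use Conj.prems in auto)
  ultimately show ?case by simp
qed auto

end

section \<open>Ultraproducts\<close>

text \<open>Zorn's lemma yields a maximal family \<open>M\<close> above \<open>F\<close> whose
  finite intersections meet \<open>X\<close>. The filter generated by \<open>X\<close> and
  \<open>M\<close> decides every set: one that cannot be added to \<open>M\<close> is disjoint from
  \<open>X\<close> intersected with finitely many members of \<open>M\<close>.\<close>

lemma ultrafilter_exists: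
  assumes fip: "\<And>G. finite G \<Longrightarrow> G \<subseteq> F \<Longrightarrow> X \<inter> \<Inter>G \<noteq> {}"
  shows "\<exists>U. ultrafilter_on X U \<and> (\<forall>S\<in>F. eventually (\<lambda>a. a \<in> S) U)"
proof -
  define \<A> where "\<A> = {M. F \<subseteq> M \<and> (\<forall>G. finite G \<and> G \<subseteq> M \<longrightarrow> X \<inter> \<Inter>G \<noteq> {})}"
  have "\<exists>M\<in>\<A>. \<forall>Y\<in>\<A>. M \<subseteq> Y \<longrightarrow> Y = M"
  proof (rule subset_Zorn_nonempty)
    show "\<A> \<noteq> {}" using fip by (auto simp: \<A>_def)
  next
    fix C assume C: "C \<noteq> {}" "subset.chain \<A> C"
    have *: "X \<inter> \<Inter>G \<noteq> {}" if G: "finite G" "G \<subseteq> \<Union>C" for G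
    proof -
      obtain M where "M \<in> C" "G \<subseteq> M" by (rule finite_subset_Union_chain[OF G C])
      then show ?thesis using C G by (auto simp: \<A>_def subset_chain_def)
    qed
    obtain M0 where "M0 \<in> C" "M0 \<in> \<A>" using C by (auto simp: subset_chain_def)
    then have "F \<subseteq> \<Union>C" by (auto simp: \<A>_def)
    then show "\<Union>C \<in> \<A>" using * by (simp add: \<A>_def)
  qed
  then obtain M where M: "M \<in> \<A>" and max: "\<And>Y. Y \<in> \<A> \<Longrightarrow> M \<subseteq> Y \<Longrightarrow> Y = M" by blast
  define U where "U = (INF S\<in>insert X M. principal S)"
  have evU: "eventually P U \<longleftrightarrow> (\<exists>Y\<subseteq>insert X M. finite Y \<and> eventually P (INF S\<in>Y. principal S))" for P
    unfolding U_def by (rule eventually_INF)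
  have ev: "eventually P U \<longleftrightarrow> (\<exists>G. finite G \<and> G \<subseteq> M \<and> X \<inter> \<Inter>G \<subseteq> {a. P a})" for P
  proof
    assume "eventually P U"
    then obtain G where G: "G \<subseteq> insert X M" "finite G" "eventually P (INF S\<in>G. principal S)"
      unfolding evU by blast
    then have "X \<inter> \<Inter>(G - {X}) \<subseteq> {a. P a}"
      by (auto simp: INF_principal_finite eventually_principal)
    then show "\<exists>G. finite G \<and> G \<subseteq> M \<and> X \<inter> \<Inter>G \<subseteq> {a. P a}" using G by (intro exI[of _ "G - {X}"]) auto
  next
    assume "\<exists>G. finite G \<and> G \<subseteq> M \<and> X \<inter> \<Inter>G \<subseteq> {a. P a}"
    then obtain G where G: "finite G" "G \<subseteq> M" "X \<inter> \<Inter>G \<subseteq> {a. P a}" by blast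
    then have "eventually P (INF S\<in>insert X G. principal S)"
      by (subst INF_principal_finite) (auto simp: eventually_principal)
    then show "eventually P U" unfolding evU using G by (intro exI[of _ "insert X G"]) auto
  qed
  have "U \<noteq> bot" using ev[of "\<lambda>_. False"] M by (auto simp: trivial_limit_def \<A>_def)
  moreover have "eventually (\<lambda>a. a \<in> X) U" unfolding ev by (intro exI[of _ "{}"]) auto
  moreover have "eventually P U \<or> eventually (\<lambda>a. \<not> P a) U" for P
  proof (cases "{a. P a} \<in> M")
    case True
    then have "eventually P U" unfolding ev by (intro exI[of _ "{{a. P a}}"]) auto
    then show ?thesis ..
  next
    case False
    then have "insert {a. P a} M \<notin> \<A>" using max[of "insert {a. P a} M"] by auto
    then obtain G where G: "finite G" "G \<subseteq> insert {a. P a} M" "X \<inter> \<Inter>G = {}" using M by (auto simp: \<A>_def)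
    \<comment> \<open>Dropping \<open>{a. P a}\<close> from a finite family without common point in
      \<open>X\<close> leaves members of \<open>M\<close> whose common points in \<open>X\<close>
      all violate \<open>P\<close>.\<close>
    then have "eventually (\<lambda>a. \<not> P a) U" unfolding ev by (intro exI[of _ "G - {{a. P a}}"]) auto
    then show ?thesis ..
  qed
  moreover have "eventually (\<lambda>a. a \<in> S) U" if "S \<in> F" for S
    unfolding ev using that M by (intro exI[of _ "{S}"]) (auto simp: \<A>_def)
  ultimately show ?thesis unfolding ultrafilter_on_def by blast
qed

lemma eventually_sym: "eventually (\<lambda>a. x a = y a) F \<Longrightarrow> eventually (\<lambda>a. y a = x a) F"
  by (erule eventually_mono) simp

lemma eventually_trans:
  "eventually (\<lambda>a. x a = y a) F \<Longrightarrow> eventually (\<lambda>a. y a = z a) F \<Longrightarrow> eventually (\<lambda>a. x a = z a) F"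
  by (erule eventually_elim2) auto

lemma ultrafilter_Neg:
  assumes "ultrafilter_on X U"
  shows "eventually (\<lambda>a. \<not> P a) U \<longleftrightarrow> \<not> eventually P U"
proof
  assume "eventually (\<lambda>a. \<not> P a) U"
  then show "\<not> eventually P U"
    using assms eventually_elim2[of "\<lambda>a. \<not> P a" U P "\<lambda>_. False"] by (auto simp: ultrafilter_on_def trivial_limit_def)
qed (use assms in \<open>auto simp: ultrafilter_on_def\<close>)

section \<open>Los' theorem\<close>

locale ultra =
  fixes L :: "(unit, 'f, 'r) lang" and X :: "'m set" and U :: "'m filter"
    and N :: "'m \<Rightarrow> (unit, 'f, 'r, 'u) struct"
  assumes L: "wf_lang L" and U: "ultrafilter_on X U" and N: "\<And>a. a \<in> X \<Longrightarrow> is_struct L (N a)"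
begin

abbreviation "UP \<equiv> ultraproduct X U N"
abbreviation "PiN \<equiv> (\<Pi>\<^sub>E a\<in>X. univ (N a))"
abbreviation "cls x \<equiv> ultra_rel X U N `` {x}"

lemma in_X: "eventually (\<lambda>a. a \<in> X) U"
  using U by (simp add: ultrafilter_on_def)

lemma eventuallyI: "(\<And>a. a \<in> X \<Longrightarrow> P a) \<Longrightarrow> eventually P U"
  using in_X by (rule eventually_mono) auto

lemma eventually_cong: "eventually (\<lambda>a. P a = Q a) U \<Longrightarrow> eventually P U = eventually Q U"
  by (auto elim: eventually_elim2)

lemma cls_eq: "x \<in> PiN \<Longrightarrow> y \<in> PiN \<Longrightarrow> cls x = cls y \<longleftrightarrow> eventually (\<lambda>a. x a = y a) U"
proof -
  assume x: "x \<in> PiN" "y \<in> PiN"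
  have "equiv PiN (ultra_rel X U N)"
  proof (rule equivI)
    show "ultra_rel X U N \<subseteq> PiN \<times> PiN" by (auto simp: ultra_rel_def)
    show "refl_on PiN (ultra_rel X U N)" by (auto simp: refl_on_def ultra_rel_def)
    show "sym (ultra_rel X U N)" by (auto simp: sym_def ultra_rel_def intro: eventually_sym)
    show "trans (ultra_rel X U N)"
      by (auto simp: trans_def ultra_rel_def intro: eventually_trans)
  qed
  then show ?thesis using x by (simp add: eq_equiv_class_iff) (simp add: ultra_rel_def)
qed

lemma carr_UP: "carr UP s = (\<lambda>x. cls x) ` PiN"
  by (auto simp: ultraproduct_def quotient_def)

lemma some_cls:
  assumes "x \<in> PiN"
  shows "(SOME y. y \<in> cls x) \<in> PiN \<and> eventually (\<lambda>a. (SOME y. y \<in> cls x) a = x a) U"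
proof -
  have "x \<in> cls x" using assms by (auto simp: ultra_rel_def)
  then have "(SOME y. y \<in> cls x) \<in> cls x" by (rule someI[where P = "\<lambda>y. y \<in> cls x"])
  then show ?thesis by (auto simp: ultra_rel_def intro: eventually_sym)
qed

lemma lsorts_L [simp]: "lsorts L = UNIV"
  using L by (auto simp: wf_lang_def)

lemma tm_val_carr': "wf_tm L t \<Longrightarrow> a \<in> X \<Longrightarrow> (\<And>v. e v \<in> univ (N a)) \<Longrightarrow> tm_val (N a) e t \<in> univ (N a)"
  using tm_val_carr[OF N, of a t e] by auto

lemma fint_carr': "f \<in> funs L \<Longrightarrow> a \<in> X \<Longrightarrow> length us = length (fdom L f) \<Longrightarrow> set us \<subseteq> univ (N a) \<Longrightarrow>
    fint (N a) f us \<in> univ (N a)"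
  using N[of a] by (auto simp: is_struct_def list_all2_conv_all_nth subset_iff)

text \<open>The ultraproduct computes its functions and relations from chosen representatives of the
  classes. These agree with prescribed representatives almost everywhere, and for finitely many
  arguments this happens simultaneously.\<close>

lemma Los_args:
  assumes E: "\<And>t. t \<in> set ts \<Longrightarrow> T t \<in> PiN"
  shows "eventually (\<lambda>a. map (\<lambda>Y. (SOME y. y \<in> Y) a) (map (\<lambda>t. cls (T t)) ts) = map (\<lambda>t. T t a) ts) U"
proof -
  have "eventually (\<lambda>a. \<forall>t\<in>set ts. (SOME y. y \<in> cls (T t)) a = T t a) U"
    by (rule eventually_ball_finite) (use E some_cls in auto)
  then show ?thesis by (rule eventually_mono) auto
qed

lemma Los_tm:
  "wf_tm L t \<Longrightarrow> (\<And>v. E v \<in> PiN) \<Longrightarrow>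
    tm_val UP (\<lambda>v. cls (E v)) t = cls (\<lambda>a\<in>X. tm_val (N a) (\<lambda>v. E v a) t)"
proof (induction t)
  case (Var v)
  have "(\<lambda>a\<in>X. E v a) = E v" using Var(2)[of v] by (auto simp: PiE_def extensional_def)
  then show ?case by simp
next
  case (Fn f ts)
  define T where "T t = (\<lambda>a\<in>X. tm_val (N a) (\<lambda>v. E v a) t)" for t
  have E: "E v a \<in> univ (N a)" if "a \<in> X" for v a using Fn.prems(2)[of v] that by auto
  have T: "T t \<in> PiN" if "t \<in> set ts" for t
    using tm_val_carr' E Fn.prems(1) that by (auto simp: T_def)
  have len: "length ts = length (fdom L f)" and f: "f \<in> funs L"
    using Fn.prems(1) by (simp_all, metis length_map)
  let ?s = "\<lambda>a. map (\<lambda>Y. (SOME y. y \<in> Y) a) (map (\<lambda>t. cls (T t)) ts)"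
  have "map (tm_val UP (\<lambda>v. cls (E v))) ts = map (\<lambda>t. cls (T t)) ts"
    unfolding T_def by (intro map_cong refl Fn.IH) (use Fn.prems in auto)
  then have "tm_val UP (\<lambda>v. cls (E v)) (Fn f ts) = cls (\<lambda>a\<in>X. fint (N a) f (?s a))"
    by (simp only: tm_val.simps) (simp add: ultraproduct_def)
  also have "\<dots> = cls (\<lambda>a\<in>X. tm_val (N a) (\<lambda>v. E v a) (Fn f ts))"
  proof (subst cls_eq)
    have "(SOME y. y \<in> cls (T t)) a \<in> univ (N a)" if "t \<in> set ts" "a \<in> X" for t a
      using some_cls[OF T[OF that(1)]] that(2) by auto
    then show "(\<lambda>a\<in>X. fint (N a) f (?s a)) \<in> PiN"
      using f len by (auto intro!: fint_carr')
    show "(\<lambda>a\<in>X. tm_val (N a) (\<lambda>v. E v a) (Fn f ts)) \<in> PiN"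
      using Fn.prems(1) E by (auto simp del: tm_val.simps intro!: tm_val_carr')
    have "eventually (\<lambda>a. ?s a = map (\<lambda>t. T t a) ts) U" by (rule Los_args[OF T])
    then show "eventually (\<lambda>a. (\<lambda>a\<in>X. fint (N a) f (?s a)) a = (\<lambda>a\<in>X. tm_val (N a) (\<lambda>v. E v a) (Fn f ts)) a) U"
      using in_X
    proof eventually_elim
      case (elim a)
      have "map (\<lambda>t. T t a) ts = map (tm_val (N a) (\<lambda>v. E v a)) ts" using elim by (simp add: T_def)
      then show ?case using elim by (simp del: map_map map_eq_conv)
    qed
  qed
  finally show ?case .
qed

theorem Los:
  "wf_fm L \<phi> \<Longrightarrow> (\<And>v. E v \<in> PiN) \<Longrightarrow>
    sat UP (\<lambda>v. cls (E v)) \<phi> \<longleftrightarrow> eventually (\<lambda>a. sat (N a) (\<lambda>v. E v a) \<phi>) U"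
proof (induction \<phi> arbitrary: E)
  case Fls
  then show ?case using U by (simp add: ultrafilter_on_def trivial_limit_def[symmetric])
next
  case (Eq t s)
  have E: "E v a \<in> univ (N a)" if "a \<in> X" for v a using Eq.prems(2)[of v] that by auto
  have "(\<lambda>a\<in>X. tm_val (N a) (\<lambda>v. E v a) x) \<in> PiN" if "wf_tm L x" for x
    using tm_val_carr' E that by auto
  then have "sat UP (\<lambda>v. cls (E v)) (Eq t s) \<longleftrightarrow>
      eventually (\<lambda>a. (\<lambda>a\<in>X. tm_val (N a) (\<lambda>v. E v a) t) a = (\<lambda>a\<in>X. tm_val (N a) (\<lambda>v. E v a) s) a) U"
    using Eq.prems by (simp add: Los_tm cls_eq)
  also have "\<dots> \<longleftrightarrow> eventually (\<lambda>a. sat (N a) (\<lambda>v. E v a) (Eq t s)) U"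
    by (rule eventually_cong, rule eventuallyI) simp
  finally show ?case .
next
  case (Rel r ts)
  define T where "T t = (\<lambda>a\<in>X. tm_val (N a) (\<lambda>v. E v a) t)" for t
  have E: "E v a \<in> univ (N a)" if "a \<in> X" for v a using Rel.prems(2)[of v] that by auto
  have T: "T t \<in> PiN" if "t \<in> set ts" for t
    using tm_val_carr' E Rel.prems(1) that by (auto simp: T_def)
  let ?s = "\<lambda>a. map (\<lambda>Y. (SOME y. y \<in> Y) a) (map (\<lambda>t. cls (T t)) ts)"
  have "map (tm_val UP (\<lambda>v. cls (E v))) ts = map (\<lambda>t. cls (T t)) ts"
    using Rel Los_tm by (simp add: T_def)
  then have "sat UP (\<lambda>v. cls (E v)) (Rel r ts) \<longleftrightarrow> eventually (\<lambda>a. rint (N a) r (?s a)) U"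
    by (simp only: sat.simps) (simp add: ultraproduct_def)
  also have "\<dots> \<longleftrightarrow> eventually (\<lambda>a. sat (N a) (\<lambda>v. E v a) (Rel r ts)) U"
  proof (rule eventually_cong)
    have "eventually (\<lambda>a. ?s a = map (\<lambda>t. T t a) ts) U" by (rule Los_args[OF T])
    then show "eventually (\<lambda>a. rint (N a) r (?s a) = sat (N a) (\<lambda>v. E v a) (Rel r ts)) U"
      using in_X
    proof eventually_elim
      case (elim a)
      have "map (\<lambda>t. T t a) ts = map (tm_val (N a) (\<lambda>v. E v a)) ts" using elim by (simp add: T_def)
      then show ?case using elim by (simp del: map_map map_eq_conv)
    qed
  qed
  finally show ?case .
next
  case (Neg \<phi>)
  then show ?case by (simp add: ultrafilter_Neg[OF U])
next
  case (Conj \<phi> \<psi>)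
  then show ?case by (simp add: eventually_conj_iff)
next
  case (Ex v \<phi>)
  have E: "E v a \<in> univ (N a)" if "a \<in> X" for v a using Ex.prems(2)[of v] that by auto
  have "sat UP (\<lambda>v. cls (E v)) (Ex v \<phi>) \<longleftrightarrow> (\<exists>y\<in>PiN. sat UP ((\<lambda>v. cls (E v))(v := cls y)) \<phi>)"
    by (simp add: carr_UP)
  also have "\<dots> \<longleftrightarrow> (\<exists>y\<in>PiN. sat UP (\<lambda>w. cls ((E(v := y)) w)) \<phi>)"
    by (rule bex_cong[OF refl], rule arg_cong[where f = "\<lambda>e. sat UP e \<phi>"], rule ext) simp
  also have "\<dots> \<longleftrightarrow> (\<exists>y\<in>PiN. eventually (\<lambda>a. sat (N a) (\<lambda>w. (E(v := y)) w a) \<phi>) U)"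
    by (rule bex_cong[OF refl], rule Ex.IH) (use Ex.prems in auto)
  also have "\<dots> \<longleftrightarrow> (\<exists>y\<in>PiN. eventually (\<lambda>a. sat (N a) ((\<lambda>w. E w a)(v := y a)) \<phi>) U)"
    by (rule bex_cong[OF refl], rule arg_cong[where f = "\<lambda>P. eventually P U"])
      (intro ext arg_cong[where f = "\<lambda>e. sat (N _) e \<phi>"], auto)
  also have "\<dots> \<longleftrightarrow> eventually (\<lambda>a. \<exists>u\<in>univ (N a). sat (N a) ((\<lambda>w. E w a)(v := u)) \<phi>) U" (is "?l \<longleftrightarrow> ?r")
  proof
    assume ?l
    then obtain y where y: "y \<in> PiN" "eventually (\<lambda>a. sat (N a) ((\<lambda>w. E w a)(v := y a)) \<phi>) U" by blast
    from y(2) in_X show ?r by eventually_elim (use y(1) in auto)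
  next
    assume r: ?r
    \<comment> \<open>Witnesses are chosen in all fibres at once. Where there is none,
      \<open>E v a\<close> serves as a default, which keeps \<open>y\<close> inside the
      product.\<close>
    define y where "y = (\<lambda>a\<in>X. if \<exists>u\<in>univ (N a). sat (N a) ((\<lambda>w. E w a)(v := u)) \<phi>
       then SOME u. u \<in> univ (N a) \<and> sat (N a) ((\<lambda>w. E w a)(v := u)) \<phi> else E v a)"
    have y: "y a \<in> univ (N a) \<and> ((\<exists>u\<in>univ (N a). sat (N a) ((\<lambda>w. E w a)(v := u)) \<phi>) \<longrightarrow>
        sat (N a) ((\<lambda>w. E w a)(v := y a)) \<phi>)" if a: "a \<in> X" for a
    proof (cases "\<exists>u\<in>univ (N a). sat (N a) ((\<lambda>w. E w a)(v := u)) \<phi>")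
      case True
      then have "\<exists>u. u \<in> univ (N a) \<and> sat (N a) ((\<lambda>w. E w a)(v := u)) \<phi>" by blast
      from someI_ex[OF this] show ?thesis using a True by (simp add: y_def)
    qed (use a E in \<open>simp add: y_def\<close>)
    have "y \<in> PiN" using y by (auto simp: y_def)
    moreover from r in_X have "eventually (\<lambda>a. sat (N a) ((\<lambda>w. E w a)(v := y a)) \<phi>) U"
      by eventually_elim (use y in auto)
    ultimately show ?l by blast
  qed
  also have "\<dots> \<longleftrightarrow> eventually (\<lambda>a. sat (N a) (\<lambda>v. E v a) (Ex v \<phi>)) U" by simp
  finally show ?case .
qed

section \<open>Tuples of the ultraproduct and their coordinates\<close>

definition rep :: "('m \<Rightarrow> 'u) set \<Rightarrow> 'm \<Rightarrow> 'u" where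
  "rep Y = (SOME x. x \<in> PiN \<and> cls x = Y)"

abbreviation ev_at :: "'m \<Rightarrow> ('m \<Rightarrow> 'u) set list \<Rightarrow> 'u list" where
  "ev_at a us \<equiv> map (\<lambda>Y. rep Y a) us"

lemma rep: "Y \<in> univ UP \<Longrightarrow> rep Y \<in> PiN \<and> cls (rep Y) = Y"
proof -
  assume "Y \<in> univ UP"
  then have "\<exists>x. x \<in> PiN \<and> cls x = Y" unfolding carr_UP by blast
  then show ?thesis unfolding rep_def by (rule someI_ex)
qed

lemma Pi_ne: "PiN \<noteq> {}"
  using N by (auto simp: PiE_eq_empty_iff is_struct_def)

lemma holds_UP:
  assumes \<phi>: "is_fm L n \<phi>" and us: "us \<in> tuples UP n"
  shows "holds UP \<phi> us \<longleftrightarrow> eventually (\<lambda>a. holds (N a) \<phi> (ev_at a us)) U"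
proof -
  obtain x0 where x0: "x0 \<in> PiN" using Pi_ne by blast
  \<comment> \<open>Los' theorem wants a member of the product for every variable; \<open>x0\<close>
    fills those beyond the length of the tuple.\<close>
  define E where "E v = (if snd v < n then rep (us ! snd v) else x0)" for v :: "unit var"
  have len: "length us = n" and us': "us ! i \<in> univ UP" if "i < n" for i
    using us that by (auto simp: tuples_def)
  have len: "length us = n" using us by (simp add: tuples_def)
  have fv: "snd v < n" if "v \<in> fv \<phi>" for v using \<phi> that by (auto simp: is_fm_def vars_below_def)
  have E: "E v \<in> PiN" for v using rep us' x0 by (auto simp: E_def)
  have "holds UP \<phi> us \<longleftrightarrow> sat UP (\<lambda>v. cls (E v)) \<phi>"
    unfolding holds_def by (rule sat_cong) (use fv rep us' in \<open>simp add: E_def\<close>)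
  also have "\<dots> \<longleftrightarrow> eventually (\<lambda>a. sat (N a) (\<lambda>v. E v a) \<phi>) U"
    by (rule Los) (use \<phi> E in \<open>auto simp: is_fm_def\<close>)
  also have "(\<lambda>a. sat (N a) (\<lambda>v. E v a) \<phi>) = (\<lambda>a. holds (N a) \<phi> (ev_at a us))"
    unfolding holds_def by (intro ext sat_cong) (use fv len in \<open>simp add: E_def\<close>)
  finally show ?thesis .
qed

lemma at_tuples: "us \<in> tuples UP n \<Longrightarrow> a \<in> X \<Longrightarrow> ev_at a us \<in> tuples (N a) n"
  using rep by (fastforce simp: tuples_def)

text \<open>The entries of the tuples \<open>g a\<close> form elements of the product, and their
  classes form the tuple sought. Its chosen representatives may differ from \<open>g\<close> on a
  negligible set, whence the agreement only almost everywhere.\<close>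

lemma at_surj:
  assumes g: "\<And>a. a \<in> X \<Longrightarrow> g a \<in> tuples (N a) n"
  shows "\<exists>us\<in>tuples UP n. eventually (\<lambda>a. ev_at a us = g a) U"
proof -
  define y where "y j = (\<lambda>a\<in>X. g a ! j)" for j
  have y: "y j \<in> PiN" if "j < n" for j using g that by (fastforce simp: y_def tuples_def)
  let ?us = "map (\<lambda>j. cls (y j)) [0..<n]"
  have us: "?us \<in> tuples UP n" using y by (auto simp: tuples_def carr_UP)
  have "eventually (\<lambda>a. rep (cls (y j)) a = y j a) U" if "j < n" for j
  proof -
    have "cls (y j) \<in> univ UP" using y[OF that] by (auto simp: carr_UP)
    from rep[OF this] show ?thesis using cls_eq y[OF that] by blast
  qed
  then have "eventually (\<lambda>a. \<forall>j\<in>{..<n}. rep (cls (y j)) a = y j a) U" by (intro eventually_ball_finite) auto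
  then have "eventually (\<lambda>a. ev_at a ?us = g a) U" using in_X
  proof eventually_elim
    case (elim a)
    show ?case by (rule nth_equalityI) (use elim g[of a] in \<open>auto simp: y_def tuples_def\<close>)
  qed
  then show ?thesis using us by blast
qed

lemma is_struct_UP: "is_struct L UP"
proof -
  have "fint UP f us \<in> univ UP"
    if f: "f \<in> funs L" and us: "length us = length (fdom L f)" "\<And>i. i < length us \<Longrightarrow> us ! i \<in> univ UP" for f us
  proof -
    have "(SOME y. y \<in> Y) a \<in> univ (N a)" if "Y \<in> set us" "a \<in> X" for Y a
    proof -
      have "Y \<in> univ UP" using us that by (auto simp: in_set_conv_nth)
      then obtain x where x: "x \<in> PiN" "Y = cls x" by (auto simp: carr_UP)
      show ?thesis using some_cls[OF x(1)] that(2) x(2) by auto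
    qed
    then have "(\<lambda>a\<in>X. fint (N a) f (map (\<lambda>Y. (SOME y. y \<in> Y) a) us)) \<in> PiN"
      using f us(1) by (auto intro!: fint_carr')
    then show ?thesis by (auto simp: carr_UP) (auto simp: ultraproduct_def)
  qed
  then show ?thesis using Pi_ne by (auto simp: is_struct_def carr_UP list_all2_conv_all_nth)
qed

end

section \<open>The structure interpreted in an ultraproduct\<close>

locale interp_ultra = interp_data LN LK I k J + ultra LN X U N
  for LN :: "(unit, 'fn, 'rn) lang" and LK :: "(unit, 'fk, 'rk) lang"
    and I :: "'i set" and k :: "'i \<Rightarrow> nat" and J :: "('fn, 'rn, 'fk, 'rk, 'i) interp"
    and X :: "'m set" and U :: "'m filter" and N :: "'m \<Rightarrow> (unit, 'fn, 'rn, 'u) struct" +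
  fixes K :: "(unit, 'fk, 'rk, 'w) struct" and lam :: "'i \<Rightarrow> 'm \<Rightarrow> 'u list \<Rightarrow> 'w" and Hs :: "'m \<Rightarrow> 'u list \<Rightarrow> 'w"
  assumes coded_N: "\<And>a. a \<in> X \<Longrightarrow> coded (N a) K (\<lambda>i. lam i a) (Hs a)"
begin

abbreviation "D \<equiv> interp_dom J UP"
abbreviation "E \<equiv> interp_eq J UP"
abbreviation "cl x \<equiv> E `` {x}"

text \<open>By \<open>x \<mapsto> val x\<close> the quotient interpreted in the ultraproduct becomes
  the ultrapower of \<open>K\<close> modulo \<open>U\<close>: \<open>E_iff\<close> says that
  equality of classes is equality of values almost everywhere, and \<open>val_surj\<close> that
  every function from the index set to \<open>K\<close> occurs.\<close>

definition val :: "('m \<Rightarrow> 'u) set list \<Rightarrow> 'm \<Rightarrow> 'w" where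
  "val x a = Hs a (ev_at a x)"

lemma is_struct_K: "is_struct LK K"
proof -
  obtain a where "a \<in> X" using eventually_happens[OF in_X] U by (auto simp: ultrafilter_on_def)
  from coded_N[OF this] show ?thesis by (simp add: coded_def)
qed

lemma codedD:
  assumes "a \<in> X"
  shows "Hs a ` interp_dom J (N a) = univ K"
    "\<And>i ws. i \<in> I \<Longrightarrow> ws \<in> tuples (N a) (k i) \<Longrightarrow> lam i a ws \<in> univ K"
    "\<And>x y. x \<in> interp_dom J (N a) \<Longrightarrow> y \<in> interp_dom J (N a) \<Longrightarrow> holds (N a) (ieq J) (x @ y) \<longleftrightarrow> Hs a x = Hs a y"
    "\<And>g xss y. g \<in> funs LK \<Longrightarrow> length xss = length (fdom LK g) \<Longrightarrow> set xss \<subseteq> interp_dom J (N a) \<Longrightarrow> y \<in> interp_dom J (N a) \<Longrightarrow>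
       holds (N a) (ifun J g) (concat xss @ y) \<longleftrightarrow> fint K g (map (Hs a) xss) = Hs a y"
    "\<And>q xss. q \<in> rels LK \<Longrightarrow> length xss = length (rdom LK q) \<Longrightarrow> set xss \<subseteq> interp_dom J (N a) \<Longrightarrow>
       holds (N a) (irel J q) (concat xss) \<longleftrightarrow> rint K q (map (Hs a) xss)"
    "\<And>i ws y. i \<in> I \<Longrightarrow> ws \<in> tuples (N a) (k i) \<Longrightarrow> y \<in> interp_dom J (N a) \<Longrightarrow>
       holds (N a) (imap J i) (ws @ y) \<longleftrightarrow> lam i a ws = Hs a y"
  using coded_N[OF assms] unfolding coded_def by blast+

lemma D_tuples: "x \<in> D \<Longrightarrow> x \<in> tuples UP d"
  by (simp add: interp_dom_def)

lemma D_iff: "x \<in> D \<longleftrightarrow> x \<in> tuples UP d \<and> eventually (\<lambda>a. ev_at a x \<in> interp_dom J (N a)) U"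
proof -
  have "holds UP (idom J) x \<longleftrightarrow> eventually (\<lambda>a. ev_at a x \<in> interp_dom J (N a)) U" if x: "x \<in> tuples UP d"
    unfolding holds_UP[OF idom x]
    by (rule eventually_cong, rule eventuallyI) (use at_tuples[OF x] in \<open>auto simp: interp_dom_def\<close>)
  then show ?thesis by (auto simp: interp_dom_def)
qed

lemma D_list: "set xss \<subseteq> D \<Longrightarrow> eventually (\<lambda>a. set (map (ev_at a) xss) \<subseteq> interp_dom J (N a)) U"
proof -
  assume "set xss \<subseteq> D"
  then have "eventually (\<lambda>a. \<forall>x\<in>set xss. ev_at a x \<in> interp_dom J (N a)) U"
    by (intro eventually_ball_finite) (auto simp: D_iff)
  then show ?thesis by (rule eventually_mono) auto
qed

lemma tuples_append: "us \<in> tuples A n \<Longrightarrow> vs \<in> tuples A m \<Longrightarrow> us @ vs \<in> tuples A (n + m)"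
  by (auto simp: tuples_def)

lemma tuples_concat: "set xss \<subseteq> tuples A n \<Longrightarrow> concat xss \<in> tuples A (length xss * n)"
  by (induction xss) (auto simp: tuples_def)

lemma at_concat: "ev_at a (concat xss) = concat (map (ev_at a) xss)"
  by (simp add: map_concat)

lemma E_iff: "(x, y) \<in> E \<longleftrightarrow> x \<in> D \<and> y \<in> D \<and> eventually (\<lambda>a. val x a = val y a) U"
proof -
  have "holds UP (ieq J) (x @ y) \<longleftrightarrow> eventually (\<lambda>a. val x a = val y a) U" if xy: "x \<in> D" "y \<in> D"
  proof -
    have t: "x @ y \<in> tuples UP (2 * d)" using tuples_append[OF xy[THEN D_tuples]] by (simp add: mult_2)
    have "eventually (\<lambda>a. ev_at a x \<in> interp_dom J (N a)) U" "eventually (\<lambda>a. ev_at a y \<in> interp_dom J (N a)) U"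
      using xy by (auto simp: D_iff)
    then have "eventually (\<lambda>a. holds (N a) (ieq J) (ev_at a (x @ y)) = (val x a = val y a)) U"
      using in_X by eventually_elim (simp add: codedD(3) val_def)
    then show ?thesis unfolding holds_UP[OF ieq t] by (rule eventually_cong)
  qed
  then show ?thesis by (auto simp: interp_eq_def)
qed

lemma equiv_E: "equiv D E"
proof (rule equivI)
  show "E \<subseteq> D \<times> D" by (auto simp: E_iff)
  show "refl_on D E" by (auto simp: refl_on_def E_iff)
  show "sym E" by (rule symI) (auto simp: E_iff elim!: eventually_mono)
  show "trans E"
  proof (rule transI)
    fix x y z assume "(x, y) \<in> E" "(y, z) \<in> E"
    then show "(x, z) \<in> E" unfolding E_iff using eventually_trans[of "val x" "val y" U "val z"] by simp
  qed
qed

lemma cl_eq: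
  assumes "x \<in> D" "y \<in> D"
  shows "cl x = cl y \<longleftrightarrow> eventually (\<lambda>a. val x a = val y a) U"
proof -
  have "cl x = cl y \<longleftrightarrow> (x, y) \<in> E" by (rule eq_equiv_class_iff[OF equiv_E assms])
  then show ?thesis using assms unfolding E_iff by argo
qed

lemma cl_mem: "x \<in> cl y \<longleftrightarrow> x \<in> D \<and> y \<in> D \<and> cl x = cl y"
proof -
  have "x \<in> cl y \<longleftrightarrow> (y, x) \<in> E" by (rule Image_singleton_iff)
  also have "\<dots> \<longleftrightarrow> cl y = cl x \<and> y \<in> D \<and> x \<in> D" by (rule equiv_class_eq_iff[OF equiv_E])
  finally show ?thesis by argo
qed

lemma E_refl [simp]: "x \<in> D \<Longrightarrow> (x, x) \<in> E"
  by (simp add: E_iff)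

lemma quotient_D: "D // E = cl ` D"
  by (auto simp: quotient_def)

lemma val_surj:
  assumes "\<And>a. a \<in> X \<Longrightarrow> c a \<in> univ K"
  shows "\<exists>y\<in>D. eventually (\<lambda>a. val y a = c a) U"
proof -
  have "\<exists>y\<in>interp_dom J (N a). Hs a y = c a" if "a \<in> X" for a
    using assms[OF that] codedD(1)[OF that] by (metis imageE)
  then obtain g where g: "\<And>a. a \<in> X \<Longrightarrow> g a \<in> interp_dom J (N a) \<and> Hs a (g a) = c a" by metis
  then have "g a \<in> tuples (N a) d" if "a \<in> X" for a using that by (auto simp: interp_dom_def)
  then obtain y where y: "y \<in> tuples UP d" "eventually (\<lambda>a. ev_at a y = g a) U" using at_surj by blast
  from y(2) in_X have "eventually (\<lambda>a. ev_at a y \<in> interp_dom J (N a)) U" by eventually_elim (simp add: g)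
  then have "y \<in> D" using y by (simp add: D_iff)
  moreover from y(2) in_X have "eventually (\<lambda>a. val y a = c a) U" by eventually_elim (simp add: g val_def)
  ultimately show ?thesis by blast
qed

lemma val_carr: "x \<in> D \<Longrightarrow> eventually (\<lambda>a. val x a \<in> univ K) U"
proof -
  assume "x \<in> D"
  then have "eventually (\<lambda>a. ev_at a x \<in> interp_dom J (N a)) U" by (simp add: D_iff)
  then show ?thesis using in_X by eventually_elim (use codedD(1) in \<open>auto simp: val_def\<close>)
qed

lemma list_all2_cl:
  assumes "list_all2 (\<in>) xss' (map cl xss)" "set xss \<subseteq> D"
  shows "set xss' \<subseteq> D" "length xss' = length xss"
    "eventually (\<lambda>a. map (\<lambda>x. val x a) xss' = map (\<lambda>x. val x a) xss) U"
proof -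
  have *: "length xss' = length xss" "\<And>i. i < length xss \<Longrightarrow> xss' ! i \<in> cl (xss ! i)"
    using assms(1) by (auto simp: list_all2_conv_all_nth)
  show "length xss' = length xss" by (rule *)
  show 1: "set xss' \<subseteq> D" using * by (auto simp: in_set_conv_nth E_iff)
  have "eventually (\<lambda>a. \<forall>i\<in>{..<length xss}. val (xss' ! i) a = val (xss ! i) a) U"
  proof (intro eventually_ball_finite ballI)
    fix i assume "i \<in> {..<length xss}"
    then have "eventually (\<lambda>a. val (xss ! i) a = val (xss' ! i) a) U" using *(2)[of i] by (simp add: E_iff)
    then show "eventually (\<lambda>a. val (xss' ! i) a = val (xss ! i) a) U" by (rule eventually_mono) simp
  qed simp
  then show "eventually (\<lambda>a. map (\<lambda>x. val x a) xss' = map (\<lambda>x. val x a) xss) U"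
    by (rule eventually_mono) (auto intro!: nth_equalityI simp: *)
qed

lemma list_all2_refl_cl: "set xss \<subseteq> D \<Longrightarrow> list_all2 (\<in>) xss (map cl xss)"
  by (auto simp: list_all2_conv_all_nth cl_mem subset_iff)

lemma holds_ifun:
  assumes g: "g \<in> funs LK" and len: "length xss = length (fdom LK g)" and xss: "set xss \<subseteq> D" and y: "y \<in> D"
  shows "holds UP (ifun J g) (concat xss @ y) \<longleftrightarrow>
    eventually (\<lambda>a. fint K g (map (\<lambda>x. val x a) xss) = val y a) U"
proof -
  have "concat xss @ y \<in> tuples UP (length xss * d + d)"
    using xss y D_tuples by (intro tuples_append tuples_concat) auto
  then have t: "concat xss @ y \<in> tuples UP ((length (fdom LK g) + 1) * d)" by (simp add: len add.commute)
  have "eventually (\<lambda>a. ev_at a y \<in> interp_dom J (N a)) U" using y by (simp add: D_iff)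
  with D_list[OF xss] in_X
  have "eventually (\<lambda>a. holds (N a) (ifun J g) (ev_at a (concat xss @ y)) =
      (fint K g (map (\<lambda>x. val x a) xss) = val y a)) U"
  proof eventually_elim
    case (elim a)
    then show ?case using codedD(4)[OF elim(2) g, of "map (ev_at a) xss" "ev_at a y"] len
      by (simp add: at_concat val_def comp_def del: map_map) (simp add: comp_def)
  qed
  then show ?thesis unfolding holds_UP[OF ifun[OF g] t] by (rule eventually_cong)
qed

lemma holds_irel:
  assumes q: "q \<in> rels LK" and len: "length xss = length (rdom LK q)" and xss: "set xss \<subseteq> D"
  shows "holds UP (irel J q) (concat xss) \<longleftrightarrow> eventually (\<lambda>a. rint K q (map (\<lambda>x. val x a) xss)) U"
proof -
  have "concat xss \<in> tuples UP (length xss * d)"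
    using xss D_tuples by (intro tuples_concat) auto
  then have t: "concat xss \<in> tuples UP (length (rdom LK q) * d)" by (simp add: len)
  from D_list[OF xss] in_X
  have "eventually (\<lambda>a. holds (N a) (irel J q) (ev_at a (concat xss)) = rint K q (map (\<lambda>x. val x a) xss)) U"
  proof eventually_elim
    case (elim a)
    then show ?case using codedD(5)[OF elim(2) q, of "map (ev_at a) xss"] len
      by (simp add: at_concat val_def comp_def del: map_map) (simp add: comp_def)
  qed
  then show ?thesis unfolding holds_UP[OF irel[OF q] t] by (rule eventually_cong)
qed

lemma holds_imap:
  assumes i: "i \<in> I" and ws: "ws \<in> tuples UP (k i)" and y: "y \<in> D"
  shows "holds UP (imap J i) (ws @ y) \<longleftrightarrow> eventually (\<lambda>a. lam i a (ev_at a ws) = val y a) U"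
proof -
  have t: "ws @ y \<in> tuples UP (k i + d)" using ws y D_tuples by (intro tuples_append) auto
  have "eventually (\<lambda>a. ev_at a y \<in> interp_dom J (N a)) U" using y by (simp add: D_iff)
  then have "eventually (\<lambda>a. holds (N a) (imap J i) (ev_at a (ws @ y)) = (lam i a (ev_at a ws) = val y a)) U"
    using in_X by eventually_elim (simp add: codedD(6)[OF _ i at_tuples[OF ws]] val_def)
  then show ?thesis unfolding holds_UP[OF imap[OF i] t] by (rule eventually_cong)
qed

text \<open>The interpreted function is a definite description, so exactly one class must satisfy
  the graph formula. By Los' theorem existence and uniqueness both become statements about almost
  all fibres, where the formula defines the graph of the function of \<open>K\<close>.\<close>

lemma fint_interp:
  assumes g: "g \<in> funs LK" and len: "length xss = length (fdom LK g)" and xss: "set xss \<subseteq> D"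
  shows "\<exists>y\<in>D. fint (interp_struct J UP) g (map cl xss) = cl y \<and>
    eventually (\<lambda>a. fint K g (map (\<lambda>x. val x a) xss) = val y a) U"
proof -
  have K: "fint K g us \<in> univ K" if "length us = length (fdom LK g)" "set us \<subseteq> univ K" for us
    using is_struct_K g that by (auto simp: is_struct_def list_all2_conv_all_nth subset_iff)
  \<comment> \<open>The values of the arguments lie in \<open>K\<close> only almost everywhere;
    elsewhere an arbitrary element of \<open>K\<close> stands in, because \<open>val_surj\<close>
    asks for a function into \<open>K\<close>.\<close>
  define c where "c a = (if set (map (\<lambda>x. val x a) xss) \<subseteq> univ K
    then fint K g (map (\<lambda>x. val x a) xss) else SOME u. u \<in> univ K)" for a
  have "univ K \<noteq> {}" using is_struct_K LK by (auto simp: is_struct_def wf_lang_def)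
  then have "c a \<in> univ K" for a using K[of "map (\<lambda>x. val x a) xss"] len by (auto simp: c_def some_in_eq)
  then obtain y where y: "y \<in> D" "eventually (\<lambda>a. val y a = c a) U" using val_surj[of c] by blast
  have "eventually (\<lambda>a. \<forall>x\<in>set xss. val x a \<in> univ K) U"
    using xss val_carr by (intro eventually_ball_finite) auto
  with y(2) have y2: "eventually (\<lambda>a. fint K g (map (\<lambda>x. val x a) xss) = val y a) U"
    by eventually_elim (auto simp: c_def)
  have "fint (interp_struct J UP) g (map cl xss) = cl y"
    unfolding interp_struct_def struct.simps
  proof (rule the_equality)
    show "cl y \<in> D // E \<and> (\<exists>xss' y'. list_all2 (\<in>) xss' (map cl xss) \<and> y' \<in> cl y \<and>
        holds UP (ifun J g) (concat xss' @ y'))"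
      using y(1) list_all2_refl_cl[OF xss] holds_ifun[OF g len xss y(1)] y2
      by (auto simp: quotient_D cl_mem intro!: exI[of _ xss] exI[of _ y])
  next
    fix Y assume "Y \<in> D // E \<and> (\<exists>xss' y'. list_all2 (\<in>) xss' (map cl xss) \<and> y' \<in> Y \<and>
        holds UP (ifun J g) (concat xss' @ y'))"
    then obtain z xss' y' where z: "z \<in> D" "Y = cl z" "list_all2 (\<in>) xss' (map cl xss)" "y' \<in> cl z"
        "holds UP (ifun J g) (concat xss' @ y')" by (auto simp: quotient_D)
    have y': "y' \<in> D" "cl y' = cl z" using z(4) unfolding cl_mem by blast+
    have "eventually (\<lambda>a. fint K g (map (\<lambda>x. val x a) xss') = val y' a) U"
      using z(5) holds_ifun[OF g _ list_all2_cl(1)[OF z(3) xss] y'(1)] list_all2_cl(2)[OF z(3) xss] len by simp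
    with list_all2_cl(3)[OF z(3) xss] y2 have "eventually (\<lambda>a. val y' a = val y a) U"
      by eventually_elim simp
    then show "Y = cl y" using cl_eq[OF y'(1) y(1)] y' z by simp
  qed
  then show ?thesis using y(1) y2 by blast
qed

lemma interp_map_UP:
  assumes i: "i \<in> I" and ws: "ws \<in> tuples UP (k i)"
  shows "\<exists>y\<in>D. interp_map J UP i ws = cl y \<and> eventually (\<lambda>a. lam i a (ev_at a ws) = val y a) U"
proof -
  obtain y where y: "y \<in> D" "eventually (\<lambda>a. val y a = lam i a (ev_at a ws)) U"
    using val_surj[of "\<lambda>a. lam i a (ev_at a ws)"] codedD(2)[OF _ i at_tuples[OF ws]] by blast
  from y(2) have y2: "eventually (\<lambda>a. lam i a (ev_at a ws) = val y a) U" by eventually_elim simp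
  have "interp_map J UP i ws = cl y"
    unfolding interp_map_def
  proof (rule the_equality)
    show "cl y \<in> D // E \<and> (\<exists>y'\<in>cl y. holds UP (imap J i) (ws @ y'))"
      using y(1) holds_imap[OF i ws y(1)] y2 by (auto simp: quotient_D cl_mem intro!: bexI[of _ y])
  next
    fix Y assume "Y \<in> D // E \<and> (\<exists>y'\<in>Y. holds UP (imap J i) (ws @ y'))"
    then obtain z y' where z: "z \<in> D" "Y = cl z" "y' \<in> cl z" "holds UP (imap J i) (ws @ y')"
      by (auto simp: quotient_D)
    have y': "y' \<in> D" "cl y' = cl z" using z(3) unfolding cl_mem by blast+
    have "eventually (\<lambda>a. lam i a (ev_at a ws) = val y' a) U" using z(4) holds_imap[OF i ws y'(1)] by simp
    with y2 have "eventually (\<lambda>a. val y' a = val y a) U" by eventually_elim simp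
    then show "Y = cl y" using cl_eq[OF y'(1) y(1)] y' z by simp
  qed
  then show ?thesis using y(1) y2 by blast
qed

text \<open>This makes the translation valid in the ultraproduct together with its own quotient. The
  assumption on quantifier elimination concerns exactly this expansion, so no detour through an
  isomorphic ultrapower is required.\<close>

theorem coded_UP: "coded UP (interp_struct J UP) (interp_map J UP) cl"
  unfolding coded_def
proof (intro conjI ballI allI impI)
  have carr: "carr (interp_struct J UP) s = cl ` D" for s by (simp add: interp_struct_def quotient_D)
  show "is_struct LN UP" by (rule is_struct_UP)
  show "cl ` D = univ (interp_struct J UP)" by (simp add: carr)
  show "is_struct LK (interp_struct J UP)"
    unfolding is_struct_def
  proof (intro conjI ballI allI impI)
    have "univ K \<noteq> {}" using is_struct_K LK by (auto simp: is_struct_def wf_lang_def)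
    then have "D \<noteq> {}" using val_surj[of "\<lambda>_. SOME u. u \<in> univ K"] by (auto simp: some_in_eq)
    then show "carr (interp_struct J UP) s \<noteq> {}" for s by (simp add: carr)
    fix g us assume g: "g \<in> funs LK" and us: "list_all2 (\<lambda>u s. u \<in> carr (interp_struct J UP) s) us (fdom LK g)"
    have "set us \<subseteq> cl ` D" using us by (auto simp: list_all2_conv_all_nth carr in_set_conv_nth)
    then have "us \<in> map cl ` lists D" unfolding lists_image[symmetric] by auto
    then obtain xss where xss: "us = map cl xss" "set xss \<subseteq> D" by blast
    show "fint (interp_struct J UP) g us \<in> carr (interp_struct J UP) (fcod LK g)"
      using fint_interp[OF g, of xss] xss us by (auto simp: carr dest!: list_all2_lengthD)
  qed
  fix i ws assume i: "i \<in> I" "ws \<in> tuples UP (k i)"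
  then show "interp_map J UP i ws \<in> univ (interp_struct J UP)"
    using interp_map_UP by (fastforce simp: carr)
  fix y assume y: "y \<in> D"
  obtain z where z: "z \<in> D" "interp_map J UP i ws = cl z" "eventually (\<lambda>a. lam i a (ev_at a ws) = val z a) U"
    using interp_map_UP[OF i] by blast
  have "eventually (\<lambda>a. lam i a (ev_at a ws) = val y a) U \<longleftrightarrow> eventually (\<lambda>a. val z a = val y a) U"
    by (rule eventually_cong) (use z(3) in \<open>auto elim: eventually_mono\<close>)
  then show "holds UP (imap J i) (ws @ y) \<longleftrightarrow> interp_map J UP i ws = cl y"
    using z cl_eq[OF z(1) y] holds_imap[OF i y] by simp
next
  fix x y assume "x \<in> D" "y \<in> D"
  then show "holds UP (ieq J) (x @ y) \<longleftrightarrow> cl x = cl y"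
    using cl_eq[of x y] E_iff[of x y] by (simp add: interp_eq_def)
next
  fix g xss y assume g: "g \<in> funs LK" and as: "length xss = length (fdom LK g) \<and> set xss \<subseteq> D \<and> y \<in> D"
  then obtain z where z: "z \<in> D" "fint (interp_struct J UP) g (map cl xss) = cl z"
     "eventually (\<lambda>a. fint K g (map (\<lambda>x. val x a) xss) = val z a) U"
    using fint_interp[OF g] by blast
  have "eventually (\<lambda>a. fint K g (map (\<lambda>x. val x a) xss) = val y a) U \<longleftrightarrow> eventually (\<lambda>a. val z a = val y a) U"
    by (rule eventually_cong) (use z(3) in \<open>auto elim: eventually_mono\<close>)
  then show "holds UP (ifun J g) (concat xss @ y) \<longleftrightarrow> fint (interp_struct J UP) g (map cl xss) = cl y"
    using z cl_eq[OF z(1)] holds_ifun[OF g] as by simp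
next
  fix q xss assume q: "q \<in> rels LK" and as: "length xss = length (rdom LK q) \<and> set xss \<subseteq> D"
  \<comment> \<open>The interpreted relation asks for some representatives satisfying the formula;
    here its truth turns out to be the same for all of them.\<close>
  have "holds UP (irel J q) (concat xss') \<longleftrightarrow> holds UP (irel J q) (concat xss)"
    if l: "list_all2 (\<in>) xss' (map cl xss)" for xss'
  proof -
    have xss: "set xss \<subseteq> D" using as by simp
    note l' = list_all2_cl[OF l xss]
    have "holds UP (irel J q) (concat xss') \<longleftrightarrow> eventually (\<lambda>a. rint K q (map (\<lambda>x. val x a) xss')) U"
      by (rule holds_irel[OF q _ l'(1)]) (use l' as in simp)
    also have "\<dots> \<longleftrightarrow> eventually (\<lambda>a. rint K q (map (\<lambda>x. val x a) xss)) U"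
      by (rule eventually_cong) (use l'(3) in \<open>auto elim!: eventually_mono simp del: map_eq_conv\<close>)
    finally show ?thesis using holds_irel[OF q] as by simp
  qed
  then show "holds UP (irel J q) (concat xss) \<longleftrightarrow> rint (interp_struct J UP) q (map cl xss)"
    using list_all2_refl_cl[of xss] as unfolding interp_struct_def struct.simps by blast
qed

end

section \<open>Uniform quantifier elimination in the fibres\<close>

fun lift :: "('s, 'f, 'r) fm \<Rightarrow> ('s, 'f, ('s, 'f, 'r) morley_rel) fm" where
  "lift Fls = Fls"
| "lift (Eq t u) = Eq t u"
| "lift (Rel r ts) = Rel (Inl r) ts"
| "lift (Neg \<phi>) = Neg (lift \<phi>)"
| "lift (Conj \<phi> \<psi>) = Conj (lift \<phi>) (lift \<psi>)"
| "lift (Ex v \<phi>) = Ex v (lift \<phi>)"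

text \<open>Each new predicate is replaced by its defining formula, with the arguments substituted.
  Quantifiers reappear, but the result is a formula of the original language, to which
  \<open>tr\<close> applies.\<close>

fun unmorley :: "('s, 'f, ('s, 'f, 'r) morley_rel) fm \<Rightarrow> ('s, 'f, 'r) fm" where
  "unmorley Fls = Fls"
| "unmorley (Eq t u) = Eq t u"
| "unmorley (Rel r ts) = (case r of Inl r \<Rightarrow> Rel r ts | Inr (xs, \<theta>) \<Rightarrow> inst xs ts \<theta>)"
| "unmorley (Neg \<phi>) = Neg (unmorley \<phi>)"
| "unmorley (Conj \<phi> \<psi>) = Conj (unmorley \<phi>) (unmorley \<psi>)"
| "unmorley (Ex v \<phi>) = Ex v (unmorley \<phi>)"

lemma morley_struct_simps [simp]:
  "carr (morley_struct A) = carr A" "fint (morley_struct A) = fint A"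
  "rint (morley_struct A) (Inl r) us = rint A r us"
  "rint (morley_struct A) (Inr (xs, \<theta>)) us = sat A (\<lambda>v. the (map_of (zip xs us) v)) \<theta>"
  by (simp_all add: morley_struct_def)

lemma morley_lang_simps [simp]:
  "lsorts (morley_lang L \<Sigma>) = lsorts L" "funs (morley_lang L \<Sigma>) = funs L"
  "fdom (morley_lang L \<Sigma>) = fdom L" "fcod (morley_lang L \<Sigma>) = fcod L"
  "Inl r \<in> rels (morley_lang L \<Sigma>) \<longleftrightarrow> r \<in> rels L"
  "Inr (xs, \<theta>) \<in> rels (morley_lang L \<Sigma>) \<longleftrightarrow> distinct xs \<and> fst ` set xs \<subseteq> lsorts L \<inter> \<Sigma> \<and>
     wf_fm (restrict_lang L \<Sigma>) \<theta> \<and> fv \<theta> \<subseteq> set xs"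
  "rdom (morley_lang L \<Sigma>) (Inl r) = rdom L r"
  "rdom (morley_lang L \<Sigma>) (Inr (xs, \<theta>)) = map fst xs"
  by (auto simp: morley_lang_def)

lemma tm_val_morley [simp]: "tm_val (morley_struct A) e t = tm_val A e t"
  by (induction t) (simp_all cong: map_cong)

lemma tm_sort_morley [simp]: "tm_sort (morley_lang L \<Sigma>) t = tm_sort L t"
  by (cases t) simp_all

lemma wf_tm_morley [simp]: "wf_tm (morley_lang L \<Sigma>) t = wf_tm L t"
  by (induction t) (auto cong: map_cong)

lemma map_sort_morley [simp]: "map (tm_sort (morley_lang L \<Sigma>)) ts = map (tm_sort L) ts"
  by simp

lemma tm_sort_restrict [simp]: "tm_sort (restrict_lang L \<Sigma>) t = tm_sort L t"
  by (cases t) (simp_all add: restrict_lang_def)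

lemma restrict_lang_simps [simp]:
  "lsorts (restrict_lang L \<Sigma>) = lsorts L \<inter> \<Sigma>"
  "f \<in> funs (restrict_lang L \<Sigma>) \<longleftrightarrow> f \<in> funs L \<and> set (fdom L f) \<subseteq> \<Sigma> \<and> fcod L f \<in> \<Sigma>"
  "fdom (restrict_lang L \<Sigma>) = fdom L" "fcod (restrict_lang L \<Sigma>) = fcod L"
  "r \<in> rels (restrict_lang L \<Sigma>) \<longleftrightarrow> r \<in> rels L \<and> set (rdom L r) \<subseteq> \<Sigma>"
  "rdom (restrict_lang L \<Sigma>) = rdom L"
  by (auto simp: restrict_lang_def)

lemma map_sort_restrict [simp]: "map (tm_sort (restrict_lang L \<Sigma>)) ts = map (tm_sort L) ts"
  by simp

lemma wf_tm_restrict: "wf_tm (restrict_lang L \<Sigma>) t \<Longrightarrow> wf_tm L t"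
  by (induction t) auto

lemma wf_restrict: "wf_fm (restrict_lang L \<Sigma>) \<phi> \<Longrightarrow> wf_fm L \<phi>"
  by (induction \<phi>) (auto dest: wf_tm_restrict)

lemma lift_simps [simp]:
  "sat (morley_struct A) e (lift \<phi>) = sat A e \<phi>"
  "wf_fm (morley_lang L \<Sigma>) (lift \<phi>) = wf_fm L \<phi>"
  "fv (lift \<phi>) = fv \<phi>" "qf (lift \<phi>) = qf \<phi>"
proof -
  show "sat (morley_struct A) e (lift \<phi>) = sat A e \<phi>"
    by (induction \<phi> arbitrary: e) (simp_all cong: map_cong)
qed (induction \<phi>, auto)+

lemma sat_unmorley:
  assumes A: "is_struct L A" and L: "lsorts L = UNIV"
  shows "wf_fm (morley_lang L \<Sigma>) \<psi> \<Longrightarrow> (\<And>v. e v \<in> carr A (fst v)) \<Longrightarrow>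
    sat A e (unmorley \<psi>) = sat (morley_struct A) e \<psi>"
proof (induction \<psi> arbitrary: e)
  case (Rel r ts)
  have tv: "map (tm_val (morley_struct A) e) ts = map (tm_val A e) ts" by simp
  show ?case
  proof (cases r)
    case (Inl q)
    then show ?thesis by (simp cong: map_cong)
  next
    case (Inr p)
    obtain xs \<theta> where p: "p = (xs, \<theta>)" by (cases p)
    have srt: "map (tm_sort L) ts = map fst xs" "\<forall>t\<in>set ts. wf_tm L t" "distinct xs" "fv \<theta> \<subseteq> set xs"
      using Rel by (auto simp: Inr p)
    have len: "length ts = length xs" using srt(1) map_eq_imp_length_eq by blast
    have "sat A e (inst xs ts \<theta>) = sat A (\<lambda>v. the (map_of (zip xs (map (tm_val A e) ts)) v)) \<theta>"
    proof (rule sat_inst[OF srt(3) len srt(4)])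
      fix i assume i: "i < length xs"
      have "tm_val A e (ts ! i) \<in> carr A (tm_sort L (ts ! i))"
        by (rule tm_val_carr[OF A]) (use srt len i Rel.prems in auto)
      then show "tm_val A e (ts ! i) \<in> carr A (fst (xs ! i))"
        using srt(1) i len by (metis nth_map)
    qed
    then show ?thesis unfolding sat.simps tv by (simp add: Inr p)
  qed
qed (auto cong: map_cong)

lemma wf_unmorley: "wf_fm (morley_lang L \<Sigma>) \<psi> \<Longrightarrow> wf_fm L (unmorley \<psi>)"
proof (induction \<psi>)
  case (Rel r ts)
  show ?case
  proof (cases r)
    case (Inl q)
    then show ?thesis using Rel by simp
  next
    case (Inr p)
    obtain xs \<theta> where p: "p = (xs, \<theta>)" by (cases p)
    show ?thesis using Rel by (auto simp: Inr p intro!: wf_inst dest: wf_restrict)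
  qed
qed auto

section \<open>Validity in the expanded fibre as a sentence of the fibre language\<close>

text \<open>Closing a formula is necessary because definability is assumed for sentences. Any list
  of the finitely many free variables serves; \<open>alls_set\<close> hides which one was
  chosen.\<close>

definition alls :: "('s, 'f, 'r) fm \<Rightarrow> ('s, 'f, 'r) fm" where
  "alls \<phi> = Neg (Exs (SOME vs. set vs = fv \<phi>) (Neg \<phi>))"

lemma alls_set: "set (SOME vs. set vs = fv \<phi>) = fv \<phi>"
  by (rule someI_ex) (rule finite_list[OF finite_fv])

lemma alls_syntax:
  "fv (alls \<phi>) = {}" "lsorts L = UNIV \<Longrightarrow> wf_fm L \<phi> \<Longrightarrow> wf_fm L (alls \<phi>)"
  by (simp_all add: alls_def alls_set)

lemma sat_alls:
  assumes e: "\<And>v. e v \<in> carr A (fst v)"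
  shows "sat A e (alls \<phi>) \<longleftrightarrow> (\<forall>e. (\<forall>v. e v \<in> carr A (fst v)) \<longrightarrow> sat A e \<phi>)"
proof -
  have "(\<exists>e'. (\<forall>v\<in>fv \<phi>. e' v \<in> carr A (fst v)) \<and> (\<forall>v. v \<notin> fv \<phi> \<longrightarrow> e' v = e v) \<and> \<not> sat A e' \<phi>) \<longleftrightarrow>
     (\<exists>e. (\<forall>v. e v \<in> carr A (fst v)) \<and> \<not> sat A e \<phi>)" (is "?l \<longleftrightarrow> ?r")
  proof
    assume ?l then show ?r using e by metis
  next
    assume ?r
    then obtain e' where e': "\<forall>v. e' v \<in> carr A (fst v)" "\<not> sat A e' \<phi>" by blast
    have "sat A (\<lambda>v. if v \<in> fv \<phi> then e' v else e v) \<phi> = sat A e' \<phi>" by (rule sat_cong) simp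
    then show ?l using e' by (intro exI[of _ "\<lambda>v. if v \<in> fv \<phi> then e' v else e v"]) auto
  qed
  then show ?thesis by (auto simp: alls_def sat_Exs alls_set)
qed

context interp_data
begin

lemma tr_sentence: "wf_fm L' \<chi> \<Longrightarrow> is_fm LN 0 (tr (alls \<chi>))"
  using tr_syntax[of "alls \<chi>"] by (auto simp: is_fm_def alls_syntax)

text \<open>The truth of a sentence may be tested at any assignment; one exists because the universe
  and the domain of the interpretation are nonempty. From there \<open>sat_tr\<close> leads to the
  expanded structure, where the closure quantifies over all assignments.\<close>

lemma holds_tr_alls:
  assumes c: "coded A K lam H" and wf: "wf_fm L' \<chi>"
  shows "holds A (tr (alls \<chi>)) [] \<longleftrightarrow>
    (\<forall>e. (\<forall>v. e v \<in> carr (adjoin_struct A K lam) (fst v)) \<longrightarrow> sat (adjoin_struct A K lam) e \<chi>)"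
proof -
  have "univ A \<noteq> {}" "univ K \<noteq> {}" using c LK by (auto simp: coded_def is_struct_def wf_lang_def)
  moreover have "H ` interp_dom J A = univ K" using c by (simp add: coded_def)
  ultimately obtain x y where "x \<in> univ A" "y \<in> interp_dom J A" by blast
  then obtain f F where f: "\<And>n :: nat. f n \<in> univ A" "\<And>n :: nat. F n \<in> interp_dom J A"
    using that[of "\<lambda>_. x" "\<lambda>_. y"] by blast
  have "holds A (tr (alls \<chi>)) [] \<longleftrightarrow> sat A (cenv d f F) (tr (alls \<chi>))"
    unfolding holds_def by (rule sat_cong) (use tr_sentence[OF wf] in \<open>auto simp: is_fm_def vars_below_def\<close>)
  also have "\<dots> \<longleftrightarrow> sat (adjoin_struct A K lam) (benv H f F) (alls \<chi>)"
    by (rule sat_tr[OF c, symmetric]) (use f wf in \<open>auto simp: alls_syntax\<close>)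
  also have "\<dots> \<longleftrightarrow> (\<forall>e. (\<forall>v. e v \<in> carr (adjoin_struct A K lam) (fst v)) \<longrightarrow> sat (adjoin_struct A K lam) e \<chi>)"
    by (rule sat_alls, rule benv_carr) (use c f in \<open>auto simp: coded_def\<close>)
  finally show ?thesis .
qed

end

section \<open>Compactness over the family of fibres\<close>

locale lex_setting =
  fixes LM :: "(unit, 'fm, 'rm) lang" and M :: "(unit, 'fm, 'rm, 'm) struct"
    and LN :: "(unit, 'fn, 'rn) lang" and N :: "'m \<Rightarrow> (unit, 'fn, 'rn, 'n) struct"
    and LK :: "(unit, 'fk, 'rk) lang" and K :: "(unit, 'fk, 'rk, 'k) struct"
    and I :: "'i set" and k :: "'i \<Rightarrow> nat" and lam :: "'i \<Rightarrow> 'm \<Rightarrow> 'n list \<Rightarrow> 'k"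
    and J :: "('fn, 'rn, 'fk, 'rk, 'i) interp"
  assumes langs: "wf_lang LM" "wf_lang LN" "wf_lang LK"
    and LN_no_constants: "\<forall>g\<in>funs LN. fdom LN g \<noteq> []"
    and M: "is_struct LM M"
    and N: "\<forall>a\<in>univ M. is_struct LN (N a)"
    and K: "is_struct LK K"
    and definability:
      "\<forall>\<phi>. is_fm LN 0 \<phi> \<longrightarrow> definable LM M {a \<in> univ M. holds (N a) \<phi> []}"
    and k_pos: "\<forall>i\<in>I. k i \<ge> 1"
    and maps_surj: "\<forall>i\<in>I. \<forall>a\<in>univ M. lam i a ` tuples (N a) (k i) = univ K"
    and uniform_interp: "interprets_uniformly LN (univ M) N LK K I k lam J"
    and RQE:
      "\<forall>\<rho> U. complete_1type LM M \<rho> \<and> ultrafilter_on (univ M) U \<and>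
          (\<forall>\<phi>\<in>\<rho>. eventually (\<lambda>a. holds M \<phi> [a]) U) \<longrightarrow>
        elim_quantifiers_rel (interp_expansion_lang LN LK I k) {Inr ()}
          (interp_expansion J (ultraproduct (univ M) U N))"
begin

sublocale interp_data LN LK I k J
proof -
  note ui = uniform_interp[unfolded interprets_uniformly_def]
  note c2 = ui[THEN conjunct2] note c3 = c2[THEN conjunct2] note c4 = c3[THEN conjunct2]
  show "interp_data LN LK I k J"
    by unfold_locales (use langs ui[THEN conjunct1] c2[THEN conjunct1] c3[THEN conjunct1]
      c4[THEN conjunct1] c4[THEN conjunct2, THEN conjunct1] in blast)+
qed

lemma lam_carr: "i \<in> I \<Longrightarrow> a \<in> univ M \<Longrightarrow> ws \<in> tuples (N a) (k i) \<Longrightarrow> lam i a ws \<in> univ K"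
  using maps_surj by blast

text \<open>The coding takes a tuple to its class and the class to \<open>K\<close> by the given
  identification \<open>h\<close>. Injectivity of \<open>h\<close> turns equivalence of tuples into
  equality of values, and its surjectivity makes every element of \<open>K\<close>
  represented.\<close>

lemma coded_N:
  assumes a: "a \<in> univ M"
  shows "\<exists>H. coded (N a) K (\<lambda>i. lam i a) H"
proof -
  let ?D = "interp_dom J (N a)" and ?E = "interp_eq J (N a)"
  have "equiv ?D ?E \<and> (\<exists>h. bij_betw h (?D // ?E) (univ K)
             \<and> (\<forall>g\<in>funs LK. \<forall>xss y. length xss = length (fdom LK g) \<and> set xss \<subseteq> ?D \<and> y \<in> ?D \<longrightarrow>
                  (holds (N a) (ifun J g) (concat xss @ y) \<longleftrightarrow>
                     fint K g (map (\<lambda>x. h (?E `` {x})) xss) = h (?E `` {y})))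
             \<and> (\<forall>q\<in>rels LK. \<forall>xss. length xss = length (rdom LK q) \<and> set xss \<subseteq> ?D \<longrightarrow>
                  (holds (N a) (irel J q) (concat xss) \<longleftrightarrow>
                     rint K q (map (\<lambda>x. h (?E `` {x})) xss)))
             \<and> (\<forall>i\<in>I. \<forall>ws\<in>tuples (N a) (k i). \<forall>y\<in>?D.
                  (holds (N a) (imap J i) (ws @ y) \<longleftrightarrow> lam i a ws = h (?E `` {y}))))"
    using uniform_interp a unfolding interprets_uniformly_def Let_def by blast
  then obtain h where eq: "equiv ?D ?E" and h: "bij_betw h (?D // ?E) (univ K)"
    and fs: "\<forall>g\<in>funs LK. \<forall>xss y. length xss = length (fdom LK g) \<and> set xss \<subseteq> ?D \<and> y \<in> ?D \<longrightarrow>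
                  (holds (N a) (ifun J g) (concat xss @ y) \<longleftrightarrow>
                     fint K g (map (\<lambda>x. h (?E `` {x})) xss) = h (?E `` {y}))"
      "\<forall>q\<in>rels LK. \<forall>xss. length xss = length (rdom LK q) \<and> set xss \<subseteq> ?D \<longrightarrow>
                  (holds (N a) (irel J q) (concat xss) \<longleftrightarrow>
                     rint K q (map (\<lambda>x. h (?E `` {x})) xss))"
      "\<forall>i\<in>I. \<forall>ws\<in>tuples (N a) (k i). \<forall>y\<in>?D.
                  (holds (N a) (imap J i) (ws @ y) \<longleftrightarrow> lam i a ws = h (?E `` {y}))" by blast
  let ?H = "\<lambda>x. h (?E `` {x})"
  have e: "holds (N a) (ieq J) (x @ y) \<longleftrightarrow> ?H x = ?H y" if xy: "x \<in> ?D" "y \<in> ?D" for x y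
  proof -
    have "holds (N a) (ieq J) (x @ y) \<longleftrightarrow> (x, y) \<in> ?E" using xy by (simp add: interp_eq_def)
    also have "\<dots> \<longleftrightarrow> ?E `` {x} = ?E `` {y}" by (rule eq_equiv_class_iff[OF eq xy, symmetric])
    also have "\<dots> \<longleftrightarrow> ?H x = ?H y"
      by (rule inj_on_eq_iff[OF bij_betw_imp_inj_on[OF h], symmetric]) (rule quotientI, rule xy)+
    finally show ?thesis .
  qed
  have "?H ` ?D = h ` (?D // ?E)" by (auto simp: quotient_def)
  then have 1: "?H ` ?D = univ K" using bij_betw_imp_surj_on[OF h] by simp
  have 2: "\<forall>x\<in>?D. \<forall>y\<in>?D. holds (N a) (ieq J) (x @ y) \<longleftrightarrow> ?H x = ?H y" using e by blast
  have 3: "is_struct LN (N a)" using N a by blast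
  have 4: "\<forall>i\<in>I. \<forall>ws\<in>tuples (N a) (k i). lam i a ws \<in> univ K" using lam_carr a by blast
  have "coded (N a) K (\<lambda>i. lam i a) ?H"
    unfolding coded_def by (intro conjI 1 2 3 4 K fs)
  then show ?thesis by (intro exI[of _ ?H])
qed

abbreviation "N' a \<equiv> adjoin_struct (N a) K (\<lambda>i. lam i a)"
abbreviation "ML' \<equiv> morley_lang L' {Inr ()}"

lemma is_struct_N': "a \<in> univ M \<Longrightarrow> is_struct L' (N' a)"
  by (rule is_struct_adjoin) (use N K lam_carr in auto)

definition equivalent_in :: "'m \<Rightarrow> _ \<Rightarrow> _ \<Rightarrow> bool" where
  "equivalent_in a \<phi> \<psi> \<longleftrightarrow>
     (\<forall>e. (\<forall>v. e v \<in> carr (N' a) (fst v)) \<longrightarrow> sat (N' a) e \<phi> = sat (morley_struct (N' a)) e \<psi>)"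

text \<open>The sentence of the pure language saying that \<open>\<psi>\<close> does the work of
  \<open>\<phi>\<close> in the expanded fibre. Los' theorem and the definability assumption are both
  applied to it.\<close>

definition equivalence :: "_ \<Rightarrow> _ \<Rightarrow> _" where
  "equivalence \<phi> \<psi> = tr (alls (Iff \<phi> (unmorley \<psi>)))"

lemma is_fm_equivalence: "wf_fm L' \<phi> \<Longrightarrow> wf_fm ML' \<psi> \<Longrightarrow> is_fm LN 0 (equivalence \<phi> \<psi>)"
  unfolding equivalence_def by (rule tr_sentence) (simp add: wf_unmorley)

lemma holds_equivalence:
  assumes "coded A K0 lam0 H" "wf_fm L' \<phi>" "wf_fm ML' \<psi>"
  shows "holds A (equivalence \<phi> \<psi>) [] \<longleftrightarrow>
    (\<forall>e. (\<forall>v. e v \<in> carr (adjoin_struct A K0 lam0) (fst v)) \<longrightarrow>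
       sat (adjoin_struct A K0 lam0) e \<phi> = sat (morley_struct (adjoin_struct A K0 lam0)) e \<psi>)"
proof -
  have "is_struct L' (adjoin_struct A K0 lam0)" using assms(1) unfolding coded_def by (intro is_struct_adjoin) blast+
  then show ?thesis
    unfolding equivalence_def using assms
    by (subst holds_tr_alls[OF assms(1)]) (auto simp: wf_unmorley sat_unmorley)
qed

lemma holds_equivalence_N:
  assumes "a \<in> univ M" "wf_fm L' \<phi>" "wf_fm ML' \<psi>"
  shows "holds (N a) (equivalence \<phi> \<psi>) [] \<longleftrightarrow> equivalent_in a \<phi> \<psi>"
proof -
  obtain H where "coded (N a) K (\<lambda>i. lam i a) H" using coded_N[OF assms(1)] by blast
  from holds_equivalence[OF this assms(2,3)] show ?thesis unfolding equivalent_in_def .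
qed

lemma definable_equivalent:
  assumes "wf_fm L' \<phi>" "wf_fm ML' \<psi>"
  shows "definable LM M {a \<in> univ M. equivalent_in a \<phi> \<psi>}"
proof -
  have "{a \<in> univ M. equivalent_in a \<phi> \<psi>} = {a \<in> univ M. holds (N a) (equivalence \<phi> \<psi>) []}"
    using holds_equivalence_N assms by blast
  then show ?thesis using definability is_fm_equivalence[OF assms] by simp
qed

text \<open>If no finite set of candidates were enough, the sets of fibres in which the single
  candidates fail would have the finite intersection property. An ultrafilter containing all of them
  leads to an ultraproduct in which, by assumption, some candidate succeeds; by Los' theorem this
  candidate succeeds in almost all fibres, although it fails in almost all of them.\<close>

theorem uniform_qe:
  assumes \<phi>: "wf_fm L' \<phi>"
  shows "\<exists>\<Psi>. finite \<Psi> \<and> (\<forall>\<psi>\<in>\<Psi>. wf_fm ML' \<psi> \<and> qf \<psi> \<and> fv \<psi> \<subseteq> fv \<phi>) \<and>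
    (\<forall>a\<in>univ M. \<exists>\<psi>\<in>\<Psi>. equivalent_in a \<phi> \<psi>)"
proof (rule ccontr)
  assume no: "\<not> ?thesis"
  define Q where "Q = {\<psi>. wf_fm ML' \<psi> \<and> qf \<psi> \<and> fv \<psi> \<subseteq> fv \<phi>}"
  define S where "S \<psi> = {a \<in> univ M. \<not> equivalent_in a \<phi> \<psi>}" for \<psi>
  have "\<exists>U. ultrafilter_on (univ M) U \<and> (\<forall>S\<in>S ` Q. eventually (\<lambda>a. a \<in> S) U)"
  proof (rule ultrafilter_exists)
    fix G assume G: "finite G" "G \<subseteq> S ` Q"
    \<comment> \<open>Finitely many of the sets come from finitely many candidates, and these fail
      together in some fibre.\<close>
    then obtain \<Psi> where \<Psi>: "finite \<Psi>" "\<Psi> \<subseteq> Q" "G = S ` \<Psi>" using finite_subset_image[OF G] by blast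
    have "\<not> (\<forall>a\<in>univ M. \<exists>\<psi>\<in>\<Psi>. equivalent_in a \<phi> \<psi>)" using no \<Psi>(1,2) unfolding Q_def by blast
    then obtain a where "a \<in> univ M" "\<forall>\<psi>\<in>\<Psi>. \<not> equivalent_in a \<phi> \<psi>" by blast
    then have "a \<in> univ M \<inter> \<Inter>G" using \<Psi> by (auto simp: S_def)
    then show "univ M \<inter> \<Inter>G \<noteq> {}" by blast
  qed
  then obtain U where Ult: "ultrafilter_on (univ M) U" "\<And>\<psi>. \<psi> \<in> Q \<Longrightarrow> eventually (\<lambda>a. a \<in> S \<psi>) U" by blast
  have "\<forall>a. \<exists>H. a \<in> univ M \<longrightarrow> coded (N a) K (\<lambda>i. lam i a) H" using coded_N by blast
  from choice[OF this] obtain Hs where Hs: "\<And>a. a \<in> univ M \<Longrightarrow> coded (N a) K (\<lambda>i. lam i a) (Hs a)" by blast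
  interpret interp_ultra LN LK I k J "univ M" U N K lam Hs
  proof unfold_locales
    show "wf_lang LN" by (rule langs)
    show "ultrafilter_on (univ M) U" by (rule Ult(1))
    show "is_struct LN (N a)" if "a \<in> univ M" for a using N that by blast
    show "coded (N a) K (\<lambda>i. lam i a) (Hs a)" if "a \<in> univ M" for a by (rule Hs[OF that])
  qed
  \<comment> \<open>The type is read off from the ultrafilter, so that \<open>U\<close> contains the
    sets defined by its formulas by construction and the assumption on quantifier elimination
    applies to this very ultraproduct.\<close>
  define \<rho> where "\<rho> = {\<phi>. is_fm LM 1 \<phi> \<and> eventually (\<lambda>a. holds M \<phi> [a]) U}"
  have "complete_1type LM M \<rho>"
    unfolding complete_1type_def
  proof (intro conjI allI impI)
    fix \<Delta> assume \<Delta>: "finite \<Delta> \<and> \<Delta> \<subseteq> \<rho>"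
    then have "eventually (\<lambda>a. \<forall>\<phi>\<in>\<Delta>. holds M \<phi> [a]) U"
      by (intro eventually_ball_finite) (auto simp: \<rho>_def)
    then have "eventually (\<lambda>a. a \<in> univ M \<and> (\<forall>\<phi>\<in>\<Delta>. holds M \<phi> [a])) U" using in_X by eventually_elim simp
    then show "\<exists>a\<in>univ M. \<forall>\<phi>\<in>\<Delta>. holds M \<phi> [a]"
      using eventually_happens Ult(1) by (fastforce simp: ultrafilter_on_def)
  next
    fix \<phi> :: "(unit, 'fm, 'rm) fm" assume "is_fm LM 1 \<phi>"
    then show "\<phi> \<in> \<rho> \<or> Neg \<phi> \<in> \<rho>"
      using ultrafilter_Neg[OF Ult(1), of "\<lambda>a. holds M \<phi> [a]"] by (auto simp: \<rho>_def is_fm_def holds_def)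
  qed (simp add: \<rho>_def)
  then have "elim_quantifiers_rel L' {Inr ()} (interp_expansion J UP)"
    using RQE Ult(1) unfolding \<rho>_def by blast
  then have "elim_quantifiers ML' (morley_struct (adjoin_struct UP (interp_struct J UP) (interp_map J UP)))"
    by (simp add: elim_quantifiers_rel_def interp_expansion_def)
  moreover have "wf_fm ML' (lift \<phi>)" using \<phi> by simp
  ultimately obtain \<psi> where \<psi>: "wf_fm ML' \<psi>" "qf \<psi>" "fv \<psi> \<subseteq> fv (lift \<phi>)"
    and eq: "\<forall>e. (\<forall>v. fst v \<in> lsorts ML' \<longrightarrow>
        e v \<in> carr (morley_struct (adjoin_struct UP (interp_struct J UP) (interp_map J UP))) (fst v)) \<longrightarrow>
      sat (morley_struct (adjoin_struct UP (interp_struct J UP) (interp_map J UP))) e (lift \<phi>) =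
      sat (morley_struct (adjoin_struct UP (interp_struct J UP) (interp_map J UP))) e \<psi>"
    unfolding elim_quantifiers_def by blast
  have \<psi>Q: "\<psi> \<in> Q" using \<psi> by (simp add: Q_def)
  have "holds UP (equivalence \<phi> \<psi>) []"
    unfolding holds_equivalence[OF coded_UP \<phi> \<psi>(1)] using eq by simp
  moreover have "[] \<in> tuples UP 0" by (simp add: tuples_def)
  ultimately have "eventually (\<lambda>a. holds (N a) (equivalence \<phi> \<psi>) []) U"
    using holds_UP[OF is_fm_equivalence[OF \<phi> \<psi>(1)], of "[]"] by simp
  with in_X have "eventually (\<lambda>a. a \<notin> S \<psi>) U"
    by eventually_elim (use holds_equivalence_N \<phi> \<psi>(1) in \<open>auto simp: S_def\<close>)
  with Ult(2)[OF \<psi>Q] have "eventually (\<lambda>a. False) U" by eventually_elim simp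
  then show False using Ult(1) by (simp add: ultrafilter_on_def trivial_limit_def[symmetric])
qed

end

section \<open>Formulas over the lexicographic sum\<close>

text \<open>Formulas are mostly replaced by the predicates on assignments they define; \<open>X\<close> is the set of
  assignments on which predicates are compared.\<close>

inductive boolcl :: "'e set \<Rightarrow> ('e \<Rightarrow> bool) set \<Rightarrow> ('e \<Rightarrow> bool) \<Rightarrow> bool" for X G where
  base: "R \<in> G \<Longrightarrow> boolcl X G R"
| neg: "boolcl X G R \<Longrightarrow> boolcl X G (\<lambda>e. \<not> R e)"
| conj: "boolcl X G R \<Longrightarrow> boolcl X G R' \<Longrightarrow> boolcl X G (\<lambda>e. R e \<and> R' e)"
| cong: "boolcl X G R \<Longrightarrow> (\<And>e. e \<in> X \<Longrightarrow> R e = R' e) \<Longrightarrow> boolcl X G R'"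

lemma boolcl_disj:
  assumes "boolcl X G R" "boolcl X G R'"
  shows "boolcl X G (\<lambda>e. R e \<or> R' e)"
proof -
  have "boolcl X G (\<lambda>e. \<not> (\<not> R e \<and> \<not> R' e))" by (intro boolcl.neg boolcl.conj assms)
  then show ?thesis by simp
qed

text \<open>Without generators the closure would be empty; a given member \<open>R\<close> supplies
  truth as \<open>R\<close> or its negation.\<close>

lemma boolcl_True:
  assumes "boolcl X G R"
  shows "boolcl X G (\<lambda>_. True)"
proof -
  have "boolcl X G (\<lambda>e. R e \<or> \<not> R e)" by (intro boolcl_disj boolcl.neg assms)
  then show ?thesis by simp
qed

lemma boolcl_ball:
  assumes "finite P" "boolcl X G (\<lambda>_. True)" "\<And>p. p \<in> P \<Longrightarrow> boolcl X G (R p)"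
  shows "boolcl X G (\<lambda>e. \<forall>p\<in>P. R p e)"
  using assms
proof (induction P rule: finite_induct)
  case (insert p P)
  have "boolcl X G (\<lambda>e. R p e \<and> (\<forall>p\<in>P. R p e))"
    by (rule boolcl.conj) (use insert in auto)
  then show ?case by (rule boolcl.cong) auto
qed simp

lemma boolcl_mono:
  assumes "boolcl X G R" "X' \<subseteq> X" "\<And>R. R \<in> G \<Longrightarrow> boolcl X' G' R"
  shows "boolcl X' G' R"
  using assms(1)
proof induction
  case (cong R R')
  then show ?case using assms(2) by (intro boolcl.cong[of X' G' R R']) auto
qed (use assms in \<open>auto intro: boolcl.intros\<close>)

section \<open>Disjunctive normal forms over two kinds of predicates\<close>

definition bool_closed :: "('e \<Rightarrow> bool) set \<Rightarrow> bool" where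
  "bool_closed A \<longleftrightarrow> (\<lambda>_. True) \<in> A \<and> (\<forall>R\<in>A. (\<lambda>e. \<not> R e) \<in> A) \<and> (\<forall>R\<in>A. \<forall>R'\<in>A. (\<lambda>e. R e \<and> R' e) \<in> A)"

text \<open>Made for eliminating an existential quantifier: it distributes over the finite
  disjunction and then meets, in each disjunct, the conjunction of a single predicate of either
  kind.\<close>

definition dnf :: "'e set \<Rightarrow> ('e \<Rightarrow> bool) set \<Rightarrow> ('e \<Rightarrow> bool) set \<Rightarrow> ('e \<Rightarrow> bool) \<Rightarrow> bool" where
  "dnf X A B R \<longleftrightarrow> (\<exists>P. finite P \<and> P \<subseteq> A \<times> B \<and> (\<forall>e\<in>X. R e = (\<exists>p\<in>P. fst p e \<and> snd p e)))"

lemma dnfI: "finite P \<Longrightarrow> P \<subseteq> A \<times> B \<Longrightarrow> (\<And>e. e \<in> X \<Longrightarrow> R e = (\<exists>p\<in>P. fst p e \<and> snd p e)) \<Longrightarrow> dnf X A B R"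
  unfolding dnf_def by (intro exI[of _ P] conjI) simp_all

lemma dnfE:
  assumes "dnf X A B R"
  obtains P where "finite P" "P \<subseteq> A \<times> B" "\<And>e. e \<in> X \<Longrightarrow> R e = (\<exists>p\<in>P. fst p e \<and> snd p e)"
  using assms unfolding dnf_def by (elim exE conjE) simp

lemma dnf_cong:
  assumes "dnf X A B R" "\<And>e. e \<in> X \<Longrightarrow> R e = R' e"
  shows "dnf X A B R'"
proof -
  obtain P where P: "finite P" "P \<subseteq> A \<times> B" "\<And>e. e \<in> X \<Longrightarrow> R e = (\<exists>p\<in>P. fst p e \<and> snd p e)"
    by (rule dnfE[OF assms(1)]) (rule that)
  show ?thesis
  proof (rule dnfI[OF P(1,2)])
    show "R' e = (\<exists>p\<in>P. fst p e \<and> snd p e)" if "e \<in> X" for e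
      using assms(2)[OF that] P(3)[OF that] by simp
  qed
qed

lemma dnf_conj:
  assumes A: "bool_closed A" and B: "bool_closed B" and "dnf X A B R" "dnf X A B R'"
  shows "dnf X A B (\<lambda>e. R e \<and> R' e)"
proof -
  obtain P where P: "finite P" "P \<subseteq> A \<times> B" "\<And>e. e \<in> X \<Longrightarrow> R e = (\<exists>p\<in>P. fst p e \<and> snd p e)"
    by (rule dnfE[OF assms(3)]) (rule that)
  obtain Q where Q: "finite Q" "Q \<subseteq> A \<times> B" "\<And>e. e \<in> X \<Longrightarrow> R' e = (\<exists>p\<in>Q. fst p e \<and> snd p e)"
    by (rule dnfE[OF assms(4)]) (rule that)
  let ?f = "\<lambda>(p, q). ((\<lambda>e. fst p e \<and> fst q e), (\<lambda>e. snd p e \<and> snd q e))"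
  show ?thesis
  proof (rule dnfI)
    show "finite (?f ` (P \<times> Q))" using P Q by simp
    show "?f ` (P \<times> Q) \<subseteq> A \<times> B"
    proof
      fix x assume "x \<in> ?f ` (P \<times> Q)"
      then obtain p q where pq: "p \<in> P" "q \<in> Q" "x = ?f (p, q)" by blast
      then have "fst p \<in> A" "fst q \<in> A" "snd p \<in> B" "snd q \<in> B" using P(2) Q(2) by auto
      then show "x \<in> A \<times> B" using A B pq(3) by (simp add: bool_closed_def)
    qed
    show "(R e \<and> R' e) = (\<exists>p\<in>?f ` (P \<times> Q). fst p e \<and> snd p e)" if "e \<in> X" for e
    proof -
      have "(\<exists>p\<in>?f ` (P \<times> Q). fst p e \<and> snd p e) \<longleftrightarrow> (\<exists>p\<in>P. \<exists>q\<in>Q. (fst p e \<and> fst q e) \<and> snd p e \<and> snd q e)"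
        by (auto simp: split_beta)
      then show ?thesis using P(3)[OF that] Q(3)[OF that] by auto
    qed
  qed
qed

lemma dnf_disj:
  assumes "dnf X A B R" "dnf X A B R'"
  shows "dnf X A B (\<lambda>e. R e \<or> R' e)"
proof -
  obtain P where P: "finite P" "P \<subseteq> A \<times> B" "\<And>e. e \<in> X \<Longrightarrow> R e = (\<exists>p\<in>P. fst p e \<and> snd p e)"
    by (rule dnfE[OF assms(1)]) (rule that)
  obtain Q where Q: "finite Q" "Q \<subseteq> A \<times> B" "\<And>e. e \<in> X \<Longrightarrow> R' e = (\<exists>p\<in>Q. fst p e \<and> snd p e)"
    by (rule dnfE[OF assms(2)]) (rule that)
  show ?thesis by (rule dnfI[of "P \<union> Q"]) (use P Q in \<open>simp_all add: bex_Un\<close>)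
qed

text \<open>The induction carries the normal form of the complement along. Then negation merely
  swaps the two forms, and the complement of a conjunction is a disjunction of complements.\<close>

lemma boolcl_dnf:
  assumes A: "bool_closed A" and B: "bool_closed B" and R: "boolcl X (A \<union> B) R"
  shows "dnf X A B R"
proof -
  have inA: "dnf X A B R" if "R \<in> A" for R
    by (rule dnfI[of "{(R, \<lambda>_. True)}"]) (use that B in \<open>simp_all add: bool_closed_def\<close>)
  have inB: "dnf X A B R" if "R \<in> B" for R
    by (rule dnfI[of "{(\<lambda>_. True, R)}"]) (use that A in \<open>simp_all add: bool_closed_def\<close>)
  have "dnf X A B R \<and> dnf X A B (\<lambda>e. \<not> R e)"
    using R
  proof induction
    case (base R)
    then consider "R \<in> A" | "R \<in> B" by blast
    then show ?case
    proof cases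
      case 1
      then have "(\<lambda>e. \<not> R e) \<in> A" using A by (simp add: bool_closed_def)
      then show ?thesis using inA 1 by simp
    next
      case 2
      then have "(\<lambda>e. \<not> R e) \<in> B" using B by (simp add: bool_closed_def)
      then show ?thesis using inB 2 by simp
    qed
  next
    case (conj R R')
    have "dnf X A B (\<lambda>e. \<not> R e \<or> \<not> R' e)" by (rule dnf_disj) (use conj in simp_all)
    then have "dnf X A B (\<lambda>e. \<not> (R e \<and> R' e))" by simp
    moreover have "dnf X A B (\<lambda>e. R e \<and> R' e)" by (rule dnf_conj[OF A B]) (use conj in simp_all)
    ultimately show ?case by simp
  next
    case (cong R R')
    have "dnf X A B R'" by (rule dnf_cong[of _ _ _ R]) (use cong in simp_all)
    moreover have "dnf X A B (\<lambda>e. \<not> R' e)" by (rule dnf_cong[of _ _ _ "\<lambda>e. \<not> R e"]) (use cong in simp_all)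
    ultimately show ?case ..
  qed simp
  then show ?thesis ..
qed

lemma fresh_names:
  assumes "finite P" "finite W"
  obtains \<iota> :: "'a \<Rightarrow> nat" where "inj_on \<iota> P" "\<iota> ` P \<inter> W = {}"
proof -
  have "infinite (UNIV - W)" using assms(2) by simp
  then obtain B where B: "finite B" "card B = card P" "B \<subseteq> UNIV - W"
    using infinite_arbitrarily_large by blast
  then obtain \<iota> where \<iota>: "bij_betw \<iota> P B" using assms(1) finite_same_card_bij by metis
  show thesis by (rule that[of \<iota>]) (use B \<iota> in \<open>auto simp: bij_betw_def\<close>)
qed

section \<open>The lexicographic sum with the sort of K as a structure\<close>

type_synonym ('m, 'n, 'k) lex_env = "(lex_sort + unit) var \<Rightarrow> ('m, 'n) lex_elt + 'k option"

type_synonym ('fm, 'fn, 'fk, 'i) lex_tm = "(lex_sort + unit, (('fm, 'fn) lex_fun, 'fk option, 'i) adj_fun) tm"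

locale lex_setup = lex_setting LM M LN N LK K I k lam J
  for LM :: "(unit, 'fm, 'rm) lang" and M :: "(unit, 'fm, 'rm, 'm) struct"
    and LN :: "(unit, 'fn, 'rn) lang" and N :: "'m \<Rightarrow> (unit, 'fn, 'rn, 'n) struct"
    and LK :: "(unit, 'fk, 'rk) lang" and K :: "(unit, 'fk, 'rk, 'k) struct"
    and I :: "'i set" and k :: "'i \<Rightarrow> nat" and lam :: "'i \<Rightarrow> 'm \<Rightarrow> 'n list \<Rightarrow> 'k"
    and J :: "('fn, 'rn, 'fk, 'rk, 'i) interp" +
  fixes u :: "('m, 'n) lex_elt" and z :: "'fk option"
  assumes undetermined: "u \<in> carr (lex_struct M N u) MainS" and zero: "zero_choice LK z"
begin

abbreviation "LS \<equiv> lex_expansion_lang LM LN LK z I k"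
abbreviation "S \<equiv> lex_expansion M N u K z lam"
abbreviation "\<Sigma> \<equiv> {Inl BaseS, Inr ()} :: (lex_sort + unit) set"
abbreviation "ML \<equiv> morley_lang LS \<Sigma>"
abbreviation "MS \<equiv> morley_struct S"
abbreviation "has_undet \<equiv> \<exists>g\<in>funs LN. length (fdom LN g) \<ge> 2"

lemma LS_simps [simp]:
  "lsorts LS = UNIV"
  "Inl (Inl (BaseFn f)) \<in> funs LS \<longleftrightarrow> f \<in> funs LM"
  "Inl (Inl (MainFn g)) \<in> funs LS \<longleftrightarrow> g \<in> funs LN"
  "Inl (Inl Undet) \<in> funs LS \<longleftrightarrow> has_undet"
  "Inl (Inl Proj) \<in> funs LS"
  "Inl (Inr (Some c)) \<in> funs LS \<longleftrightarrow> c \<in> funs LK"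
  "Inl (Inr None) \<in> funs LS \<longleftrightarrow> z = None"
  "Inr i \<in> funs LS \<longleftrightarrow> i \<in> I"
  "fdom LS (Inl (Inl (BaseFn f))) = map (\<lambda>_. Inl BaseS) (fdom LM f)"
  "fdom LS (Inl (Inl (MainFn g))) = map (\<lambda>_. Inl MainS) (fdom LN g)"
  "fdom LS (Inl (Inl Undet)) = []"
  "fdom LS (Inl (Inl Proj)) = [Inl MainS]"
  "fdom LS (Inl (Inr (Some c))) = map (\<lambda>_. Inr ()) (fdom LK c)"
  "fdom LS (Inl (Inr None)) = []"
  "fdom LS (Inr i) = replicate (k i) (Inl MainS)"
  "fcod LS (Inl (Inl (BaseFn f))) = Inl BaseS"
  "fcod LS (Inl (Inl (MainFn g))) = Inl MainS"
  "fcod LS (Inl (Inl Undet)) = Inl MainS"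
  "fcod LS (Inl (Inl Proj)) = Inl BaseS"
  "fcod LS (Inl (Inr h)) = Inr ()"
  "fcod LS (Inr i) = Inr ()"
  "Inl (Inl r) \<in> rels LS \<longleftrightarrow> r \<in> rels LM"
  "Inl (Inr q) \<in> rels LS \<longleftrightarrow> q \<in> rels LN"
  "Inr p \<in> rels LS \<longleftrightarrow> p \<in> rels LK"
  "rdom LS (Inl (Inl r)) = map (\<lambda>_. Inl BaseS) (rdom LM r)"
  "rdom LS (Inl (Inr q)) = map (\<lambda>_. Inl MainS) (rdom LN q)"
  "rdom LS (Inr p) = map (\<lambda>_. Inr ()) (rdom LK p)"
proof -
  have "lsorts LK = {()}" using langs by (auto simp: wf_lang_def)
  moreover have "(x :: lex_sort + unit) \<in> Inl ` {MainS, BaseS} \<union> Inr ` {()}" for x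
    by (cases x; cases "projl x") auto
  ultimately show "lsorts LS = UNIV"
    by (auto simp: lex_expansion_lang_def adjoin_lang_def lex_lang_def pointed_lang_def)
qed (auto simp: lex_expansion_lang_def adjoin_lang_def lex_lang_def pointed_lang_def comp_def)

lemma S_simps [simp]:
  "carr S (Inl MainS) = Inl ` {MainElt a b | a b. a \<in> univ M \<and> b \<in> univ (N a)}"
  "carr S (Inl BaseS) = Inl ` BaseElt ` univ M"
  "carr S (Inr t) = Inr ` (Some ` univ K \<union> (if z = None then {None} else {}))"
  "fint S (Inl (Inl (BaseFn f))) us = Inl (BaseElt (fint M f (map (base_of \<circ> projl) us)))"
  "fint S (Inl (Inl (MainFn g))) us = Inl (fibrewise (\<lambda>a bs. MainElt a (fint (N a) g bs)) u (map projl us))"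
  "fint S (Inl (Inl Undet)) us = Inl u"
  "fint S (Inl (Inl Proj)) us = Inl (BaseElt (fibre (hd (map projl us))))"
  "fint S (Inl (Inr (Some c))) us =
     Inr (if None \<in> set (map projr us) then None else Some (fint K c (map (the \<circ> projr) us)))"
  "fint S (Inl (Inr None)) us = Inr None"
  "fint S (Inr i) us = Inr (fibrewise (\<lambda>a bs. Some (lam i a bs)) (zero_elt K z) (map projl us))"
  "rint S (Inl (Inl r)) us = rint M r (map (base_of \<circ> projl) us)"
  "rint S (Inl (Inr q)) us \<longleftrightarrow> (\<exists>a\<in>univ M. \<exists>bs. map projl us = map (MainElt a) bs \<and> rint (N a) q bs)"
  "rint S (Inr p) us \<longleftrightarrow> None \<notin> set (map projr us) \<and> rint K p (map (the \<circ> projr) us)"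
  by (auto simp: lex_expansion_def adjoin_struct_def lex_struct_def pointed_struct_def comp_def)

lemma u_main: "Inl u \<in> carr S (Inl MainS)"
  using undetermined by (auto simp: lex_struct_def)

lemma lsorts_unit [simp]: "lsorts LM = UNIV" "lsorts LN = UNIV" "lsorts LK = UNIV"
  using langs by (auto simp: wf_lang_def)

lemma carr_nonempty: "univ M \<noteq> {}" "univ K \<noteq> {}" "a \<in> univ M \<Longrightarrow> univ (N a) \<noteq> {}"
  using M K N by (auto simp: is_struct_def)

lemma fint_closed:
  "f \<in> funs LM \<Longrightarrow> length us = length (fdom LM f) \<Longrightarrow> set us \<subseteq> univ M \<Longrightarrow> fint M f us \<in> univ M"
  "a \<in> univ M \<Longrightarrow> g \<in> funs LN \<Longrightarrow> length vs = length (fdom LN g) \<Longrightarrow> set vs \<subseteq> univ (N a) \<Longrightarrow> fint (N a) g vs \<in> univ (N a)"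
  "c \<in> funs LK \<Longrightarrow> length ws = length (fdom LK c) \<Longrightarrow> set ws \<subseteq> univ K \<Longrightarrow> fint K c ws \<in> univ K"
  using M N K by (auto simp: is_struct_def list_all2_conv_all_nth subset_iff)

lemma zero_carr: "Inr (zero_elt K z) \<in> carr S (Inr ())"
proof -
  have "zero_elt K z \<in> Some ` univ K \<union> (if z = None then {None} else {})"
    using zero fint_closed(3)[of _ "[]"] by (cases z) (auto simp: zero_elt_def zero_choice_def)
  then show ?thesis by simp
qed

lemma symbol_cases:
  obtains (base_fn) f where "h = Inl (Inl (BaseFn f))" | (main_fn) g where "h = Inl (Inl (MainFn g))"
  | (undet) "h = Inl (Inl Undet)" | (proj) "h = Inl (Inl Proj)" | (K_fn) c where "h = Inl (Inr (Some c))"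
  | (zero) "h = Inl (Inr None)" | (map) i where "h = Inr i"
proof (cases h rule: adj_fun_cases)
  case (1 f)
  then show ?thesis using that(1-4) by (cases f) auto
next
  case (2 g)
  then show ?thesis using that(5,6) by (cases g) auto
qed (use that(7) in auto)

lemma fibrewise_same:
  assumes "us \<noteq> []" "\<And>w. w \<in> set us \<Longrightarrow> fibre (projl w) = a"
  shows "fibrewise t c (map projl us) = t a (map (coord \<circ> projl) us)"
proof -
  have "\<exists>a. \<forall>w\<in>set (map projl us). fibre w = a" using assms(2) by auto
  moreover have "fibre (hd (map projl us)) = a" using assms by (simp add: hd_map)
  ultimately show ?thesis by (simp add: fibrewise_def)
qed

lemma fibrewise_diff:
  "v \<in> set us \<Longrightarrow> w \<in> set us \<Longrightarrow> fibre (projl v) \<noteq> fibre (projl w) \<Longrightarrow> fibrewise t c (map projl us) = c"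
  by (auto simp: fibrewise_def)

lemma main_eltD: "x \<in> carr S (Inl MainS) \<Longrightarrow> x = Inl (MainElt (fibre (projl x)) (coord (projl x))) \<and>
    fibre (projl x) \<in> univ M \<and> coord (projl x) \<in> univ (N (fibre (projl x)))"
  by auto

lemma fibrewise_cases:
  assumes "us \<noteq> []" "set us \<subseteq> carr S (Inl MainS)"
  obtains (same) a where "a \<in> univ M" "\<And>w. w \<in> set us \<Longrightarrow> fibre (projl w) = a"
      "map (coord \<circ> projl) us \<in> tuples (N a) (length us)"
  | (diff) v w where "v \<in> set us" "w \<in> set us" "fibre (projl v) \<noteq> fibre (projl w)"
proof (cases "\<exists>a. \<forall>w\<in>set us. fibre (projl w) = a")
  case True
  then obtain a where a: "\<And>w. w \<in> set us \<Longrightarrow> fibre (projl w) = a" by blast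
  have "hd us \<in> set us" using assms(1) by simp
  then have "a \<in> univ M" using main_eltD[of "hd us"] a[of "hd us"] assms(2) by auto
  moreover have "coord (projl w) \<in> univ (N a)" if "w \<in> set us" for w
    using main_eltD[of w] a[OF that] assms(2) that by blast
  then have "map (coord \<circ> projl) us \<in> tuples (N a) (length us)" by (auto simp: tuples_def)
  ultimately show thesis using same a by blast
next
  case False
  then have "\<exists>w\<in>set us. fibre (projl w) \<noteq> fibre (projl (hd us))" by blast
  then show thesis using diff[of "hd us"] assms(1) by auto
qed

lemma is_struct_S: "is_struct LS S"
  unfolding is_struct_def
proof (intro conjI ballI allI impI)
  fix s show "carr S s \<noteq> {}"
  proof (cases s)
    case (Inl l)
    then show ?thesis using carr_nonempty u_main by (cases l) auto
  qed (use carr_nonempty in auto)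
next
  fix h us assume h: "h \<in> funs LS" and us: "list_all2 (\<lambda>u s. u \<in> carr S s) us (fdom LS h)"
  have len: "length us = length (fdom LS h)" using us by (rule list_all2_lengthD)
  have mem: "set us \<subseteq> carr S s" if "fdom LS h = replicate n s" for n s
    using us that by (auto simp: list_all2_conv_all_nth in_set_conv_nth)
  have const: "map (\<lambda>_. s) xs = replicate (length xs) s" for s and xs :: "'x list" by (simp add: map_replicate_const)
  show "fint S h us \<in> carr S (fcod LS h)"
  proof (cases h rule: symbol_cases)
    case (base_fn f)
    have "set us \<subseteq> Inl ` BaseElt ` univ M" using mem[of "length (fdom LM f)" "Inl BaseS"] by (simp add: base_fn const)
    then have "set (map (base_of \<circ> projl) us) \<subseteq> univ M" by auto
    then show ?thesis using fint_closed(1)[of f "map (base_of \<circ> projl) us"] h len by (simp add: base_fn)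
  next
    case (main_fn g)
    have us': "set us \<subseteq> carr S (Inl MainS)" using mem[of "length (fdom LN g)" "Inl MainS"] by (simp add: main_fn const)
    have ne: "us \<noteq> []" using LN_no_constants h len by (auto simp: main_fn)
    show ?thesis
    proof (rule fibrewise_cases[OF ne us'], goal_cases same diff)
      case (same a)
      have "fint (N a) g (map (coord \<circ> projl) us) \<in> univ (N a)"
        by (rule fint_closed(2)) (use same h len in \<open>auto simp: main_fn tuples_def\<close>)
      then show ?thesis using same(1) by (simp add: main_fn fibrewise_same[OF ne same(2)])
    next
      case (diff v w)
      then show ?thesis using u_main by (simp add: main_fn fibrewise_diff)
    qed
  next
    case undet
    then show ?thesis using u_main by simp
  next
    case proj
    have "us \<noteq> []" "hd us \<in> carr S (Inl MainS)" using us by (auto simp: proj list_all2_Cons2)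
    then show ?thesis using main_eltD[of "hd us"] by (auto simp: proj hd_map)
  next
    case (K_fn c)
    have us': "set us \<subseteq> carr S (Inr ())" 
    proof (rule mem)
      show "fdom LS h = replicate (length (fdom LK c)) (Inr ())" by (rule nth_equalityI) (auto simp: K_fn)
    qed
    show ?thesis
    proof (cases "None \<in> projr ` set us")
      case True
      then obtain w where w: "w \<in> set us" "projr w = None" by (metis imageE)
      then have "w \<in> carr S (Inr ())" using us' by blast
      moreover from this have "w = Inr None" using w(2) by auto
      \<comment> \<open>The added point occurs among the arguments only if it belongs to the sort of
        K, and then it is an admissible value too.\<close>
      ultimately have "Inr None \<in> carr S (Inr ())" by simp
      moreover have "fint S h us = Inr None" "fcod LS h = Inr ()" using True by (simp_all add: K_fn)
      ultimately show ?thesis by (simp only:)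
    next
      case False
      have "the (projr w) \<in> univ K" if "w \<in> set us" for w
      proof -
        have "w \<in> carr S (Inr ())" using us' that by blast
        moreover have "projr w \<noteq> None" using False that by force
        ultimately show ?thesis by (auto split: if_splits)
      qed
      then have "fint K c (map (the \<circ> projr) us) \<in> univ K"
        using h len by (intro fint_closed(3)) (auto simp: K_fn)
      then show ?thesis using False by (simp add: K_fn)
    qed
  next
    case zero
    have z: "z = None" using h by (simp add: zero)
    have "Inr None \<in> carr S (Inr ())" by (simp only: S_simps(3)) (simp add: z)
    then show ?thesis unfolding zero by (simp only: S_simps LS_simps)
  next
    case (map i)
    have us': "set us \<subseteq> carr S (Inl MainS)" using mem[of "k i" "Inl MainS"] by (simp add: map)
    have ne: "us \<noteq> []" using k_pos h len by (auto simp: map)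
    show ?thesis
    proof (rule fibrewise_cases[OF ne us'], goal_cases same diff)
      case (same a)
      have "lam i a (map (coord \<circ> projl) us) \<in> univ K"
        by (rule lam_carr) (use same h len in \<open>auto simp: map\<close>)
      then show ?thesis by (simp add: map fibrewise_same[OF ne same(2)])
    next
      case (diff v w)
      then show ?thesis using zero_carr by (simp add: map fibrewise_diff)
    qed
  qed
qed

section \<open>Predicates given by quantifier-free formulas of the enrichment\<close>

definition ok :: "('m, 'n, 'k) lex_env \<Rightarrow> bool" where
  "ok e \<longleftrightarrow> (\<forall>v. e v \<in> carr S (fst v))"

lemma ok_tm_val: "ok e \<Longrightarrow> wf_tm LS t \<Longrightarrow> tm_val S e t \<in> carr S (tm_sort LS t)"
  using tm_val_carr[OF is_struct_S] by (auto simp: ok_def)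

lemma ok_upd: "ok e \<Longrightarrow> x \<in> carr S (fst v) \<Longrightarrow> ok (e(v := x))"
  by (simp add: ok_def)

text \<open>The set \<open>V\<close> is carried along for two reasons: the eliminating formula must
  not have new free variables, and by \<open>QF_dep\<close> the predicate is independent of all
  variables outside \<open>V\<close>.\<close>

definition QF :: "(lex_sort + unit) var set \<Rightarrow> (('m, 'n, 'k) lex_env \<Rightarrow> bool) \<Rightarrow> bool" where
  "QF V R \<longleftrightarrow> (\<exists>\<psi>. wf_fm ML \<psi> \<and> qf \<psi> \<and> fv \<psi> \<subseteq> V \<and> (\<forall>e. ok e \<longrightarrow> R e = sat MS e \<psi>))"

lemma QF_I: "wf_fm ML \<psi> \<Longrightarrow> qf \<psi> \<Longrightarrow> fv \<psi> \<subseteq> V \<Longrightarrow> (\<And>e. ok e \<Longrightarrow> R e = sat MS e \<psi>) \<Longrightarrow> QF V R"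
  unfolding QF_def by (intro exI[of _ \<psi>] conjI allI impI) simp_all

lemma QF_E:
  assumes "QF V R"
  obtains \<psi> where "wf_fm ML \<psi>" "qf \<psi>" "fv \<psi> \<subseteq> V" "\<And>e. ok e \<Longrightarrow> R e = sat MS e \<psi>"
  using assms unfolding QF_def by (elim exE conjE) simp

lemma QF_sat: "wf_fm ML \<psi> \<Longrightarrow> qf \<psi> \<Longrightarrow> fv \<psi> \<subseteq> V \<Longrightarrow> QF V (\<lambda>e. sat MS e \<psi>)"
  by (rule QF_I) simp_all

lemma QF_neg:
  assumes "QF V R"
  shows "QF V (\<lambda>e. \<not> R e)"
proof -
  obtain \<psi> where "wf_fm ML \<psi>" "qf \<psi>" "fv \<psi> \<subseteq> V" "\<And>e. ok e \<Longrightarrow> R e = sat MS e \<psi>"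
    by (rule QF_E[OF assms]) (rule that)
  then show ?thesis by (intro QF_I[of "Neg \<psi>"]) simp_all
qed

lemma QF_conj:
  assumes "QF V R" "QF V R'"
  shows "QF V (\<lambda>e. R e \<and> R' e)"
proof -
  obtain \<psi> where "wf_fm ML \<psi>" "qf \<psi>" "fv \<psi> \<subseteq> V" "\<And>e. ok e \<Longrightarrow> R e = sat MS e \<psi>"
    by (rule QF_E[OF assms(1)]) (rule that)
  moreover obtain \<psi>' where "wf_fm ML \<psi>'" "qf \<psi>'" "fv \<psi>' \<subseteq> V" "\<And>e. ok e \<Longrightarrow> R' e = sat MS e \<psi>'"
    by (rule QF_E[OF assms(2)]) (rule that)
  ultimately show ?thesis by (intro QF_I[of "Conj \<psi> \<psi>'"]) simp_all
qed

lemma QF_cong: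
  assumes "QF V R" "\<And>e. ok e \<Longrightarrow> R e = R' e"
  shows "QF V R'"
proof -
  obtain \<psi> where \<psi>: "wf_fm ML \<psi>" "qf \<psi>" "fv \<psi> \<subseteq> V" "\<And>e. ok e \<Longrightarrow> R e = sat MS e \<psi>"
    by (rule QF_E[OF assms(1)]) (rule that)
  show ?thesis by (rule QF_I[OF \<psi>(1-3)]) (use \<psi>(4) assms(2) in metis)
qed

lemma QF_mono:
  assumes "QF V R" "V \<subseteq> V'"
  shows "QF V' R"
proof -
  obtain \<psi> where \<psi>: "wf_fm ML \<psi>" "qf \<psi>" "fv \<psi> \<subseteq> V" "\<And>e. ok e \<Longrightarrow> R e = sat MS e \<psi>"
    by (rule QF_E[OF assms(1)]) (rule that)
  show ?thesis by (rule QF_I[OF \<psi>(1,2) order_trans[OF \<psi>(3) assms(2)] \<psi>(4)])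
qed

lemma QF_False: "QF V (\<lambda>_. False)"
  by (rule QF_I[of Fls]) simp_all

lemma QF_const: "QF V (\<lambda>_. b)"
  using QF_False QF_neg[OF QF_False] by (cases b) simp_all

lemma QF_disj: "QF V R \<Longrightarrow> QF V R' \<Longrightarrow> QF V (\<lambda>e. R e \<or> R' e)"
  using QF_neg[OF QF_conj[OF QF_neg QF_neg]] by simp

lemma QF_bex: "finite P \<Longrightarrow> (\<And>p. p \<in> P \<Longrightarrow> QF V (R p)) \<Longrightarrow> QF V (\<lambda>e. \<exists>p\<in>P. R p e)"
proof (induction P rule: finite_induct)
  case (insert p P)
  have "QF V (\<lambda>e. R p e \<or> (\<exists>p\<in>P. R p e))" by (rule QF_disj) (use insert in auto)
  then show ?case by simp
qed (simp add: QF_False)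

lemma QF_ball: "finite P \<Longrightarrow> (\<And>p. p \<in> P \<Longrightarrow> QF V (R p)) \<Longrightarrow> QF V (\<lambda>e. \<forall>p\<in>P. R p e)"
  using QF_neg[OF QF_bex[of P V "\<lambda>p e. \<not> R p e"]] QF_neg by simp

text \<open>Case distinction on a finite invariant of the assignment. It is enough to be right
  separately on the assignments of each pattern, since the formula itself can test which pattern
  occurs.\<close>

lemma QF_cases:
  assumes fin: "finite (pat ` {e. ok e})" and pat: "\<And>p. QF V (\<lambda>e. pat e = p)"
    and R: "\<And>e0. ok e0 \<Longrightarrow> \<exists>R'. QF V R' \<and> (\<forall>e. ok e \<and> pat e = pat e0 \<longrightarrow> R e = R' e)"
  shows "QF V R"
proof -
  have "\<exists>R'. QF V R' \<and> (\<forall>e. ok e \<and> pat e = p \<longrightarrow> R e = R' e)" if "p \<in> pat ` {e. ok e}" for p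
    using that R by auto
  then obtain R' where R': "\<And>p. p \<in> pat ` {e. ok e} \<Longrightarrow> QF V (R' p)"
    "\<And>p e. p \<in> pat ` {e. ok e} \<Longrightarrow> ok e \<Longrightarrow> pat e = p \<Longrightarrow> R e = R' p e"
    using bchoice[of "pat ` {e. ok e}" "\<lambda>p R'. QF V R' \<and> (\<forall>e. ok e \<and> pat e = p \<longrightarrow> R e = R' e)"] by blast
  have "QF V (\<lambda>e. \<exists>p\<in>pat ` {e. ok e}. pat e = p \<and> R' p e)"
    by (rule QF_bex[OF fin], rule QF_conj[OF pat R'(1)])
  then show ?thesis by (rule QF_cong) (use R'(2) in auto)
qed

lemma QF_bool_closed: "bool_closed {R. QF V R}"
  by (simp add: bool_closed_def QF_const QF_neg QF_conj)

lemma QF_dep: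
  assumes "QF V R" "ok e" "ok e'" "\<And>v. v \<in> V \<Longrightarrow> e v = e' v"
  shows "R e = R e'"
proof -
  obtain \<psi> where \<psi>: "wf_fm ML \<psi>" "qf \<psi>" "fv \<psi> \<subseteq> V" "\<And>e. ok e \<Longrightarrow> R e = sat MS e \<psi>"
    by (rule QF_E[OF assms(1)]) (rule that)
  have "sat MS e \<psi> = sat MS e' \<psi>" by (rule sat_cong) (use \<psi>(3) assms(4) in blast)
  then show ?thesis using \<psi>(4) assms(2,3) by simp
qed

text \<open>Quantifiers inside \<open>\<theta>\<close> cost nothing, as the enrichment has a
  predicate for \<open>\<theta>\<close> in any listing of its free variables; this predicate is
  applied to the terms \<open>\<sigma> v\<close>, which may involve the main sort.\<close>

lemma QF_sigma:
  assumes \<theta>: "wf_fm (restrict_lang LS \<Sigma>) \<theta>"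
    and \<sigma>: "\<And>v. v \<in> fv \<theta> \<Longrightarrow> fst v \<in> \<Sigma> \<and> wf_tm LS (\<sigma> v) \<and> tm_sort LS (\<sigma> v) = fst v \<and> fv_tm (\<sigma> v) \<subseteq> V"
  shows "QF V (\<lambda>e. sat S (\<lambda>v. tm_val S e (\<sigma> v)) \<theta>)"
proof -
  obtain xs where xs: "set xs = fv \<theta>" "distinct xs" using finite_distinct_list[OF finite_fv] by blast
  let ?\<psi> = "Rel (Inr (xs, \<theta>)) (map \<sigma> xs)"
  have "wf_fm ML ?\<psi>" using \<theta> \<sigma> xs by auto
  moreover have "fv ?\<psi> \<subseteq> V" using \<sigma> xs by auto
  moreover have "sat S (\<lambda>v. tm_val S e (\<sigma> v)) \<theta> = sat MS e ?\<psi>" for e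
  proof -
    have "sat S (\<lambda>v. tm_val S e (\<sigma> v)) \<theta> = sat S (\<lambda>v. the (map_of (zip xs (map (\<lambda>v. tm_val S e (\<sigma> v)) xs)) v)) \<theta>"
      by (rule sat_cong) (use xs in \<open>auto simp: map_of_zip_map\<close>)
    then show ?thesis by (simp add: comp_def)
  qed
  ultimately show ?thesis by (intro QF_I[of ?\<psi>]) simp_all
qed

end

section \<open>Separating the main sort from the other sorts\<close>

lemma ex_env_Cons:
  "(\<exists>e'. (\<forall>v\<in>set (w # vs). e' v \<in> C v) \<and> (\<forall>v. v \<notin> set (w # vs) \<longrightarrow> e' v = e v) \<and> Q e') \<longleftrightarrow>
   (\<exists>x\<in>C w. \<exists>e'. (\<forall>v\<in>set vs. e' v \<in> C v) \<and> (\<forall>v. v \<notin> set vs \<longrightarrow> e' v = (e(w := x)) v) \<and> Q e')"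
  (is "?l \<longleftrightarrow> ?r")
proof
  assume ?l
  then obtain e' where e': "\<forall>v\<in>set (w # vs). e' v \<in> C v" "\<forall>v. v \<notin> set (w # vs) \<longrightarrow> e' v = e v" "Q e'" by blast
  then show ?r by (intro bexI[of _ "e' w"] exI[of _ e']) auto
next
  assume ?r
  then obtain x e' where "x \<in> C w" "\<forall>v\<in>set vs. e' v \<in> C v" "\<forall>v. v \<notin> set vs \<longrightarrow> e' v = (e(w := x)) v" "Q e'" by blast
  then show ?l by (intro exI[of _ e']) (metis fun_upd_apply list.set_intros set_ConsD)
qed

lemma tm_sort_restrict_eq [simp]: "tm_sort (restrict_lang L \<Sigma>) = tm_sort L"
  by (rule ext) simp

lemma tm_val_morley_eq [simp]: "tm_val (morley_struct A) = tm_val A"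
  by (intro ext) simp

context lex_setup
begin

text \<open>The symbols leading from the main sort to the sorts in \<open>\<Sigma>\<close>. A term of a sort in \<open>\<Sigma>\<close> depends on
  variables of the main sort only through subterms starting with such a symbol.\<close>

definition is_iface :: "(('fm, 'fn) lex_fun, 'fk option, 'i) adj_fun \<Rightarrow> bool" where
  "is_iface h \<longleftrightarrow> h = Inl (Inl Proj) \<or> (\<exists>i. h = Inr i)"

text \<open>The recursion stops at the outermost interface symbol, because everything below it has
  the main sort.\<close>

fun ifc :: "('fm, 'fn, 'fk, 'i) lex_tm \<Rightarrow> _ set" where
  "ifc (Var v) = {}"
| "ifc (Fn h ts) = (if is_iface h then {Fn h ts} else (\<Union>t\<in>set ts. ifc t))"

fun ifc_fm :: "(lex_sort + unit, (('fm, 'fn) lex_fun, 'fk option, 'i) adj_fun, _) fm \<Rightarrow> _ set" where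
  "ifc_fm (Eq t s) = ifc t \<union> ifc s"
| "ifc_fm (Rel r ts) = (\<Union>t\<in>set ts. ifc t)"
| "ifc_fm (Neg \<phi>) = ifc_fm \<phi>"
| "ifc_fm (Conj \<phi> \<psi>) = ifc_fm \<phi> \<union> ifc_fm \<psi>"
| "ifc_fm _ = {}"

definition iface :: "('fm, 'fn, 'fk, 'i) lex_tm \<Rightarrow> bool" where
  "iface p \<longleftrightarrow> wf_tm LS p \<and> (\<exists>h ts. p = Fn h ts \<and> is_iface h)"

abbreviation "main_var \<equiv> {v :: (lex_sort + unit) var. fst v = Inl MainS}"

lemma main_tm_cases:
  assumes "wf_tm LS t" "tm_sort LS t = Inl MainS"
  obtains (var) n where "t = Var (Inl MainS, n)"
  | (main_fn) g ts where "t = Fn (Inl (Inl (MainFn g))) ts" "g \<in> funs LN" "length ts = length (fdom LN g)" "ts \<noteq> []"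
      "\<And>s. s \<in> set ts \<Longrightarrow> wf_tm LS s \<and> tm_sort LS s = Inl MainS"
  | (undet) "t = Fn (Inl (Inl Undet)) []" "has_undet"
proof (cases t)
  case (Var v)
  then show thesis using assms var by (cases v) auto
next
  case (Fn h ts)
  show thesis
  proof (cases h rule: symbol_cases)
    case (main_fn g)
    have g: "g \<in> funs LN" "map (tm_sort LS) ts = map (\<lambda>_. Inl MainS) (fdom LN g)" "\<forall>s\<in>set ts. wf_tm LS s"
      using assms by (auto simp: Fn main_fn)
    have len: "length ts = length (fdom LN g)" using g(2) map_eq_imp_length_eq by blast
    have "tm_sort LS s = Inl MainS" if s: "s \<in> set ts" for s
    proof -
      obtain i where "i < length ts" "s = ts ! i" using s by (auto simp: in_set_conv_nth)
      then show ?thesis using arg_cong[OF g(2), of "\<lambda>xs. xs ! i"] len by simp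
    qed
    moreover have "ts \<noteq> []" using LN_no_constants g(1) len by auto
    ultimately show thesis using that(2)[of g ts] g len by (simp add: Fn main_fn)
  next
    case undet
    then show thesis using assms that(3) by (auto simp: Fn undet)
  next
    case zero
    have "tm_sort LS t = Inr ()" by (simp add: Fn zero)
    then show thesis using assms(2) by simp
  qed (use assms in \<open>auto simp: Fn\<close>)
qed

text \<open>No symbol leads from the sorts in \<open>\<Sigma>\<close> back to the main sort. For
  this reason a quantifier over M or K leaves the atoms of the main sort and the interface terms
  untouched.\<close>

lemma main_tm_fv: "wf_tm LS t \<Longrightarrow> tm_sort LS t = Inl MainS \<Longrightarrow> fv_tm t \<subseteq> main_var"
proof (induction t)
  case (Fn h ts)
  show ?case
    by (rule main_tm_cases[OF Fn.prems]) (use Fn.IH in auto)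
qed simp

lemma iface_args:
  assumes "iface p"
  obtains (proj) t where "p = Fn (Inl (Inl Proj)) [t]" "wf_tm LS t" "tm_sort LS t = Inl MainS"
  | (map) i ts where "p = Fn (Inr i) ts" "i \<in> I" "length ts = k i" "ts \<noteq> []"
      "\<And>s. s \<in> set ts \<Longrightarrow> wf_tm LS s \<and> tm_sort LS s = Inl MainS"
proof -
  obtain h ts where p: "p = Fn h ts" "is_iface h" "wf_tm LS p" using assms by (auto simp: iface_def)
  show thesis
  proof (cases "h = Inl (Inl Proj)")
    case True
    then have "map (tm_sort LS) ts = [Inl MainS]" "\<forall>t\<in>set ts. wf_tm LS t" using p by auto
    then show thesis using that(1) p True by (cases ts) auto
  next
    case False
    then obtain i where h: "h = Inr i" using p(2) by (auto simp: is_iface_def)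
    have ts: "i \<in> I" "map (tm_sort LS) ts = replicate (k i) (Inl MainS)" "\<forall>t\<in>set ts. wf_tm LS t"
      using p by (auto simp: h)
    have len: "length ts = k i" using arg_cong[OF ts(2), of length] by simp
    have "tm_sort LS s = Inl MainS" if s: "s \<in> set ts" for s
    proof -
      have "tm_sort LS s \<in> set (replicate (k i) (Inl MainS))" unfolding ts(2)[symmetric] using s by simp
      then show ?thesis by (auto split: if_splits)
    qed
    moreover have "ts \<noteq> []" using len k_pos ts(1) by auto
    ultimately show thesis using that(2)[of i ts] p(1) h ts len by simp
  qed
qed

lemma iface_fv:
  assumes "iface p"
  shows "fv_tm p \<subseteq> main_var"
proof (rule iface_args[OF assms])
  fix t assume "p = Fn (Inl (Inl Proj)) [t]" "wf_tm LS t" "tm_sort LS t = Inl MainS"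
  then show ?thesis using main_tm_fv[of t] by simp
next
  fix i ts assume p: "p = Fn (Inr i) ts" and ts: "\<And>s. s \<in> set ts \<Longrightarrow> wf_tm LS s \<and> tm_sort LS s = Inl MainS"
  have "fv_tm s \<subseteq> main_var" if "s \<in> set ts" for s using main_tm_fv ts[OF that] by blast
  then show ?thesis by (simp add: p UN_subset_iff)
qed

lemma iface_sort: "iface p \<Longrightarrow> tm_sort LS p \<in> \<Sigma>"
  by (elim iface_args) simp_all

lemma ifc_iface: "wf_tm LS t \<Longrightarrow> p \<in> ifc t \<Longrightarrow> iface p \<and> fv_tm p \<subseteq> fv_tm t"
proof (induction t)
  case (Fn h ts)
  show ?case
  proof (cases "is_iface h")
    case True
    then show ?thesis using Fn.prems unfolding iface_def by auto
  next
    case False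
    then show ?thesis using Fn by fastforce
  qed
qed simp

lemma ifc_fm_iface: "wf_fm ML \<psi> \<Longrightarrow> p \<in> ifc_fm \<psi> \<Longrightarrow> qf \<psi> \<Longrightarrow> iface p \<and> fv_tm p \<subseteq> fv \<psi>"
proof (induction \<psi>)
  case (Eq t s)
  then show ?case using ifc_iface[of t p] ifc_iface[of s p] by auto
next
  case (Rel r ts)
  then show ?case using ifc_iface by fastforce
qed auto

lemma finite_ifc: "finite (ifc t)"
  by (induction t) auto

lemma finite_ifc_fm: "finite (ifc_fm \<psi>)"
  by (induction \<psi>) (auto simp: finite_ifc)

text \<open>\<open>iv \<iota> p\<close> is the variable standing for the interface term \<open>p\<close>; \<open>ext\<close> gives these variables the
  values of their terms.\<close>

definition iv :: "(_ \<Rightarrow> nat) \<Rightarrow> _ \<Rightarrow> (lex_sort + unit) var" where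
  "iv \<iota> p = (tm_sort LS p, \<iota> p)"

definition isub :: "_ set \<Rightarrow> (_ \<Rightarrow> nat) \<Rightarrow> (lex_sort + unit) var \<Rightarrow> ('fm, 'fn, 'fk, 'i) lex_tm" where
  "isub P \<iota> v = (if v \<in> iv \<iota> ` P then inv_into P (iv \<iota>) v else Var v)"

definition ext :: "_ set \<Rightarrow> (_ \<Rightarrow> nat) \<Rightarrow> ('m, 'n, 'k) lex_env \<Rightarrow> ('m, 'n, 'k) lex_env" where
  "ext P \<iota> e v = tm_val S e (isub P \<iota> v)"

fun abstr :: "(_ \<Rightarrow> nat) \<Rightarrow> ('fm, 'fn, 'fk, 'i) lex_tm \<Rightarrow> _" where
  "abstr \<iota> (Var v) = Var v"
| "abstr \<iota> (Fn h ts) = (if is_iface h then Var (iv \<iota> (Fn h ts)) else Fn h (map (abstr \<iota>) ts))"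

lemma fst_iv [simp]: "fst (iv \<iota> p) = tm_sort LS p"
  by (simp add: iv_def)

lemma isub_iv: "inj_on \<iota> P \<Longrightarrow> p \<in> P \<Longrightarrow> isub P \<iota> (iv \<iota> p) = p"
proof -
  assume "inj_on \<iota> P" "p \<in> P"
  moreover from this have "inj_on (iv \<iota>) P" by (auto simp: inj_on_def iv_def)
  ultimately show ?thesis by (simp add: isub_def)
qed

lemma isub_other: "snd v \<notin> \<iota> ` P \<Longrightarrow> isub P \<iota> v = Var v"
  by (auto simp: isub_def iv_def)

text \<open>With the outermost interface subterms replaced by variables, nothing of the main sort is
  left in a term whose sort is in \<open>\<Sigma>\<close>. The disjointness condition ensures that
  \<open>ext\<close> does not change the values of the variables already present in
  \<open>t\<close>.\<close>

lemma abstr: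
  assumes inj: "inj_on \<iota> P"
  shows "wf_tm LS t \<Longrightarrow> tm_sort LS t \<in> \<Sigma> \<Longrightarrow> ifc t \<subseteq> P \<Longrightarrow> snd ` fv_tm t \<inter> \<iota> ` P = {} \<Longrightarrow>
    tm_val S (ext P \<iota> e) (abstr \<iota> t) = tm_val S e t \<and> wf_tm (restrict_lang LS \<Sigma>) (abstr \<iota> t) \<and>
    tm_sort LS (abstr \<iota> t) = tm_sort LS t \<and> fv_tm (abstr \<iota> t) \<subseteq> {v \<in> fv_tm t. fst v \<in> \<Sigma>} \<union> iv \<iota> ` P"
proof (induction t)
  case (Var v)
  then show ?case by (simp add: ext_def isub_other)
next
  case (Fn h ts)
  show ?case
  proof (cases "is_iface h")
    case True
    then have p: "Fn h ts \<in> P" using Fn.prems by simp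
    have "tm_val S (ext P \<iota> e) (Var (iv \<iota> (Fn h ts))) = tm_val S e (Fn h ts)"
      by (simp only: tm_val.simps(1) ext_def isub_iv[OF inj p])
    moreover have "iv \<iota> (Fn h ts) \<in> iv \<iota> ` P" using p by blast
    ultimately show ?thesis using True Fn.prems by simp
  next
    case False
    have dom: "set (fdom LS h) \<subseteq> \<Sigma>"
    proof -
      have "fcod LS h \<in> \<Sigma>" using Fn.prems(2) by simp
      then show ?thesis using False by (cases h rule: symbol_cases) (auto simp: is_iface_def)
    qed
    have srt: "tm_sort LS t \<in> \<Sigma>" if "t \<in> set ts" for t
    proof -
      have "map (tm_sort LS) ts = fdom LS h" using Fn.prems by simp
      then have "tm_sort LS t \<in> set (fdom LS h)" using that by (metis image_eqI list.set_map)
      then show ?thesis using dom by blast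
    qed
    have IH: "tm_val S (ext P \<iota> e) (abstr \<iota> t) = tm_val S e t \<and> wf_tm (restrict_lang LS \<Sigma>) (abstr \<iota> t) \<and>
      tm_sort LS (abstr \<iota> t) = tm_sort LS t \<and> fv_tm (abstr \<iota> t) \<subseteq> {v \<in> fv_tm t. fst v \<in> \<Sigma>} \<union> iv \<iota> ` P" if "t \<in> set ts" for t
    proof (rule Fn.IH[OF that])
      have "snd ` fv_tm t \<subseteq> snd ` fv_tm (Fn h ts)" using that by auto
      then show "snd ` fv_tm t \<inter> \<iota> ` P = {}" using Fn.prems(4) by blast
      have "ifc t \<subseteq> ifc (Fn h ts)" using that False by auto
      then show "ifc t \<subseteq> P" using Fn.prems(3) by blast
      show "wf_tm LS t" using Fn.prems(1) that by simp
    qed (rule srt[OF that])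
    have "map (tm_val S (ext P \<iota> e) \<circ> abstr \<iota>) ts = map (tm_val S e) ts"
      "map (tm_sort LS \<circ> abstr \<iota>) ts = map (tm_sort LS) ts" using IH by auto
    moreover have "fv_tm (Fn h (map (abstr \<iota>) ts)) \<subseteq> {v \<in> fv_tm (Fn h ts). fst v \<in> \<Sigma>} \<union> iv \<iota> ` P"
      using IH by fastforce
    ultimately show ?thesis using False Fn.prems IH dom by (auto simp del: map_eq_conv)
  qed
qed

section \<open>Normal form of quantifier-free formulas\<close>

text \<open>Relation symbols of arity 0 are excluded: their list of sorts is empty, so they belong
  to the language restricted to \<open>\<Sigma>\<close> and are treated there.\<close>

definition main_atom :: "(lex_sort + unit, (('fm, 'fn) lex_fun, 'fk option, 'i) adj_fun, ('rm + 'rn) + 'rk) fm \<Rightarrow> bool" where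
  "main_atom \<alpha> \<longleftrightarrow> wf_fm LS \<alpha> \<and> ((\<exists>t s. \<alpha> = Eq t s \<and> tm_sort LS t = Inl MainS) \<or> (\<exists>q ts. \<alpha> = Rel (Inl (Inr q)) ts \<and> ts \<noteq> []))"

text \<open>Truth is included so that the Boolean closure is nonempty even when there is no
  atom.\<close>

definition main_gen :: "(lex_sort + unit) var set \<Rightarrow> (('m, 'n, 'k) lex_env \<Rightarrow> bool) set" where
  "main_gen V = insert (\<lambda>_. True) ((\<lambda>\<alpha> e. sat S e \<alpha>) ` {\<alpha>. main_atom \<alpha> \<and> fv \<alpha> \<subseteq> V})"

definition sigma_preds :: "_ set \<Rightarrow> (_ \<Rightarrow> nat) \<Rightarrow> (lex_sort + unit) var set \<Rightarrow> (('m, 'n, 'k) lex_env \<Rightarrow> bool) set" where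
  "sigma_preds P \<iota> V = (\<lambda>\<theta> e. sat S (ext P \<iota> e) \<theta>) `
     {\<theta>. wf_fm (restrict_lang LS \<Sigma>) \<theta> \<and> fv \<theta> \<subseteq> {v \<in> V. fst v \<in> \<Sigma>} \<union> iv \<iota> ` P}"

lemma main_atom_fv: "main_atom \<alpha> \<Longrightarrow> fv \<alpha> \<subseteq> main_var"
proof -
  assume a: "main_atom \<alpha>"
  then consider t s where "\<alpha> = Eq t s" "tm_sort LS t = Inl MainS" | q ts where "\<alpha> = Rel (Inl (Inr q)) ts"
    by (auto simp: main_atom_def)
  then show ?thesis
  proof cases
    case 1
    then show ?thesis using a main_tm_fv[of t] main_tm_fv[of s] by (auto simp: main_atom_def)
  next
    case 2
    have ts: "map (tm_sort LS) ts = map (\<lambda>_. Inl MainS) (rdom LN q)" "\<forall>t\<in>set ts. wf_tm LS t"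
      using a 2 by (auto simp: main_atom_def)
    have "fv_tm t \<subseteq> main_var" if "t \<in> set ts" for t
    proof (rule main_tm_fv)
      have "tm_sort LS t \<in> set (map (\<lambda>_. Inl MainS) (rdom LN q))" unfolding ts(1)[symmetric] using that by simp
      then show "tm_sort LS t = Inl MainS" by auto
    qed (use ts that in blast)
    then show ?thesis using 2 by auto
  qed
qed

lemma QF_main: "boolcl UNIV (main_gen V) R \<Longrightarrow> QF (V \<inter> main_var) R"
proof (induction rule: boolcl.induct)
  case (base R)
  show ?case
  proof (cases "R = (\<lambda>_. True)")
    case False
    then obtain \<alpha> where \<alpha>: "main_atom \<alpha>" "fv \<alpha> \<subseteq> V" "R = (\<lambda>e. sat S e \<alpha>)" using base by (auto simp: main_gen_def)
    have "qf \<alpha>" using \<alpha>(1) by (auto simp: main_atom_def)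
    then show ?thesis
      by (intro QF_I[of "lift \<alpha>"]) (use \<alpha> main_atom_fv[OF \<alpha>(1)] in \<open>auto simp: main_atom_def\<close>)
  qed (simp add: QF_const)
next
  case (neg R)
  show ?case by (rule QF_neg[OF neg.IH])
next
  case (conj R R')
  show ?case by (rule QF_conj[OF conj.IH])
next
  case (cong R R')
  show ?case by (rule QF_cong[OF cong.IH]) (use cong.hyps in simp)
qed

lemma bool_closed_sigma_preds: "bool_closed (sigma_preds P \<iota> V)"
  unfolding bool_closed_def
proof (intro conjI ballI)
  have "(\<lambda>_. True) = (\<lambda>e. sat S (ext P \<iota> e) (Neg Fls))" by simp
  then show "(\<lambda>_. True) \<in> sigma_preds P \<iota> V" unfolding sigma_preds_def by (rule image_eqI) simp
next
  fix R assume "R \<in> sigma_preds P \<iota> V"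
  then obtain \<theta> where \<theta>: "R = (\<lambda>e. sat S (ext P \<iota> e) \<theta>)" "wf_fm (restrict_lang LS \<Sigma>) \<theta>"
    "fv \<theta> \<subseteq> {v \<in> V. fst v \<in> \<Sigma>} \<union> iv \<iota> ` P" unfolding sigma_preds_def by blast
  have "(\<lambda>e. \<not> R e) = (\<lambda>e. sat S (ext P \<iota> e) (Neg \<theta>))" by (simp add: \<theta>(1))
  then show "(\<lambda>e. \<not> R e) \<in> sigma_preds P \<iota> V" unfolding sigma_preds_def by (rule image_eqI) (use \<theta> in simp)
  fix R' assume "R' \<in> sigma_preds P \<iota> V"
  then obtain \<theta>' where \<theta>': "R' = (\<lambda>e. sat S (ext P \<iota> e) \<theta>')" "wf_fm (restrict_lang LS \<Sigma>) \<theta>'"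
    "fv \<theta>' \<subseteq> {v \<in> V. fst v \<in> \<Sigma>} \<union> iv \<iota> ` P" unfolding sigma_preds_def by blast
  have "(\<lambda>e. R e \<and> R' e) = (\<lambda>e. sat S (ext P \<iota> e) (Conj \<theta> \<theta>'))" by (simp add: \<theta>(1) \<theta>'(1))
  then show "(\<lambda>e. R e \<and> R' e) \<in> sigma_preds P \<iota> V"
    unfolding sigma_preds_def by (rule image_eqI) (use \<theta> \<theta>' in simp)
qed

lemma bool_closed_main: "bool_closed {R. boolcl UNIV (main_gen V) R}"
proof -
  have "boolcl UNIV (main_gen V) (\<lambda>_. True)" by (rule boolcl.base) (simp add: main_gen_def)
  then show ?thesis by (simp add: bool_closed_def boolcl.neg boolcl.conj)
qed

lemma sigma_predsI:
  assumes "wf_fm (restrict_lang LS \<Sigma>) \<theta>" "fv \<theta> \<subseteq> {v \<in> V. fst v \<in> \<Sigma>} \<union> iv \<iota> ` P"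
    "\<And>e. ok e \<Longrightarrow> R e = sat S (ext P \<iota> e) \<theta>"
  shows "boolcl {e. ok e} ({R. boolcl UNIV (main_gen V) R} \<union> sigma_preds P \<iota> V) R"
proof (rule boolcl.cong)
  show "boolcl {e. ok e} ({R. boolcl UNIV (main_gen V) R} \<union> sigma_preds P \<iota> V) (\<lambda>e. sat S (ext P \<iota> e) \<theta>)"
    by (rule boolcl.base) (use assms(1,2) in \<open>auto simp: sigma_preds_def\<close>)
qed (use assms(3) in simp)

lemma main_predsI:
  assumes "main_atom \<alpha>" "fv \<alpha> \<subseteq> V"
  shows "boolcl {e. ok e} ({R. boolcl UNIV (main_gen V) R} \<union> sigma_preds P \<iota> V) (\<lambda>e. sat S e \<alpha>)"
proof -
  have "boolcl UNIV (main_gen V) (\<lambda>e. sat S e \<alpha>)"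
    by (rule boolcl.base) (use assms in \<open>auto simp: main_gen_def\<close>)
  then show ?thesis by (intro boolcl.base) blast
qed

lemma normal_form_boolcl:
  assumes inj: "inj_on \<iota> P"
  shows "wf_fm ML \<psi> \<Longrightarrow> qf \<psi> \<Longrightarrow> fv \<psi> \<subseteq> V \<Longrightarrow> ifc_fm \<psi> \<subseteq> P \<Longrightarrow> snd ` fv \<psi> \<inter> \<iota> ` P = {} \<Longrightarrow>
    boolcl {e. ok e} ({R. boolcl UNIV (main_gen V) R} \<union> sigma_preds P \<iota> V) (\<lambda>e. sat MS e \<psi>)"
proof (induction \<psi>)
  case Fls
  show ?case by (rule sigma_predsI[of Fls]) simp_all
next
  case (Eq t s)
  have wf: "wf_tm LS t" "wf_tm LS s" "tm_sort LS t = tm_sort LS s" using Eq.prems by auto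
  show ?case
  proof (cases "tm_sort LS t = Inl MainS")
    case True
    have "boolcl {e. ok e} ({R. boolcl UNIV (main_gen V) R} \<union> sigma_preds P \<iota> V) (\<lambda>e. sat S e (Eq t s))"
      by (rule main_predsI) (use True wf Eq.prems in \<open>auto simp: main_atom_def\<close>)
    then show ?thesis by simp
  next
    case False
    have srt: "tm_sort LS t \<in> \<Sigma>"
      using False by (cases "tm_sort LS t"; cases "projl (tm_sort LS t)") auto
    have 1: "tm_val S (ext P \<iota> e) (abstr \<iota> x) = tm_val S e x \<and> wf_tm (restrict_lang LS \<Sigma>) (abstr \<iota> x) \<and>
      tm_sort LS (abstr \<iota> x) = tm_sort LS x \<and> fv_tm (abstr \<iota> x) \<subseteq> {v \<in> fv_tm x. fst v \<in> \<Sigma>} \<union> iv \<iota> ` P" if "x \<in> {t, s}" for e x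
    proof (rule abstr[OF inj])
      show "wf_tm LS x" using that wf by auto
      show "tm_sort LS x \<in> \<Sigma>" using that srt wf(3) by (metis empty_iff insert_iff)
      show "ifc x \<subseteq> P" using that Eq.prems(4) by auto
      have "fv_tm x \<subseteq> fv (Eq t s)" using that by auto
      then show "snd ` fv_tm x \<inter> \<iota> ` P = {}" using Eq.prems(5) by blast
    qed
    have f: "fv_tm (abstr \<iota> x) \<subseteq> {v \<in> V. fst v \<in> \<Sigma>} \<union> iv \<iota> ` P" if "x \<in> {t, s}" for x
    proof -
      have "fv_tm x \<subseteq> V" using that Eq.prems(3) by auto
      then show ?thesis using 1[OF that] by blast
    qed
    show ?thesis
    proof (rule sigma_predsI[of "Eq (abstr \<iota> t) (abstr \<iota> s)"])
      show "fv (Eq (abstr \<iota> t) (abstr \<iota> s)) \<subseteq> {v \<in> V. fst v \<in> \<Sigma>} \<union> iv \<iota> ` P"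
        using f[of t] f[of s] by simp
      show "wf_fm (restrict_lang LS \<Sigma>) (Eq (abstr \<iota> t) (abstr \<iota> s))" using 1[of t] 1[of s] wf by simp
      show "sat MS e (Eq t s) = sat S (ext P \<iota> e) (Eq (abstr \<iota> t) (abstr \<iota> s))" for e
        using 1[of t e] 1[of s e] by simp
    qed
  qed
next
  case (Rel r ts)
  have abs: "tm_val S (ext P \<iota> e) (abstr \<iota> t) = tm_val S e t \<and> wf_tm (restrict_lang LS \<Sigma>) (abstr \<iota> t) \<and>
      tm_sort LS (abstr \<iota> t) = tm_sort LS t \<and> fv_tm (abstr \<iota> t) \<subseteq> {v \<in> fv_tm t. fst v \<in> \<Sigma>} \<union> iv \<iota> ` P"
    if "t \<in> set ts" "tm_sort LS t \<in> \<Sigma>" for e t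
  proof (rule abstr[OF inj])
    show "wf_tm LS t" using that(1) Rel.prems(1) by simp
    show "ifc t \<subseteq> P" using that(1) Rel.prems(4) by auto
    have "fv_tm t \<subseteq> fv (Rel r ts)" using that(1) by auto
    then show "snd ` fv_tm t \<inter> \<iota> ` P = {}" using Rel.prems(5) by blast
  qed (rule that(2))
  have srt: "tm_sort LS t \<in> \<Sigma>" if "t \<in> set ts" "set (rdom ML r) \<subseteq> \<Sigma>" for t
  proof -
    have "map (tm_sort LS) ts = rdom ML r" using Rel.prems(1) by simp
    then have "tm_sort LS t \<in> set (rdom ML r)" using that(1) by (metis image_eqI list.set_map)
    then show ?thesis using that(2) by blast
  qed
  have fvs: "(\<Union>t\<in>set ts. fv_tm (abstr \<iota> t)) \<subseteq> {v \<in> V. fst v \<in> \<Sigma>} \<union> iv \<iota> ` P" if "set (rdom ML r) \<subseteq> \<Sigma>"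
  proof
    fix v assume "v \<in> (\<Union>t\<in>set ts. fv_tm (abstr \<iota> t))"
    then obtain t where t: "t \<in> set ts" "v \<in> fv_tm (abstr \<iota> t)" by blast
    then have "v \<in> {v \<in> fv_tm t. fst v \<in> \<Sigma>} \<union> iv \<iota> ` P" using abs[OF t(1) srt[OF t(1) that]] by blast
    then show "v \<in> {v \<in> V. fst v \<in> \<Sigma>} \<union> iv \<iota> ` P" using Rel.prems(3) t(1) by auto
  qed
  have vals: "map (tm_val S (ext P \<iota> e) \<circ> abstr \<iota>) ts = map (tm_val S e) ts"
    "map (tm_sort LS \<circ> abstr \<iota>) ts = map (tm_sort LS) ts" if "set (rdom ML r) \<subseteq> \<Sigma>" for e
    using abs srt that by simp_all
  show ?case
  proof (cases r)
    case (Inl r')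
    show ?thesis
    proof (cases "set (rdom LS r') \<subseteq> \<Sigma>")
      case True
      then have \<Sigma>: "set (rdom ML r) \<subseteq> \<Sigma>" by (simp add: Inl)
      show ?thesis
      proof (rule sigma_predsI[of "Rel r' (map (abstr \<iota>) ts)"])
        show "wf_fm (restrict_lang LS \<Sigma>) (Rel r' (map (abstr \<iota>) ts))"
          using Rel.prems(1) True vals(2)[OF \<Sigma>] abs srt[OF _ \<Sigma>] by (simp add: Inl del: map_eq_conv)
        show "fv (Rel r' (map (abstr \<iota>) ts)) \<subseteq> {v \<in> V. fst v \<in> \<Sigma>} \<union> iv \<iota> ` P" using fvs[OF \<Sigma>] by simp
        show "sat MS e (Rel r ts) = sat S (ext P \<iota> e) (Rel r' (map (abstr \<iota>) ts))" for e
          using vals(1)[OF \<Sigma>, of e] by (simp add: Inl del: map_eq_conv cong: map_cong)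
      qed
    next
      case False
      \<comment> \<open>A relation with a sort outside \<open>\<Sigma>\<close> comes from the
        fibres, and it has an argument.\<close>
      then obtain q where q: "r' = Inl (Inr q)" by (cases r' rule: adj_fun_cases) auto
      have "ts \<noteq> []" using Rel.prems(1) False by (auto simp: Inl)
      have "boolcl {e. ok e} ({R. boolcl UNIV (main_gen V) R} \<union> sigma_preds P \<iota> V) (\<lambda>e. sat S e (Rel r' ts))"
        by (rule main_predsI) (use \<open>ts \<noteq> []\<close> Rel.prems in \<open>auto simp: main_atom_def Inl q\<close>)
      then show ?thesis by (simp add: Inl cong: map_cong)
    qed
  next
    case (Inr p)
    obtain xs \<theta> where p: "p = (xs, \<theta>)" by (cases p)
    have \<theta>: "distinct xs" "fst ` set xs \<subseteq> \<Sigma>" "wf_fm (restrict_lang LS \<Sigma>) \<theta>" "fv \<theta> \<subseteq> set xs" "map (tm_sort LS) ts = map fst xs"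
      "\<forall>t\<in>set ts. wf_tm LS t"
      using Rel.prems(1) by (auto simp: Inr p)
    have len: "length ts = length xs" using \<theta>(5) map_eq_imp_length_eq by blast
    have \<Sigma>: "set (rdom ML r) \<subseteq> \<Sigma>" using \<theta>(2) by (simp add: Inr p)
    show ?thesis
    \<comment> \<open>The predicate of the enrichment is unfolded again, so that the part over
      \<open>\<Sigma>\<close> is an ordinary formula, in front of which a quantifier can be put
      later.\<close>
    proof (rule sigma_predsI[of "inst xs (map (abstr \<iota>) ts) \<theta>"])
      show "wf_fm (restrict_lang LS \<Sigma>) (inst xs (map (abstr \<iota>) ts) \<theta>)"
        by (rule wf_inst) (use \<theta> vals(2)[OF \<Sigma>] abs srt[OF _ \<Sigma>] in \<open>auto simp del: map_eq_conv\<close>)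
      show "fv (inst xs (map (abstr \<iota>) ts) \<theta>) \<subseteq> {v \<in> V. fst v \<in> \<Sigma>} \<union> iv \<iota> ` P"
        using fv_inst[OF \<theta>(4), of "map (abstr \<iota>) ts"] len fvs[OF \<Sigma>] by auto
      fix e assume e: "ok e"
      have "sat S (ext P \<iota> e) (inst xs (map (abstr \<iota>) ts) \<theta>) =
          sat S (\<lambda>v. the (map_of (zip xs (map (tm_val S (ext P \<iota> e)) (map (abstr \<iota>) ts))) v)) \<theta>"
      proof (rule sat_inst[OF \<theta>(1)])
        fix i assume i: "i < length xs"
        then have t: "ts ! i \<in> set ts" using len by simp
        have "tm_val S e (ts ! i) \<in> carr S (tm_sort LS (ts ! i))" by (rule ok_tm_val[OF e]) (use \<theta>(6) t in blast)
        moreover have "tm_sort LS (ts ! i) = fst (xs ! i)" using \<theta>(5) i len by (metis nth_map)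
        ultimately show "tm_val S (ext P \<iota> e) (map (abstr \<iota>) ts ! i) \<in> carr S (fst (xs ! i))"
          using abs[OF t srt[OF t \<Sigma>], of e] i len by simp
      qed (use len \<theta> in auto)
      then show "sat MS e (Rel r ts) = sat S (ext P \<iota> e) (inst xs (map (abstr \<iota>) ts) \<theta>)"
        using vals(1)[OF \<Sigma>, of e] by (simp add: Inr p del: map_eq_conv cong: map_cong)
    qed
  qed
next
  case (Neg \<psi>)
  have "boolcl {e. ok e} ({R. boolcl UNIV (main_gen V) R} \<union> sigma_preds P \<iota> V) (\<lambda>e. sat MS e \<psi>)"
    by (rule Neg.IH) (use Neg.prems in auto)
  then show ?case unfolding sat.simps by (rule boolcl.neg)
next
  case (Conj \<phi> \<psi>)
  have "boolcl {e. ok e} ({R. boolcl UNIV (main_gen V) R} \<union> sigma_preds P \<iota> V) (\<lambda>e. sat MS e \<phi>)"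
    "boolcl {e. ok e} ({R. boolcl UNIV (main_gen V) R} \<union> sigma_preds P \<iota> V) (\<lambda>e. sat MS e \<psi>)"
    by (rule Conj.IH, use Conj.prems in auto)+
  then show ?case unfolding sat.simps by (rule boolcl.conj)
qed simp

text \<open>The names of the interface variables are chosen after the formula, away from its
  variables. The set \<open>W\<close> lets a variable about to be quantified stay distinct from
  them.\<close>

lemma normal_form:
  assumes "QF V R" "finite W"
  obtains P \<iota> where "finite P" "inj_on \<iota> P" "\<iota> ` P \<inter> W = {}" "\<And>p. p \<in> P \<Longrightarrow> iface p \<and> fv_tm p \<subseteq> V"
    "dnf {e. ok e} {R. boolcl UNIV (main_gen V) R} (sigma_preds P \<iota> V) R"
proof -
  obtain \<psi> where \<psi>: "wf_fm ML \<psi>" "qf \<psi>" "fv \<psi> \<subseteq> V" "\<And>e. ok e \<Longrightarrow> R e = sat MS e \<psi>"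
    by (rule QF_E[OF assms(1)]) (rule that)
  have fin: "finite (ifc_fm \<psi>)" "finite (snd ` fv \<psi> \<union> W)" using finite_ifc_fm finite_fv assms(2) by auto
  obtain \<iota> :: "_ \<Rightarrow> nat" where \<iota>: "inj_on \<iota> (ifc_fm \<psi>)" "\<iota> ` ifc_fm \<psi> \<inter> (snd ` fv \<psi> \<union> W) = {}"
    by (rule fresh_names[OF fin]) (rule that)
  have "boolcl {e. ok e} ({R. boolcl UNIV (main_gen V) R} \<union> sigma_preds (ifc_fm \<psi>) \<iota> V) (\<lambda>e. sat MS e \<psi>)"
    by (rule normal_form_boolcl[OF \<iota>(1)]) (use \<psi> \<iota>(2) in auto)
  then have "dnf {e. ok e} {R. boolcl UNIV (main_gen V) R} (sigma_preds (ifc_fm \<psi>) \<iota> V) (\<lambda>e. sat MS e \<psi>)"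
    by (rule boolcl_dnf[OF bool_closed_main bool_closed_sigma_preds])
  then have "dnf {e. ok e} {R. boolcl UNIV (main_gen V) R} (sigma_preds (ifc_fm \<psi>) \<iota> V) R"
    by (rule dnf_cong) (use \<psi>(4) in simp)
  moreover have "\<iota> ` ifc_fm \<psi> \<inter> W = {}" using \<iota>(2) by blast
  moreover have "iface p \<and> fv_tm p \<subseteq> V" if "p \<in> ifc_fm \<psi>" for p
    using ifc_fm_iface[OF \<psi>(1) that \<psi>(2)] \<psi>(3) by blast
  ultimately show thesis using that[OF fin(1) \<iota>(1)] by simp
qed

lemma QF_ext:
  assumes P: "inj_on \<iota> P" "\<And>p. p \<in> P \<Longrightarrow> iface p \<and> fv_tm p \<subseteq> V"
    and \<theta>: "wf_fm (restrict_lang LS \<Sigma>) \<theta>" "fv \<theta> \<subseteq> {v \<in> V. fst v \<in> \<Sigma>} \<union> iv \<iota> ` P"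
  shows "QF V (\<lambda>e. sat S (ext P \<iota> e) \<theta>)"
proof -
  have "QF V (\<lambda>e. sat S (\<lambda>v. tm_val S e (isub P \<iota> v)) \<theta>)"
  proof (rule QF_sigma[OF \<theta>(1)])
    fix v assume v: "v \<in> fv \<theta>"
    show "fst v \<in> \<Sigma> \<and> wf_tm LS (isub P \<iota> v) \<and> tm_sort LS (isub P \<iota> v) = fst v \<and> fv_tm (isub P \<iota> v) \<subseteq> V"
    proof (cases "v \<in> iv \<iota> ` P")
      case True
      then obtain p where p: "p \<in> P" "v = iv \<iota> p" by blast
      then show ?thesis using P(2)[OF p(1)] isub_iv[OF P(1) p(1)] iface_sort[of p] by (simp add: iv_def iface_def)
    next
      case False
      then show ?thesis using v \<theta>(2) by (auto simp: isub_def)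
    qed
  qed
  then show ?thesis unfolding ext_def .
qed

section \<open>Eliminating quantifiers over M and K\<close>

text \<open>Atoms of the main sort and interface terms contain main variables only, hence do not
  depend on \<open>v\<close>. In each disjunct the quantifier moves to the formula over
  \<open>\<Sigma>\<close>, and the quantified formula has again a predicate in the
  enrichment.\<close>

lemma QF_ex:
  assumes R: "QF V R" and v: "fst v \<in> \<Sigma>"
  shows "QF (V - {v}) (\<lambda>e. \<exists>x\<in>carr S (fst v). R (e(v := x)))"
proof -
  \<comment> \<open>Avoiding the number of \<open>v\<close> keeps the quantifier from capturing an
    interface variable.\<close>
  obtain P \<iota> where P: "finite P" "inj_on \<iota> P" "\<iota> ` P \<inter> {snd v} = {}" "\<And>p. p \<in> P \<Longrightarrow> iface p \<and> fv_tm p \<subseteq> V"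
    "dnf {e. ok e} {R. boolcl UNIV (main_gen V) R} (sigma_preds P \<iota> V) R"
    by (rule normal_form[OF R, of "{snd v}"]) (simp, rule that)
  obtain Q where Q: "finite Q" "Q \<subseteq> {R. boolcl UNIV (main_gen V) R} \<times> sigma_preds P \<iota> V"
    "\<And>e. e \<in> {e. ok e} \<Longrightarrow> R e = (\<exists>p\<in>Q. fst p e \<and> snd p e)" by (rule dnfE[OF P(5)]) (rule that)
  have P': "iface p \<and> fv_tm p \<subseteq> V - {v}" if "p \<in> P" for p
    using P(4)[OF that] iface_fv[of p] v by auto
  have ext: "ext P \<iota> (e(v := x)) = (ext P \<iota> e)(v := x)" for e x
  proof
    fix w show "ext P \<iota> (e(v := x)) w = ((ext P \<iota> e)(v := x)) w"
    proof (cases "w \<in> iv \<iota> ` P")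
      case True
      then obtain p where p: "p \<in> P" "w = iv \<iota> p" by blast
      have "tm_val S (e(v := x)) p = tm_val S e p" by (rule tm_val_cong) (use P'[OF p(1)] in auto)
      moreover have "w \<noteq> v" using P(3) p by (auto simp: iv_def)
      ultimately show ?thesis using isub_iv[OF P(2) p(1)] p(2) by (simp add: ext_def)
    qed (simp add: ext_def isub_def)
  qed
  have q: "QF (V - {v}) (\<lambda>e. fst q e \<and> (\<exists>x\<in>carr S (fst v). snd q (e(v := x))))" if "q \<in> Q" for q
  proof (rule QF_conj)
    have "boolcl UNIV (main_gen V) (fst q)" using that Q(2) by auto
    then have "QF (V \<inter> main_var) (fst q)" by (rule QF_main)
    then show "QF (V - {v}) (fst q)" by (rule QF_mono) (use v in auto)
    have "snd q \<in> sigma_preds P \<iota> V" using that Q(2) by auto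
    then obtain \<theta> where \<theta>: "snd q = (\<lambda>e. sat S (ext P \<iota> e) \<theta>)" "wf_fm (restrict_lang LS \<Sigma>) \<theta>"
      "fv \<theta> \<subseteq> {v \<in> V. fst v \<in> \<Sigma>} \<union> iv \<iota> ` P" unfolding sigma_preds_def by blast
    have "QF (V - {v}) (\<lambda>e. sat S (ext P \<iota> e) (Ex v \<theta>))"
      by (rule QF_ext[OF P(2) P']) (use \<theta> v in auto)
    then show "QF (V - {v}) (\<lambda>e. \<exists>x\<in>carr S (fst v). snd q (e(v := x)))" by (simp add: \<theta>(1) ext)
  qed
  have "QF (V - {v}) (\<lambda>e. \<exists>q\<in>Q. fst q e \<and> (\<exists>x\<in>carr S (fst v). snd q (e(v := x))))"
    by (rule QF_bex[OF Q(1) q])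
  then show ?thesis
  proof (rule QF_cong)
    fix e assume e: "ok e"
    have "fst q (e(v := x)) = fst q e" if "q \<in> Q" "x \<in> carr S (fst v)" for q x
    proof -
      have "boolcl UNIV (main_gen V) (fst q)" using that Q(2) by auto
      then show ?thesis by (rule QF_dep[OF QF_main ok_upd[OF e that(2)] e]) (use v in auto)
    qed
    moreover have "R (e(v := x)) = (\<exists>p\<in>Q. fst p (e(v := x)) \<and> snd p (e(v := x)))" if "x \<in> carr S (fst v)" for x
      using Q(3) ok_upd[OF e that] by simp
    ultimately show "(\<exists>q\<in>Q. fst q e \<and> (\<exists>x\<in>carr S (fst v). snd q (e(v := x)))) = (\<exists>x\<in>carr S (fst v). R (e(v := x)))"
      by auto
  qed
qed

lemma QF_exs:
  assumes "QF V R" "fst ` set vs \<subseteq> \<Sigma>"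
  shows "QF (V - set vs) (\<lambda>e. \<exists>e'. (\<forall>v\<in>set vs. e' v \<in> carr S (fst v)) \<and> (\<forall>v. v \<notin> set vs \<longrightarrow> e' v = e v) \<and> R e')"
  using assms(2)
proof (induction vs)
  case Nil
  have "(\<forall>v. e' v = e v) \<longleftrightarrow> e' = e" for e' e :: "('m, 'n, 'k) lex_env" by auto
  then show ?case using assms(1) by simp
next
  case (Cons w vs)
  have "QF (V - set vs - {w}) (\<lambda>e. \<exists>x\<in>carr S (fst w). \<exists>e'. (\<forall>v\<in>set vs. e' v \<in> carr S (fst v)) \<and>
      (\<forall>v. v \<notin> set vs \<longrightarrow> e' v = (e(w := x)) v) \<and> R e')"
    by (rule QF_ex[OF Cons.IH]) (use Cons.prems in auto)
  moreover have "V - set vs - {w} = V - set (w # vs)" by auto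
  ultimately show ?case unfolding ex_env_Cons[of w vs "\<lambda>v. carr S (fst v)"] by simp
qed

end

section \<open>Transfer between a fibre and the sum\<close>

text \<open>The variable \<open>j\<close> of the sort of \<open>\<M>\<close> takes the place of the variable \<open>0\<close>.\<close>

fun base_tm :: "nat \<Rightarrow> (unit, 'fm) tm \<Rightarrow> ('fm, 'fn, 'fk, 'i) lex_tm" where
  "base_tm j (Var v) = Var (Inl BaseS, snd v + j)"
| "base_tm j (Fn f ts) = Fn (Inl (Inl (BaseFn f))) (map (base_tm j) ts)"

fun base_fm :: "nat \<Rightarrow> (unit, 'fm, 'rm) fm \<Rightarrow>
    (lex_sort + unit, (('fm, 'fn) lex_fun, 'fk option, 'i) adj_fun, ('rm + 'rn) + 'rk) fm" where
  "base_fm j Fls = Fls"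
| "base_fm j (Eq t s) = Eq (base_tm j t) (base_tm j s)"
| "base_fm j (Rel r ts) = Rel (Inl (Inl r)) (map (base_tm j) ts)"
| "base_fm j (Neg \<phi>) = Neg (base_fm j \<phi>)"
| "base_fm j (Conj \<phi> \<psi>) = Conj (base_fm j \<phi>) (base_fm j \<psi>)"
| "base_fm j (Ex v \<phi>) = Ex (Inl BaseS, snd v + j) (base_fm j \<phi>)"

lemma tm_sort_morley_eq [simp]: "tm_sort (morley_lang L \<Sigma>) = tm_sort L"
  by (simp add: fun_eq_iff)

lemma fv_tm_base: "fv_tm (base_tm j t) = (\<lambda>v. (Inl BaseS, snd v + j)) ` fv_tm t"
  by (induction t) auto

lemma fv_base: "fv (base_fm j \<phi>) = (\<lambda>v. (Inl BaseS, snd v + j)) ` fv \<phi>"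
  by (induction \<phi>) (auto simp: fv_tm_base)

context lex_setup
begin

section \<open>Formulas of M inside the sum\<close>

lemma wf_tm_base: "wf_tm LM t \<Longrightarrow> wf_tm (restrict_lang LS \<Sigma>) (base_tm j t) \<and> tm_sort LS (base_tm j t) = Inl BaseS"
proof (induction t)
  case (Fn f ts)
  have IH: "tm_sort LS (base_tm j t) = Inl BaseS" "wf_tm (restrict_lang LS \<Sigma>) (base_tm j t)" if "t \<in> set ts" for t
    using Fn.IH[OF that] Fn.prems that by auto
  have len: "length ts = length (fdom LM f)" using Fn.prems by (simp, metis length_map)
  have "map (tm_sort LS \<circ> base_tm j) ts = map (\<lambda>_. Inl BaseS) (fdom LM f)"
    by (rule nth_equalityI) (use IH len in auto)
  then show ?case using Fn.prems IH by auto
qed simp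

lemma wf_base: "wf_fm LM \<phi> \<Longrightarrow> wf_fm (restrict_lang LS \<Sigma>) (base_fm j \<phi>)"
proof (induction \<phi>)
  case (Rel r ts)
  have IH: "tm_sort LS (base_tm j t) = Inl BaseS" "wf_tm (restrict_lang LS \<Sigma>) (base_tm j t)" if "t \<in> set ts" for t
    using wf_tm_base Rel.prems that by auto
  have len: "length ts = length (rdom LM r)" using Rel.prems by (simp, metis length_map)
  have "map (tm_sort LS \<circ> base_tm j) ts = map (\<lambda>_. Inl BaseS) (rdom LM r)"
    by (rule nth_equalityI) (use IH len in auto)
  then show ?case using Rel.prems IH by auto
qed (use wf_tm_base in auto)

definition benv' :: "nat \<Rightarrow> ('m, 'n, 'k) lex_env \<Rightarrow> unit var \<Rightarrow> 'm" where
  "benv' j e v = base_of (projl (e (Inl BaseS, snd v + j)))"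

lemma tm_val_base:
  "(\<And>v. v \<in> fv_tm t \<Longrightarrow> e (Inl BaseS, snd v + j) \<in> carr S (Inl BaseS)) \<Longrightarrow>
    tm_val S e (base_tm j t) = Inl (BaseElt (tm_val M (benv' j e) t))"
proof (induction t)
  case (Var v)
  have "e (Inl BaseS, snd v + j) \<in> carr S (Inl BaseS)" by (rule Var) simp
  then show ?case by (auto simp: benv'_def)
next
  case (Fn f ts)
  have "tm_val S e (base_tm j t) = Inl (BaseElt (tm_val M (benv' j e) t))" if "t \<in> set ts" for t
    by (rule Fn.IH[OF that], rule Fn.prems) (use that in auto)
  then have "map (tm_val S e \<circ> base_tm j) ts = map (\<lambda>t. Inl (BaseElt (tm_val M (benv' j e) t))) ts" by simp
  then have "map (base_of \<circ> projl) (map (tm_val S e \<circ> base_tm j) ts) = map (tm_val M (benv' j e)) ts"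
    by (simp add: comp_def)
  then show ?case by (simp del: map_eq_conv)
qed

lemma sat_base:
  "(\<And>v. v \<in> fv \<phi> \<Longrightarrow> e (Inl BaseS, snd v + j) \<in> carr S (Inl BaseS)) \<Longrightarrow>
    sat S e (base_fm j \<phi>) = sat M (benv' j e) \<phi>"
proof (induction \<phi> arbitrary: e)
  case (Eq t s)
  then show ?case using tm_val_base[of t e j] tm_val_base[of s e j] by simp
next
  case (Rel r ts)
  have "tm_val S e (base_tm j t) = Inl (BaseElt (tm_val M (benv' j e) t))" if "t \<in> set ts" for t
    by (rule tm_val_base, rule Rel.prems) (use that in auto)
  then have "map (tm_val S e \<circ> base_tm j) ts = map (\<lambda>t. Inl (BaseElt (tm_val M (benv' j e) t))) ts" by simp
  then have "map (base_of \<circ> projl) (map (tm_val S e \<circ> base_tm j) ts) = map (tm_val M (benv' j e)) ts"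
    by (simp add: comp_def)
  then show ?case by (simp del: map_eq_conv)
next
  case (Neg \<phi>)
  have "sat S e (base_fm j \<phi>) = sat M (benv' j e) \<phi>" by (rule Neg.IH) (use Neg.prems in simp)
  then show ?case by simp
next
  case (Conj \<phi> \<psi>)
  have "sat S e (base_fm j \<phi>) = sat M (benv' j e) \<phi>" by (rule Conj.IH) (use Conj.prems in simp)
  moreover have "sat S e (base_fm j \<psi>) = sat M (benv' j e) \<psi>" by (rule Conj.IH) (use Conj.prems in simp)
  ultimately show ?case by simp
next
  case (Ex v \<phi>)
  have upd: "benv' j (e((Inl BaseS, snd v + j) := Inl (BaseElt a))) = (benv' j e)(v := a)" for a
    by (cases v) (auto simp: benv'_def fun_eq_iff)
  have "sat S (e((Inl BaseS, snd v + j) := Inl (BaseElt a))) (base_fm j \<phi>) = sat M ((benv' j e)(v := a)) \<phi>"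
    if "a \<in> univ M" for a
    unfolding upd[symmetric]
  proof (rule Ex.IH)
    fix w assume "w \<in> fv \<phi>"
    then show "(e((Inl BaseS, snd v + j) := Inl (BaseElt a))) (Inl BaseS, snd w + j) \<in> carr S (Inl BaseS)"
      using Ex.prems[of w] that by (cases "w = v") auto
  qed
  then show ?case by simp
qed simp

abbreviation "mv j \<equiv> (Inl BaseS, j) :: (lex_sort + unit) var"

definition mval :: "nat \<Rightarrow> ('m, 'n, 'k) lex_env \<Rightarrow> 'm" where
  "mval j e = base_of (projl (e (mv j)))"

lemma mval_carr: "e (mv j) \<in> carr S (Inl BaseS) \<Longrightarrow> mval j e \<in> univ M"
  by (auto simp: mval_def)

lemma mv_carr: "ok e \<Longrightarrow> e (mv j) \<in> carr S (Inl BaseS)"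
  unfolding ok_def by (metis fst_conv)

lemma main_carr: "ok e \<Longrightarrow> e (Inl MainS, n) \<in> carr S (Inl MainS)"
  unfolding ok_def by (metis fst_conv)

text \<open>This is how definability in M becomes available in the sum: a property of the fibre
  named by \<open>mv j\<close> turns into a formula over \<open>\<Sigma>\<close> in that variable,
  which is quantifier-free in the enrichment.\<close>

lemma definable_formula:
  assumes "definable LM M X"
  obtains \<theta> where "wf_fm (restrict_lang LS \<Sigma>) \<theta>" "fv \<theta> \<subseteq> {mv j}"
    "\<And>e. e (mv j) \<in> carr S (Inl BaseS) \<Longrightarrow> sat S e \<theta> = (mval j e \<in> X)"
proof -
  obtain \<delta> where \<delta>: "is_fm LM 1 \<delta>" "X = {a \<in> univ M. holds M \<delta> [a]}" using assms by (auto simp: definable_def)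
  have fv: "v = ((), 0)" if "v \<in> fv \<delta>" for v using \<delta>(1) that by (auto simp: is_fm_def vars_below_def)
  show thesis
  proof (rule that[of "base_fm j \<delta>"])
    show "wf_fm (restrict_lang LS \<Sigma>) (base_fm j \<delta>)" using \<delta>(1) by (intro wf_base) (simp add: is_fm_def)
    show "fv (base_fm j \<delta>) \<subseteq> {mv j}" using fv by (auto simp: fv_base)
    fix e assume e: "e (mv j) \<in> carr S (Inl BaseS)"
    have "sat S e (base_fm j \<delta>) = sat M (benv' j e) \<delta>"
    proof (rule sat_base)
      fix v assume "v \<in> fv \<delta>"
      then have "v = ((), 0)" by (rule fv)
      then show "e (Inl BaseS, snd v + j) \<in> carr S (Inl BaseS)" using e by simp
    qed
    also have "\<dots> = holds M \<delta> [mval j e]"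
      unfolding holds_def
    proof (rule sat_cong)
      fix v assume "v \<in> fv \<delta>"
      then have "v = ((), 0)" by (rule fv)
      then show "benv' j e v = [mval j e] ! snd v" by (simp add: benv'_def mval_def)
    qed
    finally show "sat S e (base_fm j \<delta>) = (mval j e \<in> X)" using mval_carr[of e j] e by (simp add: \<delta>(2))
  qed
qed

text \<open>In the sum, a relation symbol of arity 0 holds as soon as it holds in some fibre, so it
  does not tell what happens in a given one. This information comes from the definability
  assumption, the atom being a sentence.\<close>

lemma definable_nullary:
  assumes "q \<in> rels LN" "rdom LN q = []"
  shows "definable LM M {a \<in> univ M. rint (N a) q []}"
proof -
  have "is_fm LN 0 (Rel q [])" using assms by (simp add: is_fm_def)
  then show ?thesis using definability by (force simp: holds_def)
qed

text \<open>The assignment in the fibre \<open>mval j e\<close>: variable \<open>0\<close> of the main sort stands for the constant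
  \<open>u\<close>, and variable \<open>n + 1\<close> for the variable \<open>n\<close> of the sum. The values make sense for variables
  that are \<open>good\<close>, that is lie in this fibre or in \<open>K\<close> without the added point.\<close>

fun loc :: "('m, 'n, 'k) lex_env \<Rightarrow> (unit + unit) var \<Rightarrow> 'n + 'k" where
  "loc e (Inl s, 0) = Inl (coord u)"
| "loc e (Inl s, Suc n) = Inl (coord (projl (e (Inl MainS, n))))"
| "loc e (Inr s, n) = Inr (the (projr (e (Inr (), n))))"

abbreviation "lval j e \<equiv> tm_val (N' (mval j e)) (loc e)"

abbreviation "lsat j e \<equiv> sat (N' (mval j e)) (loc e)"

abbreviation "lsat' j e \<equiv> sat (morley_struct (N' (mval j e))) (loc e)"

fun good :: "nat \<Rightarrow> ('m, 'n, 'k) lex_env \<Rightarrow> (unit + unit) var \<Rightarrow> bool" where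
  "good j e (Inl s, 0) \<longleftrightarrow> fibre u = mval j e"
| "good j e (Inl s, Suc n) \<longleftrightarrow> e (Inl MainS, n) \<in> carr S (Inl MainS) \<and> fibre (projl (e (Inl MainS, n))) = mval j e"
| "good j e (Inr s, n) \<longleftrightarrow> e (Inr (), n) \<in> Inr ` Some ` univ K"

text \<open>Variable 0 of the main sort corresponds to the constant for "undetermined", which exists
  only in the presence of a function symbol of arity at least two.\<close>

fun avail :: "(unit + unit) var \<Rightarrow> bool" where
  "avail (Inl s, 0) \<longleftrightarrow> has_undet"
| "avail _ \<longleftrightarrow> True"

fun pull_vars :: "(unit + unit) var \<Rightarrow> (lex_sort + unit) var set" where
  "pull_vars (Inl s, 0) = {}"
| "pull_vars (Inl s, Suc n) = {(Inl MainS, n)}"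
| "pull_vars (Inr s, n) = {(Inr (), n)}"

fun pull_var :: "(unit + unit) var \<Rightarrow> ('fm, 'fn, 'fk, 'i) lex_tm" where
  "pull_var (Inl s, 0) = Fn (Inl (Inl Undet)) []"
| "pull_var (Inl s, Suc n) = Var (Inl MainS, n)"
| "pull_var (Inr s, n) = Var (Inr (), n)"

fun pull_sym :: "('fn, 'fk, 'i) adj_fun \<Rightarrow> (('fm, 'fn) lex_fun, 'fk option, 'i) adj_fun" where
  "pull_sym (Inl (Inl g)) = Inl (Inl (MainFn g))"
| "pull_sym (Inl (Inr c)) = Inl (Inr (Some c))"
| "pull_sym (Inr i) = Inr i"

fun pull :: "(unit + unit, ('fn, 'fk, 'i) adj_fun) tm \<Rightarrow> ('fm, 'fn, 'fk, 'i) lex_tm" where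
  "pull (Var v) = pull_var v"
| "pull (Fn h ts) = Fn (pull_sym h) (map pull ts)"

fun pull_sort :: "unit + unit \<Rightarrow> lex_sort + unit" where
  "pull_sort (Inl s) = Inl MainS"
| "pull_sort (Inr s) = Inr ()"

lemma pull_sym_simps:
  "pull_sym h \<in> funs LS \<longleftrightarrow> h \<in> funs L'"
  "fdom LS (pull_sym h) = map pull_sort (fdom L' h)"
  "fcod LS (pull_sym h) = pull_sort (fcod L' h)"
  by (cases h rule: adj_fun_cases; simp add: comp_def)+

lemma local_var_cases:
  obtains (undet) "v = (Inl (), 0)" | (main) n where "v = (Inl (), Suc n)" | (K) n where "v = (Inr (), n)"
proof (cases v)
  case (Pair s n)
  then show thesis using that by (cases s; cases n) auto
qed

lemma pull_syntax:
  "wf_tm L' t \<Longrightarrow> (\<And>v. v \<in> fv_tm t \<Longrightarrow> avail v) \<Longrightarrow>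
    wf_tm LS (pull t) \<and> tm_sort LS (pull t) = pull_sort (tm_sort L' t) \<and> fv_tm (pull t) \<subseteq> (\<Union>v\<in>fv_tm t. pull_vars v)"
proof (induction t)
  case (Var v)
  then show ?case by (cases v rule: local_var_cases) auto
next
  case (Fn h ts)
  have IH: "wf_tm LS (pull t)" "tm_sort LS (pull t) = pull_sort (tm_sort L' t)" "fv_tm (pull t) \<subseteq> (\<Union>v\<in>fv_tm t. pull_vars v)"
    if "t \<in> set ts" for t
    using Fn.IH[OF that] Fn.prems that by auto
  have "map (tm_sort LS \<circ> pull) ts = map pull_sort (map (tm_sort L') ts)" using IH by simp
  also have "map (tm_sort L') ts = fdom L' h" using Fn.prems(1) by simp
  finally have "map (tm_sort LS) (map pull ts) = fdom LS (pull_sym h)" by (simp only: pull_sym_simps map_map)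
  then have "wf_tm LS (pull (Fn h ts))" using Fn.prems(1) IH(1) by (simp add: pull_sym_simps(1) del: map_map)
  moreover have "fv_tm (pull t) \<subseteq> (\<Union>v\<in>fv_tm (Fn h ts). pull_vars v)" if "t \<in> set ts" for t
    using IH(3)[OF that] that by fastforce
  ultimately show ?case by (auto simp: pull_sym_simps)
qed

text \<open>On good variables all arguments of main sort lie in the fibre \<open>mval j e\<close>,
  so the fibrewise functions and maps never take their default value; and all arguments over K avoid
  the added point, so the functions of K act as before. Arities on the main sort are positive, hence
  the arguments do determine the fibre.\<close>

lemma pull_val:
  "wf_tm L' t \<Longrightarrow> (\<And>v. v \<in> fv_tm t \<Longrightarrow> good j e v) \<Longrightarrow> mval j e \<in> univ M \<Longrightarrow>
    (tm_sort L' t = Inl () \<longrightarrow> (\<exists>x. lval j e t = Inl x \<and> tm_val S e (pull t) = Inl (MainElt (mval j e) x))) \<and>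
    (tm_sort L' t = Inr () \<longrightarrow> (\<exists>x. lval j e t = Inr x \<and> tm_val S e (pull t) = Inr (Some x)))"
proof (induction t)
  case (Var v)
  have g: "good j e v" using Var by simp
  show ?case
  proof (cases v rule: local_var_cases)
    case undet
    then have eq: "u = MainElt (mval j e) (coord u)" using g main_eltD[OF u_main] by simp
    show ?thesis by (simp add: undet) (rule eq)
  next
    case (main n)
    then show ?thesis using g main_eltD[of "e (Inl MainS, n)"] by simp
  next
    case (K n)
    then show ?thesis using g by auto
  qed
next
  case (Fn h ts)
  let ?m = "mval j e"
  have IH: "(tm_sort L' t = Inl () \<longrightarrow> (\<exists>x. tm_val (N' ?m) (loc e) t = Inl x \<and> tm_val S e (pull t) = Inl (MainElt ?m x))) \<and>
    (tm_sort L' t = Inr () \<longrightarrow> (\<exists>x. tm_val (N' ?m) (loc e) t = Inr x \<and> tm_val S e (pull t) = Inr (Some x)))" if "t \<in> set ts" for t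
    by (rule Fn.IH[OF that]) (use Fn.prems that in auto)
  have main: "\<exists>xs. map (tm_val (N' ?m) (loc e)) ts = map Inl xs \<and> map (tm_val S e) (map pull ts) = map (Inl \<circ> MainElt ?m) xs"
    if "\<And>t. t \<in> set ts \<Longrightarrow> tm_sort L' t = Inl ()"
  proof (intro exI conjI)
    let ?xs = "map (\<lambda>t. projl (tm_val (N' ?m) (loc e) t)) ts"
    have 1: "tm_val (N' ?m) (loc e) t = Inl (projl (tm_val (N' ?m) (loc e) t)) \<and>
        tm_val S e (pull t) = Inl (MainElt ?m (projl (tm_val (N' ?m) (loc e) t)))" if "t \<in> set ts" for t
      using IH[OF that] \<open>\<And>t. t \<in> set ts \<Longrightarrow> tm_sort L' t = Inl ()\<close>[OF that] by auto
    show "map (tm_val (N' ?m) (loc e)) ts = map Inl ?xs" using 1 by simp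
    show "map (tm_val S e) (map pull ts) = map (Inl \<circ> MainElt ?m) ?xs" using 1 by simp
  qed
  show ?case
  proof (cases h rule: adj_fun_cases)
    case (1 g)
    have srt: "\<And>t. t \<in> set ts \<Longrightarrow> tm_sort L' t = Inl ()" and g: "g \<in> funs LN" "length ts = length (fdom LN g)"
      using Fn.prems(1) by (auto simp: 1 sorts_main)
    obtain xs where xs: "map (tm_val (N' ?m) (loc e)) ts = map Inl xs"
      "map (tm_val S e) (map pull ts) = map (Inl \<circ> MainElt ?m) xs" using main[OF srt] by blast
    have "length xs = length ts" using arg_cong[OF xs(1), of length] by simp
    then have ne: "map (Inl \<circ> MainElt ?m) xs \<noteq> []" using LN_no_constants g by auto
    have "tm_val S e (pull (Fn h ts)) = Inl (MainElt ?m (fint (N ?m) g xs))"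
      unfolding pull.simps tm_val.simps xs 1 pull_sym.simps S_simps
      by (subst fibrewise_same[OF ne, of ?m]) (auto simp: comp_def)
    moreover have "tm_val (N' ?m) (loc e) (Fn h ts) = Inl (fint (N ?m) g xs)"
      unfolding tm_val.simps xs by (simp add: 1 comp_def)
    ultimately show ?thesis by (simp add: 1)
  next
    case (2 c)
    have srt: "\<And>t. t \<in> set ts \<Longrightarrow> tm_sort L' t = Inr ()" using Fn.prems(1) by (auto simp: 2 sorts_K)
    let ?xs = "map (\<lambda>t. projr (tm_val (N' ?m) (loc e) t)) ts"
    have 3: "tm_val (N' ?m) (loc e) t = Inr (projr (tm_val (N' ?m) (loc e) t)) \<and>
        tm_val S e (pull t) = Inr (Some (projr (tm_val (N' ?m) (loc e) t)))" if "t \<in> set ts" for t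
      using IH[OF that] srt[OF that] by auto
    have xs: "map (tm_val (N' ?m) (loc e)) ts = map Inr ?xs" "map (tm_val S e) (map pull ts) = map (Inr \<circ> Some) ?xs"
      using 3 by simp_all
    have "tm_val S e (pull (Fn h ts)) = Inr (Some (fint K c ?xs))"
      unfolding pull.simps tm_val.simps xs(2) by (auto simp: 2 comp_def)
    moreover have "tm_val (N' ?m) (loc e) (Fn h ts) = Inr (fint K c ?xs)"
      unfolding tm_val.simps by (subst xs(1)) (simp add: 2 comp_def)
    ultimately show ?thesis by (simp add: 2)
  next
    case (3 i)
    have srt: "\<And>t. t \<in> set ts \<Longrightarrow> tm_sort L' t = Inl ()" and i: "i \<in> I" "length ts = k i"
      using Fn.prems(1) by (auto simp: 3 sorts_rep)
    obtain xs where xs: "map (tm_val (N' ?m) (loc e)) ts = map Inl xs"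
      "map (tm_val S e) (map pull ts) = map (Inl \<circ> MainElt ?m) xs" using main[OF srt] by blast
    have "length xs = length ts" using arg_cong[OF xs(1), of length] by simp
    then have ne: "map (Inl \<circ> MainElt ?m) xs \<noteq> []" using k_pos i by auto
    have "tm_val S e (pull (Fn h ts)) = Inr (Some (lam i ?m xs))"
      unfolding pull.simps tm_val.simps xs 3 pull_sym.simps S_simps
      by (subst fibrewise_same[OF ne, of ?m]) (auto simp: comp_def)
    moreover have "tm_val (N' ?m) (loc e) (Fn h ts) = Inr (lam i ?m xs)"
      unfolding tm_val.simps xs by (simp add: 3 comp_def)
    ultimately show ?thesis by (simp add: 3)
  qed
qed

lemma loc_upd:
  "loc (e((Inl MainS, n) := Inl (MainElt a b))) = (loc e)((Inl (), Suc n) := Inl b)"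
  "loc (e((Inr (), n) := Inr (Some x))) = (loc e)((Inr (), n) := Inr x)"
  "loc (e(mv j := y)) = loc e"
proof -
  show "loc (e((Inl MainS, n) := Inl (MainElt a b))) = (loc e)((Inl (), Suc n) := Inl b)"
  proof
    fix v show "loc (e((Inl MainS, n) := Inl (MainElt a b))) v = ((loc e)((Inl (), Suc n) := Inl b)) v"
      by (cases v rule: local_var_cases) auto
  qed
  show "loc (e((Inr (), n) := Inr (Some x))) = (loc e)((Inr (), n) := Inr x)"
  proof
    fix v show "loc (e((Inr (), n) := Inr (Some x))) v = ((loc e)((Inr (), n) := Inr x)) v"
      by (cases v rule: local_var_cases) auto
  qed
  show "loc (e(mv j := y)) = loc e"
  proof
    fix v show "loc (e(mv j := y)) v = loc e v"
      by (cases v rule: local_var_cases) auto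
  qed
qed

section \<open>Formulas over the K of a fibre\<close>

text \<open>Inside a fibre, quantifiers over K do not reach the added point, so in the sum they must
  be relativized. If 0 is a constant of K, no point has been added and the condition is
  void.\<close>

definition nonzero :: "nat \<Rightarrow> (lex_sort + unit, (('fm, 'fn) lex_fun, 'fk option, 'i) adj_fun, ('rm + 'rn) + 'rk) fm" where
  "nonzero n = (if z = None then Neg (Eq (Var (Inr (), n)) (Fn (Inl (Inr None)) [])) else Neg Fls)"

lemma nonzero_simps:
  "wf_fm (restrict_lang LS \<Sigma>) (nonzero n)" "wf_fm LS (nonzero n)" "qf (nonzero n)" "fv (nonzero n) \<subseteq> {(Inr (), n)}"
  "e (Inr (), n) \<in> carr S (Inr ()) \<Longrightarrow> sat S e (nonzero n) \<longleftrightarrow> e (Inr (), n) \<in> Inr ` Some ` univ K"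
proof -
  have none: "Inl (Inr None) \<in> funs LS \<longleftrightarrow> z = None" by simp
  show wf: "wf_fm (restrict_lang LS \<Sigma>) (nonzero n)"
  proof (cases "z = None")
    case True
    have "Inl (Inr None) \<in> funs LS" by (rule none[THEN iffD2, OF True])
    then show ?thesis unfolding nonzero_def if_P[OF True] by (simp del: LS_simps(7))
  next
    case False
    show ?thesis unfolding nonzero_def if_not_P[OF False] by simp
  qed
  then show "wf_fm LS (nonzero n)" by (rule wf_restrict)
  show "qf (nonzero n)" "fv (nonzero n) \<subseteq> {(Inr (), n)}" by (auto simp: nonzero_def)
  assume "e (Inr (), n) \<in> carr S (Inr ())"
  then have "e (Inr (), n) \<in> Inr ` (Some ` univ K \<union> (if z = None then {None} else {}))" by (simp only: S_simps(3))
  moreover have "sat S e (Neg (Eq (Var (Inr (), n)) (Fn (Inl (Inr None)) []))) \<longleftrightarrow> e (Inr (), n) \<noteq> Inr None"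
    by simp
  ultimately show "sat S e (nonzero n) \<longleftrightarrow> e (Inr (), n) \<in> Inr ` Some ` univ K"
    by (auto simp: nonzero_def simp del: S_simps sat.simps(2) split: if_splits)
qed

text \<open>The maps into K take at least one argument from the main sort and thus drop out of the
  restriction to K; only function symbols of K remain.\<close>

lemma K_tm:
  "wf_tm (restrict_lang L' {Inr ()}) t \<Longrightarrow> wf_tm L' t \<and> tm_sort L' t = Inr () \<and>
    (\<forall>v\<in>fv_tm t. fst v = Inr ()) \<and> wf_tm (restrict_lang LS \<Sigma>) (pull t)"
proof (induction t)
  case (Var v)
  then show ?case by (cases v rule: local_var_cases) auto
next
  case (Fn h ts)
  have IH: "wf_tm L' t" "tm_sort L' t = Inr ()" "\<forall>v\<in>fv_tm t. fst v = Inr ()" "wf_tm (restrict_lang LS \<Sigma>) (pull t)"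
    if "t \<in> set ts" for t
    using Fn.IH[OF that] Fn.prems that by auto
  have h: "h \<in> funs L'" "set (fdom L' h) \<subseteq> {Inr ()}" "fcod L' h = Inr ()" "map (tm_sort L') ts = fdom L' h"
    using Fn.prems by auto
  obtain c where c: "h = Inl (Inr c)"
    using h k_pos by (cases h rule: adj_fun_cases) (auto split: if_splits)
  have av: "avail v" if "t \<in> set ts" "v \<in> fv_tm t" for t v
    using IH(3)[OF that(1)] that(2) by (cases v rule: local_var_cases) auto
  have "tm_sort LS (pull t) = Inr ()" if "t \<in> set ts" for t
    using pull_syntax[OF IH(1)[OF that] av[OF that]] IH(2)[OF that] by simp
  moreover have "length ts = length (fdom LK c)" using arg_cong[OF h(4), of length] by (simp add: c)
  ultimately have "map (tm_sort LS \<circ> pull) ts = map (\<lambda>_. Inr ()) (fdom LK c)"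
    by (intro nth_equalityI) auto
  then show ?case using Fn.prems IH c by auto
qed

lemma nullary_formula:
  assumes "q \<in> rels LN" "rdom LN q = []"
  obtains \<theta> where "wf_fm (restrict_lang LS \<Sigma>) \<theta>" "fv \<theta> \<subseteq> {mv j}"
    "\<And>e. e (mv j) \<in> carr S (Inl BaseS) \<Longrightarrow> sat S e \<theta> = rint (N (mval j e)) q []"
proof (rule definable_formula[OF definable_nullary[OF assms]])
  fix \<theta> assume \<theta>: "wf_fm (restrict_lang LS \<Sigma>) \<theta>" "fv \<theta> \<subseteq> {mv j}"
    "\<And>e. e (mv j) \<in> carr S (Inl BaseS) \<Longrightarrow> sat S e \<theta> = (mval j e \<in> {a \<in> univ M. rint (N a) q []})"
  show thesis by (rule that[OF \<theta>(1,2)]) (use \<theta>(3) mval_carr in blast)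
qed

text \<open>The variable \<open>mv j\<close> is needed only for relation symbols of the fibres of
  arity 0: they survive the restriction to K, and their truth depends on the fibre.\<close>

lemma K_formula:
  "wf_fm (restrict_lang L' {Inr ()}) \<theta> \<Longrightarrow> \<exists>\<theta>'. wf_fm (restrict_lang LS \<Sigma>) \<theta>' \<and>
    fv \<theta>' \<subseteq> insert (mv j) (\<Union>v\<in>fv \<theta>. pull_vars v) \<and> (\<forall>v\<in>fv \<theta>. fst v = Inr ()) \<and>
    (\<forall>e. e (mv j) \<in> carr S (Inl BaseS) \<longrightarrow> (\<forall>v\<in>fv \<theta>. good j e v) \<longrightarrow>
       sat S e \<theta>' = lsat j e \<theta>)"
proof (induction \<theta>)
  case Fls
  show ?case by (rule exI[of _ Fls]) simp
next
  case (Eq t s)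
  have t: "wf_tm L' x \<and> tm_sort L' x = Inr () \<and> (\<forall>v\<in>fv_tm x. fst v = Inr ()) \<and> wf_tm (restrict_lang LS \<Sigma>) (pull x)"
    if "x \<in> {t, s}" for x by (rule K_tm) (use Eq that in auto)
  have av: "avail v" if "x \<in> {t, s}" "v \<in> fv_tm x" for x v
    using t[OF that(1)] that(2) by (cases v rule: local_var_cases) auto
  have b: "tm_sort LS (pull x) = Inr ()" "fv_tm (pull x) \<subseteq> (\<Union>v\<in>fv_tm x. pull_vars v)" if "x \<in> {t, s}" for x
    using pull_syntax[of x] t[OF that] av[OF that] by auto
  have v: "sat S e (Eq (pull t) (pull s)) = lsat j e (Eq t s)"
    if e: "e (mv j) \<in> carr S (Inl BaseS)" "\<forall>v\<in>fv (Eq t s). good j e v" for e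
  proof -
    have "\<exists>y. lval j e x = Inr y \<and> tm_val S e (pull x) = Inr (Some y)" if x: "x \<in> {t, s}" for x
    proof -
      have "good j e v" if "v \<in> fv_tm x" for v using e(2) x that by auto
      then show ?thesis using pull_val[of x j e, OF _ _ mval_carr[of e j, OF e(1)]] t[OF x] by blast
    qed
    from this[of t] this[of s] show ?thesis by auto
  qed
  show ?case
    by (rule exI[of _ "Eq (pull t) (pull s)"]) (use t[of t] t[of s] b[of t] b[of s] v in auto)
next
  case (Rel r ts)
  have t: "wf_tm L' x \<and> tm_sort L' x = Inr () \<and> (\<forall>v\<in>fv_tm x. fst v = Inr ()) \<and> wf_tm (restrict_lang LS \<Sigma>) (pull x)"
    if "x \<in> set ts" for x by (rule K_tm) (use Rel that in auto)
  have av: "avail v" if "x \<in> set ts" "v \<in> fv_tm x" for x v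
    using t[OF that(1)] that(2) by (cases v rule: local_var_cases) auto
  have b: "tm_sort LS (pull x) = Inr ()" "fv_tm (pull x) \<subseteq> (\<Union>v\<in>fv_tm x. pull_vars v)" if "x \<in> set ts" for x
    using pull_syntax[of x] t[OF that] av[OF that] by auto
  show ?case
  proof (cases r)
    case (Inl q)
    have r: "set (map Inl (rdom LN q)) \<subseteq> {Inr () :: unit + unit}" "map (tm_sort L') ts = map Inl (rdom LN q)" "q \<in> rels LN"
      using Rel by (auto simp: Inl)
    \<comment> \<open>A relation of the fibres has no sort but the main one, so it lies in the
      restriction only if it has no argument.\<close>
    have "rdom LN q = []" using r(1) by (cases "rdom LN q") auto
    then have q: "q \<in> rels LN" "rdom LN q = []" "ts = []" using r by auto
    obtain \<theta> where \<theta>: "wf_fm (restrict_lang LS \<Sigma>) \<theta>" "fv \<theta> \<subseteq> {mv j}"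
      "\<And>e. e (mv j) \<in> carr S (Inl BaseS) \<Longrightarrow> sat S e \<theta> = rint (N (mval j e)) q []"
      by (rule nullary_formula[OF q(1,2)]) (rule that)
    show ?thesis by (rule exI[of _ \<theta>]) (use \<theta> q in \<open>auto simp: Inl\<close>)
  next
    case (Inr p)
    have p: "p \<in> rels LK" "length ts = length (rdom LK p)" using Rel by (auto simp: Inr sorts_K)
    have "map (tm_sort LS \<circ> pull) ts = map (\<lambda>_. Inr ()) (rdom LK p)"
      by (rule nth_equalityI) (use b p in auto)
    then have wf: "wf_fm (restrict_lang LS \<Sigma>) (Rel (Inr p) (map pull ts))" using p t by auto
    have v: "sat S e (Rel (Inr p) (map pull ts)) = lsat j e (Rel r ts)"
      if e: "e (mv j) \<in> carr S (Inl BaseS)" "\<forall>v\<in>fv (Rel r ts). good j e v" for e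
    proof -
      have 1: "\<exists>y. lval j e x = Inr y \<and> tm_val S e (pull x) = Inr (Some y)" if x: "x \<in> set ts" for x
      proof -
        have "good j e v" if "v \<in> fv_tm x" for v using e(2) x that by auto
        then show ?thesis using pull_val[of x j e, OF _ _ mval_carr[of e j, OF e(1)]] t[OF x] by blast
      qed
      let ?xs = "map (\<lambda>x. projr (lval j e x)) ts"
      have 2: "lval j e x = Inr (projr (lval j e x)) \<and>
         tm_val S e (pull x) = Inr (Some (projr (lval j e x)))" if "x \<in> set ts" for x
        using 1[OF that] by auto
      have vals: "map (lval j e) ts = map Inr ?xs" "map (tm_val S e) (map pull ts) = map (Inr \<circ> Some) ?xs"
        using 2 by simp_all
      show ?thesis unfolding sat.simps vals by (auto simp: Inr comp_def)
    qed
    have "fv (Rel (Inr p) (map pull ts)) \<subseteq> (\<Union>v\<in>fv (Rel r ts). pull_vars v)" using b(2) by fastforce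
    then show ?thesis using wf v t by (intro exI[of _ "Rel (Inr p) (map pull ts)"]) auto
  qed
next
  case (Neg \<theta>)
  then obtain \<theta>' where "wf_fm (restrict_lang LS \<Sigma>) \<theta>'" "fv \<theta>' \<subseteq> insert (mv j) (\<Union>v\<in>fv \<theta>. pull_vars v)" "\<forall>v\<in>fv \<theta>. fst v = Inr ()"
    "\<forall>e. e (mv j) \<in> carr S (Inl BaseS) \<longrightarrow> (\<forall>v\<in>fv \<theta>. good j e v) \<longrightarrow> sat S e \<theta>' = lsat j e \<theta>"
    by auto
  then show ?case by (intro exI[of _ "Neg \<theta>'"]) simp
next
  case (Conj \<theta> \<eta>)
  then obtain \<theta>' \<eta>' where "wf_fm (restrict_lang LS \<Sigma>) \<theta>'" "fv \<theta>' \<subseteq> insert (mv j) (\<Union>v\<in>fv \<theta>. pull_vars v)" "\<forall>v\<in>fv \<theta>. fst v = Inr ()"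
    "\<forall>e. e (mv j) \<in> carr S (Inl BaseS) \<longrightarrow> (\<forall>v\<in>fv \<theta>. good j e v) \<longrightarrow> sat S e \<theta>' = lsat j e \<theta>"
    "wf_fm (restrict_lang LS \<Sigma>) \<eta>'" "fv \<eta>' \<subseteq> insert (mv j) (\<Union>v\<in>fv \<eta>. pull_vars v)" "\<forall>v\<in>fv \<eta>. fst v = Inr ()"
    "\<forall>e. e (mv j) \<in> carr S (Inl BaseS) \<longrightarrow> (\<forall>v\<in>fv \<eta>. good j e v) \<longrightarrow> sat S e \<eta>' = lsat j e \<eta>"
    by auto
  then show ?case by (intro exI[of _ "Conj \<theta>' \<eta>'"]) auto
next
  case (Ex v \<theta>)
  have "fst v = Inr ()" "wf_fm (restrict_lang L' {Inr ()}) \<theta>" using Ex.prems by auto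
  then obtain n where v: "v = (Inr (), n)" by (cases v) auto
  obtain \<theta>' where \<theta>': "wf_fm (restrict_lang LS \<Sigma>) \<theta>'" "fv \<theta>' \<subseteq> insert (mv j) (\<Union>v\<in>fv \<theta>. pull_vars v)" "\<forall>v\<in>fv \<theta>. fst v = Inr ()"
    "\<And>e. e (mv j) \<in> carr S (Inl BaseS) \<Longrightarrow> \<forall>v\<in>fv \<theta>. good j e v \<Longrightarrow> sat S e \<theta>' = lsat j e \<theta>"
    using Ex.IH[OF \<open>wf_fm (restrict_lang L' {Inr ()}) \<theta>\<close>] by blast
  let ?\<phi> = "Ex (Inr (), n) (Conj (nonzero n) \<theta>')"
  have "fv ?\<phi> \<subseteq> insert (mv j) (\<Union>v\<in>fv (Ex v \<theta>). pull_vars v)"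
  proof
    fix w assume w: "w \<in> fv ?\<phi>"
    then have "w \<in> fv \<theta>'" "w \<noteq> (Inr (), n)" using nonzero_simps(4)[of n] by auto
    then have "w = mv j \<or> (\<exists>x\<in>fv \<theta>. w \<in> pull_vars x)" using \<theta>'(2) by auto
    moreover have "x \<in> fv (Ex v \<theta>)" if "x \<in> fv \<theta>" "w \<in> pull_vars x" for x
      using that \<open>w \<noteq> (Inr (), n)\<close> by (auto simp: v)
    ultimately show "w \<in> insert (mv j) (\<Union>v\<in>fv (Ex v \<theta>). pull_vars v)" by blast
  qed
  moreover have "sat S e ?\<phi> = lsat j e (Ex v \<theta>)"
    if e: "e (mv j) \<in> carr S (Inl BaseS)" "\<forall>v\<in>fv (Ex v \<theta>). good j e v" for e
  proof -
    have "sat S e ?\<phi> \<longleftrightarrow> (\<exists>x\<in>carr S (Inr ()). sat S (e((Inr (), n) := x)) (nonzero n) \<and> sat S (e((Inr (), n) := x)) \<theta>')"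
      by (simp only: sat.simps fst_conv)
    also have "\<dots> \<longleftrightarrow> (\<exists>x\<in>carr S (Inr ()). x \<in> Inr ` Some ` univ K \<and> sat S (e((Inr (), n) := x)) \<theta>')"
      by (intro bex_cong refl conj_cong) (simp add: nonzero_simps(5) del: S_simps)
    also have "\<dots> \<longleftrightarrow> (\<exists>x\<in>univ K. sat S (e((Inr (), n) := Inr (Some x))) \<theta>')" by auto
    also have "\<dots> \<longleftrightarrow> (\<exists>x\<in>univ K. sat (N' (mval j e)) ((loc e)(v := Inr x)) \<theta>)"
    proof (rule bex_cong[OF refl])
      fix x assume x: "x \<in> univ K"
      have "good j (e((Inr (), n) := Inr (Some x))) w" if "w \<in> fv \<theta>" for w
      proof (cases "w = v")
        case False
        then have "good j e w" using e(2) that by simp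
        then show ?thesis using False by (cases w rule: local_var_cases) (auto simp: v mval_def)
      qed (use x in \<open>simp add: v\<close>)
      then have "sat S (e((Inr (), n) := Inr (Some x))) \<theta>' =
          sat (N' (mval j (e((Inr (), n) := Inr (Some x))))) (loc (e((Inr (), n) := Inr (Some x)))) \<theta>"
        using e(1) by (intro \<theta>'(4)) simp_all
      then show "sat S (e((Inr (), n) := Inr (Some x))) \<theta>' = sat (N' (mval j e)) ((loc e)(v := Inr x)) \<theta>"
        by (simp add: mval_def loc_upd v)
    qed
    also have "\<dots> \<longleftrightarrow> lsat j e (Ex v \<theta>)" by (simp add: v)
    finally show ?thesis .
  qed
  ultimately show ?case using \<theta>'(1,3) nonzero_simps(1)[of n] by (intro exI[of _ ?\<phi>]) simp
qed

lemma QF_formula: "wf_fm (restrict_lang LS \<Sigma>) \<theta> \<Longrightarrow> fv \<theta> \<subseteq> V \<Longrightarrow> (\<And>v. v \<in> fv \<theta> \<Longrightarrow> fst v \<in> \<Sigma>) \<Longrightarrow>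
    QF V (\<lambda>e. sat S e \<theta>)"
  using QF_sigma[of \<theta> Var V] by auto

lemma fibre_rel:
  assumes "a \<in> univ M" "xs \<noteq> []"
  shows "(\<exists>b\<in>univ M. \<exists>bs. map (MainElt a) xs = map (MainElt b) bs \<and> rint (N b) q bs) = rint (N a) q xs"
proof
  assume "\<exists>b\<in>univ M. \<exists>bs. map (MainElt a) xs = map (MainElt b) bs \<and> rint (N b) q bs"
  then obtain b bs where b: "map (MainElt a) xs = map (MainElt b) bs" "rint (N b) q bs" by blast
  have "a = b" using b(1) assms(2) by (cases xs; cases bs) auto
  moreover from this have "xs = bs" using b(1) by (auto simp: inj_map_eq_map inj_def)
  ultimately show "rint (N a) q xs" using b(2) by simp
qed (use assms(1) in blast)

section \<open>Formulas of a fibre as quantifier-free predicates on the sum\<close>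

text \<open>Atoms are pulled back to the sum term by term. A predicate of the enrichment becomes a
  formula over \<open>\<Sigma>\<close> by \<open>K_formula\<close>, evaluated at the pulled
  arguments.\<close>

lemma local_qf:
  "wf_fm ML' \<psi> \<Longrightarrow> qf \<psi> \<Longrightarrow> (\<And>v. v \<in> fv \<psi> \<Longrightarrow> avail v) \<Longrightarrow>
    \<exists>R. QF (insert (mv j) (\<Union>v\<in>fv \<psi>. pull_vars v)) R \<and>
      (\<forall>e. ok e \<longrightarrow> (\<forall>v\<in>fv \<psi>. good j e v) \<longrightarrow> R e = lsat' j e \<psi>)"
proof (induction \<psi>)
  case Fls
  show ?case by (rule exI[of _ "\<lambda>_. False"]) (simp add: QF_False)
next
  case (Eq t s)
  have wf: "wf_tm L' t" "wf_tm L' s" "tm_sort L' t = tm_sort L' s" using Eq.prems by auto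
  have b: "wf_tm LS (pull x) \<and> tm_sort LS (pull x) = pull_sort (tm_sort L' x) \<and> fv_tm (pull x) \<subseteq> (\<Union>v\<in>fv_tm x. pull_vars v)"
    if "x \<in> {t, s}" for x
    by (rule pull_syntax) (use that wf Eq.prems in auto)
  have "QF (insert (mv j) (\<Union>v\<in>fv (Eq t s). pull_vars v)) (\<lambda>e. sat MS e (lift (Eq (pull t) (pull s))))"
    by (rule QF_sat) (use b[of t] b[of s] wf in auto)
  moreover have "sat MS e (lift (Eq (pull t) (pull s))) = lsat' j e (Eq t s)"
    if e: "ok e" "\<forall>v\<in>fv (Eq t s). good j e v" for e
  proof -
    have m: "mval j e \<in> univ M" by (rule mval_carr[of e j, OF mv_carr[OF e(1)]])
    have gt: "good j e v" if "v \<in> fv_tm t" for v using e(2) that by simp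
    have gs: "good j e v" if "v \<in> fv_tm s" for v using e(2) that by simp
    show ?thesis
    proof (cases "tm_sort L' t")
      case (Inl a)
      then have "tm_sort L' t = Inl ()" "tm_sort L' s = Inl ()" using wf(3) by auto
      then show ?thesis using pull_val[OF wf(1) gt m] pull_val[OF wf(2) gs m] by auto
    next
      case (Inr a)
      then have "tm_sort L' t = Inr ()" "tm_sort L' s = Inr ()" using wf(3) by auto
      then show ?thesis using pull_val[OF wf(1) gt m] pull_val[OF wf(2) gs m] by auto
    qed
  qed
  ultimately show ?case by blast
next
  case (Rel r ts)
  have wf: "\<forall>t\<in>set ts. wf_tm L' t" using Rel.prems by simp
  have b: "wf_tm LS (pull x) \<and> tm_sort LS (pull x) = pull_sort (tm_sort L' x) \<and> fv_tm (pull x) \<subseteq> (\<Union>v\<in>fv_tm x. pull_vars v)"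
    if "x \<in> set ts" for x
    by (rule pull_syntax) (use that wf Rel.prems in auto)
  have fvb: "(\<Union>t\<in>set ts. fv_tm (pull t)) \<subseteq> (\<Union>v\<in>fv (Rel r ts). pull_vars v)" using b by fastforce
  have m: "mval j e \<in> univ M" if "ok e" for e by (rule mval_carr[of e j, OF mv_carr[OF that]])
  have g: "good j e v" if "\<forall>v\<in>fv (Rel r ts). good j e v" "x \<in> set ts" "v \<in> fv_tm x" for e x v using that by auto
  show ?case
  proof (cases r rule: adj_fun_cases)
    case (1 q)
    have q: "q \<in> rels LN" "length ts = length (rdom LN q)" "\<forall>t\<in>set ts. tm_sort L' t = Inl ()"
      using Rel.prems(1) by (auto simp: 1 sorts_main)
    show ?thesis
    proof (cases "ts = []")
      case True
      then have q0: "rdom LN q = []" using q(2) by simp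
      obtain \<theta> where \<theta>: "wf_fm (restrict_lang LS \<Sigma>) \<theta>" "fv \<theta> \<subseteq> {mv j}"
        "\<And>e. e (mv j) \<in> carr S (Inl BaseS) \<Longrightarrow> sat S e \<theta> = rint (N (mval j e)) q []"
        by (rule nullary_formula[OF q(1) q0]) (rule that)
      have "QF (insert (mv j) (\<Union>v\<in>fv (Rel r ts). pull_vars v)) (\<lambda>e. sat S e \<theta>)"
        by (rule QF_formula) (use \<theta> in auto)
      moreover have "sat S e \<theta> = rint (N (mval j e)) q []" if "ok e" for e by (rule \<theta>(3), rule mv_carr[OF that])
      ultimately show ?thesis by (intro exI[of _ "\<lambda>e. sat S e \<theta>"]) (simp add: 1 True)
    next
      case False
      have "map (tm_sort LS \<circ> pull) ts = map (\<lambda>_. Inl MainS) (rdom LN q)"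
        by (rule nth_equalityI) (use b q in auto)
      then have "QF (insert (mv j) (\<Union>v\<in>fv (Rel r ts). pull_vars v)) (\<lambda>e. sat MS e (lift (Rel (Inl (Inr q)) (map pull ts))))"
        by (intro QF_sat) (use b q fvb in auto)
      moreover have "sat MS e (lift (Rel (Inl (Inr q)) (map pull ts))) = lsat' j e (Rel r ts)"
        if e: "ok e" "\<forall>v\<in>fv (Rel r ts). good j e v" for e
      proof -
        let ?xs = "map (\<lambda>x. projl (lval j e x)) ts"
        have 2: "lval j e x = Inl (projl (lval j e x)) \<and>
         tm_val S e (pull x) = Inl (MainElt (mval j e) (projl (lval j e x)))" if x: "x \<in> set ts" for x
          using pull_val[of x j e, OF bspec[OF wf x] g[OF e(2) x] m[OF e(1)]] bspec[OF q(3) x] by auto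
        have vals: "map (lval j e) ts = map Inl ?xs" "map (tm_val S e) (map pull ts) = map (Inl \<circ> MainElt (mval j e)) ?xs"
          using 2 by simp_all
        have ne: "?xs \<noteq> []" using False by simp
        from fibre_rel[OF m[OF e(1)] ne] show ?thesis
          unfolding lift.simps sat.simps morley_struct_simps tm_val_morley_eq vals 1 S_simps by (simp add: comp_def)
      qed
      ultimately show ?thesis by blast
    qed
  next
    case (2 p)
    have p: "p \<in> rels LK" "length ts = length (rdom LK p)" "\<forall>t\<in>set ts. tm_sort L' t = Inr ()"
      using Rel.prems(1) by (auto simp: 2 sorts_K)
    have "map (tm_sort LS \<circ> pull) ts = map (\<lambda>_. Inr ()) (rdom LK p)"
      by (rule nth_equalityI) (use b p in auto)
    then have "QF (insert (mv j) (\<Union>v\<in>fv (Rel r ts). pull_vars v)) (\<lambda>e. sat MS e (lift (Rel (Inr p) (map pull ts))))"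
      by (intro QF_sat) (use b p fvb in auto)
    moreover have "sat MS e (lift (Rel (Inr p) (map pull ts))) = lsat' j e (Rel r ts)"
      if e: "ok e" "\<forall>v\<in>fv (Rel r ts). good j e v" for e
    proof -
      let ?xs = "map (\<lambda>x. projr (lval j e x)) ts"
      have 3: "lval j e x = Inr (projr (lval j e x)) \<and>
         tm_val S e (pull x) = Inr (Some (projr (lval j e x)))" if x: "x \<in> set ts" for x
        using pull_val[of x j e, OF bspec[OF wf x] g[OF e(2) x] m[OF e(1)]] bspec[OF p(3) x] by auto
      have vals: "map (lval j e) ts = map Inr ?xs" "map (tm_val S e) (map pull ts) = map (Inr \<circ> Some) ?xs"
        using 3 by simp_all
      show ?thesis
        unfolding lift.simps sat.simps morley_struct_simps tm_val_morley_eq vals 2 S_simps by (auto simp: comp_def)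
    qed
    ultimately show ?thesis by blast
  next
    case (3 p)
    obtain xs \<theta> where p: "p = (xs, \<theta>)" by (cases p)
    have \<theta>: "distinct xs" "fst ` set xs \<subseteq> {Inr ()}" "wf_fm (restrict_lang L' {Inr ()}) \<theta>" "fv \<theta> \<subseteq> set xs" "map (tm_sort L') ts = map fst xs"
      using Rel.prems(1) by (auto simp: 3 p)
    have len: "length ts = length xs" using \<theta>(5) map_eq_imp_length_eq by blast
    obtain \<theta>' where \<theta>': "wf_fm (restrict_lang LS \<Sigma>) \<theta>'" "fv \<theta>' \<subseteq> insert (mv j) (\<Union>v\<in>fv \<theta>. pull_vars v)"
      "\<And>e. e (mv j) \<in> carr S (Inl BaseS) \<Longrightarrow> \<forall>v\<in>fv \<theta>. good j e v \<Longrightarrow> sat S e \<theta>' = lsat j e \<theta>"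
      using K_formula[OF \<theta>(3)] by blast
    \<comment> \<open>\<open>\<theta>'\<close> uses the same variable numbers as
      \<open>\<theta>\<close>; thus variable \<open>n\<close> of the sort of K is replaced by the
      argument that stands at the place of \<open>(Inr (), n)\<close> in \<open>xs\<close>.\<close>
    define \<sigma> where "\<sigma> w = (if w = mv j then Var (mv j) else pull (the (map_of (zip xs ts) (Inr (), snd w))))" for w
    have ex_i: "\<exists>i<length xs. (Inr (), n) = xs ! i \<and> \<sigma> (Inr (), n) = pull (ts ! i) \<and> ts ! i \<in> set ts \<and> tm_sort L' (ts ! i) = Inr ()"
      if n: "(Inr (), n) \<in> fv \<theta>" for n
    proof -
      obtain i where i: "i < length xs" "(Inr (), n) = xs ! i" using n \<theta>(4) by (metis in_set_conv_nth subsetD)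
      have "the (map_of (zip xs ts) (xs ! i)) = ts ! i" by (rule the_map_of_zip[OF \<theta>(1) len i(1)])
      moreover have "tm_sort L' (ts ! i) = fst (xs ! i)" using \<theta>(5) i len by (metis nth_map)
      then have "tm_sort L' (ts ! i) = Inr ()" using i(2) by (metis fst_conv)
      ultimately show ?thesis using i len by (intro exI[of _ i]) (simp add: \<sigma>_def)
    qed
    have srt: "\<exists>n. v = (Inr (), n)" if "v \<in> fv \<theta>" for v
    proof -
      have "fst v = Inr ()" using that \<theta>(2,4) by auto
      then show ?thesis by (cases v) auto
    qed
    have "QF (insert (mv j) (\<Union>v\<in>fv (Rel r ts). pull_vars v)) (\<lambda>e. sat S (\<lambda>w. tm_val S e (\<sigma> w)) \<theta>')"
    proof (rule QF_sigma[OF \<theta>'(1)])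
      fix w assume w: "w \<in> fv \<theta>'"
      show "fst w \<in> \<Sigma> \<and> wf_tm LS (\<sigma> w) \<and> tm_sort LS (\<sigma> w) = fst w \<and> fv_tm (\<sigma> w) \<subseteq> insert (mv j) (\<Union>v\<in>fv (Rel r ts). pull_vars v)"
      proof (cases "w = mv j")
        case True
        then show ?thesis by (simp add: \<sigma>_def)
      next
        case False
        then obtain v where v: "v \<in> fv \<theta>" "w \<in> pull_vars v" using w \<theta>'(2) by auto
        obtain n where n: "v = (Inr (), n)" using srt[OF v(1)] by blast
        have w': "w = (Inr (), n)" using v(2) by (simp add: n)
        obtain i where i: "\<sigma> w = pull (ts ! i)" "ts ! i \<in> set ts" "tm_sort L' (ts ! i) = Inr ()" using ex_i[of n] v(1) n w' by auto
        have "fv_tm (pull (ts ! i)) \<subseteq> (\<Union>v\<in>fv (Rel r ts). pull_vars v)" using fvb i(2) by blast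
        then show ?thesis using b[OF i(2)] i(3) w' unfolding i(1) by auto
      qed
    qed
    moreover have "sat S (\<lambda>w. tm_val S e (\<sigma> w)) \<theta>' = lsat' j e (Rel r ts)"
      if e: "ok e" "\<forall>v\<in>fv (Rel r ts). good j e v" for e
    proof -
      let ?e = "\<lambda>w. tm_val S e (\<sigma> w)"
      have mj: "?e (mv j) = e (mv j)" by (simp add: \<sigma>_def)
      then have mval: "mval j ?e = mval j e" by (simp add: mval_def)
      have K: "good j ?e (Inr (), n) \<and> loc ?e (Inr (), n) = the (map_of (zip xs (map (lval j e) ts)) (Inr (), n))"
        if n: "(Inr (), n) \<in> fv \<theta>" for n
      proof -
        obtain i where i: "i < length xs" "(Inr (), n) = xs ! i" "\<sigma> (Inr (), n) = pull (ts ! i)" "ts ! i \<in> set ts" "tm_sort L' (ts ! i) = Inr ()"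
          using ex_i[OF n] by blast
        obtain y where y: "lval j e (ts ! i) = Inr y" "tm_val S e (pull (ts ! i)) = Inr (Some y)"
          using pull_val[of "ts ! i" j e, OF bspec[OF wf i(4)] g[OF e(2) i(4)] m[OF e(1)]] i(5) by blast
        have "Inr (Some y) \<in> carr S (Inr ())" using ok_tm_val[OF e(1), of "pull (ts ! i)"] b[OF i(4)] i(5) y(2) by simp
        then have "y \<in> univ K" by (auto split: if_splits)
        moreover have "the (map_of (zip xs (map (lval j e) ts)) (xs ! i)) = Inr y"
          using the_map_of_zip[OF \<theta>(1), of "map (lval j e) ts" i] i(1) len y(1) by simp
        ultimately show ?thesis unfolding i(2)[symmetric] using i(3) y(2) by simp
      qed
      have "sat S ?e \<theta>' = sat (N' (mval j ?e)) (loc ?e) \<theta>"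
      proof (rule \<theta>'(3))
        show "?e (mv j) \<in> carr S (Inl BaseS)" unfolding mj by (rule mv_carr[OF e(1)])
        show "\<forall>v\<in>fv \<theta>. good j ?e v"
        proof
          fix v assume v: "v \<in> fv \<theta>"
          obtain n where n: "v = (Inr (), n)" using srt[OF v] by blast
          show "good j ?e v" using K[of n] v unfolding n by blast
        qed
      qed
      also have "\<dots> = sat (N' (mval j e)) (\<lambda>v. the (map_of (zip xs (map (lval j e) ts)) v)) \<theta>"
        unfolding mval by (rule sat_cong) (use K srt in blast)
      finally show ?thesis by (simp add: 3 p)
    qed
    ultimately show ?thesis by blast
  qed
next
  case (Neg \<psi>)
  have "\<exists>R. QF (insert (mv j) (\<Union>v\<in>fv \<psi>. pull_vars v)) R \<and>
    (\<forall>e. ok e \<longrightarrow> (\<forall>v\<in>fv \<psi>. good j e v) \<longrightarrow> R e = lsat' j e \<psi>)"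
    by (rule Neg.IH) (use Neg.prems in auto)
  then obtain R where R: "QF (insert (mv j) (\<Union>v\<in>fv \<psi>. pull_vars v)) R"
    "\<forall>e. ok e \<longrightarrow> (\<forall>v\<in>fv \<psi>. good j e v) \<longrightarrow> R e = lsat' j e \<psi>" by (elim exE conjE)
  show ?case by (intro exI[of _ "\<lambda>e. \<not> R e"] conjI) (use QF_neg[OF R(1)] R(2) in simp_all)
next
  case (Conj \<phi> \<psi>)
  have "\<exists>R. QF (insert (mv j) (\<Union>v\<in>fv \<phi>. pull_vars v)) R \<and>
    (\<forall>e. ok e \<longrightarrow> (\<forall>v\<in>fv \<phi>. good j e v) \<longrightarrow> R e = lsat' j e \<phi>)"
    by (rule Conj.IH(1)) (use Conj.prems in auto)
  then obtain R where R: "QF (insert (mv j) (\<Union>v\<in>fv \<phi>. pull_vars v)) R"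
    "\<forall>e. ok e \<longrightarrow> (\<forall>v\<in>fv \<phi>. good j e v) \<longrightarrow> R e = lsat' j e \<phi>" by (elim exE conjE)
  have "\<exists>R. QF (insert (mv j) (\<Union>v\<in>fv \<psi>. pull_vars v)) R \<and>
    (\<forall>e. ok e \<longrightarrow> (\<forall>v\<in>fv \<psi>. good j e v) \<longrightarrow> R e = lsat' j e \<psi>)"
    by (rule Conj.IH(2)) (use Conj.prems in auto)
  then obtain R' where R': "QF (insert (mv j) (\<Union>v\<in>fv \<psi>. pull_vars v)) R'"
    "\<forall>e. ok e \<longrightarrow> (\<forall>v\<in>fv \<psi>. good j e v) \<longrightarrow> R' e = lsat' j e \<psi>" by (elim exE conjE)
  have "QF (insert (mv j) (\<Union>v\<in>fv (Conj \<phi> \<psi>). pull_vars v)) (\<lambda>e. R e \<and> R' e)"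
    by (rule QF_conj[OF QF_mono[OF R(1)] QF_mono[OF R'(1)]]) auto
  then show ?case by (intro exI[of _ "\<lambda>e. R e \<and> R' e"] conjI) (use R(2) R'(2) in simp_all)
qed simp

lemma loc_carr: "good j e v \<Longrightarrow> loc e v \<in> carr (N' (mval j e)) (fst v)"
proof (cases v rule: local_var_cases)
  case undet
  assume "good j e v"
  moreover have "coord u \<in> univ (N (fibre u))" using main_eltD[OF u_main] by simp
  ultimately show ?thesis using undet by simp
next
  case (main n)
  assume "good j e v"
  then show ?thesis using main main_eltD[of "e (Inl MainS, n)"] by auto
qed auto

text \<open>The choice between the finitely many candidates is made by the formula itself: it is the
  disjunction over \<open>\<psi>\<close> of \<open>\<psi>\<close> together with the statement that
  \<open>\<psi>\<close> is right in the fibre \<open>mval j\<close>, and the latter is definable in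
  M.\<close>

lemma local_formula:
  assumes \<chi>: "wf_fm L' \<chi>" and av: "\<forall>v\<in>fv \<chi>. avail v"
  obtains R where "QF (insert (mv j) (\<Union>v\<in>fv \<chi>. pull_vars v)) R"
    "\<And>e. ok e \<Longrightarrow> \<forall>v\<in>fv \<chi>. good j e v \<Longrightarrow> R e = lsat j e \<chi>"
proof -
  let ?V = "insert (mv j) (\<Union>v\<in>fv \<chi>. pull_vars v)"
  from uniform_qe[OF \<chi>] obtain \<Psi> where \<Psi>: "finite \<Psi>" "\<forall>\<psi>\<in>\<Psi>. wf_fm ML' \<psi> \<and> qf \<psi> \<and> fv \<psi> \<subseteq> fv \<chi>"
    "\<forall>a\<in>univ M. \<exists>\<psi>\<in>\<Psi>. equivalent_in a \<chi> \<psi>" by (elim exE conjE)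
  have "\<forall>\<psi>\<in>\<Psi>. \<exists>R. QF ?V R \<and> (\<forall>e. ok e \<longrightarrow> (\<forall>v\<in>fv \<chi>. good j e v) \<longrightarrow>
      R e = (equivalent_in (mval j e) \<chi> \<psi> \<and> lsat' j e \<psi>))"
  proof
    fix \<psi> assume "\<psi> \<in> \<Psi>"
    then have \<psi>: "wf_fm ML' \<psi>" "qf \<psi>" "fv \<psi> \<subseteq> fv \<chi>" using \<Psi>(2) by blast+
    have "\<exists>R. QF (insert (mv j) (\<Union>v\<in>fv \<psi>. pull_vars v)) R \<and>
      (\<forall>e. ok e \<longrightarrow> (\<forall>v\<in>fv \<psi>. good j e v) \<longrightarrow> R e = lsat' j e \<psi>)"
      by (rule local_qf) (use \<psi> av in auto)
    then obtain R where R: "QF (insert (mv j) (\<Union>v\<in>fv \<psi>. pull_vars v)) R"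
      "\<forall>e. ok e \<longrightarrow> (\<forall>v\<in>fv \<psi>. good j e v) \<longrightarrow> R e = lsat' j e \<psi>" by (elim exE conjE)
    have "definable LM M {a \<in> univ M. equivalent_in a \<chi> \<psi>}" by (rule definable_equivalent[OF \<chi> \<psi>(1)])
    then obtain \<theta> where \<theta>: "wf_fm (restrict_lang LS \<Sigma>) \<theta>" "fv \<theta> \<subseteq> {mv j}"
      "\<And>e. e (mv j) \<in> carr S (Inl BaseS) \<Longrightarrow> sat S e \<theta> = (mval j e \<in> {a \<in> univ M. equivalent_in a \<chi> \<psi>})"
      by (rule definable_formula) (rule that)
    have "QF ?V (\<lambda>e. sat S e \<theta> \<and> R e)"
    proof (rule QF_conj)
      show "QF ?V (\<lambda>e. sat S e \<theta>)" by (rule QF_formula[OF \<theta>(1)]) (use \<theta>(2) in auto)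
      show "QF ?V R" by (rule QF_mono[OF R(1)]) (use \<psi> in auto)
    qed
    moreover have "(sat S e \<theta> \<and> R e) = (equivalent_in (mval j e) \<chi> \<psi> \<and> lsat' j e \<psi>)"
      if e: "ok e" "\<forall>v\<in>fv \<chi>. good j e v" for e
    proof -
      have c: "e (mv j) \<in> carr S (Inl BaseS)" by (rule mv_carr[OF e(1)])
      have "\<forall>v\<in>fv \<psi>. good j e v" using e(2) \<psi> by blast
      then have "R e = lsat' j e \<psi>" using R(2)[rule_format, OF e(1)] by blast
      moreover have "sat S e \<theta> = (mval j e \<in> {a \<in> univ M. equivalent_in a \<chi> \<psi>})" by (rule \<theta>(3)) (rule c)
      ultimately show ?thesis using mval_carr[of e j, OF c] by simp
    qed
    ultimately show "\<exists>R. QF ?V R \<and> (\<forall>e. ok e \<longrightarrow> (\<forall>v\<in>fv \<chi>. good j e v) \<longrightarrow>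
      R e = (equivalent_in (mval j e) \<chi> \<psi> \<and> lsat' j e \<psi>))"
      by (intro exI[of _ "\<lambda>e. sat S e \<theta> \<and> R e"] conjI) simp_all
  qed
  from bchoice[OF this] obtain R where R: "\<forall>\<psi>\<in>\<Psi>. QF ?V (R \<psi>) \<and> (\<forall>e. ok e \<longrightarrow> (\<forall>v\<in>fv \<chi>. good j e v) \<longrightarrow>
      R \<psi> e = (equivalent_in (mval j e) \<chi> \<psi> \<and> lsat' j e \<psi>))" by (elim exE)
  show thesis
  proof (rule that[of "\<lambda>e. \<exists>\<psi>\<in>\<Psi>. R \<psi> e"])
    show "QF ?V (\<lambda>e. \<exists>\<psi>\<in>\<Psi>. R \<psi> e)" by (rule QF_bex[OF \<Psi>(1)]) (rule conjunct1[OF bspec[OF R]])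
    fix e assume e: "ok e" and g: "\<forall>v\<in>fv \<chi>. good j e v"
    let ?N = "N' (mval j e)"
    have m: "mval j e \<in> univ M" by (rule mval_carr[of e j, OF mv_carr[OF e]])
    have "\<exists>x. x \<in> carr ?N s" for s using is_struct_N'[OF m] by (auto simp: is_struct_def)
    then obtain d where d: "\<And>s. d s \<in> carr ?N s" using choice[of "\<lambda>s x. x \<in> carr ?N s"] by blast
    \<comment> \<open>Equivalence is known for assignments that respect all sorts, whereas
      \<open>loc e\<close> is only known to do so at good variables; values outside
      \<open>fv \<chi>\<close> are therefore replaced.\<close>
    let ?e = "\<lambda>v. if v \<in> fv \<chi> then loc e v else d (fst v)"
    have "\<forall>v. ?e v \<in> carr ?N (fst v)"
    proof
      fix v show "?e v \<in> carr ?N (fst v)" using loc_carr[OF bspec[OF g, of v]] d by simp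
    qed
    then have "sat ?N ?e \<chi> = sat (morley_struct ?N) ?e \<psi>" if "equivalent_in (mval j e) \<chi> \<psi>" for \<psi>
      using that[unfolded equivalent_in_def, rule_format, of ?e] by simp
    moreover have "sat ?N ?e \<chi> = sat ?N (loc e) \<chi>" by (rule sat_cong) simp
    moreover have "sat (morley_struct ?N) ?e \<psi> = sat (morley_struct ?N) (loc e) \<psi>" if "\<psi> \<in> \<Psi>" for \<psi>
      by (rule sat_cong) (use bspec[OF \<Psi>(2) that] in auto)
    ultimately have "sat ?N (loc e) \<chi> = sat (morley_struct ?N) (loc e) \<psi>" if "\<psi> \<in> \<Psi>" "equivalent_in (mval j e) \<chi> \<psi>" for \<psi>
      using that by simp
    moreover have "R \<psi> e = (equivalent_in (mval j e) \<chi> \<psi> \<and> sat (morley_struct ?N) (loc e) \<psi>)" if "\<psi> \<in> \<Psi>" for \<psi>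
      using bspec[OF R that] e g by simp
    ultimately show "(\<exists>\<psi>\<in>\<Psi>. R \<psi> e) = sat ?N (loc e) \<chi>" using bspec[OF \<Psi>(3) m] by blast
  qed
qed

section \<open>Localization in one fibre\<close>

text \<open>The generators of a term of the main sort, with the numbering of \<open>loc\<close>.\<close>

fun gv :: "('fm, 'fn, 'fk, 'i) lex_tm \<Rightarrow> nat set" where
  "gv (Var v) = {Suc (snd v)}"
| "gv (Fn h ts) = (if h = Inl (Inl Undet) then {0} else (\<Union>t\<in>set ts. gv t))"

text \<open>Specified for the symbols coming from the fibres; the only other symbol that can head a
  term of the main sort is \<open>Undet\<close>, which \<open>to_local\<close> treats apart.\<close>

fun fibre_fn :: "(('fm, 'fn) lex_fun, 'fk option, 'i) adj_fun \<Rightarrow> 'fn" where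
  "fibre_fn (Inl (Inl (MainFn g))) = g"

fun to_local :: "('fm, 'fn, 'fk, 'i) lex_tm \<Rightarrow> (unit + unit, ('fn, 'fk, 'i) adj_fun) tm" where
  "to_local (Var v) = Var (Inl (), Suc (snd v))"
| "to_local (Fn h ts) = (if h = Inl (Inl Undet) then Var (Inl (), 0) else Fn (Inl (Inl (fibre_fn h))) (map to_local ts))"

lemma gv_nonempty: "wf_tm LS t \<Longrightarrow> tm_sort LS t = Inl MainS \<Longrightarrow> gv t \<noteq> {}"
proof (induction t)
  case (Fn h ts)
  show ?case
  proof (rule main_tm_cases[OF Fn.prems])
    fix g ss assume s: "Fn h ts = Fn (Inl (Inl (MainFn g))) ss" "ss \<noteq> []" "\<And>s. s \<in> set ss \<Longrightarrow> wf_tm LS s \<and> tm_sort LS s = Inl MainS"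
    then have "hd ss \<in> set ts" by auto
    then have "gv (hd ss) \<noteq> {}" using Fn.IH s by simp
    then show ?thesis using s \<open>hd ss \<in> set ts\<close> by auto
  qed simp_all
qed simp

lemma to_local:
  "wf_tm LS t \<Longrightarrow> tm_sort LS t = Inl MainS \<Longrightarrow> wf_tm L' (to_local t) \<and> tm_sort L' (to_local t) = Inl () \<and>
    fv_tm (to_local t) = Pair (Inl ()) ` gv t \<and> pull (to_local t) = t"
proof (induction t)
  case (Var v)
  then show ?case by (cases v) auto
next
  case (Fn h ts)
  show ?case
  proof (rule main_tm_cases[OF Fn.prems])
    fix g ss assume s: "Fn h ts = Fn (Inl (Inl (MainFn g))) ss" "g \<in> funs LN" "length ss = length (fdom LN g)"
      "\<And>s. s \<in> set ss \<Longrightarrow> wf_tm LS s \<and> tm_sort LS s = Inl MainS"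
    have IH: "wf_tm L' (to_local t)" "tm_sort L' (to_local t) = Inl ()" "fv_tm (to_local t) = Pair (Inl ()) ` gv t"
      "pull (to_local t) = t" if "t \<in> set ts" for t
      using Fn.IH[OF that] s(1,4) that by auto
    have "map (tm_sort L' \<circ> to_local) ts = map Inl (fdom LN g)"
      by (rule nth_equalityI) (use IH s(1,3) in auto)
    moreover have "map (pull \<circ> to_local) ts = ts" using IH(4) by (simp add: map_idI)
    ultimately show ?thesis using s(1,2) IH by (auto simp: image_UN)
  qed simp_all
qed

abbreviation "xv nx \<equiv> (Inl MainS, nx) :: (lex_sort + unit) var"

text \<open>The index of the variable \<open>nx\<close> is always present, since comparing it with
  the others shows which generators lie in the fibre under consideration; index 0 is present exactly
  if the constant for "undetermined" is.\<close>

definition idx :: "(lex_sort + unit) var set \<Rightarrow> nat \<Rightarrow> nat set" where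
  "idx V nx = {Suc n | n. (Inl MainS, n) \<in> V} \<union> {Suc nx} \<union> (if has_undet then {0} else {})"

text \<open>The fibre of a generator; that of the variable \<open>nx\<close> to be eliminated is presented by the
  variable \<open>j\<close> of the sort of \<open>\<M>\<close> instead.\<close>

fun fib :: "nat \<Rightarrow> nat \<Rightarrow> ('m, 'n, 'k) lex_env \<Rightarrow> nat \<Rightarrow> 'm" where
  "fib j nx e 0 = fibre u"
| "fib j nx e (Suc n) = (if n = nx then mval j e else fibre (projl (e (Inl MainS, n))))"

text \<open>The second component is there because a variable whose value is the added point has no
  counterpart in a fibre, where K has its original points only.\<close>

definition pat :: "nat \<Rightarrow> nat \<Rightarrow> (lex_sort + unit) var set \<Rightarrow> ('m, 'n, 'k) lex_env \<Rightarrow> (nat \<times> nat) set \<times> nat set" where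
  "pat j nx V e = ({(i, l) \<in> idx V nx \<times> idx V nx. fib j nx e i = fib j nx e l},
     {n. (Inr (), n) \<in> V \<and> e (Inr (), n) = Inr None})"

text \<open>\<open>e0\<close> matters through its pattern alone. On these assignments the variable
  \<open>nx\<close> really lies in the fibre presented by \<open>j\<close>, so that
  \<open>fib\<close> gives the true fibres.\<close>

definition dom_pat :: "nat \<Rightarrow> nat \<Rightarrow> (lex_sort + unit) var set \<Rightarrow> ('m, 'n, 'k) lex_env \<Rightarrow> _ set" where
  "dom_pat j nx V e0 = {e. ok e \<and> pat j nx V e = pat j nx V e0 \<and> fibre (projl (e (xv nx))) = mval j e}"

lemma gv_idx: "wf_tm LS t \<Longrightarrow> tm_sort LS t = Inl MainS \<Longrightarrow> fv_tm t \<subseteq> V \<Longrightarrow> gv t \<subseteq> idx V nx"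
proof (induction t)
  case (Var v)
  then show ?case by (cases v) (auto simp: idx_def)
next
  case (Fn h ts)
  show ?case
  proof (rule main_tm_cases[OF Fn.prems(1,2)])
    fix g ss assume s: "Fn h ts = Fn (Inl (Inl (MainFn g))) ss" "\<And>s. s \<in> set ss \<Longrightarrow> wf_tm LS s \<and> tm_sort LS s = Inl MainS"
    have "gv t \<subseteq> idx V nx" if "t \<in> set ts" for t
      by (rule Fn.IH[OF that]) (use s that Fn.prems(3) in auto)
    then show ?thesis using s(1) by auto
  next
    assume "Fn h ts = Fn (Inl (Inl Undet)) []" "has_undet"
    then show ?thesis by (auto simp: idx_def)
  qed simp
qed

lemma pat_fib:
  assumes "pat j nx V e = pat j nx V e0" "i \<in> idx V nx" "l \<in> idx V nx"
  shows "fib j nx e i = fib j nx e l \<longleftrightarrow> fib j nx e0 i = fib j nx e0 l"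
proof -
  have "(i, l) \<in> fst (pat j nx V e) \<longleftrightarrow> (i, l) \<in> fst (pat j nx V e0)" using assms(1) by simp
  then show ?thesis using assms(2,3) by (simp add: pat_def)
qed

text \<open>For a fixed pattern every term may be replaced by one whose generators all lie in its own fibre:
  a function applied to arguments from different fibres yields \<open>u\<close>.\<close>

definition reduced where
  "reduced j nx V e0 t t' \<longleftrightarrow> wf_tm LS t' \<and> tm_sort LS t' = Inl MainS \<and> fv_tm t' \<subseteq> fv_tm t \<and> gv t' \<subseteq> idx V nx \<and>
      (\<forall>i\<in>gv t'. \<forall>l\<in>gv t'. fib j nx e0 i = fib j nx e0 l) \<and>
      (\<forall>e\<in>dom_pat j nx V e0. tm_val S e t = tm_val S e t' \<and> (\<forall>i\<in>gv t'. fibre (projl (tm_val S e t')) = fib j nx e i))"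

lemma reducedD:
  assumes "reduced j nx V e0 t t'"
  shows "wf_tm LS t'" "tm_sort LS t' = Inl MainS" "fv_tm t' \<subseteq> fv_tm t" "gv t' \<subseteq> idx V nx"
    "i \<in> gv t' \<Longrightarrow> l \<in> gv t' \<Longrightarrow> fib j nx e0 i = fib j nx e0 l"
    "e \<in> dom_pat j nx V e0 \<Longrightarrow> tm_val S e t = tm_val S e t'"
    "e \<in> dom_pat j nx V e0 \<Longrightarrow> i \<in> gv t' \<Longrightarrow> fibre (projl (tm_val S e t')) = fib j nx e i"
  using assms unfolding reduced_def by blast+

lemma reducedI:
  assumes "wf_tm LS t'" "tm_sort LS t' = Inl MainS" "fv_tm t' \<subseteq> fv_tm t" "gv t' \<subseteq> idx V nx"
    "\<And>i l. i \<in> gv t' \<Longrightarrow> l \<in> gv t' \<Longrightarrow> fib j nx e0 i = fib j nx e0 l"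
    "\<And>e. e \<in> dom_pat j nx V e0 \<Longrightarrow> tm_val S e t = tm_val S e t'"
    "\<And>e i. e \<in> dom_pat j nx V e0 \<Longrightarrow> i \<in> gv t' \<Longrightarrow> fibre (projl (tm_val S e t')) = fib j nx e i"
  shows "reduced j nx V e0 t t'"
  unfolding reduced_def using assms by (intro conjI ballI)

lemma reduce_term:
  "wf_tm LS t \<Longrightarrow> tm_sort LS t = Inl MainS \<Longrightarrow> gv t \<subseteq> idx V nx \<Longrightarrow>
    \<exists>t'. reduced j nx V e0 t t'"
proof (induction t)
  case (Var v)
  then show ?case by (intro exI[of _ "Var v"]) (cases v, auto simp: reduced_def dom_pat_def)
next
  case (Fn h ts)
  show ?case
  proof (rule main_tm_cases[OF Fn.prems(1,2)])
    assume "Fn h ts = Fn (Inl (Inl Undet)) []" "has_undet"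
    then show ?thesis by (intro exI[of _ "Fn h ts"]) (auto simp: reduced_def idx_def)
  next
    fix g ss assume "Fn h ts = Fn (Inl (Inl (MainFn g))) ss" "g \<in> funs LN" "length ss = length (fdom LN g)" "ss \<noteq> []"
      "\<And>s. s \<in> set ss \<Longrightarrow> wf_tm LS s \<and> tm_sort LS s = Inl MainS"
    then have h: "h = Inl (Inl (MainFn g))" and g: "g \<in> funs LN" "length ts = length (fdom LN g)" "ts \<noteq> []"
      and ts: "\<And>s. s \<in> set ts \<Longrightarrow> wf_tm LS s \<and> tm_sort LS s = Inl MainS" by auto
    have "\<forall>t\<in>set ts. \<exists>t'. reduced j nx V e0 t t'"
    proof
      fix t assume t: "t \<in> set ts"
      show "\<exists>t'. reduced j nx V e0 t t'" by (rule Fn.IH[OF t]) (use ts[OF t] Fn.prems(3) t in \<open>auto simp: h\<close>)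
    qed
    from bchoice[OF this] obtain r where r': "\<And>t. t \<in> set ts \<Longrightarrow> reduced j nx V e0 t (r t)" by blast
    note r = reducedD[OF r']
    have vals: "map (tm_val S e) ts = map (tm_val S e) (map r ts)" if "e \<in> dom_pat j nx V e0" for e
      using r(6)[OF _ that] by simp
    show ?thesis
    \<comment> \<open>The pattern is fixed, so the answer at \<open>e0\<close> is the answer for all
      assignments in \<open>dom_pat j nx V e0\<close>.\<close>
    proof (cases "\<forall>i\<in>(\<Union>t\<in>set ts. gv (r t)). \<forall>l\<in>(\<Union>t\<in>set ts. gv (r t)). fib j nx e0 i = fib j nx e0 l")
      case True
      let ?t = "Fn h (map r ts)"
      have "map (tm_sort LS \<circ> r) ts = map (\<lambda>_. Inl MainS) (fdom LN g)"
        by (rule nth_equalityI) (use r(2) g in auto)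
      then have wf: "wf_tm LS ?t" "tm_sort LS ?t = Inl MainS" using r(1) g by (auto simp: h)
      have gv: "gv ?t = (\<Union>t\<in>set ts. gv (r t))" by (simp add: h)
      have "fibre (projl (tm_val S e ?t)) = fib j nx e i" if e: "e \<in> dom_pat j nx V e0" and i: "i \<in> gv ?t" for e i
      proof -
        have p: "pat j nx V e = pat j nx V e0" using e by (simp add: dom_pat_def)
        have "fibre (projl (tm_val S e (r t))) = fib j nx e i" if t: "t \<in> set ts" for t
        proof -
          obtain l where l: "l \<in> gv (r t)" using gv_nonempty[OF r(1,2)[OF t]] by blast
          have "fib j nx e0 l = fib j nx e0 i" using True l t i unfolding gv by blast
          moreover have "l \<in> idx V nx" "i \<in> idx V nx" using l r(4) t i unfolding gv by blast+
          ultimately show ?thesis using r(7)[OF t e l] pat_fib[OF p] by simp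
        qed
        then have f: "fibre (projl w) = fib j nx e i" if "w \<in> set (map (tm_val S e) (map r ts))" for w using that by auto
        have ne: "map (tm_val S e) (map r ts) \<noteq> []" using g by simp
        show ?thesis unfolding tm_val.simps h S_simps by (subst fibrewise_same[OF ne f]) simp_all
      qed
      moreover have "tm_val S e (Fn h ts) = tm_val S e ?t" if "e \<in> dom_pat j nx V e0" for e
        unfolding tm_val.simps vals[OF that] ..
      moreover have "fv_tm ?t \<subseteq> fv_tm (Fn h ts)" using r(3) by (simp add: UN_mono)
      moreover have "gv ?t \<subseteq> idx V nx" unfolding gv using r(4) by blast
      moreover have "fib j nx e0 i = fib j nx e0 l" if "i \<in> gv ?t" "l \<in> gv ?t" for i l
        by (rule True[rule_format]) (use that in \<open>simp_all only: gv\<close>)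
      ultimately have "reduced j nx V e0 (Fn h ts) ?t" using wf by (intro reducedI)
      then show ?thesis ..
    next
      case False
      then obtain s t i l where sl: "s \<in> set ts" "t \<in> set ts" "i \<in> gv (r s)" "l \<in> gv (r t)" "fib j nx e0 i \<noteq> fib j nx e0 l" by blast
      \<comment> \<open>The generators of one reduced argument share a fibre; hence two different
        arguments are involved, the arity is at least two, and the constant for "undetermined" is in
        the language.\<close>
      have "s \<noteq> t" using r(5)[OF sl(1)] sl by blast
      then have "2 \<le> length ts" using sl(1,2) by (cases ts; cases "tl ts") auto
      then have und: "has_undet" using g by auto
      have "tm_val S e (Fn h ts) = Inl u" if e: "e \<in> dom_pat j nx V e0" for e
      proof -
        have p: "pat j nx V e = pat j nx V e0" using e by (simp add: dom_pat_def)
        have "i \<in> idx V nx" "l \<in> idx V nx" using sl r(4) by blast+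
        then have "fib j nx e i \<noteq> fib j nx e l" using sl(5) pat_fib[OF p] by blast
        then have d: "fibre (projl (tm_val S e s)) \<noteq> fibre (projl (tm_val S e t))"
          unfolding r(6)[OF sl(1) e] r(6)[OF sl(2) e] r(7)[OF sl(1) e sl(3)] r(7)[OF sl(2) e sl(4)] .
        show ?thesis unfolding tm_val.simps h S_simps
          by (subst fibrewise_diff[of "tm_val S e s" _ "tm_val S e t"]) (use sl d in auto)
      qed
      then show ?thesis using und by (intro exI[of _ "Fn (Inl (Inl Undet)) []"]) (auto simp: reduced_def idx_def)
    qed
  qed simp
qed

definition here :: "nat \<Rightarrow> nat \<Rightarrow> (lex_sort + unit) var set \<Rightarrow> ('m, 'n, 'k) lex_env \<Rightarrow> nat set" where
  "here j nx V e0 = {i \<in> idx V nx. fib j nx e0 i = mval j e0}"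

lemma fib_xv [simp]: "fib j nx e (Suc nx) = mval j e"
  by simp

lemma xv_idx: "Suc nx \<in> idx V nx"
  by (simp add: idx_def)

lemma here_iff: "pat j nx V e = pat j nx V e0 \<Longrightarrow> i \<in> idx V nx \<Longrightarrow> fib j nx e i = mval j e \<longleftrightarrow> i \<in> here j nx V e0"
  using pat_fib[of j nx V e e0 i "Suc nx"] xv_idx by (simp add: here_def)

text \<open>Given the pattern of \<open>e0\<close>, a term is either local, that is equal to a term of the fibre
  \<open>mval j\<close>, or external, that is outside that fibre and independent of the variable \<open>nx\<close>.\<close>

definition loc_tm where
  "loc_tm j nx V e0 t t' \<longleftrightarrow> wf_tm L' t' \<and> tm_sort L' t' = Inl () \<and> fv_tm t' \<subseteq> Pair (Inl ()) ` here j nx V e0 \<and>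
     (\<forall>e\<in>dom_pat j nx V e0. \<exists>y. tm_val S e t = Inl (MainElt (mval j e) y) \<and> lval j e t' = Inl y)"

definition ext_tm where
  "ext_tm j nx V e0 t t' \<longleftrightarrow> wf_tm LS t' \<and> tm_sort LS t' = Inl MainS \<and> fv_tm t' \<subseteq> fv_tm t - {xv nx} \<and>
     (\<forall>e\<in>dom_pat j nx V e0. tm_val S e t = tm_val S e t' \<and> fibre (projl (tm_val S e t')) \<noteq> mval j e)"

text \<open>All generators of a reduced term lie in its own fibre. If this is \<open>mval j\<close>,
  the term can be evaluated inside the fibre. Otherwise the variable \<open>nx\<close> cannot be one
  of its generators, since \<open>nx\<close> does lie in \<open>mval j\<close>.\<close>

lemma classify:
  assumes "wf_tm LS t" "tm_sort LS t = Inl MainS" "fv_tm t \<subseteq> V"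
  shows "(\<exists>t'. loc_tm j nx V e0 t t') \<or> (\<exists>t'. ext_tm j nx V e0 t t')"
proof -
  obtain t' where "reduced j nx V e0 t t'" using reduce_term[OF assms(1,2) gv_idx[OF assms]] by blast
  note t' = reducedD[OF this]
  obtain i where i: "i \<in> gv t'" using gv_nonempty[OF t'(1,2)] by blast
  have pat: "pat j nx V e = pat j nx V e0" "ok e" "fibre (projl (e (xv nx))) = mval j e" if "e \<in> dom_pat j nx V e0" for e
    using that by (auto simp: dom_pat_def)
  show ?thesis
  proof (cases "i \<in> here j nx V e0")
    case True
    have sub: "gv t' \<subseteq> here j nx V e0"
    proof
      fix l assume l: "l \<in> gv t'"
      have "fib j nx e0 l = mval j e0" using t'(5)[OF l i] True by (simp add: here_def)
      then show "l \<in> here j nx V e0" using l t'(4) by (auto simp: here_def)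
    qed
    have "loc_tm j nx V e0 t (to_local t')"
      unfolding loc_tm_def
    proof (intro conjI ballI)
      show "fv_tm (to_local t') \<subseteq> Pair (Inl ()) ` here j nx V e0" using to_local[OF t'(1,2)] sub by auto
      fix e assume e: "e \<in> dom_pat j nx V e0"
      have m: "mval j e \<in> univ M" by (rule mval_carr[of e j, OF mv_carr[OF pat(2)[OF e]]])
      have g: "good j e v" if "v \<in> fv_tm (to_local t')" for v
      proof -
        obtain l where l: "v = (Inl (), l)" "l \<in> gv t'" using \<open>v \<in> fv_tm (to_local t')\<close> to_local[OF t'(1,2)] by auto
        \<comment> \<open>Membership in the fibre was decided at \<open>e0\<close>; equality of the
          patterns carries it over to \<open>e\<close>.\<close>
        then have f: "fib j nx e l = mval j e" using here_iff[OF pat(1)[OF e], of l] sub t'(4) by blast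
        show ?thesis
        proof (cases l)
          case 0
          then show ?thesis using f l by simp
        next
          case (Suc n)
          then show ?thesis using f l pat(3)[OF e] main_carr[OF pat(2)[OF e], of n] by (auto split: if_splits)
        qed
      qed
      show "\<exists>y. tm_val S e t = Inl (MainElt (mval j e) y) \<and> lval j e (to_local t') = Inl y"
        using pull_val[of "to_local t'" j e, OF _ g m] to_local[OF t'(1,2)] t'(6)[OF e] by auto
    qed (use to_local[OF t'(1,2)] in auto)
    then show ?thesis by blast
  next
    case False
    have "ext_tm j nx V e0 t t'"
      unfolding ext_tm_def
    proof (intro conjI ballI)
      have "Suc nx \<notin> gv t'"
      proof
        assume "Suc nx \<in> gv t'"
        then have "fib j nx e0 i = mval j e0" using t'(5)[OF i] by simp
        then show False using False i t'(4) by (auto simp: here_def)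
      qed
      then have "(Inl (), Suc nx) \<notin> fv_tm (to_local t')" using to_local[OF t'(1,2)] by auto
      moreover have "xv nx \<in> fv_tm t' \<Longrightarrow> (Inl (), Suc nx) \<in> fv_tm (to_local t')"
      proof -
        \<comment> \<open>\<open>pull\<close> only lowers the numbers of main variables by one, so
          an occurrence of \<open>nx\<close> in a pulled term comes from variable
          \<open>Suc nx\<close>.\<close>
        have *: "(Inl (), Suc nx) \<in> fv_tm s" if "xv nx \<in> fv_tm (pull s)" for s
          using that
        proof (induction s)
          case (Var v)
          then show ?case by (cases v rule: local_var_cases) auto
        qed auto
        show "xv nx \<in> fv_tm t' \<Longrightarrow> (Inl (), Suc nx) \<in> fv_tm (to_local t')" using *[of "to_local t'"] to_local[OF t'(1,2)] by simp
      qed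
      ultimately show "fv_tm t' \<subseteq> fv_tm t - {xv nx}" using t'(3) by blast
      fix e assume e: "e \<in> dom_pat j nx V e0"
      show "tm_val S e t = tm_val S e t'" by (rule t'(6)[OF e])
      show "fibre (projl (tm_val S e t')) \<noteq> mval j e"
        using t'(7)[OF e i] here_iff[OF pat(1)[OF e], of i] False i t'(4) by auto
    qed (use t' in auto)
    then show ?thesis by blast
  qed
qed

section \<open>Decomposing atoms into outer and local predicates\<close>

text \<open>Variables over K whose value is the added point are left out, as they are not
  \<open>good\<close>; by the pattern they are the same variables for all assignments
  considered.\<close>

definition local_vars where
  "local_vars j nx V e0 = Pair (Inl ()) ` here j nx V e0 \<union> {(Inr (), n) | n. (Inr (), n) \<in> V \<and> e0 (Inr (), n) \<noteq> Inr None}"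

definition local_preds where
  "local_preds j nx V e0 = (\<lambda>b e. lsat j e b) ` {b. wf_fm L' b \<and> fv b \<subseteq> local_vars j nx V e0}"

definition outer_vars where
  "outer_vars j nx V = insert (mv j) (V - {xv nx})"

abbreviation "decomposed j nx V e0 \<equiv>
  boolcl (dom_pat j nx V e0) ({R. QF (outer_vars j nx V) R} \<union> local_preds j nx V e0)"

lemma bool_closed_local: "bool_closed (local_preds j nx V e0)"
  unfolding bool_closed_def
proof (intro conjI ballI)
  have "(\<lambda>_. True) = (\<lambda>e. lsat j e (Neg Fls))" by simp
  then show "(\<lambda>_. True) \<in> local_preds j nx V e0" unfolding local_preds_def by (rule image_eqI) simp
next
  fix R assume "R \<in> local_preds j nx V e0"
  then obtain b where b: "R = (\<lambda>e. lsat j e b)" "wf_fm L' b" "fv b \<subseteq> local_vars j nx V e0"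
    unfolding local_preds_def by blast
  have "(\<lambda>e. \<not> R e) = (\<lambda>e. lsat j e (Neg b))" by (simp add: b(1))
  then show "(\<lambda>e. \<not> R e) \<in> local_preds j nx V e0" unfolding local_preds_def by (rule image_eqI) (use b in simp)
  fix R' assume "R' \<in> local_preds j nx V e0"
  then obtain b' where b': "R' = (\<lambda>e. lsat j e b')" "wf_fm L' b'" "fv b' \<subseteq> local_vars j nx V e0"
    unfolding local_preds_def by blast
  have "(\<lambda>e. R e \<and> R' e) = (\<lambda>e. lsat j e (Conj b b'))" by (simp add: b(1) b'(1))
  then show "(\<lambda>e. R e \<and> R' e) \<in> local_preds j nx V e0"
    unfolding local_preds_def by (rule image_eqI) (use b b' in simp)
qed

lemma decomposed_outer:
  assumes "QF (outer_vars j nx V) R'" "\<And>e. e \<in> dom_pat j nx V e0 \<Longrightarrow> R' e = R e"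
  shows "decomposed j nx V e0 R"
  by (rule boolcl.cong[OF boolcl.base assms(2)]) (use assms(1) in simp_all)

lemma decomposed_local:
  assumes "wf_fm L' b" "fv b \<subseteq> local_vars j nx V e0"
    "\<And>e. e \<in> dom_pat j nx V e0 \<Longrightarrow> lsat j e b = R e"
  shows "decomposed j nx V e0 R"
  by (rule boolcl.cong[OF boolcl.base assms(3)]) (use assms(1,2) in \<open>auto simp: local_preds_def\<close>)

lemma decomposed_sat:
  assumes "wf_fm LS \<alpha>" "qf \<alpha>" "fv \<alpha> \<subseteq> outer_vars j nx V" "\<And>e. e \<in> dom_pat j nx V e0 \<Longrightarrow> sat S e \<alpha> = R e"
  shows "decomposed j nx V e0 R"
proof (rule decomposed_outer)
  show "QF (outer_vars j nx V) (\<lambda>e. sat MS e (lift \<alpha>))" by (rule QF_sat) (use assms in simp_all)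
qed (use assms(4) in simp)

lemma decomposed_False:
  assumes "\<And>e. e \<in> dom_pat j nx V e0 \<Longrightarrow> \<not> R e"
  shows "decomposed j nx V e0 R"
  by (rule decomposed_outer[OF QF_False]) (use assms in simp)

lemma loc_tmD:
  assumes "loc_tm j nx V e0 t t'"
  shows "wf_tm L' t'" "tm_sort L' t' = Inl ()" "fv_tm t' \<subseteq> local_vars j nx V e0"
    "e \<in> dom_pat j nx V e0 \<Longrightarrow> tm_val S e t = Inl (MainElt (mval j e) (projl (lval j e t')))"
    "e \<in> dom_pat j nx V e0 \<Longrightarrow> lval j e t' = Inl (projl (lval j e t'))"
  using assms by (force simp: loc_tm_def local_vars_def)+

lemma loc_tm_fibre: "loc_tm j nx V e0 t t' \<Longrightarrow> e \<in> dom_pat j nx V e0 \<Longrightarrow> fibre (projl (tm_val S e t)) = mval j e"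
  by (auto simp: loc_tm_def)

lemma ext_tmD:
  assumes "ext_tm j nx V e0 t t'"
  shows "wf_tm LS t'" "tm_sort LS t' = Inl MainS" "fv_tm t \<subseteq> V \<Longrightarrow> fv_tm t' \<subseteq> outer_vars j nx V"
    "e \<in> dom_pat j nx V e0 \<Longrightarrow> tm_val S e t = tm_val S e t'"
    "e \<in> dom_pat j nx V e0 \<Longrightarrow> fibre (projl (tm_val S e t)) \<noteq> mval j e"
  using assms by (auto simp: ext_tm_def outer_vars_def)

lemma classify_list:
  assumes "\<And>t. t \<in> set ts \<Longrightarrow> wf_tm LS t \<and> tm_sort LS t = Inl MainS \<and> fv_tm t \<subseteq> V"
  obtains (loc) f where "\<And>t. t \<in> set ts \<Longrightarrow> loc_tm j nx V e0 t (f t)"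
  | (ext) f where "\<And>t. t \<in> set ts \<Longrightarrow> ext_tm j nx V e0 t (f t)"
  | (mixed) s s' t t' where "s \<in> set ts" "loc_tm j nx V e0 s s'" "t \<in> set ts" "ext_tm j nx V e0 t t'"
proof -
  have c: "(\<exists>t'. loc_tm j nx V e0 t t') \<or> (\<exists>t'. ext_tm j nx V e0 t t')" if "t \<in> set ts" for t
    by (rule classify) (use assms[OF that] in auto)
  consider "\<forall>t\<in>set ts. \<exists>t'. loc_tm j nx V e0 t t'" | "\<forall>t\<in>set ts. \<exists>t'. ext_tm j nx V e0 t t'"
    | s s' t t' where "s \<in> set ts" "loc_tm j nx V e0 s s'" "t \<in> set ts" "ext_tm j nx V e0 t t'"
    using c by blast
  then show thesis
  proof cases
    case 1
    from bchoice[OF this] show ?thesis using loc by blast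
  next
    case 2
    from bchoice[OF this] show ?thesis using ext by blast
  next
    case 3
    then show ?thesis by (rule mixed)
  qed
qed

text \<open>A term in the fibre \<open>mval j\<close> and one outside it are neither equal nor
  related, so an atom containing both kinds is false. An atom with local terms only is an atom of
  the fibre; one with external terms only no longer contains \<open>nx\<close>.\<close>

lemma decompose_main:
  assumes \<alpha>: "main_atom \<alpha>" "fv \<alpha> \<subseteq> V"
  shows "decomposed j nx V e0 (\<lambda>e. sat S e \<alpha>)"
proof -
  consider t s where "\<alpha> = Eq t s" "tm_sort LS t = Inl MainS" | q ts where "\<alpha> = Rel (Inl (Inr q)) ts" "ts \<noteq> []"
    using \<alpha>(1) by (auto simp: main_atom_def)
  then show ?thesis
  proof cases
    case 1
    have wf: "wf_tm LS x \<and> tm_sort LS x = Inl MainS \<and> fv_tm x \<subseteq> V" if "x \<in> {t, s}" for x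
      using \<alpha> that 1 by (auto simp: main_atom_def)
    have cl: "(\<exists>x'. loc_tm j nx V e0 x x') \<or> (\<exists>x'. ext_tm j nx V e0 x x')" if "x \<in> {t, s}" for x
      by (rule classify) (use wf[OF that] in auto)
    consider t' s' where "loc_tm j nx V e0 t t'" "loc_tm j nx V e0 s s'"
      | t' s' where "loc_tm j nx V e0 t t'" "ext_tm j nx V e0 s s'"
      | t' s' where "ext_tm j nx V e0 t t'" "loc_tm j nx V e0 s s'"
      | t' s' where "ext_tm j nx V e0 t t'" "ext_tm j nx V e0 s s'"
      using cl[of t] cl[of s] by blast
    then show ?thesis
    proof cases
      case l: 1
      show ?thesis
      proof (rule decomposed_local[of "Eq t' s'"])
        fix e assume e: "e \<in> dom_pat j nx V e0"
        show "lsat j e (Eq t' s') = sat S e \<alpha>"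
          using loc_tmD(4,5)[OF l(1) e] loc_tmD(4,5)[OF l(2) e] by (simp add: 1) (metis sum.sel(1))
      qed (use loc_tmD(1-3)[OF l(1)] loc_tmD(1-3)[OF l(2)] in auto)
    next
      case l: 2
      show ?thesis
      proof (rule decomposed_False)
        fix e assume e: "e \<in> dom_pat j nx V e0"
        show "\<not> sat S e \<alpha>" using loc_tm_fibre[OF l(1) e] ext_tmD(5)[OF l(2) e] by (auto simp: 1)
      qed
    next
      case l: 3
      show ?thesis
      proof (rule decomposed_False)
        fix e assume e: "e \<in> dom_pat j nx V e0"
        show "\<not> sat S e \<alpha>" using loc_tm_fibre[OF l(2) e] ext_tmD(5)[OF l(1) e] by (auto simp: 1)
      qed
    next
      case l: 4
      show ?thesis
      proof (rule decomposed_sat[of "Eq t' s'"])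
        fix e assume e: "e \<in> dom_pat j nx V e0"
        show "sat S e (Eq t' s') = sat S e \<alpha>" using ext_tmD(4)[OF l(1) e] ext_tmD(4)[OF l(2) e] by (simp add: 1)
      qed (use ext_tmD(1-3)[OF l(1)] ext_tmD(1-3)[OF l(2)] wf in auto)
    qed
  next
    case 2
    have q: "q \<in> rels LN" "map (tm_sort LS) ts = map (\<lambda>_. Inl MainS) (rdom LN q)" "\<forall>t\<in>set ts. wf_tm LS t"
      using \<alpha>(1) by (auto simp: main_atom_def 2)
    have len: "length ts = length (rdom LN q)" using arg_cong[OF q(2), of length] by simp
    have ts: "wf_tm LS t \<and> tm_sort LS t = Inl MainS \<and> fv_tm t \<subseteq> V" if t: "t \<in> set ts" for t
    proof -
      have "tm_sort LS t \<in> set (map (\<lambda>_. Inl MainS) (rdom LN q))" unfolding q(2)[symmetric] using t by simp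
      then show ?thesis using t q(3) \<alpha>(2) by (auto simp: 2)
    qed
    show ?thesis
    proof (rule classify_list[OF ts, where j = j and nx = nx and ?e0.0 = e0])
      fix f assume f: "\<And>t. t \<in> set ts \<Longrightarrow> loc_tm j nx V e0 t (f t)"
      show ?thesis
      proof (rule decomposed_local[of "Rel (Inl q) (map f ts)"])
        have "map (tm_sort L') (map f ts) = map Inl (rdom LN q)" unfolding sorts_main using len loc_tmD(2)[OF f] by simp
        then show "wf_fm L' (Rel (Inl q) (map f ts))" using q(1) loc_tmD(1)[OF f] by simp
        show "fv (Rel (Inl q) (map f ts)) \<subseteq> local_vars j nx V e0" using loc_tmD(3)[OF f] by auto
        fix e assume e: "e \<in> dom_pat j nx V e0"
        let ?xs = "map (\<lambda>t. projl (lval j e (f t))) ts"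
        have vals: "map (lval j e) (map f ts) = map Inl ?xs"
          "map (tm_val S e) ts = map (Inl \<circ> MainElt (mval j e)) ?xs"
          using loc_tmD(5)[OF f e] loc_tmD(4)[OF f e] by auto
        have m: "mval j e \<in> univ M" using e by (intro mval_carr[of e j] mv_carr) (simp add: dom_pat_def)
        have ne: "?xs \<noteq> []" using 2(2) by simp
        from fibre_rel[OF m ne] show "lsat j e (Rel (Inl q) (map f ts)) = sat S e \<alpha>"
          unfolding 2 sat.simps vals S_simps by (simp add: comp_def)
      qed
    next
      fix f assume f: "\<And>t. t \<in> set ts \<Longrightarrow> ext_tm j nx V e0 t (f t)"
      show ?thesis
      proof (rule decomposed_sat[of "Rel (Inl (Inr q)) (map f ts)"])
        have "map (tm_sort LS \<circ> f) ts = map (\<lambda>_. Inl MainS) (rdom LN q)"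
          by (rule nth_equalityI) (use ext_tmD(2)[OF f] len in auto)
        then show "wf_fm LS (Rel (Inl (Inr q)) (map f ts))" using q(1) ext_tmD(1)[OF f] by simp
        show "fv (Rel (Inl (Inr q)) (map f ts)) \<subseteq> outer_vars j nx V" using ext_tmD(3)[OF f] ts by fastforce
        fix e assume e: "e \<in> dom_pat j nx V e0"
        have "map (tm_val S e) (map f ts) = map (tm_val S e) ts" using ext_tmD(4)[OF f e] by simp
        then show "sat S e (Rel (Inl (Inr q)) (map f ts)) = sat S e \<alpha>" by (simp only: 2 sat.simps)
      qed simp
    next
      fix s s' t t' assume st: "s \<in> set ts" "loc_tm j nx V e0 s s'" "t \<in> set ts" "ext_tm j nx V e0 t t'"
      show ?thesis
      proof (rule decomposed_False)
        fix e assume e: "e \<in> dom_pat j nx V e0"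
        have d: "fibre (projl (tm_val S e s)) \<noteq> fibre (projl (tm_val S e t))"
          using loc_tm_fibre[OF st(2) e] ext_tmD(5)[OF st(4) e] by simp
        have "\<not> (map projl (map (tm_val S e) ts) = map (MainElt a) bs)" for a bs
        proof
          assume eq: "map projl (map (tm_val S e) ts) = map (MainElt a) bs"
          have "fibre (projl (tm_val S e x)) = a" if "x \<in> set ts" for x
          proof -
            have "projl (tm_val S e x) \<in> set (map (MainElt a) bs)" unfolding eq[symmetric] using that by simp
            then show ?thesis by auto
          qed
          then show False using d st by metis
        qed
        then show "\<not> sat S e \<alpha>" unfolding 2 sat.simps S_simps by blast
      qed
    qed
  qed
qed

text \<open>Either choice of 0 provides a constant in the language of the sum: a constant of K or
  the newly added one. It replaces a map to K whose arguments come from different fibres.\<close>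

lemma zero_symbol: "Inl (Inr z) \<in> funs LS \<and> fdom LS (Inl (Inr z)) = []"
proof -
  have "Inl (Inr w) \<in> funs LS \<and> fdom LS (Inl (Inr w)) = []" if w: "w = z" for w
  proof (cases w)
    case None
    then have "z = None" using w by simp
    then have "Inl (Inr None) \<in> funs LS" by (rule LS_simps(7)[THEN iffD2])
    then show ?thesis unfolding None by (intro conjI LS_simps(14))
  next
    case (Some c)
    have "zero_choice LK w" using zero w by simp
    then have "c \<in> funs LK \<and> fdom LK c = []" by (simp add: Some zero_choice_def)
    then show ?thesis unfolding Some by simp
  qed
  then show ?thesis by blast
qed

lemma zero_val: "tm_val S e (Fn (Inl (Inr w)) []) = Inr (zero_elt K w)"
  by (cases w) (simp_all add: zero_elt_def)

text \<open>The projection of a local term is the value of \<open>mv j\<close>. A map to K with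
  local arguments has a value among the original points: the equation can be tested in the fibre, or
  it is false because the variable holds the added point. With local and external arguments together
  the value is 0; with external ones only, the equation does not involve \<open>nx\<close>.\<close>

lemma decompose_iface:
  assumes p: "iface p" "fv_tm p \<subseteq> V" "(tm_sort LS p, n) \<in> V"
  shows "decomposed j nx V e0 (\<lambda>e. e (tm_sort LS p, n) = tm_val S e p)"
proof (rule iface_args[OF p(1)])
  fix t assume t: "p = Fn (Inl (Inl Proj)) [t]" "wf_tm LS t" "tm_sort LS t = Inl MainS"
  have srt: "tm_sort LS p = Inl BaseS" by (simp add: t(1))
  have "(\<exists>t'. loc_tm j nx V e0 t t') \<or> (\<exists>t'. ext_tm j nx V e0 t t')"
    by (rule classify) (use t p in auto)
  then show ?thesis
  proof (elim disjE exE)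
    fix t' assume l: "loc_tm j nx V e0 t t'"
    show ?thesis
    proof (rule decomposed_sat[of "Eq (Var (Inl BaseS, n)) (Var (mv j))"])
      show "fv (Eq (Var (Inl BaseS, n)) (Var (mv j))) \<subseteq> outer_vars j nx V" using p(3) srt by (auto simp: outer_vars_def)
      fix e assume e: "e \<in> dom_pat j nx V e0"
      have "e (mv j) \<in> carr S (Inl BaseS)" using e by (intro mv_carr) (simp add: dom_pat_def)
      then have "e (mv j) = Inl (BaseElt (mval j e))" by (auto simp: mval_def)
      then show "sat S e (Eq (Var (Inl BaseS, n)) (Var (mv j))) = (e (tm_sort LS p, n) = tm_val S e p)"
        using loc_tmD(4)[OF l e] by (simp add: srt) (simp add: t(1))
    qed simp_all
  next
    fix t' assume l: "ext_tm j nx V e0 t t'"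
    show ?thesis
    proof (rule decomposed_sat[of "Eq (Var (Inl BaseS, n)) (Fn (Inl (Inl Proj)) [t'])"])
      show "fv (Eq (Var (Inl BaseS, n)) (Fn (Inl (Inl Proj)) [t'])) \<subseteq> outer_vars j nx V"
        using p srt ext_tmD(3)[OF l] t(1) by (auto simp: outer_vars_def)
      fix e assume e: "e \<in> dom_pat j nx V e0"
      show "sat S e (Eq (Var (Inl BaseS, n)) (Fn (Inl (Inl Proj)) [t'])) = (e (tm_sort LS p, n) = tm_val S e p)"
        using ext_tmD(4)[OF l e] by (simp add: srt) (simp add: t(1))
    qed (use ext_tmD(1,2)[OF l] in simp_all)
  qed
next
  fix i ts assume p': "p = Fn (Inr i) ts" and i: "i \<in> I" "length ts = k i" "ts \<noteq> []"
    and ts': "\<And>s. s \<in> set ts \<Longrightarrow> wf_tm LS s \<and> tm_sort LS s = Inl MainS"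
  have ts: "wf_tm LS s \<and> tm_sort LS s = Inl MainS \<and> fv_tm s \<subseteq> V" if "s \<in> set ts" for s
    using ts'[OF that] p(2) that by (auto simp: p')
  have srt: "tm_sort LS p = Inr ()" by (simp add: p')
  let ?v = "(Inr (), n) :: (lex_sort + unit) var"
  have vV: "?v \<in> V" using p(3) srt by simp
  have vo: "?v \<in> outer_vars j nx V" using vV by (auto simp: outer_vars_def)
  show ?thesis
  proof (rule classify_list[OF ts, where j = j and nx = nx and ?e0.0 = e0])
    fix f assume f: "\<And>t. t \<in> set ts \<Longrightarrow> loc_tm j nx V e0 t (f t)"
    have val: "\<exists>y. tm_val S e p = Inr (Some y) \<and> lval j e (Fn (Inr i) (map f ts)) = Inr y"
      if e: "e \<in> dom_pat j nx V e0" for e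
    proof -
      let ?xs = "map (\<lambda>t. projl (lval j e (f t))) ts"
      have vals: "map (lval j e) (map f ts) = map Inl ?xs"
        "map (tm_val S e) ts = map (Inl \<circ> MainElt (mval j e)) ?xs"
        using loc_tmD(5)[OF f e] loc_tmD(4)[OF f e] by auto
      have ne: "map (Inl \<circ> MainElt (mval j e)) ?xs \<noteq> []" using i by simp
      have "tm_val S e p = Inr (Some (lam i (mval j e) ?xs))"
        unfolding p' tm_val.simps vals S_simps by (subst fibrewise_same[OF ne, of "mval j e"]) (auto simp: comp_def)
      moreover have "lval j e (Fn (Inr i) (map f ts)) = Inr (lam i (mval j e) ?xs)"
        unfolding tm_val.simps vals by (simp add: comp_def)
      ultimately show ?thesis by blast
    qed
    \<comment> \<open>Owing to the second component of the pattern, the case distinction at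
      \<open>e0\<close> is valid for all \<open>e\<close> considered.\<close>
    have zero: "e ?v = Inr None \<longleftrightarrow> e0 ?v = Inr None" if "e \<in> dom_pat j nx V e0" for e
    proof -
      have "n \<in> snd (pat j nx V e) \<longleftrightarrow> n \<in> snd (pat j nx V e0)" using that by (simp add: dom_pat_def)
      then show ?thesis using vV by (simp add: pat_def)
    qed
    show ?thesis
    proof (cases "e0 ?v = Inr None")
      case True
      show ?thesis
      proof (rule decomposed_False)
        fix e assume e: "e \<in> dom_pat j nx V e0"
        then show "e (tm_sort LS p, n) \<noteq> tm_val S e p" using val[OF e] zero[OF e] True srt by auto
      qed
    next
      case False
      show ?thesis
      proof (rule decomposed_local[of "Eq (Var (Inr (), n)) (Fn (Inr i) (map f ts))"])
        have "map (tm_sort L') (map f ts) = replicate (k i) (Inl ())" unfolding sorts_rep using i loc_tmD(2)[OF f] by simp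
        then show "wf_fm L' (Eq (Var (Inr (), n)) (Fn (Inr i) (map f ts)))"
          using i loc_tmD(1)[OF f] by simp
        show "fv (Eq (Var (Inr (), n)) (Fn (Inr i) (map f ts))) \<subseteq> local_vars j nx V e0"
          using loc_tmD(3)[OF f] False vV by (auto simp: local_vars_def)
        fix e assume e: "e \<in> dom_pat j nx V e0"
        obtain y where y: "tm_val S e p = Inr (Some y)" "lval j e (Fn (Inr i) (map f ts)) = Inr y"
          using val[OF e] by blast
        have "ok e" using e by (simp add: dom_pat_def)
        then have "e ?v \<in> carr S (Inr ())" unfolding ok_def by (metis fst_conv)
        then obtain w where w: "e ?v = Inr (Some w)" using zero[OF e] False by (auto split: if_splits)
        show "lsat j e (Eq (Var (Inr (), n)) (Fn (Inr i) (map f ts))) = (e (tm_sort LS p, n) = tm_val S e p)"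
          unfolding sat.simps y srt by (simp add: w)
      qed
    qed
  next
    fix f assume f: "\<And>t. t \<in> set ts \<Longrightarrow> ext_tm j nx V e0 t (f t)"
    show ?thesis
    proof (rule decomposed_sat[of "Eq (Var ?v) (Fn (Inr i) (map f ts))"])
      have "map (tm_sort LS \<circ> f) ts = replicate (k i) (Inl MainS)"
        by (rule nth_equalityI) (use ext_tmD(2)[OF f] i in auto)
      then show "wf_fm LS (Eq (Var ?v) (Fn (Inr i) (map f ts)))" using i ext_tmD(1)[OF f] by simp
      show "fv (Eq (Var ?v) (Fn (Inr i) (map f ts))) \<subseteq> outer_vars j nx V" using ext_tmD(3)[OF f] ts vo by fastforce
      fix e assume e: "e \<in> dom_pat j nx V e0"
      have "map (tm_val S e) (map f ts) = map (tm_val S e) ts" using ext_tmD(4)[OF f e] by simp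
      then show "sat S e (Eq (Var ?v) (Fn (Inr i) (map f ts))) = (e (tm_sort LS p, n) = tm_val S e p)"
        unfolding sat.simps tm_val.simps p' by (simp only: tm_sort.simps LS_simps)
    qed simp
  next
    fix s s' t t' assume st: "s \<in> set ts" "loc_tm j nx V e0 s s'" "t \<in> set ts" "ext_tm j nx V e0 t t'"
    show ?thesis
    proof (rule decomposed_sat[of "Eq (Var ?v) (Fn (Inl (Inr z)) [])"])
      show "wf_fm LS (Eq (Var ?v) (Fn (Inl (Inr z)) []))"
        using zero_symbol by simp
      show "fv (Eq (Var ?v) (Fn (Inl (Inr z)) [])) \<subseteq> outer_vars j nx V" using vo by simp
      fix e assume e: "e \<in> dom_pat j nx V e0"
      have d: "fibre (projl (tm_val S e s)) \<noteq> fibre (projl (tm_val S e t))"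
        using loc_tm_fibre[OF st(2) e] ext_tmD(5)[OF st(4) e] by simp
      have "tm_val S e p = Inr (zero_elt K z)"
        unfolding p' tm_val.simps S_simps by (subst fibrewise_diff[of "tm_val S e s" _ "tm_val S e t"]) (use st d in auto)
      then show "sat S e (Eq (Var ?v) (Fn (Inl (Inr z)) [])) = (e (tm_sort LS p, n) = tm_val S e p)"
        by (simp only: sat.simps srt tm_val.simps(1) zero_val)
    qed simp
  qed
qed

section \<open>Elimination of a main-sort quantifier\<close>

lemma finite_idx: "finite V \<Longrightarrow> finite (idx V nx)"
proof -
  assume "finite V"
  then have "finite (Suc ` snd ` V)" by simp
  moreover have "{Suc n | n. (Inl MainS, n) \<in> V} \<subseteq> Suc ` snd ` V" by force
  ultimately have "finite {Suc n | n. (Inl MainS, n) \<in> V}" by (rule rev_finite_subset)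
  then show ?thesis unfolding idx_def by (cases has_undet) simp_all
qed

lemma finite_pat: "finite V \<Longrightarrow> finite (pat j nx V ` A)"
proof (rule finite_subset)
  assume "finite V"
  then have "finite {n. (Inr (), n) \<in> V}" using finite_imageI[of V snd] by (rule_tac finite_subset[of _ "snd ` V"]) force+
  then show "finite (Pow (idx V nx \<times> idx V nx) \<times> Pow {n. (Inr (), n) \<in> V})" using finite_idx[OF \<open>finite V\<close>] by simp
qed (auto simp: pat_def)

text \<open>In \<open>fib\<close> the variable \<open>nx\<close> is represented by the fibre named
  by \<open>j\<close>, so the pattern does not change while \<open>nx\<close> varies.\<close>

lemma pat_cong:
  "mval j e = mval j e' \<Longrightarrow> (\<And>v. v \<in> V \<Longrightarrow> v \<noteq> xv nx \<Longrightarrow> e v = e' v) \<Longrightarrow> pat j nx V e = pat j nx V e'"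
proof -
  assume m: "mval j e = mval j e'" and e: "\<And>v. v \<in> V \<Longrightarrow> v \<noteq> xv nx \<Longrightarrow> e v = e' v"
  have "fib j nx e i = fib j nx e' i" if "i \<in> idx V nx" for i
  proof (cases i)
    case (Suc n)
    then show ?thesis using that m e[of "(Inl MainS, n)"] by (auto simp: idx_def split: if_splits)
  qed simp
  moreover have "e (Inr (), n) = e' (Inr (), n)" if "(Inr (), n) \<in> V" for n using e[OF that] by simp
  ultimately show ?thesis unfolding pat_def by auto
qed

section \<open>Patterns can be tested without quantifiers\<close>

text \<open>A generator's fibre is a projection, except for \<open>nx\<close>, whose place is taken
  by the variable \<open>mv j\<close>. So two generators lying in one fibre is expressed by an atom
  not containing \<open>nx\<close>.\<close>

lemma base_of_fib:
  assumes "i \<in> idx V nx"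
  obtains t where "wf_tm LS t" "tm_sort LS t = Inl BaseS" "fv_tm t \<subseteq> outer_vars j nx V"
    "\<And>e. ok e \<Longrightarrow> tm_val S e t = Inl (BaseElt (fib j nx e i))"
proof (cases i)
  case 0
  then have und: "has_undet" using assms by (auto simp: idx_def split: if_splits)
  show thesis by (rule that[of "Fn (Inl (Inl Proj)) [Fn (Inl (Inl Undet)) []]"]) (use und in \<open>simp_all add: 0\<close>)
next
  case (Suc n)
  show thesis
  proof (cases "n = nx")
    case True
    show thesis
    proof (rule that[of "Var (mv j)"])
      fix e assume "ok e"
      then have "e (mv j) \<in> carr S (Inl BaseS)" by (rule mv_carr)
      then show "tm_val S e (Var (mv j)) = Inl (BaseElt (fib j nx e i))" by (auto simp: Suc True mval_def)
    qed (simp_all add: outer_vars_def)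
  next
    case False
    then have "(Inl MainS, n) \<in> V" using assms by (auto simp: idx_def Suc split: if_splits)
    then show thesis using False by (intro that[of "Fn (Inl (Inl Proj)) [Var (Inl MainS, n)]"]) (simp_all add: outer_vars_def Suc)
  qed
qed

lemma QF_fib:
  assumes "i \<in> idx V nx" "l \<in> idx V nx"
  shows "QF (outer_vars j nx V) (\<lambda>e. fib j nx e i = fib j nx e l)"
proof -
  obtain t where t: "wf_tm LS t" "tm_sort LS t = Inl BaseS" "fv_tm t \<subseteq> outer_vars j nx V"
    "\<And>e. ok e \<Longrightarrow> tm_val S e t = Inl (BaseElt (fib j nx e i))" by (rule base_of_fib[OF assms(1)]) (rule that)
  obtain s where s: "wf_tm LS s" "tm_sort LS s = Inl BaseS" "fv_tm s \<subseteq> outer_vars j nx V"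
    "\<And>e. ok e \<Longrightarrow> tm_val S e s = Inl (BaseElt (fib j nx e l))" by (rule base_of_fib[OF assms(2)]) (rule that)
  show ?thesis by (rule QF_I[of "Eq t s"]) (use t s in simp_all)
qed

lemma QF_zero: "(Inr (), n) \<in> V \<Longrightarrow> QF V (\<lambda>e. e (Inr (), n) = Inr None)"
proof (rule QF_I[of "lift (Neg (nonzero n))"])
  assume V: "(Inr (), n) \<in> V"
  show "fv (lift (Neg (nonzero n))) \<subseteq> V" using nonzero_simps(4)[of n] V by auto
  fix e assume e: "ok e"
  then have c: "e (Inr (), n) \<in> carr S (Inr ())" unfolding ok_def by (metis fst_conv)
  then have "e (Inr (), n) = Inr None \<longleftrightarrow> e (Inr (), n) \<notin> Inr ` Some ` univ K"
    by (auto split: if_splits)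
  then show "(e (Inr (), n) = Inr None) = sat MS e (lift (Neg (nonzero n)))"
    using nonzero_simps(5)[of e n, OF c] by simp
qed (simp_all add: nonzero_simps)

lemma QF_pat:
  assumes "finite V"
  shows "QF (outer_vars j nx V) (\<lambda>e. pat j nx V e = p)"
proof -
  obtain A B where p: "p = (A, B)" by (cases p)
  have eq: "pat j nx V e = p \<longleftrightarrow> (A \<subseteq> idx V nx \<times> idx V nx \<and> B \<subseteq> {n. (Inr (), n) \<in> V}) \<and>
      (\<forall>x\<in>idx V nx \<times> idx V nx. (fib j nx e (fst x) = fib j nx e (snd x)) = (x \<in> A)) \<and>
      (\<forall>n\<in>{n. (Inr (), n) \<in> V}. (e (Inr (), n) = Inr None) = (n \<in> B))" for e
    unfolding p pat_def by auto
  have iff: "QF W (\<lambda>e. R e = b)" if "QF W R" for W R b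
    using QF_neg[OF that] that by (cases b) simp_all
  show ?thesis unfolding eq
  proof (rule QF_conj[OF QF_const QF_conj[OF QF_ball QF_ball]])
    show "finite (idx V nx \<times> idx V nx)" using finite_idx[OF assms] by simp
    have "{n. (Inr (), n) \<in> V} \<subseteq> snd ` V" by force
    then show "finite {n. (Inr (), n) \<in> V}" using assms by (meson finite_imageI finite_subset)
  next
    fix x assume "x \<in> idx V nx \<times> idx V nx"
    then show "QF (outer_vars j nx V) (\<lambda>e. (fib j nx e (fst x) = fib j nx e (snd x)) = (x \<in> A))"
      by (intro iff QF_fib) auto
  next
    fix n assume "n \<in> {n. (Inr (), n) \<in> V}"
    then show "QF (outer_vars j nx V) (\<lambda>e. (e (Inr (), n) = Inr None) = (n \<in> B))"
      by (intro iff QF_zero) (simp add: outer_vars_def)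
  qed
qed

text \<open>Equations by which a variable stands for an interface term.\<close>

definition link_gen where
  "link_gen V = {R. \<exists>p n. R = (\<lambda>e. e (tm_sort LS p, n) = tm_val S e p) \<and> iface p \<and> fv_tm p \<subseteq> V \<and> (tm_sort LS p, n) \<in> V}"

lemma gen_dep:
  assumes "boolcl UNIV (main_gen V \<union> link_gen V) \<gamma>" and e: "\<And>v. v \<in> V \<Longrightarrow> e v = e' v"
  shows "\<gamma> e = \<gamma> e'"
  using assms(1)
proof (induction rule: boolcl.induct)
  case (base R)
  then consider "R = (\<lambda>_. True)" | \<alpha> where "R = (\<lambda>e. sat S e \<alpha>)" "fv \<alpha> \<subseteq> V" | "R \<in> link_gen V"
    by (auto simp: main_gen_def)
  then show ?case
  proof cases
    case 2
    show ?thesis unfolding 2(1) by (rule sat_cong) (use 2(2) e in blast)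
  next
    case 3
    then obtain p n where p: "R = (\<lambda>e. e (tm_sort LS p, n) = tm_val S e p)" "fv_tm p \<subseteq> V" "(tm_sort LS p, n) \<in> V"
      unfolding link_gen_def by blast
    have "tm_val S e p = tm_val S e' p" by (rule tm_val_cong) (use p(2) e in blast)
    then show ?thesis using e[OF p(3)] by (simp add: p(1))
  qed simp
qed simp_all

lemma decompose_gen:
  assumes "R \<in> main_gen V \<union> link_gen V"
  shows "decomposed j nx V e0 R"
proof -
  consider "R = (\<lambda>_. True)" | \<alpha> where "R = (\<lambda>e. sat S e \<alpha>)" "main_atom \<alpha>" "fv \<alpha> \<subseteq> V"
    | p n where "R = (\<lambda>e. e (tm_sort LS p, n) = tm_val S e p)" "iface p" "fv_tm p \<subseteq> V" "(tm_sort LS p, n) \<in> V"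
    using assms by (auto simp: main_gen_def link_gen_def)
  then show ?thesis
  proof cases
    case 1
    show ?thesis unfolding 1 by (rule boolcl.base) (simp add: QF_const)
  next
    case 2
    show ?thesis unfolding 2(1) by (rule decompose_main[OF 2(2,3)])
  next
    case 3
    show ?thesis unfolding 3(1) by (rule decompose_iface[OF 3(2-4)])
  qed
qed

section \<open>Eliminating the new element\<close>

text \<open>The quantifier is put in front of \<open>b\<close> in the language of the expanded
  fibre, where the finitely many candidates eliminate it. The variable of the new element is bound
  there, and the remaining variables correspond to outer ones.\<close>

lemma local_ex:
  assumes j: "mv j \<notin> V" and b: "wf_fm L' b" "fv b \<subseteq> local_vars j nx V e0"
  obtains R where "QF (outer_vars j nx V) R"
    "\<And>e. ok e \<Longrightarrow> pat j nx V e = pat j nx V e0 \<Longrightarrow>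
      R e = (\<exists>y\<in>univ (N (mval j e)). sat (N' (mval j e)) ((loc e)((Inl (), Suc nx) := Inl y)) b)"
proof -
  let ?b = "Ex (Inl (), Suc nx) b"
  have v: "(\<exists>i. v = (Inl (), i) \<and> i \<in> here j nx V e0 \<and> i \<noteq> Suc nx) \<or> (\<exists>n. v = (Inr (), n) \<and> (Inr (), n) \<in> V \<and> e0 (Inr (), n) \<noteq> Inr None)"
    if "v \<in> fv ?b" for v
    using that b(2) by (auto simp: local_vars_def)
  have idx: "i \<in> idx V nx" if "i \<in> here j nx V e0" for i using that by (simp add: here_def)
  have wf: "wf_fm L' ?b" using b(1) by simp
  have av: "\<forall>v\<in>fv ?b. avail v"
  proof
    fix w assume "w \<in> fv ?b"
    from v[OF this] show "avail w"
    proof (elim disjE exE conjE)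
      fix i assume i: "w = (Inl (), i)" "i \<in> here j nx V e0"
      then show ?thesis using idx[OF i(2)] by (cases i) (auto simp: idx_def split: if_splits)
    qed simp
  qed
  obtain R where R: "QF (insert (mv j) (\<Union>v\<in>fv ?b. pull_vars v)) R"
    "\<And>e. ok e \<Longrightarrow> \<forall>v\<in>fv ?b. good j e v \<Longrightarrow> R e = lsat j e ?b"
    by (rule local_formula[OF wf av, of j]) (rule that)
  show thesis
  proof (rule that)
    show "QF (outer_vars j nx V) R"
    proof (rule QF_mono[OF R(1)], rule insert_subsetI)
      show "mv j \<in> outer_vars j nx V" by (simp add: outer_vars_def)
      show "(\<Union>v\<in>fv ?b. pull_vars v) \<subseteq> outer_vars j nx V"
      proof (rule UN_least)
        fix w assume "w \<in> fv ?b"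
        from v[OF this] show "pull_vars w \<subseteq> outer_vars j nx V"
        proof (elim disjE exE conjE)
          fix i assume i: "w = (Inl (), i)" "i \<in> here j nx V e0" "i \<noteq> Suc nx"
          then show ?thesis using idx[OF i(2)] by (cases i) (auto simp: idx_def outer_vars_def split: if_splits)
        qed (simp add: outer_vars_def)
      qed
    qed
    fix e assume e: "ok e" "pat j nx V e = pat j nx V e0"
    have "good j e w" if "w \<in> fv ?b" for w
      using v[OF that]
    proof (elim disjE exE conjE)
      fix i assume i: "w = (Inl (), i)" "i \<in> here j nx V e0" "i \<noteq> Suc nx"
      have "fib j nx e i = mval j e" using here_iff[OF e(2) idx[OF i(2)]] i(2) by simp
      then show ?thesis using i main_carr[OF e(1)] by (cases i) auto
    next
      fix n assume n: "w = (Inr (), n)" "(Inr (), n) \<in> V" "e0 (Inr (), n) \<noteq> Inr None"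
      have "n \<in> snd (pat j nx V e) \<longleftrightarrow> n \<in> snd (pat j nx V e0)" using e(2) by simp
      then have "e (Inr (), n) \<noteq> Inr None" using n by (simp add: pat_def)
      moreover have "e (Inr (), n) \<in> carr S (Inr ())" using e(1) unfolding ok_def by (metis fst_conv)
      ultimately show ?thesis using n(1) by (auto split: if_splits)
    qed
    then have "R e = lsat j e ?b" using R(2)[OF e(1)] by blast
    also have "\<dots> = (\<exists>y\<in>univ (N (mval j e)). sat (N' (mval j e)) ((loc e)((Inl (), Suc nx) := Inl y)) b)" by simp
    finally show "R e = (\<exists>y\<in>univ (N (mval j e)). sat (N' (mval j e)) ((loc e)((Inl (), Suc nx) := Inl y)) b)" .
  qed
qed

text \<open>Here the fibre is held fixed by \<open>j\<close>. For a fixed pattern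
  \<open>\<gamma>\<close> is a disjunction of conjunctions with one outer and one local factor; the
  outer factor leaves the scope of the quantifier and the local one is handled inside the
  fibre.\<close>

lemma QF_ex_fibre:
  assumes V: "finite V" and j: "mv j \<notin> V" and \<gamma>: "boolcl UNIV (main_gen V \<union> link_gen V) \<gamma>"
  shows "QF (outer_vars j nx V) (\<lambda>e. \<exists>y\<in>univ (N (mval j e)). \<gamma> (e(xv nx := Inl (MainElt (mval j e) y))))"
proof (rule QF_cases[of "pat j nx V"])
  show "finite (pat j nx V ` {e. ok e})" by (rule finite_pat[OF V])
  show "QF (outer_vars j nx V) (\<lambda>e. pat j nx V e = p)" for p by (rule QF_pat[OF V])
  fix e0
  have "decomposed j nx V e0 \<gamma>" by (rule boolcl_mono[OF \<gamma>]) (simp, rule decompose_gen)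
  then have "dnf (dom_pat j nx V e0) {R. QF (outer_vars j nx V) R} (local_preds j nx V e0) \<gamma>"
    by (rule boolcl_dnf[OF QF_bool_closed bool_closed_local])
  then obtain P where P: "finite P" "P \<subseteq> {R. QF (outer_vars j nx V) R} \<times> local_preds j nx V e0"
    "\<And>e. e \<in> dom_pat j nx V e0 \<Longrightarrow> \<gamma> e = (\<exists>p\<in>P. fst p e \<and> snd p e)" by (rule dnfE) (rule that)
  have "\<forall>p\<in>P. \<exists>R. QF (outer_vars j nx V) R \<and> (\<forall>e. ok e \<longrightarrow> pat j nx V e = pat j nx V e0 \<longrightarrow>
    R e = (fst p e \<and> (\<exists>y\<in>univ (N (mval j e)). snd p (e(xv nx := Inl (MainElt (mval j e) y))))))"
  proof
    fix p assume "p \<in> P"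
    then have p: "QF (outer_vars j nx V) (fst p)" "snd p \<in> local_preds j nx V e0" using P(2) by auto
    obtain b where b: "snd p = (\<lambda>e. lsat j e b)" "wf_fm L' b" "fv b \<subseteq> local_vars j nx V e0"
      using p(2) unfolding local_preds_def by blast
    obtain R where R: "QF (outer_vars j nx V) R"
      "\<And>e. ok e \<Longrightarrow> pat j nx V e = pat j nx V e0 \<Longrightarrow>
      R e = (\<exists>y\<in>univ (N (mval j e)). sat (N' (mval j e)) ((loc e)((Inl (), Suc nx) := Inl y)) b)"
      by (rule local_ex[OF j b(2,3)]) (rule that)
    have "mval j (e(xv nx := y)) = mval j e" for e y by (simp add: mval_def)
    then show "\<exists>R. QF (outer_vars j nx V) R \<and> (\<forall>e. ok e \<longrightarrow> pat j nx V e = pat j nx V e0 \<longrightarrow>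
      R e = (fst p e \<and> (\<exists>y\<in>univ (N (mval j e)). snd p (e(xv nx := Inl (MainElt (mval j e) y))))))"
      by (intro exI[of _ "\<lambda>e. fst p e \<and> R e"] conjI QF_conj[OF p(1) R(1)]) (simp add: R(2) b(1) loc_upd)
  qed
  from bchoice[OF this] obtain R where R: "\<forall>p\<in>P. QF (outer_vars j nx V) (R p) \<and> (\<forall>e. ok e \<longrightarrow> pat j nx V e = pat j nx V e0 \<longrightarrow>
    R p e = (fst p e \<and> (\<exists>y\<in>univ (N (mval j e)). snd p (e(xv nx := Inl (MainElt (mval j e) y))))))" by (elim exE)
  show "\<exists>R'. QF (outer_vars j nx V) R' \<and> (\<forall>e. ok e \<and> pat j nx V e = pat j nx V e0 \<longrightarrow>
    (\<exists>y\<in>univ (N (mval j e)). \<gamma> (e(xv nx := Inl (MainElt (mval j e) y)))) = R' e)"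
  proof (intro exI[of _ "\<lambda>e. \<exists>p\<in>P. R p e"] conjI allI impI)
    show "QF (outer_vars j nx V) (\<lambda>e. \<exists>p\<in>P. R p e)" by (rule QF_bex[OF P(1)]) (rule conjunct1[OF bspec[OF R]])
    fix e assume e: "ok e \<and> pat j nx V e = pat j nx V e0"
    let ?e = "\<lambda>y. e(xv nx := Inl (MainElt (mval j e) y))"
    have m: "mval j e \<in> univ M" using e by (intro mval_carr[of e j] mv_carr) simp
    have ok: "ok (?e y)" if "y \<in> univ (N (mval j e))" for y
      by (rule ok_upd) (use e m that in auto)
    have "\<gamma> (?e y) = (\<exists>p\<in>P. fst p e \<and> snd p (?e y))" if y: "y \<in> univ (N (mval j e))" for y
    proof -
      have "mval j (?e y) = mval j e" by (simp add: mval_def)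
      \<comment> \<open>Moving the new element within the fibre keeps the pattern, so one
        decomposition is good for all \<open>y\<close>.\<close>
      moreover have "pat j nx V (?e y) = pat j nx V e" by (rule pat_cong) (simp_all add: mval_def)
      ultimately have "?e y \<in> dom_pat j nx V e0" using ok[OF y] e by (simp add: dom_pat_def)
      then have "\<gamma> (?e y) = (\<exists>p\<in>P. fst p (?e y) \<and> snd p (?e y))" by (rule P(3))
      moreover have "fst p (?e y) = fst p e" if "p \<in> P" for p
      proof -
        have "QF (outer_vars j nx V) (fst p)" using that P(2) by auto
        then show ?thesis by (rule QF_dep[OF _ ok[OF y]]) (use e in \<open>auto simp: outer_vars_def\<close>)
      qed
      ultimately show ?thesis by auto
    qed
    then have "(\<exists>y\<in>univ (N (mval j e)). \<gamma> (?e y)) = (\<exists>p\<in>P. fst p e \<and> (\<exists>y\<in>univ (N (mval j e)). snd p (?e y)))" by auto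
    also have "\<dots> = (\<exists>p\<in>P. R p e)"
    proof (rule bex_cong[OF refl])
      fix p assume p: "p \<in> P"
      show "(fst p e \<and> (\<exists>y\<in>univ (N (mval j e)). snd p (?e y))) = R p e" using bspec[OF R p] e by simp
    qed
    finally show "(\<exists>y\<in>univ (N (mval j e)). \<gamma> (?e y)) = (\<exists>p\<in>P. R p e)" .
  qed
qed

text \<open>An element of the main sort is a fibre together with an element of it. The fibre is
  named by a variable \<open>mv j\<close> foreign to \<open>\<gamma>\<close>, and the quantifier
  over that variable ranges over M.\<close>

lemma QF_ex_gen:
  assumes V: "finite V" and \<gamma>: "boolcl UNIV (main_gen V \<union> link_gen V) \<gamma>"
  shows "QF (V - {xv nx}) (\<lambda>e. \<exists>y\<in>carr S (Inl MainS). \<gamma> (e(xv nx := y)))"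
proof -
  obtain j where "j \<notin> snd ` V" using ex_new_if_finite[of "snd ` V"] V by blast
  then have j: "mv j \<notin> V" by (metis image_eqI snd_conv)
  have "QF (outer_vars j nx V - {mv j}) (\<lambda>e. \<exists>x\<in>carr S (fst (mv j)). \<exists>y\<in>univ (N (mval j (e(mv j := x)))).
      \<gamma> ((e(mv j := x))(xv nx := Inl (MainElt (mval j (e(mv j := x))) y))))"
    by (rule QF_ex[OF QF_ex_fibre[OF V j \<gamma>]]) simp
  then have "QF (V - {xv nx}) (\<lambda>e. \<exists>x\<in>carr S (fst (mv j)). \<exists>y\<in>univ (N (mval j (e(mv j := x)))).
      \<gamma> ((e(mv j := x))(xv nx := Inl (MainElt (mval j (e(mv j := x))) y))))"
    by (rule QF_mono) (auto simp: outer_vars_def)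
  then show ?thesis
  proof (rule QF_cong)
    fix e
    have "\<gamma> ((e(mv j := x))(xv nx := y)) = \<gamma> (e(xv nx := y))" for x y
      by (rule gen_dep[OF \<gamma>]) (use j in auto)
    then show "(\<exists>x\<in>carr S (fst (mv j)). \<exists>y\<in>univ (N (mval j (e(mv j := x)))).
      \<gamma> ((e(mv j := x))(xv nx := Inl (MainElt (mval j (e(mv j := x))) y)))) =
      (\<exists>y\<in>carr S (Inl MainS). \<gamma> (e(xv nx := y)))"
      by (auto simp: mval_def) 
  qed
qed

lemma main_gen_mono: "main_gen V \<subseteq> main_gen (V \<inter> main_var \<union> X)"
proof
  fix R assume "R \<in> main_gen V"
  then consider "R = (\<lambda>_. True)" | \<alpha> where "R = (\<lambda>e. sat S e \<alpha>)" "main_atom \<alpha>" "fv \<alpha> \<subseteq> V"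
    unfolding main_gen_def by blast
  then show "R \<in> main_gen (V \<inter> main_var \<union> X)"
  proof cases
    case 2
    then have "fv \<alpha> \<subseteq> V \<inter> main_var \<union> X" using main_atom_fv[of \<alpha>] by blast
    then show ?thesis using 2 unfolding main_gen_def by blast
  qed (simp add: main_gen_def)
qed

text \<open>The list \<open>vs\<close> consists of names for the values of the interface terms. Once
  these values are named, the new element occurs only in atoms of the main sort and in the linking
  equations, which is the situation of \<open>QF_ex_gen\<close>; the names themselves are then
  quantified by \<open>QF_exs\<close>.\<close>

lemma QF_ex_main:
  assumes V: "finite V" and R: "QF V R"
  shows "QF (V - {xv nx}) (\<lambda>e. \<exists>y\<in>carr S (Inl MainS). R (e(xv nx := y)))"
proof -
  \<comment> \<open>The empty set of names to avoid is enough: interface variables have sorts in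
    \<open>\<Sigma>\<close> and so differ from \<open>xv nx\<close>.\<close>
  obtain P \<iota> where P: "finite P" "inj_on \<iota> P" "\<iota> ` P \<inter> {} = {}" "\<And>p. p \<in> P \<Longrightarrow> iface p \<and> fv_tm p \<subseteq> V"
    "dnf {e. ok e} {R. boolcl UNIV (main_gen V) R} (sigma_preds P \<iota> V) R"
    by (rule normal_form[OF R finite.emptyI]) (rule that)
  obtain Q where Q: "finite Q" "Q \<subseteq> {R. boolcl UNIV (main_gen V) R} \<times> sigma_preds P \<iota> V"
    "\<And>e. e \<in> {e. ok e} \<Longrightarrow> R e = (\<exists>p\<in>Q. fst p e \<and> snd p e)" by (rule dnfE[OF P(5)]) (rule that)
  from finite_list[OF finite_imageI[OF P(1)]] obtain vs where vs: "set vs = iv \<iota> ` P" ..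
  have iv_sort: "fst v \<in> \<Sigma>" if v: "v \<in> iv \<iota> ` P" for v
  proof -
    obtain p where p: "p \<in> P" "v = iv \<iota> p" using v by blast
    show ?thesis unfolding p(2) fst_iv by (rule iface_sort) (use P(4)[OF p(1)] in simp)
  qed
  have xv: "xv nx \<notin> iv \<iota> ` P"
  proof
    assume "xv nx \<in> iv \<iota> ` P"
    then show False using iv_sort[of "xv nx"] by simp
  qed
  let ?V = "V \<inter> main_var \<union> iv \<iota> ` P" and ?W = "(V - {xv nx}) \<union> iv \<iota> ` P"
  let ?vals = "\<lambda>e' e. (\<forall>v\<in>set vs. e' v \<in> carr S (fst v)) \<and> (\<forall>v. v \<notin> set vs \<longrightarrow> e' v = e v)"
  have fv_P: "fv_tm p \<subseteq> V \<inter> main_var" if "p \<in> P" for p using P(4)[OF that] iface_fv[of p] by auto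
  have finV: "finite ?V" using V P(1) by simp
  have q: "QF (V - {xv nx}) (\<lambda>e. \<exists>y\<in>carr S (Inl MainS). fst q (e(xv nx := y)) \<and> snd q (e(xv nx := y)))"
    if "q \<in> Q" for q
  proof -
    have main: "boolcl UNIV (main_gen V) (fst q)" using that Q(2) by auto
    have "snd q \<in> sigma_preds P \<iota> V" using that Q(2) by auto
    then obtain \<theta> where \<theta>: "snd q = (\<lambda>e. sat S (ext P \<iota> e) \<theta>)" "wf_fm (restrict_lang LS \<Sigma>) \<theta>"
      "fv \<theta> \<subseteq> {v \<in> V. fst v \<in> \<Sigma>} \<union> iv \<iota> ` P" unfolding sigma_preds_def by blast
    \<comment> \<open>The conjunction of the main part with the links between the names and their
      terms.\<close>
    let ?\<gamma> = "\<lambda>e. fst q e \<and> (\<forall>p\<in>P. e (iv \<iota> p) = tm_val S e p)"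
    have main': "boolcl UNIV (main_gen ?V \<union> link_gen ?V) (fst q)"
    proof (rule boolcl_mono[OF main])
      fix R assume "R \<in> main_gen V"
      then have "R \<in> main_gen ?V" using main_gen_mono by blast
      then show "boolcl UNIV (main_gen ?V \<union> link_gen ?V) R" by (intro boolcl.base) simp
    qed simp
    have \<gamma>: "boolcl UNIV (main_gen ?V \<union> link_gen ?V) ?\<gamma>"
    proof (rule boolcl.conj[OF main' boolcl_ball[OF P(1) boolcl_True[OF main']]])
      fix p assume p: "p \<in> P"
      have "(tm_sort LS p, \<iota> p) \<in> ?V" using p by (auto simp: iv_def)
      then have "(\<lambda>e. e (iv \<iota> p) = tm_val S e p) \<in> link_gen ?V"
        unfolding link_gen_def using fv_P[OF p] P(4)[OF p]
        by (intro CollectI exI[of _ p] exI[of _ "\<iota> p"]) (auto simp: iv_def)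
      then show "boolcl UNIV (main_gen ?V \<union> link_gen ?V) (\<lambda>e. e (iv \<iota> p) = tm_val S e p)" by (intro boolcl.base) simp
    qed
    \<comment> \<open>\<open>\<theta>\<close> stands outside the quantifier over \<open>y\<close>:
      it refers to the names, not to the terms.\<close>
    have "QF ?W (\<lambda>e. (\<exists>y\<in>carr S (Inl MainS). ?\<gamma> (e(xv nx := y))) \<and> sat S e \<theta>)"
    proof (rule QF_conj)
      show "QF ?W (\<lambda>e. \<exists>y\<in>carr S (Inl MainS). ?\<gamma> (e(xv nx := y)))"
        by (rule QF_mono[OF QF_ex_gen[OF finV \<gamma>]]) auto
      show "QF ?W (\<lambda>e. sat S e \<theta>)"
      proof (rule QF_formula[OF \<theta>(2)])
        show "fv \<theta> \<subseteq> ?W" using \<theta>(3) by auto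
        show "fst v \<in> \<Sigma>" if "v \<in> fv \<theta>" for v using that \<theta>(3) iv_sort[of v] by blast
      qed
    qed
    then have "QF (?W - set vs) (\<lambda>e. \<exists>e'. (\<forall>v\<in>set vs. e' v \<in> carr S (fst v)) \<and> (\<forall>v. v \<notin> set vs \<longrightarrow> e' v = e v) \<and>
        ((\<exists>y\<in>carr S (Inl MainS). ?\<gamma> (e'(xv nx := y))) \<and> sat S e' \<theta>))"
      by (rule QF_exs) (use iv_sort vs in auto)
    then have "QF (V - {xv nx}) (\<lambda>e. \<exists>e'. (\<forall>v\<in>set vs. e' v \<in> carr S (fst v)) \<and> (\<forall>v. v \<notin> set vs \<longrightarrow> e' v = e v) \<and>
        ((\<exists>y\<in>carr S (Inl MainS). ?\<gamma> (e'(xv nx := y))) \<and> sat S e' \<theta>))"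
      by (rule QF_mono) (auto simp: vs)
    then show ?thesis
    proof (rule QF_cong)
      fix e assume e: "ok e"
      \<comment> \<open>Interface terms contain main variables only, so their values are unaffected
        by what is assigned to the names.\<close>
      have val: "tm_val S (e'(xv nx := y)) p = tm_val S (e(xv nx := y)) p"
        if "\<forall>v. v \<notin> set vs \<longrightarrow> e' v = e v" "p \<in> P" for e' y p
      proof (rule tm_val_cong)
        fix v assume "v \<in> fv_tm p"
        then have "v \<notin> set vs" using fv_P[OF that(2)] iv_sort[of v] by (auto simp: vs)
        then show "(e'(xv nx := y)) v = (e(xv nx := y)) v" using that(1) by simp
      qed
      have a: "fst q (e'(xv nx := y)) = fst q (e(xv nx := y))"
        if e': "ok e'" "\<forall>v. v \<notin> set vs \<longrightarrow> e' v = e v" and y: "y \<in> carr S (Inl MainS)" for e' y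
      proof (rule QF_dep[OF QF_main[OF main] ok_upd[OF e'(1)] ok_upd[OF e]])
        fix v assume "v \<in> V \<inter> main_var"
        then have "v \<notin> set vs" using iv_sort[of v] by (auto simp: vs)
        then show "(e'(xv nx := y)) v = (e(xv nx := y)) v" using e'(2) by simp
      qed (use y in simp_all)
      have \<theta>_eq: "sat S e' \<theta> = snd q (e(xv nx := y))"
        if e': "\<forall>v. v \<notin> set vs \<longrightarrow> e' v = e v" "\<forall>p\<in>P. e' (iv \<iota> p) = tm_val S (e(xv nx := y)) p" for e' y
        unfolding \<theta>(1)
      proof (rule sat_cong)
        fix v assume v: "v \<in> fv \<theta>"
        show "e' v = ext P \<iota> (e(xv nx := y)) v"
        proof (cases "v \<in> iv \<iota> ` P")
          case True
          then obtain p where "p \<in> P" "v = iv \<iota> p" by blast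
          then show ?thesis using e'(2) by (simp add: ext_def isub_iv[OF P(2)])
        next
          case False
          then have "fst v \<in> \<Sigma>" using v \<theta>(3) by auto
          then have "v \<noteq> xv nx" by auto
          then show ?thesis using False e'(1) by (simp add: ext_def isub_def vs)
        qed
      qed
      show "(\<exists>e'. (\<forall>v\<in>set vs. e' v \<in> carr S (fst v)) \<and> (\<forall>v. v \<notin> set vs \<longrightarrow> e' v = e v) \<and>
          ((\<exists>y\<in>carr S (Inl MainS). ?\<gamma> (e'(xv nx := y))) \<and> sat S e' \<theta>)) =
        (\<exists>y\<in>carr S (Inl MainS). fst q (e(xv nx := y)) \<and> snd q (e(xv nx := y)))" (is "?l = ?r")
      proof
        assume ?l
        then obtain e' y where e': "\<forall>v\<in>set vs. e' v \<in> carr S (fst v)" "\<forall>v. v \<notin> set vs \<longrightarrow> e' v = e v"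
          and y: "y \<in> carr S (Inl MainS)" "fst q (e'(xv nx := y))" "\<forall>p\<in>P. (e'(xv nx := y)) (iv \<iota> p) = tm_val S (e'(xv nx := y)) p"
            "sat S e' \<theta>" by (elim exE bexE conjE)
        have ok: "ok e'" unfolding ok_def
        proof
          fix v show "e' v \<in> carr S (fst v)" using e e' unfolding ok_def by (cases "v \<in> set vs") (simp_all del: S_simps)
        qed
        have "e' (iv \<iota> p) = tm_val S (e(xv nx := y)) p" if p: "p \<in> P" for p
        proof -
          have "iv \<iota> p \<noteq> xv nx" using xv imageI[OF p, of "iv \<iota>"] by metis
          then show ?thesis using bspec[OF y(3) p] val[OF e'(2) p] by simp
        qed
        then have "snd q (e(xv nx := y))" using \<theta>_eq[OF e'(2)] y(4) by simp
        then show ?r using y(1,2) a[OF ok e'(2) y(1)] by blast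
      next
        assume ?r
        then obtain y where y: "y \<in> carr S (Inl MainS)" "fst q (e(xv nx := y))" "snd q (e(xv nx := y))" by blast
        \<comment> \<open>Every name receives the value that its term has at the witness
          \<open>y\<close>; this makes the links true.\<close>
        define e' where "e' v = (if v \<in> iv \<iota> ` P then ext P \<iota> (e(xv nx := y)) v else e v)" for v
        have oky: "ok (e(xv nx := y))" by (rule ok_upd[OF e]) (use y(1) in simp)
        have iv: "e' (iv \<iota> p) = tm_val S (e(xv nx := y)) p" if "p \<in> P" for p
          using that by (simp add: e'_def ext_def isub_iv[OF P(2)])
        have off: "\<forall>v. v \<notin> set vs \<longrightarrow> e' v = e v" by (simp add: e'_def vs)
        have on: "\<forall>v\<in>set vs. e' v \<in> carr S (fst v)"
        proof
          fix v assume "v \<in> set vs"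
          then obtain p where p: "p \<in> P" "v = iv \<iota> p" by (auto simp: vs)
          have "tm_val S (e(xv nx := y)) p \<in> carr S (tm_sort LS p)"
            by (rule ok_tm_val[OF oky]) (use P(4)[OF p(1)] in \<open>simp add: iface_def\<close>)
          then show "e' v \<in> carr S (fst v)" using iv[OF p(1)] by (simp add: p(2) del: S_simps)
        qed
        have ok: "ok e'" unfolding ok_def
        proof
          fix v show "e' v \<in> carr S (fst v)" using e on off unfolding ok_def by (cases "v \<in> set vs") (simp_all del: S_simps)
        qed
        have links: "\<forall>p\<in>P. (e'(xv nx := y)) (iv \<iota> p) = tm_val S (e'(xv nx := y)) p"
        proof
          fix p assume p: "p \<in> P"
          have "iv \<iota> p \<noteq> xv nx" using xv imageI[OF p, of "iv \<iota>"] by metis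
          then show "(e'(xv nx := y)) (iv \<iota> p) = tm_val S (e'(xv nx := y)) p" using iv[OF p] val[OF off p] by simp
        qed
        have "sat S e' \<theta>" using \<theta>_eq[OF off, of y] iv y(3) by simp
        moreover have "fst q (e'(xv nx := y))" using a[OF ok off y(1)] y(2) by simp
        ultimately show ?l using on off links y(1) by (intro exI[of _ e'] conjI bexI[of _ y])
      qed
    qed
  qed
  have "QF (V - {xv nx}) (\<lambda>e. \<exists>q\<in>Q. \<exists>y\<in>carr S (Inl MainS). fst q (e(xv nx := y)) \<and> snd q (e(xv nx := y)))"
    by (rule QF_bex[OF Q(1) q])
  then show ?thesis
  proof (rule QF_cong)
    fix e assume e: "ok e"
    have "R (e(xv nx := y)) = (\<exists>q\<in>Q. fst q (e(xv nx := y)) \<and> snd q (e(xv nx := y)))" if "y \<in> carr S (Inl MainS)" for y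
      by (rule Q(3)) (use ok_upd[OF e, of y "xv nx"] that in simp)
    then show "(\<exists>q\<in>Q. \<exists>y\<in>carr S (Inl MainS). fst q (e(xv nx := y)) \<and> snd q (e(xv nx := y))) =
      (\<exists>y\<in>carr S (Inl MainS). R (e(xv nx := y)))" by blast
  qed
qed

section \<open>Induction on formulas and the theorem\<close>

lemma QF_all: "wf_fm ML \<phi> \<Longrightarrow> QF (fv \<phi>) (\<lambda>e. sat MS e \<phi>)"
proof (induction \<phi>)
  case (Neg \<phi>)
  have "QF (fv \<phi>) (\<lambda>e. sat MS e \<phi>)" using Neg by simp
  then show ?case by (simp add: QF_neg)
next
  case (Conj \<phi> \<psi>)
  have "QF (fv \<phi>) (\<lambda>e. sat MS e \<phi>)" "QF (fv \<psi>) (\<lambda>e. sat MS e \<psi>)" using Conj by simp_all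
  then have "QF (fv \<phi> \<union> fv \<psi>) (\<lambda>e. sat MS e \<phi> \<and> sat MS e \<psi>)" by (intro QF_conj) (rule QF_mono, assumption, simp)+
  then show ?case by simp
next
  case (Ex v \<phi>)
  have IH: "QF (fv \<phi>) (\<lambda>e. sat MS e \<phi>)" using Ex by simp
  obtain s n where v: "v = (s, n)" by (cases v)
  have "QF (fv \<phi> - {v}) (\<lambda>e. \<exists>x\<in>carr S (fst v). sat MS (e(v := x)) \<phi>)"
  proof (cases "s = Inl MainS")
    case True
    show ?thesis unfolding v True fst_conv by (rule QF_ex_main[OF finite_fv IH])
  next
    case False
    then have "fst v \<in> \<Sigma>" unfolding v by (cases s; cases "projl s") auto
    then show ?thesis by (rule QF_ex[OF IH])
  qed
  then show ?case by simp
qed (rule QF_sat; simp)+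

theorem elim_quantifiers_lex: "elim_quantifiers_rel LS \<Sigma> S"
  unfolding elim_quantifiers_rel_def elim_quantifiers_def
proof (intro allI impI)
  fix \<phi> assume \<phi>: "wf_fm ML \<phi>"
  obtain \<psi> where \<psi>: "wf_fm ML \<psi>" "qf \<psi>" "fv \<psi> \<subseteq> fv \<phi>" "\<And>e. ok e \<Longrightarrow> sat MS e \<phi> = sat MS e \<psi>"
    by (rule QF_E[OF QF_all[OF \<phi>]]) (rule that)
  show "\<exists>\<psi>. wf_fm ML \<psi> \<and> qf \<psi> \<and> fv \<psi> \<subseteq> fv \<phi> \<and>
    (\<forall>e. (\<forall>v. fst v \<in> lsorts ML \<longrightarrow> e v \<in> carr MS (fst v)) \<longrightarrow> sat MS e \<phi> = sat MS e \<psi>)"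
  proof (intro exI[of _ \<psi>] conjI allI impI)
    fix e :: "('m, 'n, 'k) lex_env"
    assume "\<forall>v. fst v \<in> lsorts ML \<longrightarrow> e v \<in> carr MS (fst v)"
    then have "ok e" by (simp add: ok_def del: S_simps)
    then show "sat MS e \<phi> = sat MS e \<psi>" by (rule \<psi>(4))
  qed (fact \<psi>)+
qed

end

theorem theorem2p9:
  fixes LM :: "(unit, 'fm, 'rm) lang" and M :: "(unit, 'fm, 'rm, 'm) struct"
    and LN :: "(unit, 'fn, 'rn) lang" and N :: "'m \<Rightarrow> (unit, 'fn, 'rn, 'n) struct"
    and LK :: "(unit, 'fk, 'rk) lang" and K :: "(unit, 'fk, 'rk, 'k) struct"
    and I :: "'i set" and k :: "'i \<Rightarrow> nat" and lam :: "'i \<Rightarrow> 'm \<Rightarrow> 'n list \<Rightarrow> 'k"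
    and J :: "('fn, 'rn, 'fk, 'rk, 'i) interp"
    and u :: "('m, 'n) lex_elt" and z :: "'fk option"
  assumes langs: "wf_lang LM" "wf_lang LN" "wf_lang LK"
    and LN_no_constants: "\<forall>g\<in>funs LN. fdom LN g \<noteq> []"
    and M: "is_struct LM M"
    and N: "\<forall>a\<in>univ M. is_struct LN (N a)"
    and K: "is_struct LK K"
    and undetermined: "u \<in> carr (lex_struct M N u) MainS"
    and definability:
      "\<forall>\<phi>. is_fm LN 0 \<phi> \<longrightarrow> definable LM M {a \<in> univ M. holds (N a) \<phi> []}"
    and maps_nonempty: "I \<noteq> {}"
    and k_pos: "\<forall>i\<in>I. k i \<ge> 1"
    and maps_surj: "\<forall>i\<in>I. \<forall>a\<in>univ M. lam i a ` tuples (N a) (k i) = univ K"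
    and uniform_interp: "interprets_uniformly LN (univ M) N LK K I k lam J"
    and zero: "zero_choice LK z"
    and RQE:
      "\<forall>\<rho> U. complete_1type LM M \<rho> \<and> ultrafilter_on (univ M) U \<and>
          (\<forall>\<phi>\<in>\<rho>. eventually (\<lambda>a. holds M \<phi> [a]) U) \<longrightarrow>
        elim_quantifiers_rel (interp_expansion_lang LN LK I k) {Inr ()}
          (interp_expansion J (ultraproduct (univ M) U N))"
  shows "elim_quantifiers_rel (lex_expansion_lang LM LN LK z I k) {Inl BaseS, Inr ()}
           (lex_expansion M N u K z lam)"
proof -
  interpret lex_setup LM M LN N LK K I k lam J u z
    by unfold_locales
      (fact langs LN_no_constants M N K definability k_pos maps_surj uniform_interp RQE undetermined zero)+
  show ?thesis by (rule elim_quantifiers_lex)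
qed

end
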